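(* Let $d \geq 1$, let $\Omega \subset \mathbb{R}^d$ be a bounded Lipschitz domain, and let $R := \sup_{x\in\Omega}\delta_\Omega(x) > 0$. Let $p>1$ and $s\in(0,1)$ satisfy $sp=d$, and let $n_0\in\mathbb{N}$ be such that $n_0 \geq p-1 > n_0-1$. Then there exists $\alpha_0>0$ such that for every $\alpha\in[0,\alpha_0)$ both $$\sup\left\{ \int_\Omega \Phi_{n_0}\left(\alpha\, X_d(u)(x)^{\frac{d}{d-s}}\right)\frac{dx}{\delta_\Omega(x)^d} \ :\ u\in W^{s,p}_0(\Omega),\ [u]_{W^{s,p}(\Omega)}\leq 1\right\} < \infty$$ and $$\sup\left\{ \int_\Omega \left(\sum_{n=0}^{n_0-1}\frac{\alpha^n X_d(u)(x)^{\frac{nd}{d-s}}}{n!} + \frac{\Phi_{n_0}\left(\alpha\, X_d(u)(x)^{\frac{d}{d-s}}\right)}{\delta_\Omega(x)^d}\right)dx \ :\ u\in W^{s,p}_0(\Omega),\ [u]_{W^{s,p}(\Omega)}\leq 1\right\} < \infty .$$ Also, the latter supremum equals $\infty$ for every $\alpha>\alpha_d^*$, where $$\alpha_d^* := d\left( \frac{2(d\omega_d)^2\,\Gamma(p+1)}{d!}\sum_{n=0}^\infty \frac{(d+n-1)!}{n!}\,\frac{1}{(d+2n)^p}\right)^{\frac{s}{d-s}}$$ and $\omega_d$ is the volume of the unit ball in $\mathbb{R}^d$.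
   Context: For a bounded Lipschitz domain $\Omega\subset\mathbb{R}^d$, $\delta_\Omega(x) := \min_{y\in\partial\Omega}|x-y|$ is the distance to the boundary. For $p\in[1,\infty)$ and $s\in(0,1)$, the Gagliardo seminorm is $$[u]_{W^{s,p}(\Omega)} := \left(\int_\Omega\int_\Omega \frac{|u(x)-u(y)|^p}{|x-y|^{d+sp}}\,dx\,dy\right)^{1/p}.$$ $W^{s,p}(\Omega)$ is the space of $u\in L^p(\Omega)$ with $[u]_{W^{s,p}(\Omega)}<\infty$, with norm $\|u\|_{W^{s,p}(\Omega)} := \left([u]_{W^{s,p}(\Omega)}^p+\|u\|_{L^p(\Omega)}^p\right)^{1/p}$, and $W^{s,p}_0(\Omega)$ is the completion (closure) of $C_c^\infty(\Omega)$ with respect to this norm. The average of $u$ is $(u)_\Omega := \frac{1}{|\Omega|}\int_\Omega u(y)\,dy$. For $n_0\in\mathbb{N}$, $\Phi_{n_0}(t) := \exp(t)-\sum_{n=0}^{n_0-1}\frac{t^n}{n!}$ for $t\in\mathbb{R}$. With $R=\sup_{x\in\Omega}\delta_\Omega(x)$, the function $X_d(u)$ on $\Omega$ is $$X_1(u)(x) := \frac{|u(x)-(u)_\Omega|}{\ln\left(\frac{2R}{\delta_\Omega(x)}\right)}\quad\text{if } d=1,\qquad X_d(u)(x) := |u(x)|\quad\text{if } d\geq 2.$$ The $n=0$ term of the sum is understood to be $1$ (convention $0^0=1$). *)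

theory Defs
  imports "HOL-Analysis.Analysis"
begin

(* Throughout, R^d is a type 'a :: euclidean_space with d = DIM('a).  A function on
   \<Omega> is a total function 'a => real whose values outside \<Omega> are never inspected,
   except for test functions, which are extended by zero. *)

subsection \<open>Domains\<close>

(* Near each boundary point, \<Omega> is the strict epigraph of a Lipschitz function over the
   hyperplane orthogonal to some unit vector e.  The orthogonal projection
   y - (y \<bullet> e) e replaces the first d - 1 rotated coordinates of y; for d = 1 the
   hyperplane is {0}. *)
definition bounded_lipschitz_domain :: "'a::euclidean_space set \<Rightarrow> bool" where
  "bounded_lipschitz_domain \<Omega> \<longleftrightarrow>
     open \<Omega> \<and> connected \<Omega> \<and> \<Omega> \<noteq> {} \<and> bounded \<Omega> \<and>
     (\<forall>x \<in> frontier \<Omega>. \<exists>r>0. \<exists>e L. \<exists>\<gamma> :: 'a \<Rightarrow> real.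
        norm e = 1 \<and> L-lipschitz_on {z. z \<bullet> e = 0} \<gamma> \<and>
        \<Omega> \<inter> ball x r = {y \<in> ball x r. y \<bullet> e > \<gamma> (y - (y \<bullet> e) *\<^sub>R e)})"

(* The infimum in infdist is a minimum here: the frontier is compact and nonempty. *)
definition bdist :: "'a::euclidean_space set \<Rightarrow> 'a \<Rightarrow> real" where
  "bdist \<Omega> x = infdist x (frontier \<Omega>)"

definition inradius :: "'a::euclidean_space set \<Rightarrow> real" where
  "inradius \<Omega> = (SUP x\<in>\<Omega>. bdist \<Omega> x)"

subsection \<open>Fractional Sobolev spaces\<close>

definition epowr :: "ennreal \<Rightarrow> real \<Rightarrow> ennreal" where
  "epowr x r = (if x = \<infinity> then \<infinity> else ennreal (enn2real x powr r))"

(* On the diagonal the quotient is 0 / 0 = 0; the diagonal is a null set. *)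
definition gagliardo_seminorm ::
    "real \<Rightarrow> real \<Rightarrow> 'a::euclidean_space set \<Rightarrow> ('a \<Rightarrow> real) \<Rightarrow> ennreal" where
  "gagliardo_seminorm s p \<Omega> u =
     epowr (\<integral>\<^sup>+x. (\<integral>\<^sup>+y. ennreal (\<bar>u x - u y\<bar> powr p / norm (x - y) powr (real DIM('a) + s * p))
              \<partial>lebesgue_on \<Omega>) \<partial>lebesgue_on \<Omega>) (1 / p)"

definition Lp_norm :: "real \<Rightarrow> 'a::euclidean_space set \<Rightarrow> ('a \<Rightarrow> real) \<Rightarrow> ennreal" where
  "Lp_norm p \<Omega> u = epowr (\<integral>\<^sup>+x. ennreal (\<bar>u x\<bar> powr p) \<partial>lebesgue_on \<Omega>) (1 / p)"

definition W_norm ::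
    "real \<Rightarrow> real \<Rightarrow> 'a::euclidean_space set \<Rightarrow> ('a \<Rightarrow> real) \<Rightarrow> ennreal" where
  "W_norm s p \<Omega> u =
     epowr (epowr (gagliardo_seminorm s p \<Omega> u) p + epowr (Lp_norm p \<Omega> u) p) (1 / p)"

definition W_space ::
    "real \<Rightarrow> real \<Rightarrow> 'a::euclidean_space set \<Rightarrow> ('a \<Rightarrow> real) set" where
  "W_space s p \<Omega> =
     {u. u \<in> borel_measurable (lebesgue_on \<Omega>) \<and> Lp_norm p \<Omega> u < \<infinity> \<and>
         gagliardo_seminorm s p \<Omega> u < \<infinity>}"

primrec Ck_fun :: "nat \<Rightarrow> ('a::euclidean_space \<Rightarrow> real) \<Rightarrow> bool" where
  "Ck_fun 0 f \<longleftrightarrow> continuous_on UNIV f"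
| "Ck_fun (Suc k) f \<longleftrightarrow>
     (\<forall>x. f differentiable (at x)) \<and>
     (\<forall>i\<in>Basis. Ck_fun k (\<lambda>x. frechet_derivative f (at x) i))"

definition test_functions :: "'a::euclidean_space set \<Rightarrow> ('a \<Rightarrow> real) set" where
  "test_functions \<Omega> =
     {\<phi>. (\<forall>k. Ck_fun k \<phi>) \<and> compact (closure {x. \<phi> x \<noteq> 0}) \<and> closure {x. \<phi> x \<noteq> 0} \<subseteq> \<Omega>}"

(* W_space is complete, so the completion of the test functions is their closure in it. *)
definition W0_space ::
    "real \<Rightarrow> real \<Rightarrow> 'a::euclidean_space set \<Rightarrow> ('a \<Rightarrow> real) set" where
  "W0_space s p \<Omega> =
     {u \<in> W_space s p \<Omega>. \<exists>\<phi> :: nat \<Rightarrow> 'a \<Rightarrow> real.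
        (\<forall>k. \<phi> k \<in> test_functions \<Omega>) \<and>
        (\<lambda>k. W_norm s p \<Omega> (\<lambda>x. u x - \<phi> k x)) \<longlonglongrightarrow> 0}"

subsection \<open>The functionals\<close>

definition average :: "'a::euclidean_space set \<Rightarrow> ('a \<Rightarrow> real) \<Rightarrow> real" where
  "average \<Omega> u = (1 / measure lebesgue \<Omega>) * (\<integral>y. u y \<partial>lebesgue_on \<Omega>)"

definition Phi :: "nat \<Rightarrow> real \<Rightarrow> real" where
  "Phi n0 t = exp t - (\<Sum>n<n0. t ^ n / fact n)"

definition X_fun :: "'a::euclidean_space set \<Rightarrow> ('a \<Rightarrow> real) \<Rightarrow> 'a \<Rightarrow> real" where
  "X_fun \<Omega> u x =
     (if DIM('a) = 1
      then \<bar>u x - average \<Omega> u\<bar> / ln (2 * inradius \<Omega> / bdist \<Omega> x)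
      else \<bar>u x\<bar>)"

(* The integrands below are nonnegative for \<alpha> \<ge> 0, so ennreal truncates nothing. *)
definition hardy_exp_integral ::
    "real \<Rightarrow> nat \<Rightarrow> real \<Rightarrow> 'a::euclidean_space set \<Rightarrow> ('a \<Rightarrow> real) \<Rightarrow> ennreal" where
  "hardy_exp_integral s n0 \<alpha> \<Omega> u =
     (let d = real DIM('a) in
      \<integral>\<^sup>+x. ennreal (Phi n0 (\<alpha> * X_fun \<Omega> u x powr (d / (d - s))) / bdist \<Omega> x ^ DIM('a))
        \<partial>lebesgue_on \<Omega>)"

(* The power X^(n d/(d-s)) is written (X^(d/(d-s)))^n because 0 powr 0 = 0, whereas the
   n = 0 term has to be 1. *)
definition full_exp_integral ::
    "real \<Rightarrow> nat \<Rightarrow> real \<Rightarrow> 'a::euclidean_space set \<Rightarrow> ('a \<Rightarrow> real) \<Rightarrow> ennreal" where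
  "full_exp_integral s n0 \<alpha> \<Omega> u =
     (let d = real DIM('a) in
      \<integral>\<^sup>+x. ennreal ((\<Sum>n<n0. \<alpha> ^ n * (X_fun \<Omega> u x powr (d / (d - s))) ^ n / fact n)
          + Phi n0 (\<alpha> * X_fun \<Omega> u x powr (d / (d - s))) / bdist \<Omega> x ^ DIM('a))
        \<partial>lebesgue_on \<Omega>)"

definition alpha_star :: "'a::euclidean_space itself \<Rightarrow> real \<Rightarrow> real \<Rightarrow> real" where
  "alpha_star _ s p =
     (let d = DIM('a); \<omega> = measure lebesgue (ball (0::'a) 1) in
      real d * (2 * (real d * \<omega>)\<^sup>2 * Gamma (p + 1) / fact d *
        (\<Sum>n. fact (d + n - 1) / fact n * (1 / (real d + 2 * real n) powr p)))
          powr (s / (real d - s)))"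

end

theory Submission
  imports Defs
begin

text \<open>
Let $d$ be the dimension and $\delta$ the distance to the boundary. As $sp = d$, the $p$-th power of
the seminorm is the double integral of $|u(x)-u(y)|^p / |x-y|^{2d}$ over $\Omega \times \Omega$, called the
energy below, and $d/(d-s) = p' = p/(p-1)$.

Finiteness for small $\alpha$ is a consequence of a Hardy inequality
$\int_\Omega |\phi - A|^p / (\delta^d w^p) \le C \cdot$ energy for test functions, where $A = 0$,
$w = 1$ if $d \ge 2$, and $A$ is the mean of $\phi$, $w = \ln(2R/\delta)$ if $d = 1$; in both cases
$X_d(\phi) = |\phi - A| / w$. Let $H$ be the sum of the inner energy integral, the Hardy integrand
and $1$. Choose points in the dyadic annuli around $x$ of radii at most $\delta(x)/2$, one in each
annulus, at which $H$ and the increments of $\phi$ are controlled by averages. If $m_j$ is the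
integral of $H$ over the $j$-th annulus, the resulting chain gives
$X_d(\phi)(x) \le C \sum_j m_j^{1/p}$ (\<open>annular_chain\<close>). With $T(x) = \sum_j (3/2)^j m_j$ this
sum is at most $C\,T^{1/p}$, because the terms decay geometrically, and at most
$C (1 + \ln(1+T))^{1/p'}$, by Hoelder for the first $O(\ln T)$ terms (\<open>chain_sum_bounds\<close>). The first
bound handles small values, where $\Phi_{n_0}(t) \le e\,t^{n_0}$ and $n_0 p'/p \ge 1$; the second
bound handles large ones, where $\Phi_{n_0} \le \exp$. Together
$\Phi_{n_0}(\alpha X_d(\phi)^{p'}) \le C\,T$ (\<open>Phi_chain_bound\<close>), and
$\int_\Omega T \delta^{-d} \le C \sum_j (3/2)^j 2^{-j} \int_\Omega H$ by Tonelli
(\<open>annular_mass_integral\<close>, \<open>Hardy_imp_exponential\<close>). Fatou's lemma carries the bound from test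
functions to $W^{s,p}_0$ (\<open>hardy_exp_integral_W0_le\<close>), and the second integral is at most a
constant plus a multiple of the first one (\<open>full_exp_integral_le\<close>).

Hardy inequality, $d \ge 2$ (\<open>fractional_Hardy\<close>): since $\Omega$ lies above Lipschitz graphs, the
strip $\{\delta < t\,\delta(x)\}$ fills a proportion at least $ct$ of a ball of radius $2\delta(x)$
(\<open>frontier_strip_measure\<close>). Comparing $\phi(x)$ with its values in that strip bounds the Hardy integral
by $C t^{d-1}$ times itself plus $C_t$ times the energy, and a small $t$ absorbs the first term.

Hardy inequality, $d = 1$ (\<open>log_Hardy_one_dim\<close>): the exponent $d - 1$ vanishes and no absorption is
possible, hence the logarithm. The domain is an interval; the means $a_k$ of $|\phi - A|^p$ over the
dyadic annuli around an endpoint satisfy a recursion whose errors are summable, and the claim is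
a Hardy inequality for sequences with the critical weight $k^{-p}$ (\<open>critical_discrete_Hardy\<close>).

Divergence for $\alpha > \alpha_d^*$ (\<open>full_exp_integral_unbounded\<close>): the test functions are smoothed
truncations of $\ln(\rho/|x-c|)$ with a plateau of height about $T$ on a ball of radius $\rho e^{-T}$.
Their energy is at most $\gamma (T + C)$ with $\gamma = 2 d \omega_d K$, where $K / |x|^d$ bounds the
integral of $\ln(|x|/|y|)^p / |x-y|^{2d}$ over $|y| < |x|$ (\<open>log_kernel_integral\<close>); the value of
$K$ is such that $\alpha_d^* = d \gamma^{1/(p-1)}$ (\<open>alpha_star_eq\<close>). After normalization the plateau
alone contributes about $\exp(-dT + \alpha T \gamma^{-1/(p-1)})$, which is unbounded. If $d = 1$ the
centre $c$ is taken so close to the middle of the interval that the logarithm in $X_1$ is below $1$.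
\<close>

section \<open>The energy at the critical exponent and the distance to the boundary\<close>

text \<open>The $p$-th power of the Gagliardo seminorm for $sp = d$, as an iterated integral for the Borel
measure: Tonelli and measurability arguments are then available without completions.\<close>

definition energy :: "real \<Rightarrow> 'a::euclidean_space set \<Rightarrow> ('a \<Rightarrow> real) \<Rightarrow> ennreal" where
  "energy p \<Omega> u = (\<integral>\<^sup>+x. (\<integral>\<^sup>+y. ennreal (\<bar>u x - u y\<bar> powr p / norm (x - y) ^ (2 * DIM('a))) * indicator \<Omega> y \<partial>lborel)
      * indicator \<Omega> x \<partial>lborel)"

lemma nn_integral_lebesgue_on:
  assumes "\<Omega> \<in> sets lebesgue"
  shows "(\<integral>\<^sup>+x. f x \<partial>lebesgue_on \<Omega>) = (\<integral>\<^sup>+x. f x * indicator \<Omega> x \<partial>lborel)"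
  using assms by (subst nn_integral_restrict_space) (auto simp: nn_integral_completion)

lemma norm_powr_double_dim:
  fixes z :: "'a::euclidean_space"
  shows "norm z powr (real DIM('a) + real DIM('a)) = norm z ^ (2 * DIM('a))"
proof (cases "z = 0")
  case False
  then show ?thesis by (simp add: powr_realpow[symmetric])
qed simp

lemma gagliardo_seminorm_energy:
  fixes \<Omega> :: "'a::euclidean_space set"
  assumes "\<Omega> \<in> sets lebesgue" "s * p = real DIM('a)"
  shows "gagliardo_seminorm s p \<Omega> u = epowr (energy p \<Omega> u) (1 / p)"
  unfolding gagliardo_seminorm_def energy_def assms(2) nn_integral_lebesgue_on[OF assms(1)] norm_powr_double_dim ..

text \<open>The seminorm, the $L^p$ norm and the full norm are roots of extended integrals; this lemma removes the roots
from inequalities between them and real bounds.\<close>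

lemma epowr_le_iff:
  assumes "r > 0" "b \<ge> 0"
  shows "epowr x r \<le> ennreal (b powr r) \<longleftrightarrow> x \<le> ennreal b"
proof (cases x)
  case (real a)
  then show ?thesis using assms
    using powr_less_mono2[of r b a] powr_mono2[of r a b]
    by (simp add: epowr_def) linarith
qed (auto simp: epowr_def top_unique)

lemma epowr_finite_iff: "epowr x r < \<infinity> \<longleftrightarrow> x < \<infinity>"
  by (cases x) (auto simp: epowr_def)

lemma epowr_epowr_inverse:
  assumes "p > 0"
  shows "epowr (epowr x (1 / p)) p = x" "epowr (epowr x p) (1 / p) = x"
  using assms by (cases x; auto simp: epowr_def powr_powr)+

lemma gagliardo_seminorm_le_1_iff:
  fixes \<Omega> :: "'a::euclidean_space set"
  assumes "\<Omega> \<in> sets lebesgue" "s * p = real DIM('a)" "p > 0"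
  shows "gagliardo_seminorm s p \<Omega> u \<le> 1 \<longleftrightarrow> energy p \<Omega> u \<le> 1"
  using epowr_le_iff[of "1 / p" 1 "energy p \<Omega> u"] assms by (simp add: gagliardo_seminorm_energy)

lemma energy_cmult:
  fixes u :: "'a::euclidean_space \<Rightarrow> real"
  assumes "a \<ge> 0" and [measurable]: "u \<in> borel_measurable borel" "\<Omega> \<in> sets borel"
  shows "energy p \<Omega> (\<lambda>x. a * u x) = ennreal (a powr p) * energy p \<Omega> u"
proof -
  have 1: "ennreal (\<bar>a * u x - a * u y\<bar> powr p / norm (x - y) ^ (2 * DIM('a))) * indicator \<Omega> y
     = ennreal (a powr p) * (ennreal (\<bar>u x - u y\<bar> powr p / norm (x - y) ^ (2 * DIM('a))) * indicator \<Omega> y)" for x y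
  proof -
    have "\<bar>a * u x - a * u y\<bar> = a * \<bar>u x - u y\<bar>"
      using assms by (simp add: right_diff_distrib[symmetric] abs_mult)
    then show ?thesis
      using assms by (simp add: powr_mult ennreal_mult'[symmetric] mult.assoc[symmetric])
  qed
  show ?thesis
    unfolding energy_def 1
    by (subst nn_integral_cmult, measurable)
       (simp add: mult.assoc nn_integral_cmult)
qed

lemma test_function_continuous: "u \<in> test_functions \<Omega> \<Longrightarrow> continuous_on UNIV u"
  unfolding test_functions_def using Ck_fun.simps(1) by blast

lemma test_function_measurable: "u \<in> test_functions \<Omega> \<Longrightarrow> u \<in> borel_measurable borel"
  by (intro borel_measurable_continuous_onI test_function_continuous)

lemma test_function_bounded:
  assumes "u \<in> test_functions \<Omega>"
  obtains M where "M \<ge> 0" "\<And>x. \<bar>u x\<bar> \<le> M"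
proof -
  let ?K = "closure {x. u x \<noteq> 0}"
  have "compact (u ` ?K)"
    using assms by (intro compact_continuous_image continuous_on_subset[OF test_function_continuous[OF assms]])
      (auto simp: test_functions_def)
  then have "bounded (u ` ?K)" by (rule compact_imp_bounded)
  then obtain M where M: "\<And>x. x \<in> ?K \<Longrightarrow> \<bar>u x\<bar> \<le> M"
    unfolding bounded_iff real_norm_def by blast
  have "\<bar>u x\<bar> \<le> max M 0" for x
  proof (cases "u x = 0")
    case False
    then have "x \<in> ?K" using closure_subset[of "{x. u x \<noteq> 0}"] by blast
    then show ?thesis using M by fastforce
  qed simp
  then show ?thesis by (intro that[of "max M 0"]) auto
qed

lemma test_function_in_W0_space:
  fixes \<Omega> :: "'a::euclidean_space set"
  assumes \<Omega>: "open \<Omega>" "bounded \<Omega>" and p: "p > 0" "s * p = real DIM('a)"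
    and u: "u \<in> test_functions \<Omega>" "energy p \<Omega> u < \<infinity>"
  shows "u \<in> W0_space s p \<Omega>"
proof -
  have [simp]: "\<Omega> \<in> sets lebesgue" using \<Omega> by auto
  obtain M where M: "M \<ge> 0" "\<And>x. \<bar>u x\<bar> \<le> M" using test_function_bounded[OF u(1)] by blast
  have "(\<integral>\<^sup>+x. ennreal (\<bar>u x\<bar> powr p) \<partial>lebesgue_on \<Omega>) \<le> (\<integral>\<^sup>+x. ennreal (M powr p) * indicator \<Omega> x \<partial>lborel)"
    unfolding nn_integral_lebesgue_on[OF \<open>\<Omega> \<in> sets lebesgue\<close>]
    using M p by (intro nn_integral_mono mult_right_mono ennreal_leI powr_mono2) auto
  also have "\<dots> = ennreal (M powr p) * emeasure lborel \<Omega>"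
    using \<Omega> by (simp add: nn_integral_cmult_indicator)
  also have "\<dots> < \<infinity>" using emeasure_bounded_finite[OF \<Omega>(2)] by (simp add: ennreal_mult_less_top)
  finally have "Lp_norm p \<Omega> u < \<infinity>" unfolding Lp_norm_def epowr_finite_iff .
  moreover have "gagliardo_seminorm s p \<Omega> u < \<infinity>"
    unfolding gagliardo_seminorm_energy[OF \<open>\<Omega> \<in> sets lebesgue\<close> p(2)] epowr_finite_iff by (rule u(2))
  moreover have "u \<in> borel_measurable (lebesgue_on \<Omega>)"
    using test_function_measurable[OF u(1)] by (intro measurable_restrict_space1 measurable_completion) simp
  moreover have "W_norm s p \<Omega> (\<lambda>x. u x - u x) = 0"
    using p by (simp add: W_norm_def gagliardo_seminorm_def Lp_norm_def epowr_def)
  ultimately show ?thesis using u(1)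
    by (auto simp: W0_space_def W_space_def intro!: exI[of _ "\<lambda>k. u"])
qed

lemma bdd_above_bdist:
  fixes \<Omega> :: "'a::euclidean_space set"
  assumes "bounded \<Omega>" "\<Omega> \<noteq> {}"
  shows "bdd_above (bdist \<Omega> ` \<Omega>)"
proof -
  have "frontier \<Omega> \<noteq> {}" using assms by (metis frontier_not_empty not_bounded_UNIV)
  then obtain \<xi> where \<xi>: "\<xi> \<in> frontier \<Omega>" by auto
  obtain b where b: "\<And>x. x \<in> \<Omega> \<Longrightarrow> norm x \<le> b" using assms by (auto simp: bounded_iff)
  have "bdist \<Omega> x \<le> b + norm \<xi>" if "x \<in> \<Omega>" for x
  proof -
    have "bdist \<Omega> x \<le> dist x \<xi>" unfolding bdist_def by (rule infdist_le[OF \<xi>])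
    also have "\<dots> \<le> norm x + norm \<xi>" by (simp add: dist_norm norm_triangle_ineq4)
    finally show ?thesis using b[OF that] by simp
  qed
  then show ?thesis by (auto simp: bdd_above_def)
qed

lemma bdist_pos:
  fixes \<Omega> :: "'a::euclidean_space set"
  assumes "open \<Omega>" "bounded \<Omega>" "x \<in> \<Omega>"
  shows "bdist \<Omega> x > 0"
proof -
  have ne: "frontier \<Omega> \<noteq> {}" using assms by (metis empty_iff frontier_not_empty not_bounded_UNIV)
  have "x \<notin> frontier \<Omega>" using assms by (simp add: frontier_def interior_open)
  then have "infdist x (frontier \<Omega>) \<noteq> 0"
    using in_closed_iff_infdist_zero[OF frontier_closed ne] by blast
  then show ?thesis using infdist_nonneg[of x "frontier \<Omega>"] by (simp add: bdist_def)
qed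

lemma bdist_le_inradius:
  fixes \<Omega> :: "'a::euclidean_space set"
  assumes "bounded \<Omega>" "x \<in> \<Omega>"
  shows "bdist \<Omega> x \<le> inradius \<Omega>"
  unfolding inradius_def using assms by (intro cSUP_upper bdd_above_bdist) auto

lemma bdist_lipschitz: "bdist \<Omega> x \<le> bdist \<Omega> y + dist x y"
  unfolding bdist_def by (rule infdist_triangle)

lemma continuous_on_bdist [continuous_intros]: "continuous_on A (bdist \<Omega>)"
  unfolding bdist_def[abs_def] by (intro continuous_intros)

lemma measurable_bdist [measurable]: "bdist \<Omega> \<in> borel_measurable borel"
  by (intro borel_measurable_continuous_onI continuous_on_bdist)

lemma conjugate_exponent:
  fixes s p d :: real
  assumes "p > 1" "0 < s" "s * p = d"
  shows "d / (d - s) = p / (p - 1)" "s / (d - s) = 1 / (p - 1)"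
proof -
  have "d - s = s * (p - 1)" using assms(3) by (simp add: algebra_simps)
  then show "d / (d - s) = p / (p - 1)" "s / (d - s) = 1 / (p - 1)"
    unfolding assms(3)[symmetric] using assms(1,2) by simp_all
qed

section \<open>Inverse power integrals over balls\<close>

text \<open>Inversion maps balls that avoid the origin to balls. Only the inclusion matters, since it
bounds the measure of the image from above.\<close>

lemma inversion_image_ball:
  fixes a z :: "'a::real_inner"
  assumes "r < norm a" and "z \<in> ball a r"
  shows "(1 / (norm z)^2) *\<^sub>R z \<in> ball ((1 / ((norm a)^2 - r^2)) *\<^sub>R a) (r / ((norm a)^2 - r^2))"
proof -
  have r: "0 \<le> r" using assms by (smt (verit) mem_ball dist_norm norm_ge_zero)
  define A where "A = (norm a)^2 - r^2"
  have A: "A > 0" using assms r by (simp add: A_def power_strict_mono)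
  have z0: "z \<noteq> 0" using assms by auto
  define Z where "Z = (norm z)^2"
  have Z: "Z > 0" using z0 by (simp add: Z_def)
  have d: "(norm (z - a))^2 < r^2"
    using assms r by (metis dist_commute dist_norm mem_ball norm_ge_zero power_strict_mono zero_less_numeral)
  have d': "(norm (z - a))^2 = Z - 2 * (z \<bullet> a) + (norm a)^2"
    by (simp add: Z_def power2_norm_eq_inner inner_diff inner_commute algebra_simps)
  have za: "2 * (z \<bullet> a) > Z + A" using d d' by (simp add: A_def)
  have "(norm ((1/Z) *\<^sub>R z - (1/A) *\<^sub>R a))^2 = (1/Z)^2 * Z - 2 * (z \<bullet> a) / (Z * A) + (norm a)^2 / A^2"
    unfolding power2_norm_eq_inner Z_def
    by (simp add: inner_diff inner_commute algebra_simps power2_eq_square)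
  also have "\<dots> = 1 / Z - 2 * (z \<bullet> a) / (Z * A) + (A + r^2) / A^2"
    using Z by (simp add: A_def power2_eq_square)
  also have "\<dots> < 1 / Z - (Z + A) / (Z * A) + (A + r^2) / A^2"
    using za Z A by (simp add: divide_strict_right_mono)
  also have "\<dots> = (r / A)^2"
    using Z A by (simp add: field_simps power2_eq_square)
  finally have "norm ((1/Z) *\<^sub>R z - (1/A) *\<^sub>R a) < r / A"
    using r A by (simp add: power2_less_imp_less)
  then show ?thesis
    by (simp add: dist_norm norm_minus_commute Z_def A_def)
qed

lemma inversion_involution:
  fixes z :: "'a::real_inner"
  shows "z \<noteq> 0 \<Longrightarrow> (1 / (norm ((1 / (norm z)^2) *\<^sub>R z))^2) *\<^sub>R ((1 / (norm z)^2) *\<^sub>R z) = z"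
  by (simp add: power_divide field_simps power2_eq_square)

text \<open>The weight is at most $(|a|+r)^{2d}$ on the image, and the image lies in a ball of
radius $r/(|a|^2-r^2)$. The estimate is crude for a large ball, but its constant tends to $1$ when $r/|a|$ does to $0$.\<close>

lemma inversion_small_ball_integral:
  fixes a :: "'a::euclidean_space"
  assumes "0 < r" "r < norm a"
  shows "(\<integral>\<^sup>+y. ennreal (1 / norm y ^ (2 * DIM('a)))
            * indicator ((\<lambda>z. (1 / (norm z)^2) *\<^sub>R z) ` ball a r) y \<partial>lborel)
         \<le> ennreal (((norm a + r) / (norm a - r)) ^ DIM('a)) * emeasure lborel (ball a r)"
proof -
  let ?d = "DIM('a)"
  let ?G = "\<lambda>z::'a. (1 / (norm z)^2) *\<^sub>R z"
  define A where "A = (norm a)^2 - r^2"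
  have A: "A = (norm a + r) * (norm a - r)" "A > 0"
    using assms power_strict_mono[of r "norm a" 2]
    by (auto simp: A_def power2_eq_square algebra_simps)
  let ?B = "ball ((1 / A) *\<^sub>R a) (r / A)"
  have "(\<integral>\<^sup>+y. ennreal (1 / norm y ^ (2 * ?d)) * indicator (?G ` ball a r) y \<partial>lborel)
     \<le> (\<integral>\<^sup>+y. ennreal ((norm a + r) ^ (2 * ?d)) * indicator ?B y \<partial>lborel)"
  proof (rule nn_integral_mono)
    fix y :: 'a
    show "ennreal (1 / norm y ^ (2 * ?d)) * indicator (?G ` ball a r) y
        \<le> ennreal ((norm a + r) ^ (2 * ?d)) * indicator ?B y"
    proof (cases "y \<in> ?G ` ball a r")
      case True
      then obtain z where z: "z \<in> ball a r" "y = ?G z" by auto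
      have "y \<in> ?B" using inversion_image_ball[OF assms(2) z(1)] z(2) by (simp add: A_def)
      moreover have "norm z > 0" using z assms by auto
      moreover have "norm z \<le> norm a + r"
        using z(1) norm_triangle_sub[of z a] by (simp add: dist_norm norm_minus_commute)
      moreover have "1 / norm y = norm z" using z \<open>norm z > 0\<close> by (simp add: power2_eq_square)
      ultimately show ?thesis using True
        by (simp add: power_one_over[symmetric] ennreal_leI power_mono)
    qed simp
  qed
  also have "\<dots> = ennreal ((norm a + r) ^ (2 * ?d)) * emeasure lborel ?B"
    by (simp add: nn_integral_cmult_indicator)
  also have "\<dots> = ennreal ((norm a + r) ^ (2 * ?d)) * ennreal (unit_ball_vol ?d * (r / A) ^ ?d)"
    using A assms by (simp add: emeasure_ball)
  also have "\<dots> = ennreal ((norm a + r) ^ (2 * ?d) * (unit_ball_vol ?d * (r / A) ^ ?d))"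
    using A assms by (simp add: ennreal_mult)
  also have "(norm a + r) ^ (2 * ?d) * (unit_ball_vol ?d * (r / A) ^ ?d)
     = ((norm a + r) / (norm a - r)) ^ ?d * (unit_ball_vol ?d * r ^ ?d)"
  proof -
    have "(norm a + r)^2 * (r / A) = ((norm a + r) / (norm a - r)) * r"
      using assms A by (simp add: A power2_eq_square field_simps)
    then have "((norm a + r)^2 * (r / A)) ^ ?d = (((norm a + r) / (norm a - r)) * r) ^ ?d" by simp
    then show ?thesis
      unfolding power_mult power_mult_distrib by simp
  qed
  also have "ennreal \<dots> = ennreal (((norm a + r) / (norm a - r)) ^ ?d) * emeasure lborel (ball a r)"
    using assms by (simp add: ennreal_mult emeasure_ball)
  finally show ?thesis .
qed

text \<open>The weight $|y|^{-2d}$ is the Jacobian of the inversion, so the integral over a ball is the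
volume of its inverted image. Instead of a change of variables, the image is filled up to a null set by
disjoint small balls (Vitali), and the estimate for small balls is summed.\<close>

lemma inversion_ball_integral:
  fixes a :: "'a::euclidean_space"
  assumes "0 < r" "r < norm a"
  shows "(\<integral>\<^sup>+y. ennreal (1 / norm y ^ (2 * DIM('a))) * indicator (ball a r) y \<partial>lborel)
         \<le> ennreal (unit_ball_vol (real DIM('a)) * (r / ((norm a)^2 - r^2)) ^ DIM('a))"
proof -
  let ?d = "DIM('a)"
  define G where "G = (\<lambda>z::'a. (1 / (norm z)^2) *\<^sub>R z)"
  have GG: "G (G z) = z" if "z \<noteq> 0" for z
    using inversion_involution[OF that] by (simp add: G_def)
  have G0: "G z \<noteq> 0" if "z \<noteq> 0" for z
    using that by (simp add: G_def)
  have contG: "continuous_on (-{0}) G"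
    unfolding G_def by (intro continuous_intros) auto
  define A where "A = (norm a)^2 - r^2"
  have A: "A > 0" using assms by (simp add: A_def power_strict_mono)
  define F where "F = G ` ball a r"
  have nz: "z \<noteq> 0" if "z \<in> ball a r" for z using that assms by auto
  have F_sub: "F \<subseteq> ball ((1 / A) *\<^sub>R a) (r / A)"
    using inversion_image_ball[OF assms(2)] by (auto simp: F_def G_def A_def)
  have F_eq: "F = {y. y \<noteq> 0 \<and> G y \<in> ball a r}"
    using nz GG G0 by (force simp: F_def)
  have "open (-{0} \<inter> G -` ball a r)"
    by (rule continuous_open_preimage[OF contG]) auto
  moreover have "F = -{0} \<inter> G -` ball a r" by (auto simp: F_eq)
  ultimately have F_open: "open F" by simp
  have F_low: "norm y \<ge> 1 / (norm a + r)" if "y \<in> F" for y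
  proof -
    from that obtain z where z: "z \<in> ball a r" "y = G z" by (auto simp: F_def)
    have "norm z \<le> norm a + r"
      using z(1) norm_triangle_sub[of z a] by (simp add: dist_norm norm_minus_commute)
    then show ?thesis using nz[OF z(1)] z(2)
      by (simp add: G_def power2_eq_square frac_le)
  qed
  define m where "m = 1 / (norm a + r)"
  have m: "m > 0" using assms by (auto simp: m_def intro: add_pos_pos)
  have approx: "(\<integral>\<^sup>+y. ennreal (1 / norm y ^ (2 * ?d)) * indicator (ball a r) y \<partial>lborel)
      \<le> ennreal (((1 + e) / (1 - e)) ^ ?d) * emeasure lborel F" if e: "0 < e" "e < 1" for e
  proof -
    \<comment> \<open>Radii at most $e\,m$, where $m$ bounds $|y|$ on the image from below: the constant in the estimate for small balls is then close to $1$.\<close>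
    define K where "K = {(c, \<rho>). 0 < \<rho> \<and> \<rho> \<le> e * m \<and> ball c \<rho> \<subseteq> F}"
    have cov: "\<exists>i. i \<in> K \<and> x \<in> ball (fst i) (snd i) \<and> snd i < t" if "x \<in> F" "0 < t" for x t
    proof -
      obtain \<rho>0 where \<rho>0: "\<rho>0 > 0" "ball x \<rho>0 \<subseteq> F" using F_open \<open>x \<in> F\<close> open_contains_ball by blast
      define \<rho> where "\<rho> = min \<rho>0 (min (e * m) (t / 2))"
      have "\<rho> > 0" "\<rho> \<le> e * m" "\<rho> < t" "\<rho> \<le> \<rho>0" using \<rho>0 e m that by (auto simp: \<rho>_def)
      then show ?thesis using \<rho>0 by (intro exI[of _ "(x, \<rho>)"]) (auto simp: K_def)
    qed
    obtain C where C: "countable C" "C \<subseteq> K"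
      "pairwise (\<lambda>i j. disjnt (ball (fst i) (snd i)) (ball (fst j) (snd j))) C"
      "negligible (F - (\<Union>i\<in>C. ball (fst i) (snd i)))"
      using Vitali_covering_theorem_balls[of F K fst snd] cov by blast
    define N where "N = F - (\<Union>i\<in>C. ball (fst i) (snd i))"
    have "negligible (G ` N)"
    proof (rule negligible_differentiable_image_negligible)
      have "\<exists>D. (G has_derivative D) (at z within -{0})" if "z \<noteq> 0" for z
        unfolding G_def power2_norm_eq_inner
        by (rule exI) (rule derivative_intros | (use that in simp; fail))+
      then have "G differentiable_on -{0}"
        by (auto simp: differentiable_on_def differentiable_def)
      then show "G differentiable_on N"
        by (rule differentiable_on_subset) (auto simp: N_def F_eq)
    qed (use C in \<open>auto simp: N_def\<close>)
    then have N0: "emeasure lebesgue (G ` N) = 0"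
      by (simp add: negligible_iff_null_sets null_sets_def)
    have sub: "ball a r \<subseteq> (\<Union>i\<in>C. G ` ball (fst i) (snd i)) \<union> G ` N"
    proof
      fix y assume y: "y \<in> ball a r"
      then have "G y \<in> F" "y = G (G y)" using nz GG by (auto simp: F_def)
      show "y \<in> (\<Union>i\<in>C. G ` ball (fst i) (snd i)) \<union> G ` N"
      proof (cases "\<exists>i\<in>C. G y \<in> ball (fst i) (snd i)")
        case True
        then obtain i where "i \<in> C" "G y \<in> ball (fst i) (snd i)" by blast
        then have "G (G y) \<in> G ` ball (fst i) (snd i)" by (intro imageI)
        then have "y \<in> G ` ball (fst i) (snd i)" unfolding \<open>y = G (G y)\<close>[symmetric] .
        then show ?thesis using \<open>i \<in> C\<close> by blast
      next
        case False
        then have "G y \<in> N" using \<open>G y \<in> F\<close> by (auto simp: N_def)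
        then have "G (G y) \<in> G ` N" by (intro imageI)
        then have "y \<in> G ` N" unfolding \<open>y = G (G y)\<close>[symmetric] .
        then show ?thesis by blast
      qed
    qed
    let ?f = "\<lambda>y::'a. ennreal (1 / norm y ^ (2 * ?d))"
    have image_meas: "G ` ball (fst i) (snd i) \<in> sets borel" if "i \<in> C" for i
    proof -
      have "i \<in> K" using that C(2) by blast
      then have "ball (fst i) (snd i) \<subseteq> F" by (cases i) (simp add: K_def)
      then have eq: "G ` ball (fst i) (snd i) = G -` ball (fst i) (snd i) \<inter> -{0}"
        using GG G0 F_eq by (force simp: image_iff)
      have "open (-{0} \<inter> G -` ball (fst i) (snd i))"
        by (rule continuous_open_preimage[OF contG]) auto
      then show ?thesis unfolding eq by (simp add: Int_commute)
    qed
    have "(\<integral>\<^sup>+y. ?f y * indicator (ball a r) y \<partial>lborel)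
       = (\<integral>\<^sup>+y. ?f y * indicator (ball a r) y \<partial>lebesgue)"
      by (simp add: nn_integral_completion)
    also have "\<dots> \<le> (\<integral>\<^sup>+y. ?f y * indicator (\<Union>i\<in>C. G ` ball (fst i) (snd i)) y \<partial>lebesgue)"
    proof (rule nn_integral_mono_AE)
      have "AE y in lebesgue. y \<notin> G ` N"
        using \<open>negligible (G ` N)\<close> by (simp add: negligible_iff_null_sets AE_not_in)
      then show "AE y in lebesgue. ?f y * indicator (ball a r) y
            \<le> ?f y * indicator (\<Union>i\<in>C. G ` ball (fst i) (snd i)) y"
      proof (rule eventually_mono)
        fix y assume "y \<notin> G ` N"
        then have "y \<in> ball a r \<Longrightarrow> y \<in> (\<Union>i\<in>C. G ` ball (fst i) (snd i))" using sub by blast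
        then show "?f y * indicator (ball a r) y
            \<le> ?f y * indicator (\<Union>i\<in>C. G ` ball (fst i) (snd i)) y"
          by (cases "y \<in> ball a r") simp_all
      qed
    qed
    also have "\<dots> = (\<integral>\<^sup>+y. ?f y * indicator (\<Union>i\<in>C. G ` ball (fst i) (snd i)) y \<partial>lborel)"
      by (simp add: nn_integral_completion)
    also have "\<dots> \<le> (\<integral>\<^sup>+y. (\<integral>\<^sup>+i. ?f y * indicator (G ` ball (fst i) (snd i)) y \<partial>count_space C) \<partial>lborel)"
    proof (rule nn_integral_mono)
      fix y
      show "?f y * indicator (\<Union>i\<in>C. G ` ball (fst i) (snd i)) y
        \<le> (\<integral>\<^sup>+i. ?f y * indicator (G ` ball (fst i) (snd i)) y \<partial>count_space C)"
      proof (cases "y \<in> (\<Union>i\<in>C. G ` ball (fst i) (snd i))")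
        case True
        then obtain i where i: "i \<in> C" "y \<in> G ` ball (fst i) (snd i)" by blast
        have "?f y = (\<integral>\<^sup>+j. ?f y * indicator {i} j \<partial>count_space C)"
          using i by (simp add: nn_integral_cmult_indicator)
        also have "\<dots> \<le> (\<integral>\<^sup>+i. ?f y * indicator (G ` ball (fst i) (snd i)) y \<partial>count_space C)"
          by (intro nn_integral_mono) (use i in \<open>auto split: split_indicator\<close>)
        finally show ?thesis using True by simp
      qed simp
    qed
    also have "\<dots> = (\<integral>\<^sup>+i. (\<integral>\<^sup>+y. ?f y * indicator (G ` ball (fst i) (snd i)) y \<partial>lborel) \<partial>count_space C)"
      by (rule nn_integral_count_space_nn_integral) (use C(1) image_meas in auto)
    also have "\<dots> \<le> (\<integral>\<^sup>+i. ennreal (((1 + e) / (1 - e)) ^ ?d) * emeasure lborel (ball (fst i) (snd i)) \<partial>count_space C)"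
    proof (rule nn_integral_mono)
      fix i assume "i \<in> space (count_space C)"
      then have "i \<in> K" using C by auto
      then obtain c \<rho> where i: "i = (c, \<rho>)" "0 < \<rho>" "\<rho> \<le> e * m" "ball c \<rho> \<subseteq> F" by (auto simp: K_def)
      have "c \<in> F" using i by auto
      then have c: "m \<le> norm c" using F_low by (simp add: m_def)
      have \<rho>c: "\<rho> \<le> e * norm c" using i c e by (meson mult_left_mono less_imp_le order_trans)
      have "e * norm c < 1 * norm c" using e c m by (intro mult_strict_right_mono) auto
      then have "\<rho> < norm c" using \<rho>c by simp
      have "(norm c + \<rho>) * (1 - e) \<le> (1 + e) * (norm c - \<rho>)"
        using \<rho>c by (simp add: algebra_simps)
      then have "(norm c + \<rho>) / (norm c - \<rho>) \<le> (1 + e) / (1 - e)"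
        using \<open>\<rho> < norm c\<close> e by (simp add: divide_le_eq le_divide_eq)
      then have "((norm c + \<rho>) / (norm c - \<rho>)) ^ ?d \<le> ((1 + e) / (1 - e)) ^ ?d"
        using i \<open>\<rho> < norm c\<close> by (intro power_mono) (auto intro!: divide_nonneg_pos)
      then have le: "ennreal (((norm c + \<rho>) / (norm c - \<rho>)) ^ ?d) \<le> ennreal (((1 + e) / (1 - e)) ^ ?d)"
        by (rule ennreal_leI)
      have "(\<integral>\<^sup>+y. ?f y * indicator (G ` ball c \<rho>) y \<partial>lborel)
        \<le> ennreal (((norm c + \<rho>) / (norm c - \<rho>)) ^ ?d) * emeasure lborel (ball c \<rho>)"
        unfolding G_def by (rule inversion_small_ball_integral[OF i(2) \<open>\<rho> < norm c\<close>])
      also have "\<dots> \<le> ennreal (((1 + e) / (1 - e)) ^ ?d) * emeasure lborel (ball c \<rho>)"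
        by (intro mult_right_mono le) simp
      finally show "(\<integral>\<^sup>+y. ?f y * indicator (G ` ball (fst i) (snd i)) y \<partial>lborel)
        \<le> ennreal (((1 + e) / (1 - e)) ^ ?d) * emeasure lborel (ball (fst i) (snd i))"
        by (simp only: i(1) fst_conv snd_conv)
    qed
    also have "\<dots> = ennreal (((1 + e) / (1 - e)) ^ ?d) * (\<integral>\<^sup>+i. emeasure lborel (ball (fst i) (snd i)) \<partial>count_space C)"
      by (rule nn_integral_cmult) auto
    also have "(\<integral>\<^sup>+i. emeasure lborel (ball (fst i) (snd i)) \<partial>count_space C)
        = emeasure lborel (\<Union>i\<in>C. ball (fst i) (snd i))"
      by (rule emeasure_UN_countable[symmetric])
        (use C in \<open>auto simp: disjoint_family_on_def pairwise_def disjnt_def\<close>)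
    also have "\<dots> \<le> emeasure lborel F"
    proof (intro emeasure_mono UN_least)
      fix i assume "i \<in> C"
      then have "i \<in> K" using C(2) by blast
      then show "ball (fst i) (snd i) \<subseteq> F" by (cases i) (simp add: K_def)
    qed (use F_open in simp)
    finally show ?thesis by (simp add: mult_left_mono)
  qed
  have vF: "emeasure lborel F \<le> ennreal (unit_ball_vol ?d * (r / A) ^ ?d)"
    using emeasure_mono[OF F_sub, of lborel] A assms by (simp add: emeasure_ball)
  show ?thesis
  proof (rule tendsto_lowerbound)
    show "((\<lambda>e. ennreal (((1 + e) / (1 - e)) ^ ?d * (unit_ball_vol ?d * (r / A) ^ ?d))) \<longlongrightarrow>
       ennreal (unit_ball_vol (real DIM('a)) * (r / ((norm a)^2 - r^2)) ^ DIM('a))) (at_right 0)"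
      by (intro tendsto_ennrealI) (auto intro!: tendsto_eq_intros simp: A_def)
    show "\<forall>\<^sub>F e in at_right 0. (\<integral>\<^sup>+y. ennreal (1 / norm y ^ (2 * DIM('a))) * indicator (ball a r) y \<partial>lborel)
       \<le> ennreal (((1 + e) / (1 - e)) ^ ?d * (unit_ball_vol ?d * (r / A) ^ ?d))"
    proof -
      have "\<forall>\<^sub>F e::real in at_right 0. e < 1"
        using eventually_at_right_less eventually_at_right_real[of 0 1] by (auto elim: eventually_mono)
      moreover have "\<forall>\<^sub>F e::real in at_right 0. 0 < e" by (simp add: eventually_at_right_less)
      ultimately show ?thesis
      proof eventually_elim
        case (elim e)
        have "(\<integral>\<^sup>+y. ennreal (1 / norm y ^ (2 * DIM('a))) * indicator (ball a r) y \<partial>lborel)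
          \<le> ennreal (((1 + e) / (1 - e)) ^ ?d) * ennreal (unit_ball_vol ?d * (r / A) ^ ?d)"
          using approx[OF elim(2,1)] vF by (meson mult_left_mono order_trans zero_le)
        also have "\<dots> = ennreal (((1 + e) / (1 - e)) ^ ?d * (unit_ball_vol ?d * (r / A) ^ ?d))"
          using elim A assms by (simp add: ennreal_mult)
        finally show ?case .
      qed
    qed
  qed auto
qed

section \<open>The logarithmic kernel\<close>

text \<open>Turns a power of the logarithm into an integral over its level sets, which are balls.\<close>

lemma powr_layer_cake:
  fixes p t :: real
  assumes "p > 0" "t \<ge> 0"
  shows "ennreal (t powr p) = (\<integral>\<^sup>+r. ennreal (p * r powr (p - 1)) * indicator {0<..<t} r \<partial>lborel)"
proof -
  have "((\<lambda>x. x powr (p - 1)) has_integral (t powr (p - 1 + 1) / (p - 1 + 1))) {0..t}"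
    using assms by (intro has_integral_powr_from_0) auto
  then have "((\<lambda>x. p * x powr (p - 1)) has_integral p * (t powr (p - 1 + 1) / (p - 1 + 1))) {0..t}"
    by (rule has_integral_mult_right)
  then have "((\<lambda>x. p * x powr (p - 1)) has_integral t powr p) {0..t}"
    using assms by simp
  from nn_integral_has_integral_lebesgue[OF _ this] assms
  have "ennreal (t powr p) = (\<integral>\<^sup>+r. ennreal (p * r powr (p - 1)) * indicator {0..t} r \<partial>lborel)"
    by (simp add: indicator_mult_ennreal mult.commute)
  also have "\<dots> = (\<integral>\<^sup>+r. ennreal (p * r powr (p - 1)) * indicator {0<..<t} r \<partial>lborel)"
  proof (rule nn_integral_cong_AE)
    have "AE r in lborel. r \<noteq> 0 \<and> r \<noteq> t"
      using AE_lborel_singleton[of 0] AE_lborel_singleton[of t] by eventually_elim auto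
    then show "AE r in lborel. ennreal (p * r powr (p - 1)) * indicator {0..t} r
        = ennreal (p * r powr (p - 1)) * indicator {0<..<t} r"
      by eventually_elim (auto split: split_indicator)
  qed
  finally show ?thesis .
qed

lemma Gamma_exp_integral:
  fixes p b :: real
  assumes "p > 0" "b > 0"
  shows "(\<integral>\<^sup>+r. ennreal (p * r powr (p - 1) * exp (- b * r)) * indicator {0<..} r \<partial>lborel)
     = ennreal (Gamma (p + 1) / b powr p)"
proof -
  have "ennreal (Gamma p) = (\<integral>\<^sup>+t. ennreal (indicator {0..} t * t powr (p - 1) / exp t) \<partial>lborel)"
    by (rule Gamma_conv_nn_integral_real) fact
  also have "\<dots> = ennreal \<bar>b\<bar> * (\<integral>\<^sup>+t. ennreal (indicator {0..} (0 + b * t) * (0 + b * t) powr (p - 1) / exp (0 + b * t)) \<partial>lborel)"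
    using assms by (intro nn_integral_real_affine) auto
  also have "(\<lambda>t. ennreal (indicator {0..} (0 + b * t) * (0 + b * t) powr (p - 1) / exp (0 + b * t)))
     = (\<lambda>t. ennreal (b powr (p - 1)) * (ennreal (t powr (p - 1) * exp (- b * t)) * indicator {0..} t))"
    using assms
    by (auto simp: fun_eq_iff powr_mult exp_minus field_simps ennreal_mult'[symmetric] zero_le_mult_iff split: split_indicator)
  also have "ennreal \<bar>b\<bar> * (\<integral>\<^sup>+t. ennreal (b powr (p - 1)) * (ennreal (t powr (p - 1) * exp (- b * t)) * indicator {0..} t) \<partial>lborel)
     = ennreal (b powr p) * (\<integral>\<^sup>+t. ennreal (t powr (p - 1) * exp (- b * t)) * indicator {0..} t \<partial>lborel)"
  proof -
    have "b powr p = b * b powr (p - 1)" using assms by (simp add: powr_mult_base)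
    then show ?thesis
      using assms by (subst nn_integral_cmult) (auto simp: ennreal_mult' mult.assoc)
  qed
  finally have 1: "ennreal (Gamma p) = ennreal (b powr p) * (\<integral>\<^sup>+t. ennreal (t powr (p - 1) * exp (- b * t)) * indicator {0..} t \<partial>lborel)" .
  have "(\<integral>\<^sup>+r. ennreal (p * r powr (p - 1) * exp (- b * r)) * indicator {0<..} r \<partial>lborel)
     = (\<integral>\<^sup>+r. ennreal p * (ennreal (r powr (p - 1) * exp (- b * r)) * indicator {0..} r) \<partial>lborel)"
  proof (rule nn_integral_cong_AE)
    show "AE r in lborel. ennreal (p * r powr (p - 1) * exp (- b * r)) * indicator {0<..} r =
        ennreal p * (ennreal (r powr (p - 1) * exp (- b * r)) * indicator {0..} r)"
      using AE_lborel_singleton[of "0::real"] by (rule eventually_mono) (use assms in \<open>auto simp: ennreal_mult'[symmetric] mult.assoc split: split_indicator\<close>)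
  qed
  also have "\<dots> = ennreal p * (\<integral>\<^sup>+t. ennreal (t powr (p - 1) * exp (- b * t)) * indicator {0..} t \<partial>lborel)"
    by (rule nn_integral_cmult) auto
  also have "(\<integral>\<^sup>+t. ennreal (t powr (p - 1) * exp (- b * t)) * indicator {0..} t \<partial>lborel)
      = ennreal (1 / b powr p) * ennreal (Gamma p)"
    unfolding 1 using assms by (simp add: mult.assoc[symmetric] ennreal_mult'[symmetric])
  also have "ennreal p * (ennreal (1 / b powr p) * ennreal (Gamma p)) = ennreal (Gamma (p + 1) / b powr p)"
  proof -
    have "Gamma (p + 1) = p * Gamma p" using assms by (intro Gamma_plus1) auto
    then show ?thesis using assms by (simp add: ennreal_mult'[symmetric])
  qed
  finally show ?thesis .
qed

text \<open>The negative binomial series of $(1-x)^{-d}$ at $x = e^{-2r}$. It is the source of the series in the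
critical constant.\<close>

lemma geometric_power_series:
  fixes r :: real
  assumes "r > 0" "d > 0"
  shows "(\<lambda>n. fact (d + n - 1) / (fact n * fact (d - 1)) * exp (- (real d + 2 * real n) * r))
     sums ((exp (- r) / (1 - exp (- 2 * r))) ^ d)"
proof -
  define z where "z = exp (-2 * r)"
  have z: "0 < z" "z < 1" using assms by (auto simp: z_def)
  have "(\<lambda>n. ((- real d) gchoose n) * (- z) ^ n) sums (1 + (- z)) powr (- real d)"
    by (rule gen_binomial_real) (use z in auto)
  moreover have "((- real d) gchoose n) * (- z) ^ n = fact (d + n - 1) / (fact n * fact (d - 1)) * z ^ n" for n
  proof -
    have "((- real d) gchoose n) = (-1) ^ n * ((real d + real n - 1) gchoose n)"
      by (simp add: gbinomial_minus)
    also have "real d + real n - 1 = real (d + n - 1)" using assms by simp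
    also have "(real (d + n - 1) gchoose n) = real ((d + n - 1) choose n)"
      by (simp add: binomial_gbinomial)
    also have "\<dots> = fact (d + n - 1) / (fact n * fact (d - 1))"
      using assms by (subst binomial_fact) auto
    finally have "((- real d) gchoose n) * (- z) ^ n = ((-1) ^ n * (- z) ^ n) * (fact (d + n - 1) / (fact n * fact (d - 1)))"
      by simp
    also have "(-1) ^ n * (- z) ^ n = z ^ n" by (simp add: power_mult_distrib[symmetric])
    finally show ?thesis by simp
  qed
  ultimately have "(\<lambda>n. fact (d + n - 1) / (fact n * fact (d - 1)) * z ^ n) sums (1 - z) powr (- real d)" by simp
  then have "(\<lambda>n. exp (- r) ^ d * (fact (d + n - 1) / (fact n * fact (d - 1)) * z ^ n)) sums (exp (- r) ^ d * (1 - z) powr (- real d))"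
    by (rule sums_mult)
  moreover have "exp (- r) ^ d * (1 - z) powr (- real d) = (exp (- r) / (1 - exp (- 2 * r))) ^ d"
    using z by (simp add: powr_minus powr_realpow power_divide field_simps z_def)
  moreover have "exp (- r) ^ d * (fact (d + n - 1) / (fact n * fact (d - 1)) * z ^ n)
     = fact (d + n - 1) / (fact n * fact (d - 1)) * exp (- (real d + 2 * real n) * r)" for n
  proof -
    have "exp (- r) ^ d * z ^ n = exp (- (real d + 2 * real n) * r)"
      by (simp add: z_def exp_of_nat_mult[symmetric] exp_add[symmetric] algebra_simps)
    then show ?thesis by (metis mult.left_commute)
  qed
  ultimately show ?thesis by (simp only:)
qed

text \<open>The terms are at most a constant times $n^{d-1-p}$.\<close>

lemma Moser_series_summable:
  fixes p :: real
  assumes "p > real d" "d > 0"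
  shows "summable (\<lambda>n. fact (d + n - 1) / fact n * (1 / (real d + 2 * real n) powr p))"
proof (rule summable_comparison_test)
  show "summable (\<lambda>n. real n powr (real d - 1 - p))"
    using assms by (simp add: summable_real_powr_iff)
  have "fact (d + n - 1) / fact n * (1 / (real d + 2 * real n) powr p) \<le> real n powr (real d - 1 - p)" if "n \<ge> 1" for n
  proof -
    have "fact (d + n - 1) \<le> fact n * (real (d + n)) ^ (d - 1)"
    proof -
      have "fact (d + n - 1) div fact n \<le> (d + n - 1) ^ (d + n - 1 - n)"
        using fact_div_fact_le_pow[of "d - 1" "d + n - 1"] assms by simp
      moreover have "fact n dvd (fact (d + n - 1) :: nat)" using assms by (intro fact_dvd) auto
      ultimately have "(fact (d + n - 1) :: nat) \<le> fact n * (d + n - 1) ^ (d + n - 1 - n)"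
        by (metis dvd_mult_div_cancel mult_le_mono2)
      also have "\<dots> \<le> fact n * (d + n) ^ (d - 1)"
        by (intro mult_left_mono) (auto intro!: power_mono)
      finally have "real (fact (d + n - 1)) \<le> real (fact n * (d + n) ^ (d - 1))" by (simp only: of_nat_le_iff)
      then show ?thesis by simp
    qed
    then have "fact (d + n - 1) / fact n \<le> (real (d + n)) ^ (d - 1)"
      by (simp add: divide_simps mult.commute)
    also have "\<dots> \<le> (real d + 2 * real n) ^ (d - 1)" by (intro power_mono) auto
    also have "\<dots> = (real d + 2 * real n) powr (real d - 1)"
      using assms by (subst powr_realpow[symmetric]) (auto simp: of_nat_diff)
    finally have "fact (d + n - 1) / fact n * (1 / (real d + 2 * real n) powr p)
       \<le> (real d + 2 * real n) powr (real d - 1) * (1 / (real d + 2 * real n) powr p)"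
      by (intro mult_right_mono) auto
    also have "\<dots> = (real d + 2 * real n) powr (real d - 1 - p)" by (simp add: powr_diff)
    also have "\<dots> \<le> real n powr (real d - 1 - p)"
      using assms that by (intro powr_mono2') auto
    finally show ?thesis .
  qed
  then show "\<exists>N. \<forall>n\<ge>N. norm (fact (d + n - 1) / fact n * (1 / (real d + 2 * real n) powr p)) \<le> real n powr (real d - 1 - p)"
    by (intro exI[of _ 1]) auto
qed

text \<open>Integrating the negative binomial series term by term; each term is a Gamma integral.\<close>

lemma radial_profile_integral:
  fixes p :: real
  assumes "p > real d" "d > 0"
  shows "(\<integral>\<^sup>+r. ennreal (p * r powr (p - 1) * (exp (- r) / (1 - exp (- 2 * r))) ^ d) * indicator {0<..} r \<partial>lborel)
     = ennreal (Gamma (p + 1) / fact (d - 1) * (\<Sum>n. fact (d + n - 1) / fact n * (1 / (real d + 2 * real n) powr p)))"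
proof -
  let ?c = "\<lambda>n. fact (d + n - 1) / (fact n * fact (d - 1)) :: real"
  have p: "p > 0" using assms by auto
  have "(\<integral>\<^sup>+r. ennreal (p * r powr (p - 1) * (exp (- r) / (1 - exp (- 2 * r))) ^ d) * indicator {0<..} r \<partial>lborel)
    = (\<integral>\<^sup>+r. (\<Sum>n. ennreal (?c n) * (ennreal (p * r powr (p - 1) * exp (- (real d + 2 * real n) * r)) * indicator {0<..} r)) \<partial>lborel)"
  proof (rule nn_integral_cong)
    fix r :: real
    show "ennreal (p * r powr (p - 1) * (exp (- r) / (1 - exp (- 2 * r))) ^ d) * indicator {0<..} r
      = (\<Sum>n. ennreal (?c n) * (ennreal (p * r powr (p - 1) * exp (- (real d + 2 * real n) * r)) * indicator {0<..} r))"
    proof (cases "r > 0")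
      case True
      have "(\<lambda>n. p * r powr (p - 1) * (?c n * exp (- (real d + 2 * real n) * r))) sums
        (p * r powr (p - 1) * (exp (- r) / (1 - exp (- 2 * r))) ^ d)"
        by (intro sums_mult geometric_power_series) (use True assms in auto)
      from sums_ennreal[THEN iffD2, OF _ _ this] p
      have "(\<lambda>n. ennreal (p * r powr (p - 1) * (?c n * exp (- (real d + 2 * real n) * r)))) sums
        ennreal (p * r powr (p - 1) * (exp (- r) / (1 - exp (- 2 * r))) ^ d)"
        using True by simp
      then show ?thesis using True p
        by (simp add: sums_iff ennreal_mult'[symmetric] mult_ac)
    qed simp
  qed
  also have "\<dots> = (\<Sum>n. \<integral>\<^sup>+r. ennreal (?c n) * (ennreal (p * r powr (p - 1) * exp (- (real d + 2 * real n) * r)) * indicator {0<..} r) \<partial>lborel)"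
    by (rule nn_integral_suminf) auto
  also have "\<dots> = (\<Sum>n. ennreal (?c n) * ennreal (Gamma (p + 1) / (real d + 2 * real n) powr p))"
  proof (rule suminf_cong)
    fix n
    have "(\<integral>\<^sup>+r. ennreal (p * r powr (p - 1) * exp (- (real d + 2 * real n) * r)) * indicator {0<..} r \<partial>lborel)
      = ennreal (Gamma (p + 1) / (real d + 2 * real n) powr p)"
      using p assms(2) by (intro Gamma_exp_integral) auto
    then show "(\<integral>\<^sup>+r. ennreal (?c n) * (ennreal (p * r powr (p - 1) * exp (- (real d + 2 * real n) * r)) * indicator {0<..} r) \<partial>lborel)
      = ennreal (?c n) * ennreal (Gamma (p + 1) / (real d + 2 * real n) powr p)"
      by (subst nn_integral_cmult) auto
  qed
  also have "\<dots> = (\<Sum>n. ennreal (Gamma (p + 1) / fact (d - 1) * (fact (d + n - 1) / fact n * (1 / (real d + 2 * real n) powr p))))"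
  proof (rule suminf_cong)
    fix n
    have "?c n * (Gamma (p + 1) / (real d + 2 * real n) powr p) = Gamma (p + 1) / fact (d - 1) * (fact (d + n - 1) / fact n * (1 / (real d + 2 * real n) powr p))"
      by (simp add: mult_ac)
    then show "ennreal (?c n) * ennreal (Gamma (p + 1) / (real d + 2 * real n) powr p)
      = ennreal (Gamma (p + 1) / fact (d - 1) * (fact (d + n - 1) / fact n * (1 / (real d + 2 * real n) powr p)))"
      by (subst ennreal_mult'[symmetric]) simp_all
  qed
  also have "\<dots> = ennreal (\<Sum>n. Gamma (p + 1) / fact (d - 1) * (fact (d + n - 1) / fact n * (1 / (real d + 2 * real n) powr p)))"
    using p by (intro suminf_ennreal2 summable_mult Moser_series_summable assms) (auto intro!: mult_nonneg_nonneg divide_nonneg_pos Gamma_real_nonneg)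
  also have "(\<Sum>n. Gamma (p + 1) / fact (d - 1) * (fact (d + n - 1) / fact n * (1 / (real d + 2 * real n) powr p)))
    = Gamma (p + 1) / fact (d - 1) * (\<Sum>n. fact (d + n - 1) / fact n * (1 / (real d + 2 * real n) powr p))"
    by (intro suminf_mult Moser_series_summable assms)
  finally show ?thesis .
qed

lemma nn_integral_lborel_translate:
  fixes f :: "'a::euclidean_space \<Rightarrow> ennreal"
  assumes [measurable]: "f \<in> borel_measurable borel"
  shows "(\<integral>\<^sup>+x. f (c + x) \<partial>lborel) = (\<integral>\<^sup>+x. f x \<partial>lborel)"
proof -
  have "(\<integral>\<^sup>+x. f x \<partial>lborel) = (\<integral>\<^sup>+x. f x \<partial>(distr lborel borel ((+) c)))"
    by (simp add: lborel_distr_plus)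
  also have "\<dots> = (\<integral>\<^sup>+x. f (c + x) \<partial>lborel)"
    by (subst nn_integral_distr) auto
  finally show ?thesis by simp
qed

text \<open>By the layer cake formula for $\ln(|x|/|y|)^p$, the integral is a superposition over $r > 0$ of the integrals of
$|x-y|^{-2d}$ over the balls $|y| < |x|e^{-r}$. These are known from inversion and equal a multiple of
$(e^{-r}/(1-e^{-2r}))^d$, which is integrated as a series.\<close>

lemma log_kernel_integral:
  fixes x :: "'a::euclidean_space" and p :: real
  assumes "p > real DIM('a)" "x \<noteq> 0"
  shows "(\<integral>\<^sup>+y. ennreal (ln (norm x / norm y) powr p / norm (x - y) ^ (2 * DIM('a))) * indicator (ball 0 (norm x)) y \<partial>lborel)
     \<le> ennreal (unit_ball_vol (real DIM('a)) * (Gamma (p + 1) / fact (DIM('a) - 1) *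
          (\<Sum>n. fact (DIM('a) + n - 1) / fact n * (1 / (real DIM('a) + 2 * real n) powr p)))) * ennreal (1 / norm x ^ DIM('a))"
proof -
  let ?d = "DIM('a)" and ?X = "norm x"
  let ?S = "Gamma (p + 1) / fact (DIM('a) - 1) *
          (\<Sum>n. fact (DIM('a) + n - 1) / fact n * (1 / (real DIM('a) + 2 * real n) powr p))"
  have X: "?X > 0" using assms by simp
  have p: "p > 0" using assms by (smt (verit) DIM_positive of_nat_0_less_iff)
  have "(\<integral>\<^sup>+y. ennreal (ln (?X / norm y) powr p / norm (x - y) ^ (2 * ?d)) * indicator (ball 0 ?X) y \<partial>lborel)
    \<le> (\<integral>\<^sup>+y. (\<integral>\<^sup>+r. ennreal (p * r powr (p - 1)) * indicator {0<..} r *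
         (ennreal (1 / norm (x - y) ^ (2 * ?d)) * indicator {y. norm y < ?X * exp (- r)} y) \<partial>lborel) \<partial>lborel)"
  proof (rule nn_integral_mono)
    fix y :: 'a
    show "ennreal (ln (?X / norm y) powr p / norm (x - y) ^ (2 * ?d)) * indicator (ball 0 ?X) y
      \<le> (\<integral>\<^sup>+r. ennreal (p * r powr (p - 1)) * indicator {0<..} r *
         (ennreal (1 / norm (x - y) ^ (2 * ?d)) * indicator {y. norm y < ?X * exp (- r)} y) \<partial>lborel)"
    proof (cases "y \<in> ball 0 ?X \<and> y \<noteq> 0")
      case True
      then have y: "0 < norm y" "norm y < ?X" by auto
      have "1 < ?X / norm y" using y by (simp add: less_divide_eq)
      then have "ln (?X / norm y) > 0" by (rule ln_gt_zero)
      then have "ennreal (ln (?X / norm y) powr p / norm (x - y) ^ (2 * ?d))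
         = (\<integral>\<^sup>+r. ennreal (p * r powr (p - 1)) * indicator {0<..<ln (?X / norm y)} r \<partial>lborel) * ennreal (1 / norm (x - y) ^ (2 * ?d))"
        using p by (subst powr_layer_cake[symmetric]) (auto simp: ennreal_mult'[symmetric])
      also have "\<dots> = (\<integral>\<^sup>+r. ennreal (p * r powr (p - 1)) * indicator {0<..<ln (?X / norm y)} r * ennreal (1 / norm (x - y) ^ (2 * ?d)) \<partial>lborel)"
        by (rule nn_integral_multc[symmetric]) auto
      also have "\<dots> \<le> (\<integral>\<^sup>+r. ennreal (p * r powr (p - 1)) * indicator {0<..} r *
         (ennreal (1 / norm (x - y) ^ (2 * ?d)) * indicator {y. norm y < ?X * exp (- r)} y) \<partial>lborel)"
      proof (rule nn_integral_mono)
        fix r :: real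
        have "norm y < ?X * exp (- r)" if "r < ln (?X / norm y)"
        proof -
          from that have "exp r < ?X / norm y" using y by (metis exp_less_mono exp_ln divide_pos_pos order.strict_trans)
          then show ?thesis using y by (simp add: exp_minus field_simps)
        qed
        then show "ennreal (p * r powr (p - 1)) * indicator {0<..<ln (?X / norm y)} r * ennreal (1 / norm (x - y) ^ (2 * ?d))
          \<le> ennreal (p * r powr (p - 1)) * indicator {0<..} r *
         (ennreal (1 / norm (x - y) ^ (2 * ?d)) * indicator {y. norm y < ?X * exp (- r)} y)"
          by (auto split: split_indicator)
      qed
      finally show ?thesis using True by simp
    qed (auto)
  qed
  also have "\<dots> = (\<integral>\<^sup>+r. (\<integral>\<^sup>+y. ennreal (p * r powr (p - 1)) * indicator {0<..} r *
         (ennreal (1 / norm (x - y) ^ (2 * ?d)) * indicator {y. norm y < ?X * exp (- r)} y) \<partial>lborel) \<partial>lborel)"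
    by (rule lborel_pair.Fubini') measurable
  also have "\<dots> \<le> (\<integral>\<^sup>+r. ennreal (unit_ball_vol ?d / ?X ^ ?d) * (ennreal (p * r powr (p - 1) * (exp (- r) / (1 - exp (- 2 * r))) ^ ?d) * indicator {0<..} r) \<partial>lborel)"
  proof (rule nn_integral_mono)
    fix r :: real
    show "(\<integral>\<^sup>+y. ennreal (p * r powr (p - 1)) * indicator {0<..} r *
         (ennreal (1 / norm (x - y) ^ (2 * ?d)) * indicator {y. norm y < ?X * exp (- r)} y) \<partial>lborel)
      \<le> ennreal (unit_ball_vol ?d / ?X ^ ?d) * (ennreal (p * r powr (p - 1) * (exp (- r) / (1 - exp (- 2 * r))) ^ ?d) * indicator {0<..} r)"
    proof (cases "r > 0")
      case True
      have er: "0 < exp (-r)" "exp (-r) < 1" using True by auto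
      have e2: "exp (- 2 * r) = exp (- r) ^ 2" by (simp add: exp_of_nat_mult[symmetric])
      have "(\<integral>\<^sup>+y. ennreal (1 / norm (x - y) ^ (2 * ?d)) * indicator {y. norm y < ?X * exp (- r)} y \<partial>lborel)
        = (\<integral>\<^sup>+y. ennreal (1 / norm (x - (x + y)) ^ (2 * ?d)) * indicator {y. norm y < ?X * exp (- r)} (x + y) \<partial>lborel)"
        by (rule nn_integral_lborel_translate[symmetric]) measurable
      also have "\<dots> = (\<integral>\<^sup>+y. ennreal (1 / norm y ^ (2 * ?d)) * indicator (ball (- x) (?X * exp (- r))) y \<partial>lborel)"
        by (auto intro!: nn_integral_cong split: split_indicator simp: dist_norm norm_minus_commute[of "-x"] add.commute)
      also have "\<dots> \<le> ennreal (unit_ball_vol ?d * ((?X * exp (- r)) / ((norm (- x))^2 - (?X * exp (- r))^2)) ^ ?d)"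
        by (rule inversion_ball_integral) (use X er in auto)
      also have "(?X * exp (- r)) / ((norm (- x))^2 - (?X * exp (- r))^2) = (1 / ?X) * (exp (- r) / (1 - exp (- 2 * r)))"
      proof -
        have "exp (-r) ^ 2 < 1" using er by (simp add: power_less_one_iff)
        then show ?thesis using X unfolding e2 by (simp add: divide_simps) (simp add: power2_eq_square algebra_simps)
      qed
      finally have "(\<integral>\<^sup>+y. ennreal (1 / norm (x - y) ^ (2 * ?d)) * indicator {y. norm y < ?X * exp (- r)} y \<partial>lborel)
        \<le> ennreal (unit_ball_vol ?d * ((1 / ?X) * (exp (- r) / (1 - exp (- 2 * r)))) ^ ?d)" .
      from mult_left_mono[OF this, of "ennreal (p * r powr (p - 1))"]
      have "(\<integral>\<^sup>+y. ennreal (p * r powr (p - 1)) * (ennreal (1 / norm (x - y) ^ (2 * ?d)) * indicator {y. norm y < ?X * exp (- r)} y) \<partial>lborel)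
        \<le> ennreal (p * r powr (p - 1)) * ennreal (unit_ball_vol ?d * ((1 / ?X) * (exp (- r) / (1 - exp (- 2 * r)))) ^ ?d)"
        by (subst nn_integral_cmult) auto
      also have "\<dots> = ennreal (unit_ball_vol ?d / ?X ^ ?d) * ennreal (p * r powr (p - 1) * (exp (- r) / (1 - exp (- 2 * r))) ^ ?d)"
        using p X True unfolding power_mult_distrib
        by (subst (1 2) ennreal_mult'[symmetric]) (auto simp: power_one_over mult_ac)
      finally show ?thesis using True by simp
    qed simp
  qed
  also have "\<dots> = ennreal (unit_ball_vol ?d / ?X ^ ?d) * ennreal ?S"
    by (subst nn_integral_cmult) (auto simp only: radial_profile_integral[OF assms(1) DIM_positive], auto)
  also have "\<dots> = ennreal (unit_ball_vol ?d * ?S) * ennreal (1 / ?X ^ ?d)"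
  proof -
    have "ennreal (unit_ball_vol ?d / ?X ^ ?d) = ennreal (unit_ball_vol ?d) * ennreal (1 / ?X ^ ?d)"
      using X by (simp add: ennreal_mult'[symmetric])
    moreover have "ennreal (unit_ball_vol ?d * ?S) = ennreal (unit_ball_vol ?d) * ennreal ?S"
      by (intro ennreal_mult') auto
    ultimately show ?thesis by (simp only: mult_ac)
  qed
  finally show ?thesis .
qed

lemma DERIV_neg_inverse_power:
  fixes r :: real
  assumes "r > 0"
  shows "((\<lambda>r. - (1 / r ^ n)) has_real_derivative real n / r ^ (n + 1)) (at r)"
proof (cases n)
  case (Suc m)
  have "((\<lambda>r. - (1 / r ^ Suc m)) has_real_derivative - ((0 * r ^ Suc m - 1 * (real (Suc m) * (1 * r ^ (Suc m - Suc 0)))) / (r ^ Suc m * r ^ Suc m))) (at r)"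
    using assms by (intro DERIV_minus DERIV_divide DERIV_power DERIV_ident DERIV_const) auto
  moreover have "- ((0 * r ^ Suc m - 1 * (real (Suc m) * (1 * r ^ (Suc m - Suc 0)))) / (r ^ Suc m * r ^ Suc m)) = real n / r ^ (n + 1)"
    using assms Suc by (simp add: field_simps)
  ultimately show ?thesis using Suc by simp
qed simp

lemma inverse_power_layer_cake:
  fixes t :: real
  assumes "t > 0" "n > 0"
  shows "(\<integral>\<^sup>+r. ennreal (real n / r ^ (n + 1)) * indicator {t..} r \<partial>lborel) = ennreal (1 / t ^ n)"
proof -
  have "(\<integral>\<^sup>+r. ennreal (real n / r ^ (n + 1)) * indicator {t..} r \<partial>lborel) = ennreal (0 - (- (1 / t ^ n)))"
  proof (rule nn_integral_FTC_atLeast)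
    fix r :: real assume "t \<le> r"
    then have r: "r > 0" using assms by simp
    show "((\<lambda>r. - (1 / r ^ n)) has_real_derivative real n / r ^ (n + 1)) (at r)"
      by (rule DERIV_neg_inverse_power[OF r])
    show "0 \<le> real n / r ^ (n + 1)" using r by simp
  next
    have "filterlim (\<lambda>r::real. r ^ n) at_top at_top"
      using assms by (intro filterlim_pow_at_top filterlim_ident) auto
    then have "((\<lambda>r::real. 1 / r ^ n) \<longlongrightarrow> 0) at_top"
      by (intro tendsto_divide_0[OF tendsto_const] filterlim_at_top_imp_at_infinity)
    from tendsto_minus[OF this] show "((\<lambda>r. - (1 / r ^ n)) \<longlongrightarrow> (0::real)) at_top" by simp
  qed auto
  then show ?thesis by simp
qed

text \<open>Only the leading coefficient $d\,\omega_d$ of $\ln(D/a)$ matters, so an upper bound with an additive constant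
replaces polar coordinates: the power is written as an integral over radii.\<close>

lemma shell_integral:
  fixes a D :: real
  assumes "0 < a" "a \<le> D"
  shows "(\<integral>\<^sup>+x. ennreal (1 / norm x ^ DIM('a)) * indicator {x::'a::euclidean_space. a < norm x \<and> norm x < D} x \<partial>lborel)
    \<le> ennreal (unit_ball_vol (real DIM('a)) * (real DIM('a) * ln (D / a) + 1))"
proof -
  let ?d = "DIM('a)" and ?w = "unit_ball_vol (real DIM('a))"
  have F: "(\<integral>\<^sup>+r. ennreal (real ?d / r ^ (?d + 1)) * indicator {t..} r \<partial>lborel) = ennreal (1 / t ^ ?d)" if "t > 0" for t :: real
    by (rule inverse_power_layer_cake[OF that DIM_positive])
  have "(\<integral>\<^sup>+x. ennreal (1 / norm x ^ ?d) * indicator {x::'a. a < norm x \<and> norm x < D} x \<partial>lborel)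
     \<le> (\<integral>\<^sup>+x. (\<integral>\<^sup>+r. ennreal (real ?d / r ^ (?d + 1)) * indicator {a..} r * indicator {x::'a. norm x \<le> r \<and> norm x < D} x \<partial>lborel) \<partial>lborel)"
  proof (rule nn_integral_mono)
    fix x :: 'a
    show "ennreal (1 / norm x ^ ?d) * indicator {x::'a. a < norm x \<and> norm x < D} x
      \<le> (\<integral>\<^sup>+r. ennreal (real ?d / r ^ (?d + 1)) * indicator {a..} r * indicator {x::'a. norm x \<le> r \<and> norm x < D} x \<partial>lborel)"
    proof (cases "a < norm x \<and> norm x < D")
      case True
      then have "ennreal (1 / norm x ^ ?d) = (\<integral>\<^sup>+r. ennreal (real ?d / r ^ (?d + 1)) * indicator {norm x..} r \<partial>lborel)"
        using assms by (subst F) auto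
      also have "\<dots> \<le> (\<integral>\<^sup>+r. ennreal (real ?d / r ^ (?d + 1)) * indicator {a..} r * indicator {x::'a. norm x \<le> r \<and> norm x < D} x \<partial>lborel)"
        by (rule nn_integral_mono) (use True in \<open>auto split: split_indicator\<close>)
      finally show ?thesis using True by simp
    qed auto
  qed
  also have "\<dots> = (\<integral>\<^sup>+r. (\<integral>\<^sup>+x. ennreal (real ?d / r ^ (?d + 1)) * indicator {a..} r * indicator {x::'a. norm x \<le> r \<and> norm x < D} x \<partial>lborel) \<partial>lborel)"
    by (rule lborel_pair.Fubini') measurable
  also have "\<dots> \<le> (\<integral>\<^sup>+r. ennreal ?w * (ennreal (real ?d / r) * indicator {a..D} r + ennreal (D ^ ?d) * (ennreal (real ?d / r ^ (?d + 1)) * indicator {D..} r)) \<partial>lborel)"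
  proof (rule nn_integral_mono)
    fix r :: real
    show "(\<integral>\<^sup>+x. ennreal (real ?d / r ^ (?d + 1)) * indicator {a..} r * indicator {x::'a. norm x \<le> r \<and> norm x < D} x \<partial>lborel)
      \<le> ennreal ?w * (ennreal (real ?d / r) * indicator {a..D} r + ennreal (D ^ ?d) * (ennreal (real ?d / r ^ (?d + 1)) * indicator {D..} r))"
    proof (cases "r \<ge> a")
      case True
      then have r: "r > 0" using assms by simp
      have "(\<integral>\<^sup>+x. ennreal (real ?d / r ^ (?d + 1)) * indicator {a..} r * indicator {x::'a. norm x \<le> r \<and> norm x < D} x \<partial>lborel)
        = ennreal (real ?d / r ^ (?d + 1)) * emeasure lborel {x::'a. norm x \<le> r \<and> norm x < D}"
        using True by (simp add: nn_integral_cmult_indicator)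
      also have "\<dots> \<le> ennreal (real ?d / r ^ (?d + 1)) * ennreal (?w * (min r D) ^ ?d)"
      proof (intro mult_left_mono)
        have "emeasure lborel {x::'a. norm x \<le> r \<and> norm x < D} \<le> emeasure lborel (cball (0::'a) (min r D))"
          by (intro emeasure_mono) auto
        also have "\<dots> = ennreal (?w * (min r D) ^ ?d)" using r assms by (subst emeasure_cball) auto
        finally show "emeasure lborel {x::'a. norm x \<le> r \<and> norm x < D} \<le> ennreal (?w * (min r D) ^ ?d)" .
      qed auto
      also have "\<dots> = ennreal (real ?d / r ^ (?d + 1) * (?w * (min r D) ^ ?d))"
        using r by (intro ennreal_mult'[symmetric]) auto
      also have "\<dots> \<le> ennreal ?w * (ennreal (real ?d / r) * indicator {a..D} r + ennreal (D ^ ?d) * (ennreal (real ?d / r ^ (?d + 1)) * indicator {D..} r))"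
      proof (cases "r \<le> D")
        case True
        then have "ennreal (real ?d / r ^ (?d + 1) * (?w * (min r D) ^ ?d)) = ennreal ?w * (ennreal (real ?d / r) * indicator {a..D} r)"
          using r \<open>r \<ge> a\<close> by (simp add: ennreal_mult'[symmetric] field_simps)
        also have "\<dots> \<le> ennreal ?w * (ennreal (real ?d / r) * indicator {a..D} r + ennreal (D ^ ?d) * (ennreal (real ?d / r ^ (?d + 1)) * indicator {D..} r))"
          by (intro mult_left_mono) auto
        finally show ?thesis .
      next
        case False
        then show ?thesis using r assms \<open>r \<ge> a\<close> by (simp add: ennreal_mult'[symmetric] field_simps)
      qed
      finally show ?thesis .
    qed auto
  qed
  also have "\<dots> = ennreal ?w * ((\<integral>\<^sup>+r. ennreal (real ?d / r) * indicator {a..D} r \<partial>lborel) + ennreal (D ^ ?d) * (\<integral>\<^sup>+r. ennreal (real ?d / r ^ (?d + 1)) * indicator {D..} r \<partial>lborel))"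
    by (simp add: nn_integral_cmult nn_integral_add)
  also have "(\<integral>\<^sup>+r. ennreal (real ?d / r) * indicator {a..D} r \<partial>lborel) = ennreal (real ?d * ln D - real ?d * ln a)"
    by (rule nn_integral_FTC_Icc) (use assms in \<open>auto intro!: derivative_eq_intros\<close>)
  also have "(\<integral>\<^sup>+r. ennreal (real ?d / r ^ (?d + 1)) * indicator {D..} r \<partial>lborel) = ennreal (1 / D ^ ?d)"
    using assms by (intro F) auto
  also have "ennreal ?w * (ennreal (real ?d * ln D - real ?d * ln a) + ennreal (D ^ ?d) * ennreal (1 / D ^ ?d))
     = ennreal (?w * (real ?d * ln (D / a) + 1))"
  proof -
    have "real ?d * ln D - real ?d * ln a = real ?d * ln (D / a)"
      using assms by (simp add: ln_div right_diff_distrib)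
    moreover have "0 \<le> real ?d * ln (D / a)" using assms by simp
    moreover have "ennreal (D ^ ?d) * ennreal (1 / D ^ ?d) = ennreal 1"
      using assms by (subst ennreal_mult'[symmetric]) auto
    ultimately have "ennreal (real ?d * ln D - real ?d * ln a) + ennreal (D ^ ?d) * ennreal (1 / D ^ ?d) = ennreal (real ?d * ln (D / a) + 1)"
      by (metis ennreal_plus zero_le_one)
    then show ?thesis by (simp add: ennreal_mult')
  qed
  finally show ?thesis .
qed

section \<open>Smooth truncated logarithms\<close>

text \<open>Differentiability of order $n$ of a function of one real variable. The derivative is a witness rather than a
fixed operator, which makes the closure properties direct inductions.\<close>

primrec Cn_real :: "nat \<Rightarrow> (real \<Rightarrow> real) \<Rightarrow> bool" where
  "Cn_real 0 f \<longleftrightarrow> continuous_on UNIV f"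
| "Cn_real (Suc n) f \<longleftrightarrow> (\<exists>f'. (\<forall>x. (f has_real_derivative f' x) (at x)) \<and> Cn_real n f')"

lemma Cn_real_SucI:
  "(\<And>x. (f has_real_derivative f' x) (at x)) \<Longrightarrow> Cn_real n f' \<Longrightarrow> Cn_real (Suc n) f"
  unfolding Cn_real.simps by blast

lemma Cn_real_SucD: "Cn_real (Suc n) f \<Longrightarrow> Cn_real n f"
proof (induction n arbitrary: f)
  case 0
  then obtain f' where "\<And>x. (f has_real_derivative f' x) (at x)" by auto
  then have "isCont f x" for x by (rule DERIV_isCont)
  then show ?case by (simp add: continuous_at_imp_continuous_on)
next
  case (Suc n)
  then obtain f' where f': "\<And>x. (f has_real_derivative f' x) (at x)" "Cn_real (Suc n) f'" by auto
  from f'(1) Suc.IH[OF f'(2)] show ?case by (rule Cn_real_SucI)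
qed

lemma Cn_real_const: "Cn_real n (\<lambda>x. c)"
  by (induction n arbitrary: c) (auto intro!: exI[of _ "\<lambda>x. 0"])

lemma Cn_real_add: "Cn_real n f \<Longrightarrow> Cn_real n g \<Longrightarrow> Cn_real n (\<lambda>x. f x + g x)"
proof (induction n arbitrary: f g)
  case 0 then show ?case by (auto intro: continuous_intros)
next
  case (Suc n)
  then obtain f' g' where "\<forall>x. (f has_real_derivative f' x) (at x)" "Cn_real n f'"
    "\<forall>x. (g has_real_derivative g' x) (at x)" "Cn_real n g'" by auto
  then show ?case using Suc.IH by (auto intro!: exI[of _ "\<lambda>x. f' x + g' x"] DERIV_add)
qed

lemma Cn_real_mult: "Cn_real n f \<Longrightarrow> Cn_real n g \<Longrightarrow> Cn_real n (\<lambda>x. f x * g x)"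
proof (induction n arbitrary: f g)
  case 0 then show ?case by (auto intro: continuous_intros)
next
  case (Suc n)
  then obtain f' g' where *: "\<forall>x. (f has_real_derivative f' x) (at x)" "Cn_real n f'"
    "\<forall>x. (g has_real_derivative g' x) (at x)" "Cn_real n g'" by auto
  have "Cn_real n f" "Cn_real n g" using Suc.prems by (blast intro: Cn_real_SucD)+
  then have "Cn_real n (\<lambda>x. f' x * g x + g' x * f x)"
    using * by (intro Cn_real_add Suc.IH)
  moreover have "((\<lambda>x. f x * g x) has_real_derivative f' x * g x + g' x * f x) (at x)" for x
    using * by (auto intro: DERIV_mult)
  ultimately show ?case by (intro Cn_real_SucI)
qed

lemma Cn_real_affine: "Cn_real n f \<Longrightarrow> Cn_real n (\<lambda>x. f (a * x + b))"
proof (induction n arbitrary: f)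
  case 0
  then show ?case by (auto intro!: continuous_intros elim!: continuous_on_compose2)
next
  case (Suc n)
  then obtain f' where *: "\<forall>x. (f has_real_derivative f' x) (at x)" "Cn_real n f'" by auto
  have "((\<lambda>x. f (a * x + b)) has_real_derivative f' (a * x + b) * a) (at x)" for x
    by (rule DERIV_chain'[where g=f]) (use * in \<open>auto intro!: derivative_eq_intros\<close>)
  moreover have "Cn_real n (\<lambda>x. f' (a * x + b) * a)"
    using * by (intro Cn_real_mult Cn_real_const Suc.IH) auto
  ultimately show ?case by (rule Cn_real_SucI)
qed

text \<open>Supplies the derivative of flat functions at the point where they vanish to all orders.\<close>

lemma DERIV_zero_of_quadratic_bound:
  fixes f :: "real \<Rightarrow> real"
  assumes "\<And>x. \<bar>f x\<bar> \<le> C * x^2"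
  shows "(f has_real_derivative 0) (at 0)"
proof -
  have "f 0 = 0" using assms[of 0] by simp
  have "((\<lambda>h. f h / h) \<longlongrightarrow> 0) (at 0)"
  proof (rule Lim_null_comparison)
    show "\<forall>\<^sub>F h in at 0. norm (f h / h) \<le> C * \<bar>h\<bar>"
    proof (rule eventually_mono[OF eventually_neq_at_within])
      fix h :: real assume "h \<noteq> 0"
      then show "norm (f h / h) \<le> C * \<bar>h\<bar>"
        using assms[of h] by (simp add: divide_le_eq power2_eq_square abs_mult[symmetric] mult.assoc)
    qed
    show "((\<lambda>h. C * \<bar>h\<bar>) \<longlongrightarrow> 0) (at 0)" by (auto intro!: tendsto_eq_intros)
  qed
  then show ?thesis using \<open>f 0 = 0\<close> by (simp add: DERIV_def)
qed

lemma power_div_fact_le_exp: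
  fixes x :: real
  assumes "x \<ge> 0"
  shows "x ^ n / fact n \<le> exp x"
proof -
  have "(\<lambda>k. x ^ k / fact k) sums exp x"
    using exp_converges[of x] by (simp add: divide_inverse mult.commute)
  then show ?thesis
    using sum_le_suminf[of "\<lambda>k. x ^ k / fact k" "{n}"] assms by (auto simp: sums_iff)
qed

text \<open>The standard flat function $e^{-1/t}$, multiplied by the factors that its derivatives produce
($t^{-k}$) and by powers of $1/(t+c)$. The latter allow a pole of the logarithmic derivative to be
built into the profile, and the family is closed under differentiation.\<close>

definition flat :: "nat \<Rightarrow> nat \<Rightarrow> real \<Rightarrow> real \<Rightarrow> real" where
  "flat k m c t = (if t \<le> 0 then 0 else (1 / t) ^ k * (1 / (t + c)) ^ m * exp (- (1 / t)))"

text \<open>From $e^{1/t} \ge t^{-(k+2)}/(k+2)!$.\<close>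

lemma flat_quadratic_bound:
  assumes "c > 0"
  shows "\<bar>flat k m c t\<bar> \<le> (1 / c) ^ m * fact (k + 2) * t^2"
proof (cases "t \<le> 0")
  case False
  then have t: "t > 0" by simp
  have "(1 / t) ^ (k + 2) / fact (k + 2) \<le> exp (1 / t)"
    by (rule power_div_fact_le_exp) (use t in auto)
  then have "(1 / t) ^ k * (1 / t)^2 \<le> exp (1 / t) * fact (k + 2)"
    by (simp only: pos_divide_le_eq[OF fact_gt_zero] power_add)
  then have "((1 / t) ^ k * (1 / t)^2) * (exp (- (1 / t)) * t^2) \<le> (exp (1 / t) * fact (k + 2)) * (exp (- (1 / t)) * t^2)"
    by (intro mult_right_mono) auto
  moreover have "((1 / t) ^ k * (1 / t)^2) * (exp (- (1 / t)) * t^2) = (1 / t) ^ k * exp (- (1 / t))"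
    using t by (simp add: power_divide)
  moreover have "(exp (1 / t) * fact (k + 2)) * (exp (- (1 / t)) * t^2) = (exp (1 / t) * exp (- (1 / t))) * (fact (k + 2) * t^2)"
    by (simp only: mult_ac)
  moreover have "exp (1 / t) * exp (- (1 / t)) = 1" by (simp add: exp_minus)
  ultimately have le1: "(1 / t) ^ k * exp (- (1 / t)) \<le> fact (k + 2) * t^2" by (simp only: mult_1)
  have le2: "(1 / (t + c)) ^ m \<le> (1 / c) ^ m"
    using t assms by (intro power_mono) (auto simp: frac_le)
  have "(1 / (t + c)) ^ m * ((1 / t) ^ k * exp (- (1 / t))) \<le> (1 / c) ^ m * (fact (k + 2) * t^2)"
  proof (rule mult_mono[OF le2 le1])
    show "0 \<le> (1 / t) ^ k * exp (- (1 / t))" using t by simp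
    show "0 \<le> (1 / c) ^ m" using assms by simp
  qed
  moreover have "\<bar>flat k m c t\<bar> = (1 / (t + c)) ^ m * ((1 / t) ^ k * exp (- (1 / t)))"
    using t assms by (simp add: flat_def abs_mult)
  ultimately show ?thesis by (simp only: mult.assoc)
qed (use assms in \<open>auto simp: flat_def\<close>)

lemma DERIV_inverse_power:
  fixes g :: "real \<Rightarrow> real"
  assumes "(g has_real_derivative 1) (at t)" "g t \<noteq> 0"
  shows "((\<lambda>t. inverse (g t) ^ k) has_real_derivative (- real k * inverse (g t) ^ (k + 1))) (at t)"
proof (cases k)
  case (Suc j)
  have "((\<lambda>t. inverse (g t) ^ Suc j) has_real_derivative
      (real (Suc j) * (- (inverse (g t) * 1 * inverse (g t)) * inverse (g t) ^ (Suc j - Suc 0)))) (at t)"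
    by (intro DERIV_power DERIV_inverse' assms)
  moreover have "real (Suc j) * (- (inverse (g t) * 1 * inverse (g t)) * inverse (g t) ^ (Suc j - Suc 0)) = - real k * inverse (g t) ^ (k + 1)"
    by (simp add: Suc algebra_simps)
  ultimately show ?thesis by (simp only: Suc)
qed simp

lemma DERIV_flat:
  assumes c: "c > 0"
  shows "(flat k m c has_real_derivative
    (- real k * flat (k + 1) m c t + (- real m * flat k (m + 1) c t) + flat (k + 2) m c t)) (at t)"
proof -
  consider "t < 0" | "t = 0" | "t > 0" by linarith
  then show ?thesis
  proof cases
    case 1
    have "((\<lambda>t. 0) has_real_derivative 0) (at t)" by simp
    then have "(flat k m c has_real_derivative 0) (at t)"
      by (rule has_field_derivative_transform_within[where d = "- t"]) (use 1 in \<open>auto simp: flat_def dist_real_def\<close>)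
    then show ?thesis using 1 by (simp add: flat_def)
  next
    case 2
    have "(flat k m c has_real_derivative 0) (at 0)"
      by (rule DERIV_zero_of_quadratic_bound) (rule flat_quadratic_bound[OF c])
    moreover have "flat j l c 0 = 0" for j l by (simp add: flat_def)
    ultimately show ?thesis using 2 by simp
  next
    case 3
    have P: "((\<lambda>t. inverse t ^ k) has_real_derivative (- real k * inverse t ^ (k + 1))) (at t)"
      by (rule DERIV_inverse_power) (use 3 DERIV_ident in auto)
    have Q: "((\<lambda>t. inverse (t + c) ^ m) has_real_derivative (- real m * inverse (t + c) ^ (m + 1))) (at t)"
      by (rule DERIV_inverse_power) (use 3 c in \<open>auto intro!: derivative_eq_intros\<close>)
    have R: "((\<lambda>t. exp (- inverse t)) has_real_derivative (exp (- inverse t) * inverse t ^ 2)) (at t)"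
      using 3 by (auto intro!: derivative_eq_intros simp: power2_eq_square)
    have "((\<lambda>t. inverse t ^ k * inverse (t + c) ^ m * exp (- inverse t)) has_real_derivative
       ((- real k * inverse t ^ (k + 1)) * inverse (t + c) ^ m + (- real m * inverse (t + c) ^ (m + 1)) * inverse t ^ k) * exp (- inverse t)
       + (exp (- inverse t) * inverse t ^ 2) * (inverse t ^ k * inverse (t + c) ^ m)) (at t)"
      by (intro DERIV_mult P Q R)
    then have "(flat k m c has_real_derivative
       ((- real k * inverse t ^ (k + 1)) * inverse (t + c) ^ m + (- real m * inverse (t + c) ^ (m + 1)) * inverse t ^ k) * exp (- inverse t)
       + (exp (- inverse t) * inverse t ^ 2) * (inverse t ^ k * inverse (t + c) ^ m)) (at t)"
      by (rule has_field_derivative_transform_within[where d = t])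
        (use 3 in \<open>auto simp: flat_def dist_real_def inverse_eq_divide\<close>)
    moreover have "((- real k * inverse t ^ (k + 1)) * inverse (t + c) ^ m + (- real m * inverse (t + c) ^ (m + 1)) * inverse t ^ k) * exp (- inverse t)
       + (exp (- inverse t) * inverse t ^ 2) * (inverse t ^ k * inverse (t + c) ^ m)
      = - real k * flat (k + 1) m c t + (- real m * flat k (m + 1) c t) + flat (k + 2) m c t"
      using 3 by (simp add: flat_def inverse_eq_divide power_add power2_eq_square algebra_simps)
    ultimately show ?thesis by simp
  qed
qed

lemma Cn_real_flat: "c > 0 \<Longrightarrow> Cn_real n (flat k m c)"
proof (induction n arbitrary: k m)
  case 0
  then show ?case using DERIV_flat by (auto intro!: continuous_at_imp_continuous_on DERIV_isCont)
next
  case (Suc n)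
  have "Cn_real n (\<lambda>t. - real k * flat (k + 1) m c t + (- real m * flat k (m + 1) c t) + flat (k + 2) m c t)"
    by (intro Cn_real_add Cn_real_mult Cn_real_const Suc)
  with DERIV_flat[OF Suc.prems, of k m] show ?case by (rule Cn_real_SucI)
qed

lemma Ck_fun_SucD: "Ck_fun (Suc k) f \<Longrightarrow> Ck_fun k f"
proof (induction k arbitrary: f)
  case 0
  then show ?case
    by (auto intro!: continuous_at_imp_continuous_on differentiable_imp_continuous_within)
next
  case (Suc k)
  then show ?case by (metis Ck_fun.simps(2))
qed

lemma Ck_fun_const: "Ck_fun k (\<lambda>x::'a::euclidean_space. c)"
  by (induction k arbitrary: c) auto

lemma Ck_fun_add: "Ck_fun k f \<Longrightarrow> Ck_fun k g \<Longrightarrow> Ck_fun k (\<lambda>x::'a::euclidean_space. f x + g x)"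
proof (induction k arbitrary: f g)
  case 0 then show ?case by (auto intro: continuous_intros)
next
  case (Suc k)
  then have d: "\<And>x. f differentiable (at x)" "\<And>x. g differentiable (at x)" by auto
  have "frechet_derivative (\<lambda>x. f x + g x) (at x) = (\<lambda>h. frechet_derivative f (at x) h + frechet_derivative g (at x) h)" for x
    by (rule frechet_derivative_at[symmetric]) (intro has_derivative_add d[THEN frechet_derivative_works[THEN iffD1]])
  then show ?case using Suc by auto
qed

lemma Ck_fun_mult: "Ck_fun k f \<Longrightarrow> Ck_fun k g \<Longrightarrow> Ck_fun k (\<lambda>x::'a::euclidean_space. f x * g x)"
proof (induction k arbitrary: f g)
  case 0 then show ?case by (auto intro: continuous_intros)
next
  case (Suc k)
  then have d: "\<And>x. f differentiable (at x)" "\<And>x. g differentiable (at x)" by auto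
  have "frechet_derivative (\<lambda>x. f x * g x) (at x) = (\<lambda>h. f x * frechet_derivative g (at x) h + frechet_derivative f (at x) h * g x)" for x
    by (rule frechet_derivative_at[symmetric]) (intro has_derivative_mult d[THEN frechet_derivative_works[THEN iffD1]])
  moreover have "Ck_fun k f" "Ck_fun k g" using Suc.prems by (blast intro: Ck_fun_SucD)+
  ultimately show ?case using Suc d by (auto intro!: Ck_fun_add)
qed

lemma Ck_fun_inner: "Ck_fun k (\<lambda>x::'a::euclidean_space. 2 * ((x - c) \<bullet> i))"
proof (cases k)
  case 0 then show ?thesis by (auto intro!: continuous_intros)
next
  case (Suc j)
  have D: "((\<lambda>x. 2 * ((x - c) \<bullet> i)) has_derivative (\<lambda>h. 2 * (h \<bullet> i))) (at x)" for x
    by (auto intro!: derivative_eq_intros)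
  then have "frechet_derivative (\<lambda>x. 2 * ((x - c) \<bullet> i)) (at x) = (\<lambda>h. 2 * (h \<bullet> i))" for x
    by (intro frechet_derivative_at[symmetric])
  then show ?thesis using D Suc by (auto simp: Ck_fun_const differentiable_def)
qed

text \<open>The partial derivatives of a radial function in the variable $|x-c|^2$ are linear functions times radial functions
of the same form, so smoothness follows by induction on the order.\<close>

lemma Ck_fun_radial:
  "Cn_real k F \<Longrightarrow> Ck_fun k (\<lambda>x::'a::euclidean_space. F ((x - c) \<bullet> (x - c)))"
proof (induction k arbitrary: F)
  case 0
  then show ?case by (auto intro!: continuous_intros elim!: continuous_on_compose2)
next
  case (Suc k)
  then obtain F' where F: "\<And>x. (F has_real_derivative F' x) (at x)" "Cn_real k F'" by auto
  have D: "((\<lambda>x. F ((x - c) \<bullet> (x - c))) has_derivative (\<lambda>h. F' ((x - c) \<bullet> (x - c)) * (2 * ((x - c) \<bullet> h)))) (at x)" for x :: 'a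
  proof -
    have "((\<lambda>x. (x - c) \<bullet> (x - c)) has_derivative (\<lambda>h. 2 * ((x - c) \<bullet> h))) (at x)"
      by (auto intro!: derivative_eq_intros simp: inner_commute)
    from has_derivative_compose[OF this F(1)[unfolded has_field_derivative_def]]
    show ?thesis by (simp add: mult.commute)
  qed
  have eq: "frechet_derivative (\<lambda>x. F ((x - c) \<bullet> (x - c))) (at x) = (\<lambda>h. F' ((x - c) \<bullet> (x - c)) * (2 * ((x - c) \<bullet> h)))" for x
    by (rule frechet_derivative_at[symmetric]) (rule D)
  have "Ck_fun k (\<lambda>x. frechet_derivative (\<lambda>x. F ((x - c) \<bullet> (x - c))) (at x) i)" for i
    unfolding eq by (intro Ck_fun_mult Ck_fun_inner Suc.IH F(2))
  moreover have "(\<lambda>x. F ((x - c) \<bullet> (x - c))) differentiable (at x)" for x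
    using D unfolding differentiable_def by blast
  ultimately show ?case by simp
qed

text \<open>A smooth decreasing function of $w = |x-c|^2/\rho^2$ that behaves like $-\frac12\ln w$ between $w_0$ and $1$
and is constant outside. Its derivative is $-1/(2w)$ times two smooth cut-offs, which are close to $1$ away from the end points when
$\kappa$ is small; the height only loses the factor $1 - 3\kappa$ and an additive constant.\<close>

lemma Moser_profile:
  fixes w0 \<kappa> :: real
  assumes w0: "0 < w0" "w0 \<le> 1 / 4" and \<kappa>: "0 < \<kappa>" "\<kappa> < 1"
  obtains F where "\<And>n. Cn_real n F" "\<And>w. w \<ge> 1 \<Longrightarrow> F w = 0" "\<And>w. w \<le> w0 \<Longrightarrow> F w = F 0"
    "\<And>v w. v \<le> w \<Longrightarrow> F w \<le> F v" "\<And>v w. 0 < v \<Longrightarrow> v \<le> w \<Longrightarrow> F v - F w \<le> ln (w / v) / 2"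
    "F 0 \<ge> (1 - 3 * \<kappa>) / 2 * ln (1 / (4 * w0))"
proof -
  \<comment> \<open>On $(w_0, 1)$ this is $\frac{1}{2w} e^{-\kappa/(1-w)} e^{-\kappa w_0/(w-w_0)}$. The factor $1/w$ is absorbed in the second flat function, so that smoothness at $w \le w_0$, in particular at $0$, is automatic.\<close>
  define f where "f w = (1 / (2 * \<kappa> * w0)) * (flat 0 0 1 ((- 1 / \<kappa>) * w + 1 / \<kappa>) * flat 0 1 (1 / \<kappa>) ((1 / (\<kappa> * w0)) * w + (- 1 / \<kappa>)))" for w
  have f_smooth: "Cn_real n f" for n
    unfolding f_def
    by (intro Cn_real_mult Cn_real_const Cn_real_affine Cn_real_flat) (use \<kappa> in auto)
  have f0: "f w = 0" if "w \<le> w0" for w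
  proof -
    have "w / (\<kappa> * w0) \<le> w0 / (\<kappa> * w0)" using that w0 \<kappa> by (intro divide_right_mono) auto
    also have "\<dots> = 1 / \<kappa>" using w0 by simp
    finally show ?thesis by (simp add: f_def flat_def)
  qed
  have f1: "f w = 0" if "w \<ge> 1" for w
  proof -
    have "w / \<kappa> \<ge> 1 / \<kappa>" using that \<kappa> by (intro divide_right_mono) auto
    then show ?thesis by (simp add: f_def flat_def)
  qed
  have fmid: "f w = exp (- (\<kappa> / (1 - w))) * exp (- (\<kappa> * w0 / (w - w0))) / (2 * w)" if w: "w0 < w" "w < 1" for w
  proof -
    have 1: "(- 1 / \<kappa>) * w + 1 / \<kappa> = (1 - w) / \<kappa>" by (simp add: diff_divide_distrib)
    have 2: "(1 / (\<kappa> * w0)) * w + (- 1 / \<kappa>) = (w - w0) / (\<kappa> * w0)" using w0 \<kappa> by (simp add: field_simps)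
    have 3: "(w - w0) / (\<kappa> * w0) + 1 / \<kappa> = w / (\<kappa> * w0)" using w0 \<kappa> by (simp add: field_simps)
    have 4: "(1 - w) / \<kappa> > 0" "(w - w0) / (\<kappa> * w0) > 0" using w w0 \<kappa> by auto
    have "f w = (1 / (2 * \<kappa> * w0)) * (exp (- (\<kappa> / (1 - w))) * ((\<kappa> * w0) / w * exp (- (\<kappa> * w0 / (w - w0)))))"
      unfolding f_def 1 2 using 4 by (simp add: flat_def 3)
    also have "\<dots> = exp (- (\<kappa> / (1 - w))) * exp (- (\<kappa> * w0 / (w - w0))) / (2 * w)"
      using w0 \<kappa> w by (simp add: field_simps)
    finally show ?thesis .
  qed
  have f_nonneg: "f w \<ge> 0" for w
    using f0[of w] f1[of w] fmid[of w] w0 by (cases "w \<le> w0"; cases "w \<ge> 1") auto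
  have f_le: "f w \<le> 1 / (2 * w)" if "w > 0" for w
  proof (cases "w0 < w \<and> w < 1")
    case True
    then have "exp (- (\<kappa> / (1 - w))) * exp (- (\<kappa> * w0 / (w - w0))) \<le> 1 * 1"
      using w0 \<kappa> by (intro mult_mono) (auto intro!: divide_nonneg_pos mult_nonneg_nonneg)
    then show ?thesis using True that by (simp add: fmid divide_right_mono)
  next
    case False
    then show ?thesis using f0[of w] f1[of w] that by auto
  qed
  have f_ge: "f w \<ge> (1 - 3 * \<kappa>) / (2 * w)" if "2 * w0 \<le> w" "w \<le> 1 / 2" for w
  proof -
    have w: "w0 < w" "w < 1" using that w0 by auto
    have "\<kappa> / (1 - w) \<le> \<kappa> / (1 / 2)" using that \<kappa> by (intro divide_left_mono) auto
    moreover have "\<kappa> * w0 / (w - w0) \<le> \<kappa> * w0 / w0" using that \<kappa> w0 by (intro divide_left_mono) auto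
    ultimately have le: "\<kappa> / (1 - w) + \<kappa> * w0 / (w - w0) \<le> 3 * \<kappa>" using w0 by simp
    have "1 - 3 * \<kappa> \<le> 1 + (- (\<kappa> / (1 - w) + \<kappa> * w0 / (w - w0)))" using le by simp
    also have "\<dots> \<le> exp (- (\<kappa> / (1 - w) + \<kappa> * w0 / (w - w0)))" by (rule exp_ge_add_one_self)
    also have "\<dots> = exp (- (\<kappa> / (1 - w))) * exp (- (\<kappa> * w0 / (w - w0)))"
      by (simp add: exp_add[symmetric])
    finally show ?thesis using w w0 unfolding fmid[OF w] by (intro divide_right_mono) auto
  qed
  have "isCont f x" for x
    using f_smooth[of 0] by (simp add: continuous_on_eq_continuous_at)
  then obtain G where G: "\<And>x. (G has_vector_derivative f x) (at x)"
    using einterval_antiderivative[of "-\<infinity>" "\<infinity>" f] by auto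
  define F where "F w = G 1 - G w" for w
  have dF: "(F has_real_derivative - f w) (at w)" for w
    unfolding F_def using G[of w]
    by (auto intro!: derivative_eq_intros simp: has_real_derivative_iff_has_vector_derivative)
  have anti: "F w \<le> F v" if "v \<le> w" for v w
    by (rule DERIV_nonpos_imp_nonincreasing[OF that]) (use dF f_nonneg in \<open>auto intro!: exI[of _ "- f _"]\<close>)
  have lip: "F v - F w \<le> ln (w / v) / 2" if "0 < v" "v \<le> w" for v w
  proof -
    have "F v + ln v / 2 \<le> F w + ln w / 2"
    proof (rule DERIV_nonneg_imp_nondecreasing[OF that(2)])
      fix x assume "v \<le> x" "x \<le> w"
      then have x: "x > 0" using that by simp
      then have "((\<lambda>x. F x + ln x / 2) has_real_derivative (- f x + 1 / x / 2)) (at x)"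
        by (auto intro!: derivative_eq_intros dF)
      then show "\<exists>y. ((\<lambda>x. F x + ln x / 2) has_real_derivative y) (at x) \<and> 0 \<le> y"
        using f_le[OF x] by (auto intro!: exI[of _ "- f x + 1 / x / 2"])
    qed
    then show ?thesis using that by (simp add: ln_div)
  qed
  have F1: "F w = 0" if "w \<ge> 1" for w
  proof -
    have "F w = F 1"
    proof (cases "w = 1")
      case False
      show ?thesis
      proof (rule DERIV_isconst2[of 1 w F w])
        show "continuous_on {1..w} F" using dF DERIV_isCont by (blast intro: continuous_at_imp_continuous_on)
        show "(F has_real_derivative 0) (at x)" if "1 < x" "x < w" for x using dF[of x] f1[of x] that by simp
      qed (use that False in auto)
    qed simp
    then show ?thesis by (simp add: F_def)
  qed
  show ?thesis
  proof (rule that[of F])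
    fix n
    have "Cn_real n (\<lambda>w. (-1) * f w)" by (intro Cn_real_mult Cn_real_const f_smooth)
    then have "Cn_real n (\<lambda>w. - f w)" by simp
    with dF have "Cn_real (Suc n) F" by (rule Cn_real_SucI)
    then show "Cn_real n F" by (rule Cn_real_SucD)
  next
    fix w assume "w \<le> w0"
    have eq: "F v = F w0" if "v < w0" for v
    proof (rule sym, rule DERIV_isconst2[of v w0 F w0])
      show "continuous_on {v..w0} F" using dF DERIV_isCont by (blast intro: continuous_at_imp_continuous_on)
      show "(F has_real_derivative 0) (at x)" if "v < x" "x < w0" for x using dF[of x] f0[of x] that by simp
    qed (use that in auto)
    show "F w = F 0" using eq[of w] eq[of 0] \<open>w \<le> w0\<close> w0 by (cases "w = w0") auto
  next
    have "F (1/2) + (1 - 3 * \<kappa>) / 2 * ln (1/2) \<le> F (2 * w0) + (1 - 3 * \<kappa>) / 2 * ln (2 * w0)"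
    proof (rule DERIV_nonpos_imp_nonincreasing[of "2 * w0" "1/2"])
      show "2 * w0 \<le> 1/2" using w0 by simp
      fix x assume x: "2 * w0 \<le> x" "x \<le> 1/2"
      have D: "((\<lambda>x. F x + (1 - 3 * \<kappa>) / 2 * ln x) has_real_derivative (- f x + (1 - 3 * \<kappa>) / 2 * (1 / x))) (at x)"
        using x w0 by (intro DERIV_add dF DERIV_cmult DERIV_ln_divide) auto
      have "(1 - 3 * \<kappa>) / 2 * (1 / x) = (1 - 3 * \<kappa>) / (2 * x)" by (simp only: times_divide_times_eq mult_1_right)
      then have "- f x + (1 - 3 * \<kappa>) / 2 * (1 / x) \<le> 0" using f_ge[OF x] by linarith
      then show "\<exists>y. ((\<lambda>x. F x + (1 - 3 * \<kappa>) / 2 * ln x) has_real_derivative y) (at x) \<and> y \<le> 0" using D by blast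
    qed
    moreover have "F (1/2) \<ge> 0" using anti[of "1/2" 1] F1[of 1] by simp
    moreover have "F 0 \<ge> F (2 * w0)" using anti[of 0 "2 * w0"] w0 by simp
    ultimately have "(1 - 3 * \<kappa>) / 2 * ln (1/2) - (1 - 3 * \<kappa>) / 2 * ln (2 * w0) \<le> F 0" by linarith
    moreover have "ln (1 / (4 * w0)) = ln (1/2) - ln (2 * w0)"
    proof -
      have "1 / (4 * w0) = (1/2) / (2 * w0)" by simp
      then show ?thesis using w0 ln_div[of "1/2" "2 * w0"] by simp
    qed
    ultimately show "F 0 \<ge> (1 - 3 * \<kappa>) / 2 * ln (1 / (4 * w0))" by (simp add: right_diff_distrib)
  qed (use anti lip F1 in auto)
qed

text \<open>The increments are bounded by those of the logarithm itself with constant $1$. Hence the energy of the smooth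
function has the sharp leading coefficient; smoothing costs height instead.\<close>

lemma Moser_function:
  fixes c :: "'a::euclidean_space"
  assumes \<rho>: "\<rho> > 0" "cball c \<rho> \<subseteq> \<Omega>" and \<kappa>: "0 < \<kappa>" "\<kappa> < 1" and T: "T \<ge> ln 2"
  obtains u M where "u \<in> test_functions \<Omega>" "M \<ge> (1 - 3 * \<kappa>) * (T - ln 2)"
    "\<And>x. 0 \<le> u x" "\<And>x. u x \<le> M" "\<And>x. norm (x - c) \<le> \<rho> * exp (- T) \<Longrightarrow> u x = M"
    "\<And>x. \<rho> \<le> norm (x - c) \<Longrightarrow> u x = 0"
    "\<And>x y. 0 < norm (y - c) \<Longrightarrow> norm (y - c) \<le> norm (x - c) \<Longrightarrow>
        u x \<le> u y \<and> u y - u x \<le> ln (norm (x - c) / norm (y - c))"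
proof -
  define w0 where "w0 = exp (- 2 * T)"
  have "exp (- 2 * T) \<le> exp (- 2 * ln 2)" using T by simp
  also have "\<dots> = exp (- ln 2) ^ 2" by (simp add: exp_of_nat_mult[symmetric])
  also have "\<dots> = 1 / 4" by (simp add: exp_minus power2_eq_square)
  finally have w0: "0 < w0" "w0 \<le> 1 / 4" by (auto simp: w0_def)
  obtain F where F: "\<And>n. Cn_real n F" "\<And>w. w \<ge> 1 \<Longrightarrow> F w = 0" "\<And>w. w \<le> w0 \<Longrightarrow> F w = F 0"
    "\<And>v w. v \<le> w \<Longrightarrow> F w \<le> F v" "\<And>v w. 0 < v \<Longrightarrow> v \<le> w \<Longrightarrow> F v - F w \<le> ln (w / v) / 2"
    "F 0 \<ge> (1 - 3 * \<kappa>) / 2 * ln (1 / (4 * w0))"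
    using Moser_profile[OF w0 \<kappa>] by blast
  define u where "u x = F ((1 / \<rho>^2) * ((x - c) \<bullet> (x - c)) + 0)" for x
  have u: "u x = F ((norm (x - c) / \<rho>)^2)" for x
    by (simp add: u_def power_divide power2_norm_eq_inner)
  have smooth: "Ck_fun k u" for k
    unfolding u_def by (rule Ck_fun_radial[OF Cn_real_affine[OF F(1)]])
  have supp: "u x = 0" if "\<rho> \<le> norm (x - c)" for x
  proof -
    have "1 \<le> (norm (x - c) / \<rho>)^2" using that \<rho> by (simp add: power2_eq_square power_divide) (simp add: mult_mono)
    then show ?thesis using F(2) by (simp add: u)
  qed
  have "{x. u x \<noteq> 0} \<subseteq> cball c \<rho>"
    using supp by (force simp: dist_norm norm_minus_commute not_le intro: less_imp_le)
  then have cl: "closure {x. u x \<noteq> 0} \<subseteq> cball c \<rho>" by (simp add: closure_minimal)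
  then have "compact (closure {x. u x \<noteq> 0})"
    by (meson bounded_cball bounded_subset compact_eq_bounded_closed closed_closure)
  then have "u \<in> test_functions \<Omega>"
    using smooth cl \<rho> by (auto simp: test_functions_def)
  moreover have "F 0 \<ge> (1 - 3 * \<kappa>) * (T - ln 2)"
  proof -
    have "ln (1 / (4 * w0)) = 2 * (T - ln 2)"
    proof -
      have "1 / (4 * w0) = exp (2 * (T - ln 2))"
        by (simp add: w0_def exp_minus exp_diff right_diff_distrib field_simps exp_double power2_eq_square)
      then show ?thesis by simp
    qed
    then have "(1 - 3 * \<kappa>) / 2 * ln (1 / (4 * w0)) = (1 - 3 * \<kappa>) * (T - ln 2)" by simp
    then show ?thesis using F(6) by linarith
  qed
  moreover have "0 \<le> u x" for x
    using F(4)[of "(norm (x - c) / \<rho>)^2" "max 1 ((norm (x - c) / \<rho>)^2)"] F(2)[of "max 1 ((norm (x - c) / \<rho>)^2)"]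
    by (simp add: u)
  moreover have "u x \<le> F 0" for x using F(4)[of 0 "(norm (x - c) / \<rho>)^2"] by (simp add: u)
  moreover have "u x = F 0" if "norm (x - c) \<le> \<rho> * exp (- T)" for x
  proof -
    have "norm (x - c) / \<rho> \<le> exp (- T)" using that \<rho> by (simp add: divide_le_eq mult.commute)
    then have "(norm (x - c) / \<rho>)^2 \<le> exp (- T) ^ 2" using \<rho> by (intro power_mono) auto
    also have "\<dots> = w0" by (simp add: w0_def exp_of_nat_mult[symmetric])
    finally show ?thesis using F(3) by (simp add: u)
  qed
  moreover have "u x \<le> u y \<and> u y - u x \<le> ln (norm (x - c) / norm (y - c))"
    if "0 < norm (y - c)" "norm (y - c) \<le> norm (x - c)" for x y
  proof -
    let ?v = "(norm (y - c) / \<rho>)^2" and ?w = "(norm (x - c) / \<rho>)^2"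
    have vw: "0 < ?v" "?v \<le> ?w" using that \<rho> by (auto intro!: power_mono divide_right_mono)
    have "?w / ?v = (norm (x - c) / norm (y - c))^2" using \<rho> by (simp add: power_divide)
    also have "ln \<dots> = 2 * ln (norm (x - c) / norm (y - c))"
      using that by (subst ln_realpow) (auto intro!: divide_pos_pos)
    finally have "ln (?w / ?v) / 2 = ln (norm (x - c) / norm (y - c))" by simp
    then show ?thesis using F(4)[OF vw(2)] F(5)[OF vw] by (simp add: u)
  qed
  ultimately show ?thesis using supp by (intro that[of u "F 0"]) auto
qed

section \<open>The truncated exponential\<close>

lemma Phi_eq_suminf:
  "(\<lambda>k. a ^ (k + n) / fact (k + n)) sums Phi n a"
proof -
  have "(\<lambda>k. a ^ k / fact k) sums exp a"
    using exp_converges[of a] by (simp add: divide_inverse mult.commute)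
  then show ?thesis unfolding Phi_def by (rule sums_split_initial_segment)
qed

lemma Phi_nonneg: "a \<ge> 0 \<Longrightarrow> 0 \<le> Phi n a"
  by (rule sums_le[OF _ sums_zero Phi_eq_suminf]) simp

text \<open>Together with the next estimate this gives the two regimes of the exponential tail: linear growth of the
exponent for large arguments, order of vanishing $n$ for small ones.\<close>

lemma Phi_le_exp: "a \<ge> 0 \<Longrightarrow> Phi n a \<le> exp a"
  by (auto simp: Phi_def intro!: sum_nonneg)

lemma Phi_le_power_exp:
  assumes "a \<ge> 0" shows "Phi n a \<le> a ^ n * exp a"
proof (rule sums_le[OF _ Phi_eq_suminf])
  show "(\<lambda>k. a ^ n * (a ^ k / fact k)) sums (a ^ n * exp a)"
    using exp_converges[of a] by (intro sums_mult) (simp add: divide_inverse mult.commute)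
  show "a ^ (k + n) / fact (k + n) \<le> a ^ n * (a ^ k / fact k)" for k
  proof -
    have "a ^ (k + n) / fact (k + n) \<le> a ^ (k + n) / fact k"
      using assms by (intro divide_left_mono) (auto intro!: fact_mono)
    then show ?thesis by (simp add: power_add mult.commute)
  qed
qed

lemma continuous_Phi: "continuous_on UNIV (Phi n)"
  unfolding Phi_def[abs_def] by (intro continuous_intros) auto

section \<open>Energy and growth of Moser functions\<close>

text \<open>The constant of the logarithmic kernel; the critical constant is an explicit function of it.\<close>

definition log_kernel_const :: "'a::euclidean_space itself \<Rightarrow> real \<Rightarrow> real" where
  "log_kernel_const _ p = unit_ball_vol (real DIM('a)) * (Gamma (p + 1) / fact (DIM('a) - 1) *
     (\<Sum>n. fact (DIM('a) + n - 1) / fact n * (1 / (real DIM('a) + 2 * real n) powr p)))"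

lemma log_kernel_const_pos:
  assumes "p > real DIM('a::euclidean_space)"
  shows "log_kernel_const TYPE('a) p > 0"
proof -
  have "0 < (\<Sum>n. fact (DIM('a) + n - 1) / fact n * (1 / (real DIM('a) + 2 * real n) powr p))"
  proof (intro suminf_pos Moser_series_summable assms)
    fix n
    have "0 < real DIM('a) + 2 * real n" by (intro add_pos_nonneg) auto
    then show "0 < fact (DIM('a) + n - 1) / fact n * (1 / (real DIM('a) + 2 * real n) powr p)"
      by (intro mult_pos_pos divide_pos_pos) auto
  qed auto
  moreover have "p > 0" using assms by (smt (verit) DIM_positive of_nat_0_less_iff)
  ultimately show ?thesis unfolding log_kernel_const_def
    by (intro mult_pos_pos divide_pos_pos Gamma_real_pos) auto
qed

lemma alpha_star_eq:
  assumes "p > 1" "0 < s" "s * p = real DIM('a::euclidean_space)"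
  shows "alpha_star TYPE('a) s p = real DIM('a) *
     (2 * real DIM('a) * unit_ball_vol (real DIM('a)) * log_kernel_const TYPE('a) p) powr (1 / (p - 1))"
proof -
  let ?d = "DIM('a)" and ?w = "unit_ball_vol (real DIM('a))"
  let ?S = "\<Sum>n. fact (DIM('a) + n - 1) / fact n * (1 / (real DIM('a) + 2 * real n) powr p)"
  have w: "measure lebesgue (ball (0::'a) 1) = ?w" by (simp add: content_ball)
  have "fact ?d = real ?d * fact (?d - 1)" by (rule fact_reduce) auto
  then have "2 * (real ?d * ?w)\<^sup>2 * Gamma (p + 1) / fact ?d * ?S
     = 2 * real ?d * ?w * (?w * (Gamma (p + 1) / fact (?d - 1) * ?S))"
    by (simp add: power2_eq_square field_simps)
  then show ?thesis
    unfolding alpha_star_def Let_def w log_kernel_const_def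
    using conjugate_exponent(2)[OF assms] by simp
qed

lemma log_kernel_integral_centered:
  fixes x c :: "'a::euclidean_space"
  assumes "p > real DIM('a)" "x \<noteq> c"
  shows "(\<integral>\<^sup>+y. ennreal (ln (norm (x - c) / norm (y - c)) powr p / norm (x - y) ^ (2 * DIM('a))) * indicator {y. norm (y - c) < norm (x - c)} y \<partial>lborel)
     \<le> ennreal (log_kernel_const TYPE('a) p) * ennreal (1 / norm (x - c) ^ DIM('a))"
proof -
  have "(\<integral>\<^sup>+y. ennreal (ln (norm (x - c) / norm (y - c)) powr p / norm (x - y) ^ (2 * DIM('a))) * indicator {y. norm (y - c) < norm (x - c)} y \<partial>lborel)
    = (\<integral>\<^sup>+y. ennreal (ln (norm (x - c) / norm (c + y - c)) powr p / norm (x - (c + y)) ^ (2 * DIM('a))) * indicator {y. norm (y - c) < norm (x - c)} (c + y) \<partial>lborel)"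
    by (rule nn_integral_lborel_translate[symmetric]) measurable
  also have "\<dots> = (\<integral>\<^sup>+y. ennreal (ln (norm (x - c) / norm y) powr p / norm (x - c - y) ^ (2 * DIM('a))) * indicator (ball 0 (norm (x - c))) y \<partial>lborel)"
    by (intro nn_integral_cong) (auto simp: algebra_simps split: split_indicator)
  also have "\<dots> \<le> ennreal (log_kernel_const TYPE('a) p) * ennreal (1 / norm (x - c) ^ DIM('a))"
    unfolding log_kernel_const_def by (rule log_kernel_integral) (use assms in auto)
  finally show ?thesis .
qed

lemma shell_integral_centered:
  fixes c :: "'a::euclidean_space"
  assumes "0 < a" "a \<le> D"
  shows "(\<integral>\<^sup>+x. ennreal (1 / norm (x - c) ^ DIM('a)) * indicator {x. a < norm (x - c) \<and> norm (x - c) < D} x \<partial>lborel)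
    \<le> ennreal (unit_ball_vol (real DIM('a)) * (real DIM('a) * ln (D / a) + 1))"
proof -
  have "(\<integral>\<^sup>+x. ennreal (1 / norm (x - c) ^ DIM('a)) * indicator {x. a < norm (x - c) \<and> norm (x - c) < D} x \<partial>lborel)
    = (\<integral>\<^sup>+x. ennreal (1 / norm (c + x - c) ^ DIM('a)) * indicator {x. a < norm (x - c) \<and> norm (x - c) < D} (c + x) \<partial>lborel)"
    by (rule nn_integral_lborel_translate[symmetric]) measurable
  also have "\<dots> = (\<integral>\<^sup>+x. ennreal (1 / norm x ^ DIM('a)) * indicator {x::'a. a < norm x \<and> norm x < D} x \<partial>lborel)"
    by (intro nn_integral_cong) (auto split: split_indicator)
  also have "\<dots> \<le> ennreal (unit_ball_vol (real DIM('a)) * (real DIM('a) * ln (D / a) + 1))"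
    by (rule shell_integral) fact+
  finally show ?thesis .
qed

text \<open>By symmetry the energy is twice the part with $|y-c| < |x-c|$, where the increment is dominated by that of the
logarithm. The logarithmic kernel then leaves $|x-c|^{-d}$, to be integrated over a shell: inside the plateau there
are no increments.\<close>

lemma radial_energy_bound:
  fixes u :: "'a::euclidean_space \<Rightarrow> real"
  assumes p: "p > real DIM('a)" and \<Omega>: "\<Omega> \<in> sets borel" "\<Omega> \<subseteq> ball c D" and a: "0 < a" "a \<le> D"
    and [measurable]: "u \<in> borel_measurable borel"
    and inner: "\<And>x. norm (x - c) \<le> a \<Longrightarrow> u x = M"
    and log_lip: "\<And>x y. 0 < norm (y - c) \<Longrightarrow> norm (y - c) \<le> norm (x - c) \<Longrightarrow>
        u x \<le> u y \<and> u y - u x \<le> ln (norm (x - c) / norm (y - c))"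
  shows "energy p \<Omega> u \<le> ennreal (2 * log_kernel_const TYPE('a) p * (unit_ball_vol (real DIM('a)) * (real DIM('a) * ln (D / a) + 1)))"
proof -
  let ?K = "log_kernel_const TYPE('a) p"
  have [measurable]: "\<Omega> \<in> sets borel" by fact
  have K: "?K > 0" by (rule log_kernel_const_pos[OF p])
  have p0: "p > 0" using p by (smt (verit) DIM_positive of_nat_0_less_iff)
  define f where "f x y = ennreal (\<bar>u x - u y\<bar> powr p / norm (x - y) ^ (2 * DIM('a))) * indicator \<Omega> x * indicator \<Omega> y" for x y
  have f_meas[measurable]: "(\<lambda>(x, y). f x y) \<in> borel_measurable (lborel \<Otimes>\<^sub>M lborel)"
    unfolding f_def by measurable
  have f_sym: "f x y = f y x" for x y
    unfolding f_def by (simp add: norm_minus_commute abs_minus_commute mult_ac)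
  \<comment> \<open>Pairs at equal distance from the centre drop out because the function is radial.\<close>
  define h where "h x y = f x y * indicator {y. norm (y - c) < norm (x - c)} y" for x y
  have h_meas[measurable]: "(\<lambda>(x, y). h x y) \<in> borel_measurable (lborel \<Otimes>\<^sub>M lborel)"
    unfolding h_def by measurable
  have split: "f x y \<le> h x y + h y x" for x y
  proof (cases "norm (x - c) = norm (y - c)")
    case True
    have "u x = u y"
    proof (cases "x = c")
      case False
      then show ?thesis using log_lip[of x y] log_lip[of y x] True by force
    qed (use True in auto)
    then show ?thesis using p0 by (simp add: f_def)
  next
    case False
    then consider "norm (y - c) < norm (x - c)" | "norm (x - c) < norm (y - c)" by linarith
    then show ?thesis by cases (auto simp: h_def f_sym[of y x])
  qed
  have "energy p \<Omega> u = (\<integral>\<^sup>+x. \<integral>\<^sup>+y. f x y \<partial>lborel \<partial>lborel)"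
    unfolding energy_def
    by (intro nn_integral_cong) (auto simp: f_def split: split_indicator intro!: nn_integral_cong)
  also have "\<dots> \<le> (\<integral>\<^sup>+x. \<integral>\<^sup>+y. h x y + h y x \<partial>lborel \<partial>lborel)"
    by (intro nn_integral_mono split)
  also have "\<dots> = (\<integral>\<^sup>+x. \<integral>\<^sup>+y. h x y \<partial>lborel \<partial>lborel) + (\<integral>\<^sup>+x. \<integral>\<^sup>+y. h y x \<partial>lborel \<partial>lborel)"
    by (subst nn_integral_add[symmetric]; (measurable)?) (intro nn_integral_cong nn_integral_add; measurable)
  also have "(\<integral>\<^sup>+x. \<integral>\<^sup>+y. h y x \<partial>lborel \<partial>lborel) = (\<integral>\<^sup>+x. \<integral>\<^sup>+y. h x y \<partial>lborel \<partial>lborel)"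
    by (rule lborel_pair.Fubini') measurable
  also have "(\<integral>\<^sup>+x. \<integral>\<^sup>+y. h x y \<partial>lborel \<partial>lborel)
    \<le> (\<integral>\<^sup>+x. ennreal ?K * (ennreal (1 / norm (x - c) ^ DIM('a)) * indicator {x. a < norm (x - c) \<and> norm (x - c) < D} x) \<partial>lborel)"
  proof (rule nn_integral_mono)
    fix x
    consider "norm (x - c) \<le> a" | "x \<notin> \<Omega>" | "a < norm (x - c)" "norm (x - c) < D"
      using \<Omega>(2) by (fastforce simp: dist_norm norm_minus_commute)
    then show "(\<integral>\<^sup>+y. h x y \<partial>lborel) \<le> ennreal ?K * (ennreal (1 / norm (x - c) ^ DIM('a)) * indicator {x. a < norm (x - c) \<and> norm (x - c) < D} x)"
    proof cases
      case 1
      then have "h x y = 0" for y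
        using inner[of x] inner[of y] p0 by (auto simp: h_def f_def split: split_indicator)
      then show ?thesis by simp
    next
      case 2
      then have "h x y = 0" for y by (auto simp: h_def f_def)
      then show ?thesis by simp
    next
      case 3
      then have "x \<noteq> c" using a by auto
      have "(\<integral>\<^sup>+y. h x y \<partial>lborel) \<le> (\<integral>\<^sup>+y. ennreal (ln (norm (x - c) / norm (y - c)) powr p / norm (x - y) ^ (2 * DIM('a))) * indicator {y. norm (y - c) < norm (x - c)} y \<partial>lborel)"
      proof (rule nn_integral_mono_AE)
        have "h x y \<le> ennreal (ln (norm (x - c) / norm (y - c)) powr p / norm (x - y) ^ (2 * DIM('a))) * indicator {y. norm (y - c) < norm (x - c)} y"
          if "y \<noteq> c" for y
        proof (cases "norm (y - c) < norm (x - c)")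
          case True
          have "\<bar>u x - u y\<bar> powr p \<le> ln (norm (x - c) / norm (y - c)) powr p"
            using log_lip[of y x] True that p0 by (intro powr_mono2) auto
          then show ?thesis
            using True by (auto simp: h_def f_def split: split_indicator intro!: ennreal_leI divide_right_mono)
        qed (simp add: h_def)
        then show "AE y in lborel. h x y \<le> ennreal (ln (norm (x - c) / norm (y - c)) powr p / norm (x - y) ^ (2 * DIM('a))) * indicator {y. norm (y - c) < norm (x - c)} y"
          using AE_lborel_singleton[of c] by (auto elim: eventually_mono)
      qed
      also have "\<dots> \<le> ennreal ?K * ennreal (1 / norm (x - c) ^ DIM('a))"
        by (rule log_kernel_integral_centered[OF p \<open>x \<noteq> c\<close>])
      finally show ?thesis using 3 by simp
    qed
  qed
  also have "\<dots> = ennreal ?K * (\<integral>\<^sup>+x. ennreal (1 / norm (x - c) ^ DIM('a)) * indicator {x. a < norm (x - c) \<and> norm (x - c) < D} x \<partial>lborel)"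
    by (rule nn_integral_cmult) measurable
  also have "\<dots> \<le> ennreal ?K * ennreal (unit_ball_vol (real DIM('a)) * (real DIM('a) * ln (D / a) + 1))"
    by (intro mult_left_mono shell_integral_centered a) simp
  finally have "energy p \<Omega> u \<le> ennreal ?K * ennreal (unit_ball_vol (real DIM('a)) * (real DIM('a) * ln (D / a) + 1))
     + ennreal ?K * ennreal (unit_ball_vol (real DIM('a)) * (real DIM('a) * ln (D / a) + 1))"
    by (simp add: add_mono)
  also have "\<dots> = ennreal (2 * ?K * (unit_ball_vol (real DIM('a)) * (real DIM('a) * ln (D / a) + 1)))"
  proof -
    have "0 \<le> unit_ball_vol (real DIM('a)) * (real DIM('a) * ln (D / a) + 1)"
      using a by (intro mult_nonneg_nonneg add_nonneg_nonneg) auto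
    then show ?thesis using K by (simp add: ennreal_mult'[symmetric] ennreal_plus[symmetric] del: ennreal_plus)
  qed
  finally show ?thesis .
qed

text \<open>The second summand of the exponent is asymptotic to $\alpha\,\theta^{p'}\gamma^{-1/(p-1)}\,T$, because $p' - p'/p = 1$.\<close>

lemma Moser_growth:
  fixes p \<alpha> \<gamma> \<theta> C C' d :: real
  assumes p: "p > 1" and pos: "\<gamma> > 0" "\<theta> > 0" "\<alpha> > 0"
    and big: "\<alpha> * \<theta> powr (p / (p - 1)) * \<gamma> powr (- (1 / (p - 1))) > d"
  shows "filterlim (\<lambda>T. exp (- d * T + \<alpha> * ((\<theta> * T - C') / (\<gamma> * (T + C)) powr (1 / p)) powr (p / (p - 1)))) at_top at_top"
proof -
  let ?p' = "p / (p - 1)" and ?r = "1 / (p - 1)"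
  have p': "1 / p * ?p' = ?r" "?p' = 1 + ?r" using p by (auto simp: field_simps)
  define g where "g T = \<alpha> * ((\<theta> + (- C') / T) powr ?p' * (\<gamma> * (1 + C / T)) powr (- ?r)) - d" for T
  have "((\<lambda>T::real. (- C') / T) \<longlongrightarrow> 0) at_top" "((\<lambda>T::real. C / T) \<longlongrightarrow> 0) at_top"
    by (rule tendsto_divide_0[OF tendsto_const]; rule filterlim_at_top_imp_at_infinity; rule filterlim_ident)+
  then have "(g \<longlongrightarrow> \<alpha> * ((\<theta> + 0) powr ?p' * (\<gamma> * (1 + 0)) powr (- ?r)) - d) at_top"
    unfolding g_def using pos by (intro tendsto_intros) auto
  then have g: "(g \<longlongrightarrow> \<alpha> * (\<theta> powr ?p' * \<gamma> powr (- ?r)) - d) at_top" by simp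
  have "filterlim (\<lambda>T. g T * T) at_top at_top"
    using big by (intro filterlim_tendsto_pos_mult_at_top[OF g] filterlim_ident) (simp add: mult.assoc)
  then have E: "filterlim (\<lambda>T. exp (g T * T)) at_top at_top"
    by (rule filterlim_compose[OF exp_at_top])
  have "\<forall>\<^sub>F T in at_top. T > max 1 (max (\<bar>C'\<bar> / \<theta>) \<bar>C\<bar>)" by (rule eventually_gt_at_top)
  then have "\<forall>\<^sub>F T in at_top. exp (g T * T) = exp (- d * T + \<alpha> * ((\<theta> * T - C') / (\<gamma> * (T + C)) powr (1 / p)) powr ?p')"
  proof eventually_elim
    case (elim T)
    then have T: "T > 1" "\<bar>C'\<bar> / \<theta> < T" "\<bar>C\<bar> < T" by auto
    have "\<bar>C'\<bar> < \<theta> * T" using T(2) pos by (simp add: pos_divide_less_eq mult.commute)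
    then have A: "\<theta> * T - C' > 0" by linarith
    have B: "T + C > 0" using T(3) by linarith
    have a: "\<theta> + (- C') / T = (\<theta> * T - C') / T" "1 + C / T = (T + C) / T" using T by (auto simp: field_simps)
    have "(\<theta> + (- C') / T) powr ?p' * (\<gamma> * (1 + C / T)) powr (- ?r) * T
       = (\<theta> * T - C') powr ?p' / T powr ?p' * ((\<gamma> * (T + C)) powr (- ?r) / T powr (- ?r)) * T"
      unfolding a using A B T pos by (simp add: powr_divide)
    also have "\<dots> = (\<theta> * T - C') powr ?p' * (\<gamma> * (T + C)) powr (- ?r) * (T / (T powr ?p' * T powr (- ?r)))"
      by simp
    also have "T powr ?p' * T powr (- ?r) = T" using T by (simp add: powr_add[symmetric] p'(2))
    also have "(\<theta> * T - C') powr ?p' * (\<gamma> * (T + C)) powr (- ?r) * (T / T) = (\<theta> * T - C') powr ?p' / ((\<gamma> * (T + C)) powr (1 / p)) powr ?p'"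
      using T unfolding powr_powr p'(1) by (simp add: powr_minus_divide)
    also have "\<dots> = ((\<theta> * T - C') / (\<gamma> * (T + C)) powr (1 / p)) powr ?p'"
      using A by (simp add: powr_divide)
    finally show ?case by (simp add: g_def algebra_simps)
  qed
  with E show ?thesis by (rule filterlim_mono_eventually[OF _ order_refl order_refl])
qed

section \<open>Divergence above the critical constant\<close>

lemma average_scale: "average \<Omega> (\<lambda>x. a * u x) = a * average \<Omega> u"
  by (simp add: average_def)

text \<open>In dimension one the mean is subtracted; it is small compared with the maximum when the function is
large on a small ball only.\<close>

lemma average_le_concentrated:
  fixes u :: "'a::euclidean_space \<Rightarrow> real"
  assumes \<Omega>: "open \<Omega>" "bounded \<Omega>" "\<Omega> \<noteq> {}" and u: "continuous_on UNIV u" "\<And>x. 0 \<le> u x" "\<And>x. u x \<le> M"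
    and r: "0 < r" and l: "l \<ge> 0" "\<And>x. r \<le> norm (x - c) \<Longrightarrow> u x \<le> l"
  shows "average \<Omega> u \<le> M * (unit_ball_vol (real DIM('a)) * r ^ DIM('a) / measure lebesgue \<Omega>) + l"
proof -
  have lm: "\<Omega> \<in> lmeasurable" using \<Omega> by (simp add: lmeasurable_open)
  have V: "measure lebesgue \<Omega> > 0"
  proof -
    obtain x e where "e > 0" "ball x e \<subseteq> \<Omega>" using \<Omega> open_contains_ball by (metis ex_in_conv)
    then have "measure lebesgue (ball x e) \<le> measure lebesgue \<Omega>"
      by (intro measure_mono_fmeasurable lm) auto
    moreover have "measure lebesgue (ball x e) > 0" using content_ball_pos[OF \<open>e > 0\<close>, of x] by simp
    ultimately show ?thesis by linarith
  qed
  interpret finite_measure "lebesgue_on \<Omega>" by (rule finite_measure_lebesgue_on[OF lm])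
  have M: "M \<ge> 0" using u(2,3) order_trans by blast
  have u_meas: "u \<in> borel_measurable (lebesgue_on \<Omega>)"
    using u(1) by (intro measurable_restrict_space1 measurable_completion) (simp add: borel_measurable_continuous_onI)
  have ind: "(\<lambda>x. indicat_real (ball c r) x) \<in> borel_measurable (lebesgue_on \<Omega>)"
    by (intro measurable_restrict_space1 measurable_completion) (simp add: borel_measurable_indicator)
  have sp: "space (lebesgue_on \<Omega>) = \<Omega>" by simp
  have int_ind: "integrable (lebesgue_on \<Omega>) (\<lambda>x. indicat_real (ball c r) x)"
    by (rule integrable_const_bound[where B=1]) (use ind in \<open>auto split: split_indicator\<close>)
  have "(\<integral>x. u x \<partial>lebesgue_on \<Omega>) \<le> (\<integral>x. M * indicat_real (ball c r) x + l \<partial>lebesgue_on \<Omega>)"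
  proof (rule integral_mono)
    show "integrable (lebesgue_on \<Omega>) u"
      by (rule integrable_const_bound[where B=M]) (use u u_meas in auto)
    show "integrable (lebesgue_on \<Omega>) (\<lambda>x. M * indicat_real (ball c r) x + l)"
      using int_ind by (intro Bochner_Integration.integrable_add integrable_mult_right) auto
    show "u x \<le> M * indicat_real (ball c r) x + l" for x
      using u(3)[of x] l(1) l(2)[of x] M by (auto split: split_indicator simp: dist_norm norm_minus_commute not_less)
  qed
  also have "\<dots> = M * (\<integral>x. indicat_real (ball c r) x \<partial>lebesgue_on \<Omega>) + l * measure lebesgue \<Omega>"
    using int_ind lm by (subst Bochner_Integration.integral_add) (auto simp: measure_restrict_space fmeasurableD)
  also have "(\<integral>x. indicat_real (ball c r) x \<partial>lebesgue_on \<Omega>) \<le> unit_ball_vol (real DIM('a)) * r ^ DIM('a)"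
  proof -
    have "(\<integral>x. indicat_real (ball c r) x \<partial>lebesgue_on \<Omega>) = (\<integral>x. indicat_real (ball c r \<inter> \<Omega>) x \<partial>lebesgue_on \<Omega>)"
      by (intro Bochner_Integration.integral_cong) (auto split: split_indicator)
    also have "\<dots> = measure (lebesgue_on \<Omega>) (ball c r \<inter> \<Omega>)"
      using Bochner_Integration.integral_indicator[of "lebesgue_on \<Omega>" "ball c r \<inter> \<Omega>"]
      by (simp add: Int_assoc)
    also have "\<dots> = measure lebesgue (ball c r \<inter> \<Omega>)"
      using lm by (subst measure_restrict_space) (auto simp: fmeasurableD)
    also have "\<dots> \<le> measure lebesgue (ball c r)"
      using lm by (intro measure_mono_fmeasurable) (auto simp: fmeasurableD)
    also have "\<dots> = unit_ball_vol (real DIM('a)) * r ^ DIM('a)" using r by (simp add: content_ball)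
    finally show ?thesis .
  qed
  finally have "(\<integral>x. u x \<partial>lebesgue_on \<Omega>) \<le> M * (unit_ball_vol (real DIM('a)) * r ^ DIM('a)) + l * measure lebesgue \<Omega>"
    using M by (simp add: mult_left_mono)
  then have "average \<Omega> u \<le> (M * (unit_ball_vol (real DIM('a)) * r ^ DIM('a)) + l * measure lebesgue \<Omega>) / measure lebesgue \<Omega>"
    unfolding average_def using V by (simp add: divide_right_mono)
  also have "\<dots> = M * (unit_ball_vol (real DIM('a)) * r ^ DIM('a) / measure lebesgue \<Omega>) + l"
    using V by (simp add: add_divide_distrib)
  finally show ?thesis .
qed

text \<open>On the small ball the integrand is at least $\min(1, R^{-d})$ times the whole exponential, since $\delta \le R$ and the
truncated terms and the tail of the exponential series appear with these two weights.\<close>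

lemma full_exp_integral_lower_bound:
  fixes \<Omega> :: "'a::euclidean_space set"
  assumes \<Omega>: "open \<Omega>" "bounded \<Omega>" and sub: "cball c r \<subseteq> \<Omega>" "r > 0" and n0: "\<alpha> \<ge> 0"
    and p: "p > 1" "0 < s" "s * p = real DIM('a)"
    and X: "\<And>x. x \<in> cball c r \<Longrightarrow> Y \<le> X_fun \<Omega> u x" "Y \<ge> 0"
  shows "ennreal (min 1 (1 / inradius \<Omega> ^ DIM('a)) * exp (\<alpha> * Y powr (p / (p - 1))) * (unit_ball_vol (real DIM('a)) * r ^ DIM('a)))
     \<le> full_exp_integral s n0 \<alpha> \<Omega> u"
proof -
  let ?m = "min 1 (1 / inradius \<Omega> ^ DIM('a))" and ?p' = "p / (p - 1)"
  have c: "c \<in> \<Omega>" using sub by auto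
  have R: "inradius \<Omega> > 0" using bdist_pos[OF \<Omega> c] bdist_le_inradius[OF \<Omega>(2) c] by linarith
  have m: "?m \<ge> 0" using R by simp
  have p': "?p' > 0" using p by simp
  have pt: "?m * exp (\<alpha> * Y powr ?p') \<le>
      (\<Sum>n<n0. \<alpha> ^ n * (X_fun \<Omega> u x powr ?p') ^ n / fact n) + Phi n0 (\<alpha> * X_fun \<Omega> u x powr ?p') / bdist \<Omega> x ^ DIM('a)"
    if x: "x \<in> cball c r" for x
  proof -
    define a where "a = \<alpha> * X_fun \<Omega> u x powr ?p'"
    define E where "E = (\<Sum>n<n0. a ^ n / fact n)"
    have xO: "x \<in> \<Omega>" using x sub by auto
    have \<delta>: "bdist \<Omega> x > 0" "bdist \<Omega> x \<le> inradius \<Omega>"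
      using bdist_pos[OF \<Omega> xO] bdist_le_inradius[OF \<Omega>(2) xO] by auto
    have a0: "a \<ge> 0" using n0 by (simp add: a_def)
    have "Y powr ?p' \<le> X_fun \<Omega> u x powr ?p'" using X(1)[OF x] X(2) p' by (intro powr_mono2) auto
    then have "exp (\<alpha> * Y powr ?p') \<le> exp a" using n0 by (simp add: a_def mult_left_mono)
    also have "\<dots> = E + Phi n0 a" by (simp add: E_def Phi_def)
    finally have "?m * exp (\<alpha> * Y powr ?p') \<le> ?m * E + ?m * Phi n0 a"
      using m by (simp add: mult_left_mono distrib_left[symmetric] del: mult_le_cancel_left)
    also have "\<dots> \<le> 1 * E + 1 / bdist \<Omega> x ^ DIM('a) * Phi n0 a"
    proof (intro add_mono mult_right_mono)
      have "1 / inradius \<Omega> ^ DIM('a) \<le> 1 / bdist \<Omega> x ^ DIM('a)"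
        using \<delta> by (intro divide_left_mono power_mono) auto
      then show "?m \<le> 1 / bdist \<Omega> x ^ DIM('a)" by (simp add: min_le_iff_disj)
      show "0 \<le> E" using a0 by (auto simp: E_def intro!: sum_nonneg)
    qed (use Phi_nonneg[OF a0] in auto)
    also have "E = (\<Sum>n<n0. \<alpha> ^ n * (X_fun \<Omega> u x powr ?p') ^ n / fact n)"
      by (simp add: E_def a_def power_mult_distrib)
    finally show ?thesis by (simp add: a_def)
  qed
  have "ennreal (?m * exp (\<alpha> * Y powr ?p') * (unit_ball_vol (real DIM('a)) * r ^ DIM('a)))
     = ennreal (?m * exp (\<alpha> * Y powr ?p')) * emeasure lborel (cball c r)"
    using m sub by (simp add: emeasure_cball ennreal_mult'')
  also have "\<dots> = (\<integral>\<^sup>+x. ennreal (?m * exp (\<alpha> * Y powr ?p')) * indicator (cball c r) x \<partial>lborel)"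
    by (simp add: nn_integral_cmult_indicator)
  also have "\<dots> \<le> full_exp_integral s n0 \<alpha> \<Omega> u"
    unfolding full_exp_integral_def Let_def conjugate_exponent(1)[OF p]
  proof (subst nn_integral_lebesgue_on)
    show "\<Omega> \<in> sets lebesgue" using \<Omega> by auto
    show "(\<integral>\<^sup>+x. ennreal (?m * exp (\<alpha> * Y powr ?p')) * indicator (cball c r) x \<partial>lborel)
      \<le> (\<integral>\<^sup>+x. ennreal ((\<Sum>n<n0. \<alpha> ^ n * (X_fun \<Omega> u x powr ?p') ^ n / fact n) + Phi n0 (\<alpha> * X_fun \<Omega> u x powr ?p') / bdist \<Omega> x ^ DIM('a)) * indicator \<Omega> x \<partial>lborel)"
    proof (rule nn_integral_mono)
      fix x
      show "ennreal (?m * exp (\<alpha> * Y powr ?p')) * indicator (cball c r) x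
       \<le> ennreal ((\<Sum>n<n0. \<alpha> ^ n * (X_fun \<Omega> u x powr ?p') ^ n / fact n) + Phi n0 (\<alpha> * X_fun \<Omega> u x powr ?p') / bdist \<Omega> x ^ DIM('a)) * indicator \<Omega> x"
      proof (cases "x \<in> cball c r")
        case True
        then have "x \<in> \<Omega>" using sub by blast
        then show ?thesis using True ennreal_leI[OF pt[OF True]] by simp
      qed simp
    qed
  qed
  finally show ?thesis .
qed

text \<open>All parameters except $T$ are fixed first: the losses in the height of the plateau (smoothing, the mean) are factors
close to $1$ and additive constants, which the strict inequality $\alpha > \alpha_d^*$ tolerates.\<close>

theorem full_exp_integral_unbounded:
  fixes \<Omega> :: "'a::euclidean_space set"
  assumes \<Omega>: "open \<Omega>" "bounded \<Omega>" "\<Omega> \<noteq> {}"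
    and p: "p > 1" "0 < s" "s < 1" "s * p = real DIM('a)" and \<alpha>: "\<alpha> > alpha_star TYPE('a) s p"
  shows "(SUP u \<in> {u \<in> W0_space s p \<Omega>. gagliardo_seminorm s p \<Omega> u \<le> 1}. full_exp_integral s n0 \<alpha> \<Omega> u) = \<infinity>"
proof -
  let ?d = "real DIM('a)" and ?w = "unit_ball_vol (real DIM('a))" and ?p' = "p / (p - 1)"
  define K where "K = log_kernel_const TYPE('a) p"
  have pd: "p > ?d" using p mult_strict_right_mono[of s 1 p] by simp
  have K: "K > 0" unfolding K_def by (rule log_kernel_const_pos[OF pd])
  define \<gamma> where "\<gamma> = 2 * ?d * ?w * K"
  have \<gamma>: "\<gamma> > 0" unfolding \<gamma>_def using K by (intro mult_pos_pos) auto
  have as: "alpha_star TYPE('a) s p = ?d * \<gamma> powr (1 / (p - 1))"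
    using alpha_star_eq[OF p(1,2,4)] by (simp add: \<gamma>_def K_def)
  have \<alpha>0: "\<alpha> > 0" using \<alpha> \<gamma> unfolding as by (smt (verit) mult_nonneg_nonneg of_nat_0_le_iff powr_ge_zero)
  have "?d * \<gamma> powr (1 / (p - 1)) * \<gamma> powr (- (1 / (p - 1))) < \<alpha> * \<gamma> powr (- (1 / (p - 1)))"
    using \<alpha> \<gamma> unfolding as by (intro mult_strict_right_mono) auto
  then have lim: "?d < \<alpha> * \<gamma> powr (- (1 / (p - 1)))" using \<gamma> by (simp add: mult.assoc powr_add[symmetric])
  have "((\<lambda>\<epsilon>. \<alpha> * ((1 - \<epsilon>) * (1 - 3 * \<epsilon>)) powr ?p' * \<gamma> powr (- (1 / (p - 1)))) \<longlongrightarrow>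
      \<alpha> * ((1 - 0) * (1 - 3 * 0)) powr ?p' * \<gamma> powr (- (1 / (p - 1)))) (at_right 0)"
    by (intro tendsto_intros) auto
  then have "\<forall>\<^sub>F \<epsilon> in at_right 0. ?d < \<alpha> * ((1 - \<epsilon>) * (1 - 3 * \<epsilon>)) powr ?p' * \<gamma> powr (- (1 / (p - 1)))"
    using lim by (intro order_tendstoD(1)) auto
  moreover have "\<forall>\<^sub>F \<epsilon>::real in at_right 0. \<epsilon> \<in> {0<..<1/3}" by (rule eventually_at_right_real) simp
  ultimately have "\<forall>\<^sub>F \<epsilon>::real in at_right 0. \<epsilon> \<in> {0<..<1/3} \<and> ?d < \<alpha> * ((1 - \<epsilon>) * (1 - 3 * \<epsilon>)) powr ?p' * \<gamma> powr (- (1 / (p - 1)))"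
    by eventually_elim auto
  then obtain \<epsilon> where \<epsilon>: "0 < \<epsilon>" "\<epsilon> < 1 / 3" "?d < \<alpha> * ((1 - \<epsilon>) * (1 - 3 * \<epsilon>)) powr ?p' * \<gamma> powr (- (1 / (p - 1)))"
    using eventually_happens[of _ "at_right (0::real)"] by auto
  define \<theta> where "\<theta> = (1 - \<epsilon>) * (1 - 3 * \<epsilon>)"
  have \<theta>: "\<theta> > 0" using \<epsilon> by (simp add: \<theta>_def)
  define R where "R = inradius \<Omega>"
  have R: "R > 0"
  proof -
    obtain x where "x \<in> \<Omega>" using \<Omega>(3) by blast
    then show ?thesis unfolding R_def
      using bdist_pos[OF \<Omega>(1,2)] bdist_le_inradius[OF \<Omega>(2)] less_le_trans by blast
  qed
  have "2 < exp (1::real)" using exp_lower_Taylor_quadratic[of 1] by simp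
  then have e2: "2 / exp 1 < (1::real)" by simp
  \<comment> \<open>The threshold $2R/e$ for $\delta$ makes $\ln(2R/\delta) \le 1$ on the whole ball around $c$, so dividing by the logarithm does not decrease $X$.\<close>
  have "2 / exp 1 * R < 1 * R" using R e2 by (intro mult_strict_right_mono)
  then have "2 / exp 1 * R < R" by simp
  then obtain c where c: "c \<in> \<Omega>" "2 / exp 1 * R < bdist \<Omega> c"
    unfolding R_def inradius_def using less_cSUP_iff[OF \<Omega>(3) bdd_above_bdist[OF \<Omega>(2,3)]] by blast
  have "open (\<Omega> \<inter> {x. 2 / exp 1 * R < bdist \<Omega> x})"
    using \<Omega> by (intro open_Int open_Collect_less continuous_intros)
  then obtain \<rho> where \<rho>: "\<rho> > 0" "cball c \<rho> \<subseteq> \<Omega> \<inter> {x. 2 / exp 1 * R < bdist \<Omega> x}"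
    using c open_contains_cball by blast
  obtain D0 where D0: "\<Omega> \<subseteq> ball c D0" using bounded_subset_ballD[OF \<Omega>(2)] by blast
  define D where "D = max D0 \<rho>"
  have D: "\<Omega> \<subseteq> ball c D" "\<rho> \<le> D" using D0 by (auto simp: D_def)
  define V where "V = measure lebesgue \<Omega>"
  have V: "V > 0"
  proof -
    have "measure lebesgue (ball c \<rho>) \<le> measure lebesgue \<Omega>"
    proof (intro measure_mono_fmeasurable lmeasurable_open)
      show "ball c \<rho> \<subseteq> \<Omega>" using \<rho>(2) ball_subset_cball[of c \<rho>] by blast
    qed (use \<Omega> in auto)
    moreover have "measure lebesgue (ball c \<rho>) > 0" using content_ball_pos[OF \<rho>(1), of c] by simp
    ultimately show ?thesis unfolding V_def by linarith
  qed
  have "((\<lambda>r. ?w * r ^ DIM('a) / V) \<longlongrightarrow> ?w * 0 ^ DIM('a) / V) (at_right 0)"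
    using V by (intro tendsto_intros) auto
  then have "\<forall>\<^sub>F r in at_right 0. ?w * r ^ DIM('a) / V < \<epsilon>"
    using \<epsilon> by (intro order_tendstoD(2)) (auto simp: zero_power)
  moreover have "\<forall>\<^sub>F r in at_right 0. r \<in> {0<..<\<rho>}" by (rule eventually_at_right_real) (rule \<rho>(1))
  ultimately have "\<forall>\<^sub>F r in at_right 0. r \<in> {0<..<\<rho>} \<and> ?w * r ^ DIM('a) / V < \<epsilon>" by eventually_elim auto
  then obtain r where r: "0 < r" "r < \<rho>" "?w * r ^ DIM('a) / V < \<epsilon>"
    using eventually_happens[of _ "at_right (0::real)"] by auto
  \<comment> \<open>The function is at most $l$ off the ball of radius $r$, whatever $T$ is; the mean is therefore at most $\varepsilon M + l$.\<close>
  define l where "l = ln (\<rho> / r)"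
  have l: "l \<ge> 0" using r by (simp add: l_def)
  define C' where "C' = \<theta> * ln 2 + l"
  define C where "C = ln (D / \<rho>) + 1 / ?d"
  have C: "C > 0" using D \<rho> by (simp add: C_def add_nonneg_pos)
  define m where "m = min 1 (1 / R ^ DIM('a))"
  have m: "m > 0" using R by (simp add: m_def)
  define G where "G T = exp (- ?d * T + \<alpha> * ((\<theta> * T - C') / (\<gamma> * (T + C)) powr (1 / p)) powr ?p')" for T
  have G: "filterlim G at_top at_top"
    unfolding G_def by (rule Moser_growth) (use p \<gamma> \<theta> \<alpha>0 \<epsilon>(3) in \<open>auto simp: \<theta>_def\<close>)
  have claim: "\<exists>u\<in>{u \<in> W0_space s p \<Omega>. gagliardo_seminorm s p \<Omega> u \<le> 1}.
      ennreal (m * (?w * \<rho> ^ DIM('a)) * G T) \<le> full_exp_integral s n0 \<alpha> \<Omega> u" if T: "T \<ge> ln 2" "\<theta> * T \<ge> C'" for T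
  proof -
    have "cball c \<rho> \<subseteq> \<Omega>" using \<rho> by auto
    then obtain u M where u: "u \<in> test_functions \<Omega>" "M \<ge> (1 - 3 * \<epsilon>) * (T - ln 2)"
      "\<And>x. 0 \<le> u x" "\<And>x. u x \<le> M" "\<And>x. norm (x - c) \<le> \<rho> * exp (- T) \<Longrightarrow> u x = M"
      "\<And>x. \<rho> \<le> norm (x - c) \<Longrightarrow> u x = 0"
      "\<And>x y. 0 < norm (y - c) \<Longrightarrow> norm (y - c) \<le> norm (x - c) \<Longrightarrow>
        u x \<le> u y \<and> u y - u x \<le> ln (norm (x - c) / norm (y - c))"
      using Moser_function[OF \<rho>(1) _ \<epsilon>(1) _ T(1), of c \<Omega>] \<epsilon>(2) by auto
    define a where "a = \<rho> * exp (- T)"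
    have T0: "T \<ge> 0" using T(1) by (smt (verit) ln_gt_zero)
    have a': "0 < a" "a \<le> \<rho>" using \<rho> T0 by (auto simp: a_def mult_left_le)
    then have a: "0 < a" "a \<le> \<rho>" "a \<le> D" using D by auto
    define N where "N = \<gamma> * (T + C)"
    have N: "N > 0" using \<gamma> T0 C by (simp add: N_def)
    have "energy p \<Omega> u \<le> ennreal (2 * K * (?w * (?d * ln (D / a) + 1)))"
      unfolding K_def
      by (rule radial_energy_bound[OF pd _ D(1) a(1,3) test_function_measurable[OF u(1)] u(5)[folded a_def] u(7)]) (use \<Omega> in auto)
    also have "2 * K * (?w * (?d * ln (D / a) + 1)) = N"
    proof -
      have "ln (D / a) = ln (D / \<rho>) + T"
        using D \<rho> by (simp add: a_def ln_div ln_mult)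
      then show ?thesis by (simp add: N_def \<gamma>_def C_def field_simps)
    qed
    finally have en: "energy p \<Omega> u \<le> ennreal N" .
    define b where "b = 1 / N powr (1 / p)"
    have b: "b > 0" using N by (simp add: b_def)
    define v where "v x = b * u x" for x
    have "energy p \<Omega> v = ennreal (b powr p) * energy p \<Omega> u"
      unfolding v_def using b \<Omega> test_function_measurable[OF u(1)] by (intro energy_cmult) auto
    also have "\<dots> \<le> ennreal (b powr p) * ennreal N" by (intro mult_left_mono en) auto
    also have "\<dots> = 1"
      using N p by (simp add: b_def powr_divide powr_powr ennreal_mult'[symmetric])
    finally have env: "energy p \<Omega> v \<le> 1" .
    have v_test: "v \<in> test_functions \<Omega>"
    proof -
      have "Ck_fun k v" for k
        unfolding v_def using u(1) by (intro Ck_fun_mult Ck_fun_const) (auto simp: test_functions_def)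
      moreover have "{x. v x \<noteq> 0} = {x. u x \<noteq> 0}" using b by (auto simp: v_def)
      ultimately show ?thesis using u(1) by (simp add: test_functions_def)
    qed
    have v_mem: "v \<in> {u \<in> W0_space s p \<Omega>. gagliardo_seminorm s p \<Omega> u \<le> 1}"
    proof -
      have "energy p \<Omega> v < \<infinity>" using env by (simp add: le_less_trans)
      then show ?thesis using test_function_in_W0_space[OF \<Omega>(1,2) _ p(4) v_test] env p
        gagliardo_seminorm_le_1_iff[of \<Omega> s p v] \<Omega> by auto
    qed
    have far: "u x \<le> l" if "r \<le> norm (x - c)" for x
    proof (cases "norm (x - c) \<le> \<rho>")
      case True
      obtain b0 :: 'a where b0: "b0 \<in> Basis" using nonempty_Basis by blast
      have nb: "norm (c + \<rho> *\<^sub>R b0 - c) = \<rho>" using b0 \<rho> by simp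
      have "u x - u (c + \<rho> *\<^sub>R b0) \<le> ln (\<rho> / norm (x - c))"
        using u(7)[of x "c + \<rho> *\<^sub>R b0"] True that r(1) unfolding nb by linarith
      moreover have "u (c + \<rho> *\<^sub>R b0) = 0" using u(6) nb by simp
      moreover have "ln (\<rho> / norm (x - c)) \<le> l"
      proof -
        have "norm (x - c) > 0" using that r by linarith
        then have "0 < \<rho> / norm (x - c)" "\<rho> / norm (x - c) \<le> \<rho> / r" using that r \<rho>
          by (auto intro!: divide_left_mono divide_pos_pos)
        then show ?thesis unfolding l_def by (subst ln_le_cancel_iff) auto
      qed
      ultimately show ?thesis by linarith
    qed (use u(6)[of x] l in auto)
    have avg: "average \<Omega> u \<le> M * \<epsilon> + l"
    proof -
      have "average \<Omega> u \<le> M * (?w * r ^ DIM('a) / V) + l"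
        unfolding V_def
        by (rule average_le_concentrated[OF \<Omega> test_function_continuous[OF u(1)] u(3,4) r(1) l far])
      also have "\<dots> \<le> M * \<epsilon> + l"
        using r(3) order_trans[OF u(3) u(4)[of c]] by (intro add_right_mono mult_left_mono) auto
      finally show ?thesis .
    qed
    have M0: "M \<ge> 0" using u(3,4) order_trans by blast
    define Y where "Y = (\<theta> * T - C') / N powr (1 / p)"
    have Y0: "Y \<ge> 0" using T(2) N by (simp add: Y_def)
    have "\<theta> * T - C' = (1 - \<epsilon>) * ((1 - 3 * \<epsilon>) * (T - ln 2)) - l"
      by (simp add: \<theta>_def C'_def algebra_simps)
    also have "\<dots> \<le> (1 - \<epsilon>) * M - l" using u(2) \<epsilon> by (intro diff_right_mono mult_left_mono) auto
    finally have YM: "Y \<le> b * ((1 - \<epsilon>) * M - l)"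
      unfolding Y_def b_def using N by (simp add: divide_right_mono)
    have X: "Y \<le> X_fun \<Omega> v x" if x: "x \<in> cball c a" for x
    proof -
      have ux: "u x = M" using u(5)[of x] x by (simp add: a_def dist_norm norm_minus_commute)
      show ?thesis
      proof (cases "DIM('a) = 1")
        case False
        have "(1 - \<epsilon>) * M - l \<le> M"
        proof -
          have "0 \<le> \<epsilon> * M" using \<epsilon> M0 by simp
          then show ?thesis using l by (simp add: left_diff_distrib)
        qed
        then have "b * ((1 - \<epsilon>) * M - l) \<le> b * M" using b by (intro mult_left_mono) auto
        with YM have "Y \<le> b * M" by linarith
        then show ?thesis using False b M0 by (simp add: X_fun_def v_def ux)
      next
        case True
        have xc: "x \<in> cball c \<rho>" using x a by auto
        then have xO: "x \<in> \<Omega>" and \<delta>: "2 / exp 1 * R < bdist \<Omega> x" using \<rho> by auto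
        have \<delta>': "bdist \<Omega> x > 0" "bdist \<Omega> x \<le> R" using bdist_pos[OF \<Omega>(1,2) xO] bdist_le_inradius[OF \<Omega>(2) xO] by (auto simp: R_def)
        define L where "L = ln (2 * R / bdist \<Omega> x)"
        have "2 * R / bdist \<Omega> x < exp 1" using \<delta> \<delta>' by (simp add: field_simps)
        then have L1: "L \<le> 1" unfolding L_def using R \<delta>' by (metis divide_pos_pos less_imp_le ln_exp ln_less_cancel_iff exp_gt_zero mult_pos_pos zero_less_numeral)
        have "1 < 2 * R / bdist \<Omega> x" using \<delta>' R by (simp add: less_divide_eq)
        then have L0: "L > 0" unfolding L_def by (rule ln_gt_zero)
        have "b * ((1 - \<epsilon>) * M - l) \<le> b * (M - average \<Omega> u)"
          using b avg by (intro mult_left_mono) (auto simp: algebra_simps)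
        also have "\<dots> = v x - average \<Omega> v" by (simp add: v_def[abs_def] average_scale ux right_diff_distrib)
        also have "\<dots> \<le> \<bar>v x - average \<Omega> v\<bar>" by simp
        also have "\<dots> \<le> \<bar>v x - average \<Omega> v\<bar> / L"
          using L0 L1 by (simp add: le_divide_eq mult_left_le)
        finally show ?thesis using YM True by (simp add: X_fun_def L_def R_def)
      qed
    qed
    have "ennreal (min 1 (1 / inradius \<Omega> ^ DIM('a)) * exp (\<alpha> * Y powr ?p') * (?w * a ^ DIM('a))) \<le> full_exp_integral s n0 \<alpha> \<Omega> v"
      by (rule full_exp_integral_lower_bound[OF \<Omega>(1,2) _ a(1) _ p(1,2,4) X Y0]) (use \<alpha>0 a \<rho> in auto)
    also have "min 1 (1 / inradius \<Omega> ^ DIM('a)) * exp (\<alpha> * Y powr ?p') * (?w * a ^ DIM('a)) = m * (?w * \<rho> ^ DIM('a)) * G T"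
    proof -
      have "a ^ DIM('a) = \<rho> ^ DIM('a) * exp (- ?d * T)" by (simp add: a_def power_mult_distrib exp_of_nat_mult[symmetric])
      then show ?thesis by (simp only: G_def Y_def N_def m_def R_def exp_add mult_ac)
    qed
    finally show ?thesis using v_mem by blast
  qed
  show ?thesis unfolding infinity_ennreal_def
  proof (rule ennreal_SUP_eq_top)
    fix n :: nat
    define B where "B = m * (?w * \<rho> ^ DIM('a))"
    have B: "B > 0" using m \<rho> by (simp add: B_def)
    have "\<forall>\<^sub>F T in at_top. G T \<ge> real n / B" using G by (simp add: filterlim_at_top)
    moreover have "\<forall>\<^sub>F T::real in at_top. T \<ge> max (ln 2) (C' / \<theta>)" by (rule eventually_ge_at_top)
    ultimately have "\<forall>\<^sub>F T in at_top. G T \<ge> real n / B \<and> T \<ge> max (ln 2) (C' / \<theta>)" by eventually_elim auto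
    then obtain T where T: "G T \<ge> real n / B" "T \<ge> ln 2" "C' / \<theta> \<le> T"
      using eventually_happens[of _ "at_top :: real filter"] by auto
    have "\<theta> * T \<ge> C'" using T(3) \<theta> by (simp add: pos_divide_le_eq mult.commute)
    from claim[OF T(2) this] obtain u where u: "u \<in> {u \<in> W0_space s p \<Omega>. gagliardo_seminorm s p \<Omega> u \<le> 1}"
      "ennreal (B * G T) \<le> full_exp_integral s n0 \<alpha> \<Omega> u" by (auto simp: B_def)
    have "real n \<le> B * G T" using T(1) B by (simp add: pos_divide_le_eq mult.commute)
    then have "of_nat n \<le> ennreal (B * G T)" by (simp add: ennreal_of_nat_eq_real_of_nat ennreal_leI)
    then show "\<exists>u\<in>{u \<in> W0_space s p \<Omega>. gagliardo_seminorm s p \<Omega> u \<le> 1}. of_nat n \<le> full_exp_integral s n0 \<alpha> \<Omega> u"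
      using u by (meson order_trans)
  qed
qed

section \<open>Boundary strips of Lipschitz domains\<close>

lemma lborel_emeasure_translate:
  fixes S :: "'a::euclidean_space set"
  assumes [measurable]: "S \<in> sets borel"
  shows "emeasure lborel {y. v + y \<in> S} = emeasure lborel S"
proof -
  have "emeasure lborel S = emeasure (distr lborel borel ((+) v)) S"
    by (simp add: lborel_distr_plus)
  also have "\<dots> = emeasure lborel {y. v + y \<in> S}"
    by (subst emeasure_distr) (auto simp: vimage_def)
  finally show ?thesis by simp
qed

text \<open>Translates of the strip in the direction $e$ of the graph by multiples of $t\rho/2$ cover a ball of radius comparable
to $\rho$, and $O(1/t)$ of them are enough. Hence the strip has at least the proportion $ct$ of the volume.\<close>

lemma frontier_strip_measure_local:
  fixes \<Omega> :: "'a::euclidean_space set"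
  assumes \<Omega>: "open \<Omega>" and e: "norm e = 1" and lip: "L-lipschitz_on {z. z \<bullet> e = 0} \<gamma>"
    and graph: "\<Omega> \<inter> ball \<xi> r = {y \<in> ball \<xi> r. y \<bullet> e > \<gamma> (y - (y \<bullet> e) *\<^sub>R e)}"
    and \<xi>': "\<xi>' \<in> frontier \<Omega>" "dist \<xi> \<xi>' < r / 2"
    and \<rho>: "0 < \<rho>" "\<rho> \<le> r / 4" and t: "0 < t" "t \<le> 1"
  shows "emeasure lborel {y \<in> \<Omega>. dist \<xi>' y < \<rho> \<and> bdist \<Omega> y < t * \<rho>}
     \<ge> ennreal (unit_ball_vol (real DIM('a)) * (1 / (4 * (1 + L))) ^ DIM('a) / 6 * t * \<rho> ^ DIM('a))"
proof -
  let ?d = "DIM('a)"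
  define \<tau> where "\<tau> y = y \<bullet> e - \<gamma> (y - (y \<bullet> e) *\<^sub>R e)" for y
  have L: "L \<ge> 0" using lip by (rule lipschitz_on_nonneg)
  have ee: "e \<bullet> e = 1" using e by (simp add: dot_square_norm)
  have \<tau>_shift: "\<tau> (y + a *\<^sub>R e) = \<tau> y + a" for y a
    by (simp add: \<tau>_def ee algebra_simps)
  have proj: "norm (v - (v \<bullet> e) *\<^sub>R e) \<le> norm v" for v
  proof -
    have "(norm (v - (v \<bullet> e) *\<^sub>R e))^2 = (norm v)^2 - (v \<bullet> e)^2"
      unfolding power2_norm_eq_inner
      by (simp add: inner_diff_left inner_diff_right ee inner_commute[of e v] power2_eq_square)
    also have "\<dots> \<le> (norm v)^2" by simp
    finally show ?thesis by (rule power2_le_imp_le) simp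
  qed
  have \<tau>_lip: "\<bar>\<tau> y - \<tau> z\<bar> \<le> (1 + L) * dist y z" for y z
  proof -
    have "\<bar>\<gamma> (y - (y \<bullet> e) *\<^sub>R e) - \<gamma> (z - (z \<bullet> e) *\<^sub>R e)\<bar> \<le> L * dist (y - (y \<bullet> e) *\<^sub>R e) (z - (z \<bullet> e) *\<^sub>R e)"
      using lipschitz_onD[OF lip, of "y - (y \<bullet> e) *\<^sub>R e" "z - (z \<bullet> e) *\<^sub>R e"]
      by (simp add: dist_real_def inner_diff ee)
    also have "dist (y - (y \<bullet> e) *\<^sub>R e) (z - (z \<bullet> e) *\<^sub>R e) \<le> dist y z"
      using proj[of "y - z"] by (simp add: dist_norm algebra_simps)
    finally have 1: "\<bar>\<gamma> (y - (y \<bullet> e) *\<^sub>R e) - \<gamma> (z - (z \<bullet> e) *\<^sub>R e)\<bar> \<le> L * dist y z"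
      using L by (simp add: mult_left_mono)
    have "\<bar>y \<bullet> e - z \<bullet> e\<bar> \<le> dist y z"
      using Cauchy_Schwarz_ineq2[of "y - z" e] e by (simp add: dist_norm inner_diff_left)
    then show ?thesis using 1 by (simp add: \<tau>_def algebra_simps)
  qed
  have in_\<Omega>: "y \<in> \<Omega> \<longleftrightarrow> \<tau> y > 0" if "dist \<xi> y < r" for y
    using graph that by (auto simp: \<tau>_def set_eq_iff)
  have r: "r > 0" using \<rho> by simp
  have \<tau>\<xi>': "\<tau> \<xi>' = 0"
  proof -
    have "\<xi>' \<notin> \<Omega>" using \<xi>'(1) \<Omega> by (simp add: frontier_def interior_open)
    then have "\<tau> \<xi>' \<le> 0" using in_\<Omega>[of \<xi>'] \<xi>'(2) r by auto
    moreover have "\<not> \<tau> \<xi>' < 0"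
    proof
      assume neg: "\<tau> \<xi>' < 0"
      define \<epsilon> where "\<epsilon> = min (r / 2) (- \<tau> \<xi>' / (1 + L))"
      have "0 < - \<tau> \<xi>' / (1 + L)" using neg L by (intro divide_pos_pos) auto
      then have "\<epsilon> > 0" using r by (simp add: \<epsilon>_def)
      then obtain y where y: "y \<in> \<Omega>" "dist y \<xi>' < \<epsilon>"
        using \<xi>'(1) by (auto simp: frontier_def closure_approachable)
      have "dist \<xi> y < r" using y(2) \<xi>'(2) dist_triangle[of \<xi> y \<xi>'] by (simp add: \<epsilon>_def dist_commute)
      then have "\<tau> y > 0" using in_\<Omega> y(1) by blast
      have "(1 + L) * dist y \<xi>' < (1 + L) * (- \<tau> \<xi>' / (1 + L))"
        using y(2) L by (intro mult_strict_left_mono) (auto simp: \<epsilon>_def)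
      also have "\<dots> = - \<tau> \<xi>'" using L by simp
      finally show False using \<tau>_lip[of y \<xi>'] \<open>\<tau> y > 0\<close> by linarith
    qed
    ultimately show ?thesis by simp
  qed
  have in_frontier: "z \<in> frontier \<Omega>" if z: "dist \<xi> z < r" "\<tau> z = 0" for z
  proof -
    have "z \<notin> \<Omega>" using in_\<Omega>[OF z(1)] z(2) by simp
    moreover have "z \<in> closure \<Omega>"
      unfolding closure_approachable
    proof (intro allI impI)
      fix \<epsilon> :: real assume "\<epsilon> > 0"
      define a where "a = min (\<epsilon> / 2) ((r - dist \<xi> z) / 2)"
      have a: "a > 0" "a < \<epsilon>" "a < r - dist \<xi> z"
        using \<open>\<epsilon> > 0\<close> z(1) unfolding a_def min_def by (auto split: if_splits)
      have da: "dist (z + a *\<^sub>R e) z = a" using a e by (simp add: dist_norm)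
      then have "dist \<xi> (z + a *\<^sub>R e) < r" using a(3) dist_triangle[of \<xi> "z + a *\<^sub>R e" z] by (simp add: dist_commute)
      then have "z + a *\<^sub>R e \<in> \<Omega>" using in_\<Omega> \<tau>_shift z(2) a by simp
      moreover have "dist (z + a *\<^sub>R e) z < \<epsilon>" using da a(2) by linarith
      ultimately show "\<exists>y\<in>\<Omega>. dist y z < \<epsilon>" by (rule bexI[rotated])
    qed
    ultimately show ?thesis using \<Omega> by (simp add: frontier_def interior_open)
  qed
  define S where "S = {y \<in> \<Omega>. dist \<xi>' y < \<rho> \<and> bdist \<Omega> y < t * \<rho>}"
  have "open S"
  proof -
    have "S = \<Omega> \<inter> {y. dist \<xi>' y < \<rho>} \<inter> {y. bdist \<Omega> y < t * \<rho>}" by (auto simp: S_def)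
    then show ?thesis unfolding bdist_def using \<Omega>
      by (auto intro!: open_Int open_Collect_less continuous_intros)
  qed
  then have S_meas: "S \<in> sets borel" by simp
  define h where "h = t * \<rho> / 2"
  have h: "h > 0" "h \<le> \<rho> / 2" "h < t * \<rho>" using t \<rho> by (auto simp: h_def mult_le_cancel_right2)
  define \<kappa> where "\<kappa> = 1 / (4 * (1 + L))"
  have \<kappa>: "\<kappa> > 0" "\<kappa> \<le> 1 / 4" "(1 + L) * \<kappa> = 1 / 4" using L by (auto simp: \<kappa>_def field_simps)
  \<comment> \<open>The height $\tau$ above the graph varies by at most $\rho/2$ on the ball of radius $\kappa\rho$, that is, by $1/t$ steps of size $h$.\<close>
  define N where "N = \<lceil>1 / (2 * t)\<rceil> + 1"
  have N: "N \<ge> 0" "real_of_int N \<le> 1 / (2 * t) + 2" "1 / (2 * t) + 1 \<le> real_of_int N"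
  proof -
    have "0 \<le> 1 / (2 * t)" using t by simp
    then show "N \<ge> 0" "real_of_int N \<le> 1 / (2 * t) + 2" "1 / (2 * t) + 1 \<le> real_of_int N"
      unfolding N_def by linarith+
  qed
  have cover: "ball \<xi>' (\<kappa> * \<rho>) \<subseteq> (\<Union>k\<in>{-N..N}. {y. - (real_of_int k * h) *\<^sub>R e + y \<in> S})"
  proof
    fix y assume "y \<in> ball \<xi>' (\<kappa> * \<rho>)"
    then have y: "dist \<xi>' y < \<kappa> * \<rho>" by simp
    have "\<bar>\<tau> y\<bar> \<le> (1 + L) * dist y \<xi>'" using \<tau>_lip[of y \<xi>'] \<tau>\<xi>' by simp
    also have "\<dots> \<le> (1 + L) * (\<kappa> * \<rho>)" using y L by (intro mult_left_mono) (auto simp: dist_commute)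
    also have "\<dots> = \<rho> / 4" using \<kappa>(3) by (simp add: mult.assoc[symmetric])
    finally have \<tau>y: "\<bar>\<tau> y\<bar> \<le> \<rho> / 4" .
    \<comment> \<open>Moves $y$ along $e$ to height in $(0, h]$: inside $\Omega$, and with a boundary point at distance at most $h < t\rho$ below it.\<close>
    define k where "k = \<lceil>\<tau> y / h\<rceil> - 1"
    define z where "z = y + (- (real_of_int k * h)) *\<^sub>R e"
    have "real_of_int k < \<tau> y / h" "\<tau> y / h \<le> real_of_int k + 1" unfolding k_def by linarith+
    then have kh: "real_of_int k * h < \<tau> y" "\<tau> y \<le> (real_of_int k + 1) * h"
      using h by (simp_all add: pos_less_divide_eq pos_divide_le_eq)
    have \<tau>z: "\<tau> z = \<tau> y - real_of_int k * h" unfolding z_def \<tau>_shift by simp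
    have \<tau>z': "0 < \<tau> z" "\<tau> z \<le> h" using kh \<tau>z by (auto simp: algebra_simps)
    have khb: "\<bar>real_of_int k * h\<bar> \<le> \<rho> / 4 + h" using \<tau>y \<tau>z \<tau>z' by linarith
    have dyz: "dist y z = \<bar>real_of_int k * h\<bar>" using e by (simp add: z_def dist_norm)
    have "dist \<xi>' z < \<rho>"
    proof -
      have "dist \<xi>' z \<le> dist \<xi>' y + dist y z" by (rule dist_triangle)
      also have "\<dots> < \<kappa> * \<rho> + (\<rho> / 4 + h)" using y khb dyz by linarith
      also have "\<dots> \<le> \<rho>"
      proof -
        have "\<kappa> * \<rho> \<le> 1 / 4 * \<rho>" using \<kappa> \<rho> by (intro mult_right_mono) auto
        then show ?thesis using h by linarith
      qed
      finally show ?thesis .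
    qed
    moreover have "dist \<xi> z < r"
      using \<open>dist \<xi>' z < \<rho>\<close> \<xi>'(2) \<rho> dist_triangle[of \<xi> z \<xi>'] by linarith
    then have "z \<in> \<Omega>" using in_\<Omega> \<tau>z' by simp
    moreover have "bdist \<Omega> z < t * \<rho>"
    proof -
      define z' where "z' = z + (- \<tau> z) *\<^sub>R e"
      have zz: "dist z z' = \<tau> z" using \<tau>z' e by (simp add: z'_def dist_norm)
      have "dist \<xi> z' < r"
        using \<open>dist \<xi>' z < \<rho>\<close> \<xi>'(2) \<rho> dist_triangle[of \<xi> z \<xi>'] dist_triangle[of \<xi> z' z] zz \<tau>z' h by linarith
      moreover have "\<tau> z' = 0" unfolding z'_def \<tau>_shift by simp
      ultimately have "z' \<in> frontier \<Omega>" by (rule in_frontier)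
      then have "bdist \<Omega> z \<le> dist z z'" unfolding bdist_def by (rule infdist_le)
      then show ?thesis using zz \<tau>z' h by linarith
    qed
    ultimately have "z \<in> S" by (simp add: S_def)
    moreover have "k \<in> {-N..N}"
    proof -
      have "\<bar>real_of_int k\<bar> * h \<le> (1 / (2 * t) + 1) * h"
        using khb h t \<rho> by (simp add: abs_mult h_def algebra_simps)
      then have "\<bar>real_of_int k\<bar> \<le> 1 / (2 * t) + 1" using h by simp
      then have "real_of_int \<bar>k\<bar> \<le> real_of_int N" using N by simp
      then have "\<bar>k\<bar> \<le> N" by (simp only: of_int_le_iff)
      then show ?thesis by (simp add: abs_le_iff)
    qed
    ultimately show "y \<in> (\<Union>k\<in>{-N..N}. {y. - (real_of_int k * h) *\<^sub>R e + y \<in> S})"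
      by (auto simp: z_def add.commute)
  qed
  have S_shift: "{y. v + y \<in> S} \<in> sets borel" for v
  proof -
    have "(\<lambda>y. v + y) -` S \<inter> space borel \<in> sets borel"
      by (rule measurable_sets[OF _ S_meas]) measurable
    then show ?thesis by (simp add: vimage_def)
  qed
  have "ennreal (unit_ball_vol ?d * (\<kappa> * \<rho>) ^ ?d) = emeasure lborel (ball \<xi>' (\<kappa> * \<rho>))"
    using \<kappa> \<rho> by (simp add: emeasure_ball)
  also have "\<dots> \<le> emeasure lborel (\<Union>k\<in>{-N..N}. {y. - (real_of_int k * h) *\<^sub>R e + y \<in> S})"
  proof (rule emeasure_mono[OF cover])
    show "(\<Union>k\<in>{-N..N}. {y. - (real_of_int k * h) *\<^sub>R e + y \<in> S}) \<in> sets lborel"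
      unfolding sets_lborel by (intro sets.finite_UN S_shift) auto
  qed
  also have "\<dots> \<le> (\<Sum>k\<in>{-N..N}. emeasure lborel {y. - (real_of_int k * h) *\<^sub>R e + y \<in> S})"
  proof (rule emeasure_subadditive_finite)
    show "(\<lambda>k. {y. - (real_of_int k * h) *\<^sub>R e + y \<in> S}) ` {-N..N} \<subseteq> sets lborel"
      unfolding sets_lborel using S_shift by blast
  qed simp
  also have "\<dots> = ennreal (real_of_int (2 * N + 1)) * emeasure lborel S"
  proof -
    have "(\<Sum>k\<in>{-N..N}. emeasure lborel {y. - (real_of_int k * h) *\<^sub>R e + y \<in> S}) = of_nat (nat (2 * N + 1)) * emeasure lborel S"
      unfolding lborel_emeasure_translate[OF S_meas] by (simp add: algebra_simps)
    then show ?thesis using N by (simp add: ennreal_of_nat_eq_real_of_nat)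
  qed
  also have "\<dots> \<le> ennreal (6 / t) * emeasure lborel S"
  proof (intro mult_right_mono ennreal_leI)
    have "1 \<le> 1 / t" using t by simp
    then show "real_of_int (2 * N + 1) \<le> 6 / t" using N t by (simp add: field_simps)
  qed auto
  finally have *: "ennreal (unit_ball_vol ?d * (\<kappa> * \<rho>) ^ ?d) \<le> ennreal (6 / t) * emeasure lborel S" .
  have "ennreal (unit_ball_vol ?d * \<kappa> ^ ?d / 6 * t * \<rho> ^ ?d)
      = ennreal (t / 6) * ennreal (unit_ball_vol ?d * (\<kappa> * \<rho>) ^ ?d)"
    using t by (subst ennreal_mult'[symmetric]) (auto simp: power_mult_distrib mult_ac)
  also have "\<dots> \<le> ennreal (t / 6) * (ennreal (6 / t) * emeasure lborel S)"
    by (intro mult_left_mono *) auto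
  also have "\<dots> = emeasure lborel S"
    using t by (subst mult.assoc[symmetric], subst ennreal_mult'[symmetric]) auto
  finally show ?thesis by (simp add: S_def \<kappa>_def)
qed

text \<open>Compactness of the boundary makes the local constants uniform. A point $x$ is compared with its nearest boundary
point; the scale $\rho$ is a fixed proportion of $\delta(x)$ so that the local estimate also applies far from the boundary.\<close>

lemma frontier_strip_measure:
  fixes \<Omega> :: "'a::euclidean_space set"
  assumes "bounded_lipschitz_domain \<Omega>"
  obtains c where "c > 0"
    "\<And>x t. x \<in> \<Omega> \<Longrightarrow> 0 < t \<Longrightarrow> t \<le> 1 \<Longrightarrow>
      emeasure lborel {y \<in> \<Omega>. dist x y < 2 * bdist \<Omega> x \<and> bdist \<Omega> y < t * bdist \<Omega> x}
        \<ge> ennreal (c * t * bdist \<Omega> x ^ DIM('a))"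
proof -
  let ?d = "DIM('a)" and ?F = "frontier \<Omega>"
  have \<Omega>: "open \<Omega>" "\<Omega> \<noteq> {}" "bounded \<Omega>" using assms by (auto simp: bounded_lipschitz_domain_def)
  have comp: "compact ?F" using \<Omega>(3) by (rule compact_frontier_bounded)
  have ne: "?F \<noteq> {}" using \<Omega> by (metis frontier_not_empty not_bounded_UNIV)
  define G where "G \<xi> r c \<longleftrightarrow> (\<forall>\<xi>'\<in>?F. \<forall>\<rho> t. dist \<xi> \<xi>' < r \<longrightarrow> 0 < \<rho> \<longrightarrow> \<rho> \<le> r / 2 \<longrightarrow> 0 < t \<longrightarrow> t \<le> 1 \<longrightarrow>
     ennreal (c * t * \<rho> ^ ?d) \<le> emeasure lborel {y \<in> \<Omega>. dist \<xi>' y < \<rho> \<and> bdist \<Omega> y < t * \<rho>})" for \<xi> r c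
  have "\<exists>r c. 0 < r \<and> 0 < c \<and> G \<xi> r c" if "\<xi> \<in> ?F" for \<xi>
  proof -
    from assms that obtain r e L \<gamma> where "r > 0" and *: "norm e = 1" "L-lipschitz_on {z. z \<bullet> e = 0} \<gamma>"
      "\<Omega> \<inter> ball \<xi> r = {y \<in> ball \<xi> r. y \<bullet> e > \<gamma> (y - (y \<bullet> e) *\<^sub>R e)}"
      unfolding bounded_lipschitz_domain_def by blast
    have L: "L \<ge> 0" using *(2) by (rule lipschitz_on_nonneg)
    show ?thesis unfolding G_def
    proof (rule exI[of _ "r / 2"], rule exI[of _ "unit_ball_vol (real ?d) * (1 / (4 * (1 + L))) ^ ?d / 6"],
        intro conjI ballI allI impI)
      show "0 < unit_ball_vol (real ?d) * (1 / (4 * (1 + L))) ^ ?d / 6"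
        using L by (intro divide_pos_pos mult_pos_pos zero_less_power) auto
    next
      fix \<xi>' \<rho> and t :: real
      assume "\<xi>' \<in> ?F" "dist \<xi> \<xi>' < r / 2" "0 < \<rho>" "\<rho> \<le> r / 2 / 2" "0 < t" "t \<le> 1"
      then show "ennreal (unit_ball_vol (real ?d) * (1 / (4 * (1 + L))) ^ ?d / 6 * t * \<rho> ^ ?d)
          \<le> emeasure lborel {y \<in> \<Omega>. dist \<xi>' y < \<rho> \<and> bdist \<Omega> y < t * \<rho>}"
        by (intro frontier_strip_measure_local[OF \<Omega>(1) *]) auto
    qed (use \<open>r > 0\<close> in simp)
  qed
  then obtain r c where "\<And>\<xi>. \<xi> \<in> ?F \<Longrightarrow> 0 < r \<xi> \<and> 0 < c \<xi> \<and> G \<xi> (r \<xi>) (c \<xi>)"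
    by metis
  then have rc: "\<And>\<xi>. \<xi> \<in> ?F \<Longrightarrow> 0 < r \<xi> \<and> 0 < c \<xi>"
    "\<And>\<xi> \<xi>' \<rho> t. \<xi> \<in> ?F \<Longrightarrow> \<xi>' \<in> ?F \<Longrightarrow> dist \<xi> \<xi>' < r \<xi> \<Longrightarrow> 0 < \<rho> \<Longrightarrow> \<rho> \<le> r \<xi> / 2 \<Longrightarrow> 0 < t \<Longrightarrow> t \<le> 1 \<Longrightarrow>
     ennreal (c \<xi> * t * \<rho> ^ ?d) \<le> emeasure lborel {y \<in> \<Omega>. dist \<xi>' y < \<rho> \<and> bdist \<Omega> y < t * \<rho>}"
    unfolding G_def by simp_all
  obtain C where C: "C \<subseteq> ?F" "finite C" "?F \<subseteq> (\<Union>\<xi>\<in>C. ball \<xi> (r \<xi>))"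
  proof (rule compactE_image[OF comp, of ?F "\<lambda>\<xi>. ball \<xi> (r \<xi>)"])
    show "?F \<subseteq> (\<Union>\<xi>\<in>?F. ball \<xi> (r \<xi>))" using rc(1) by force
  qed auto
  have "C \<noteq> {}" using C(3) ne by auto
  define r0 where "r0 = Min (r ` C) / 2"
  define c0 where "c0 = Min (c ` C)"
  have r0: "r0 > 0" "\<And>\<xi>. \<xi> \<in> C \<Longrightarrow> r0 \<le> r \<xi> / 2"
    using C \<open>C \<noteq> {}\<close> rc(1) by (auto simp: r0_def)
  have c0: "c0 > 0" "\<And>\<xi>. \<xi> \<in> C \<Longrightarrow> c0 \<le> c \<xi>"
    using C \<open>C \<noteq> {}\<close> rc(1) by (auto simp: c0_def)
  have loc: "ennreal (c0 * t * \<rho> ^ ?d) \<le> emeasure lborel {y \<in> \<Omega>. dist \<xi>' y < \<rho> \<and> bdist \<Omega> y < t * \<rho>}"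
    if "\<xi>' \<in> ?F" "0 < \<rho>" "\<rho> \<le> r0" "0 < t" "t \<le> 1" for \<xi>' \<rho> t
  proof -
    obtain \<xi> where \<xi>: "\<xi> \<in> C" "dist \<xi> \<xi>' < r \<xi>" using C(3) \<open>\<xi>' \<in> ?F\<close> by auto
    have "c0 * t * \<rho> ^ ?d \<le> c \<xi> * t * \<rho> ^ ?d"
      using c0(2)[OF \<xi>(1)] that by (intro mult_right_mono) auto
    then show ?thesis
      using rc(2)[of \<xi> \<xi>' \<rho> t] \<xi> C(1) that r0(2)[OF \<xi>(1)] by (meson ennreal_leI order_trans subsetD)
  qed
  obtain b where b: "\<And>x. x \<in> closure \<Omega> \<Longrightarrow> norm x \<le> b"
    using bounded_closure[OF \<Omega>(3)] by (auto simp: bounded_iff)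
  define D where "D = max r0 (2 * b)"
  have D: "D > 0" "r0 \<le> D" using r0 by (auto simp: D_def)
  have bD: "bdist \<Omega> x \<le> D" if "x \<in> \<Omega>" for x
  proof -
    obtain \<xi> where "\<xi> \<in> ?F" using ne by auto
    then have "bdist \<Omega> x \<le> dist x \<xi>" unfolding bdist_def by (rule infdist_le)
    also have "\<dots> \<le> norm x + norm \<xi>" by (simp add: dist_norm norm_triangle_ineq4)
    also have "\<dots> \<le> 2 * b" using b[of x] b[of \<xi>] that \<open>\<xi> \<in> ?F\<close> closure_subset[of \<Omega>]
      by (auto simp: frontier_def)
    finally show ?thesis by (simp add: D_def)
  qed
  show ?thesis
  proof (rule that[of "c0 * (r0 / D) ^ ?d"])
    show "0 < c0 * (r0 / D) ^ ?d" using c0 r0 D by auto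
    fix x t assume x: "x \<in> \<Omega>" and t: "0 < t" "t \<le> (1::real)"
    obtain \<xi>' where \<xi>': "\<xi>' \<in> ?F" "bdist \<Omega> x = dist x \<xi>'"
      using infdist_attains_inf[OF frontier_closed ne, of x] unfolding bdist_def by blast
    have "x \<notin> ?F" using x \<Omega>(1) by (simp add: frontier_def interior_open)
    then have pos: "bdist \<Omega> x > 0" using \<xi>' by auto
    define \<rho> where "\<rho> = bdist \<Omega> x * (r0 / D)"
    have \<rho>: "0 < \<rho>" "\<rho> \<le> bdist \<Omega> x" "\<rho> \<le> r0"
    proof -
      show "0 < \<rho>" using pos r0 D by (auto simp: \<rho>_def)
      have "r0 / D \<le> 1" using D by simp
      then show "\<rho> \<le> bdist \<Omega> x" using pos unfolding \<rho>_def by (intro mult_left_le) auto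
      have "\<rho> \<le> D * (r0 / D)" unfolding \<rho>_def using bD[OF x] r0 D by (intro mult_right_mono) auto
      then show "\<rho> \<le> r0" using D by simp
    qed
    have "ennreal (c0 * (r0 / D) ^ ?d * t * bdist \<Omega> x ^ ?d) = ennreal (c0 * t * \<rho> ^ ?d)"
      by (simp only: \<rho>_def power_mult_distrib mult_ac)
    also have "\<dots> \<le> emeasure lborel {y \<in> \<Omega>. dist \<xi>' y < \<rho> \<and> bdist \<Omega> y < t * \<rho>}"
      by (rule loc) (use \<xi>' \<rho> t in auto)
    also have "\<dots> \<le> emeasure lborel {y \<in> \<Omega>. dist x y < 2 * bdist \<Omega> x \<and> bdist \<Omega> y < t * bdist \<Omega> x}"
    proof (rule emeasure_mono)
      show "{y \<in> \<Omega>. dist \<xi>' y < \<rho> \<and> bdist \<Omega> y < t * \<rho>} \<subseteq> {y \<in> \<Omega>. dist x y < 2 * bdist \<Omega> x \<and> bdist \<Omega> y < t * bdist \<Omega> x}"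
      proof safe
        fix y assume y: "dist \<xi>' y < \<rho>" "bdist \<Omega> y < t * \<rho>"
        show "dist x y < 2 * bdist \<Omega> x" using y(1) \<rho> \<xi>'(2) dist_triangle[of x y \<xi>'] by linarith
        have "t * \<rho> \<le> t * bdist \<Omega> x" using t \<rho> by (intro mult_left_mono) auto
        then show "bdist \<Omega> y < t * bdist \<Omega> x" using y(2) by linarith
      qed
      have "{y \<in> \<Omega>. dist x y < 2 * bdist \<Omega> x \<and> bdist \<Omega> y < t * bdist \<Omega> x}
        = \<Omega> \<inter> {y. dist x y < 2 * bdist \<Omega> x} \<inter> {y. bdist \<Omega> y < t * bdist \<Omega> x}" by auto
      moreover have "open \<dots>" unfolding bdist_def using \<Omega>
        by (auto intro!: open_Int open_Collect_less continuous_intros)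
      ultimately show "{y \<in> \<Omega>. dist x y < 2 * bdist \<Omega> x \<and> bdist \<Omega> y < t * bdist \<Omega> x} \<in> sets lborel" by simp
    qed
    finally show "ennreal (c0 * (r0 / D) ^ ?d * t * bdist \<Omega> x ^ ?d) \<le> \<dots>" .
  qed
qed

section \<open>The Hardy inequality in dimension at least two\<close>

lemma powr_add_le:
  fixes a b :: real
  assumes "p \<ge> 0" "a \<ge> 0" "b \<ge> 0"
  shows "(a + b) powr p \<le> 2 powr p * (a powr p + b powr p)"
proof -
  have "(a + b) powr p \<le> (2 * max a b) powr p" using assms by (intro powr_mono2) auto
  also have "\<dots> = 2 powr p * max a b powr p" by (rule powr_mult)
  also have "\<dots> \<le> 2 powr p * (a powr p + b powr p)"
    by (intro mult_left_mono) (auto simp: max_def)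
  finally show ?thesis .
qed

text \<open>Finiteness is the qualitative input without which a term cannot be absorbed.\<close>

lemma test_function_hardy_finite:
  fixes \<Omega> :: "'a::euclidean_space set"
  assumes \<Omega>: "open \<Omega>" "bounded \<Omega>" and p: "p > 0" and \<phi>: "\<phi> \<in> test_functions \<Omega>"
  shows "(\<integral>\<^sup>+x. ennreal (\<bar>\<phi> x\<bar> powr p / bdist \<Omega> x ^ DIM('a)) * indicator \<Omega> x \<partial>lborel) < \<infinity>"
proof (cases "{x. \<phi> x \<noteq> 0} = {}")
  case True
  then have "\<phi> x = 0" for x by auto
  then show ?thesis using p by simp
next
  case False
  let ?K = "closure {x. \<phi> x \<noteq> 0}"
  have K: "compact ?K" "?K \<subseteq> \<Omega>" "?K \<noteq> {}" using \<phi> False by (auto simp: test_functions_def)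
  obtain z where z: "z \<in> ?K" "\<And>y. y \<in> ?K \<Longrightarrow> bdist \<Omega> z \<le> bdist \<Omega> y"
    using continuous_attains_inf[OF K(1,3) continuous_on_bdist] by blast
  have \<delta>: "bdist \<Omega> z > 0" using z K bdist_pos[OF \<Omega>] by blast
  obtain M where M: "M \<ge> 0" "\<And>x. \<bar>\<phi> x\<bar> \<le> M" using test_function_bounded[OF \<phi>] by blast
  have "(\<integral>\<^sup>+x. ennreal (\<bar>\<phi> x\<bar> powr p / bdist \<Omega> x ^ DIM('a)) * indicator \<Omega> x \<partial>lborel)
    \<le> (\<integral>\<^sup>+x. ennreal (M powr p / bdist \<Omega> z ^ DIM('a)) * indicator \<Omega> x \<partial>lborel)"
  proof (intro nn_integral_mono mult_right_mono ennreal_leI)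
    fix x
    show "\<bar>\<phi> x\<bar> powr p / bdist \<Omega> x ^ DIM('a) \<le> M powr p / bdist \<Omega> z ^ DIM('a)"
    proof (cases "\<phi> x = 0")
      case True
      then show ?thesis using \<delta> p M by simp
    next
      case False
      then have "x \<in> ?K" using closure_subset[of "{x. \<phi> x \<noteq> 0}"] by blast
      then have "bdist \<Omega> z \<le> bdist \<Omega> x" by (rule z)
      then show ?thesis using \<delta> M p by (intro frac_le power_mono powr_mono2) auto
    qed
  qed auto
  also have "\<dots> = ennreal (M powr p / bdist \<Omega> z ^ DIM('a)) * emeasure lborel \<Omega>"
    using \<Omega> by (simp add: nn_integral_cmult_indicator)
  also have "\<dots> < \<infinity>" using emeasure_bounded_finite[OF \<Omega>(2)] by (simp add: ennreal_mult_less_top)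
  finally show ?thesis .
qed

text \<open>After exchanging the order of integration, a point $y$ is seen by those $x$ with
$|x-y| < 2\delta(x)$; writing $\delta(x)^{-2d}$ as an integral over $r \ge \delta(x)$ reduces the estimate to volumes of balls
of radius $2r$.\<close>

lemma cone_inverse_power_integral:
  fixes \<delta> :: "'a::euclidean_space \<Rightarrow> real"
  assumes [measurable]: "\<delta> \<in> borel_measurable borel" and b: "b > 0"
  shows "(\<integral>\<^sup>+x. ennreal (1 / \<delta> x ^ (2 * DIM('a))) * indicator {x. dist x y < 2 * \<delta> x \<and> b < \<delta> x} x \<partial>lborel)
     \<le> ennreal (2 ^ (DIM('a) + 1) * unit_ball_vol (real DIM('a)) / b ^ DIM('a))"
proof -
  let ?d = "DIM('a)"
  let ?k = "\<lambda>r. ennreal (real (2 * ?d) / r ^ (2 * ?d + 1))"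
  have "(\<integral>\<^sup>+x. ennreal (1 / \<delta> x ^ (2 * ?d)) * indicator {x. dist x y < 2 * \<delta> x \<and> b < \<delta> x} x \<partial>lborel)
     \<le> (\<integral>\<^sup>+x. (\<integral>\<^sup>+r. ?k r * indicator {b..} r * indicator {x. dist x y < 2 * r} x \<partial>lborel) \<partial>lborel)"
  proof (rule nn_integral_mono)
    fix x
    show "ennreal (1 / \<delta> x ^ (2 * ?d)) * indicator {x. dist x y < 2 * \<delta> x \<and> b < \<delta> x} x
      \<le> (\<integral>\<^sup>+r. ?k r * indicator {b..} r * indicator {x. dist x y < 2 * r} x \<partial>lborel)"
    proof (cases "dist x y < 2 * \<delta> x \<and> b < \<delta> x")
      case True
      then have "ennreal (1 / \<delta> x ^ (2 * ?d)) = (\<integral>\<^sup>+r. ?k r * indicator {\<delta> x..} r \<partial>lborel)"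
        using b by (intro inverse_power_layer_cake[symmetric]) auto
      also have "\<dots> \<le> (\<integral>\<^sup>+r. ?k r * indicator {b..} r * indicator {x. dist x y < 2 * r} x \<partial>lborel)"
        using True by (intro nn_integral_mono) (auto split: split_indicator)
      finally show ?thesis using True by simp
    qed simp
  qed
  also have "\<dots> = (\<integral>\<^sup>+r. (\<integral>\<^sup>+x. ?k r * indicator {b..} r * indicator {x. dist x y < 2 * r} x \<partial>lborel) \<partial>lborel)"
    by (rule lborel_pair.Fubini') measurable
  also have "\<dots> = (\<integral>\<^sup>+r. ennreal (2 ^ (?d + 1) * unit_ball_vol ?d) * (ennreal (real ?d / r ^ (?d + 1)) * indicator {b..} r) \<partial>lborel)"
  proof (rule nn_integral_cong)
    fix r :: real
    show "(\<integral>\<^sup>+x. ?k r * indicator {b..} r * indicator {x. dist x y < 2 * r} x \<partial>lborel)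
      = ennreal (2 ^ (?d + 1) * unit_ball_vol ?d) * (ennreal (real ?d / r ^ (?d + 1)) * indicator {b..} r)"
    proof (cases "b \<le> r")
      case True
      then have r: "r > 0" using b by simp
      have "{x. dist x y < 2 * r} = ball y (2 * r)" by (auto simp: dist_commute)
      then have "(\<integral>\<^sup>+x. ?k r * indicator {b..} r * indicator {x. dist x y < 2 * r} x \<partial>lborel)
        = ?k r * ennreal (unit_ball_vol ?d * (2 * r) ^ ?d)"
        using True r by (simp add: nn_integral_cmult_indicator emeasure_ball)
      also have "\<dots> = ennreal (real (2 * ?d) / r ^ (2 * ?d + 1) * (unit_ball_vol ?d * (2 * r) ^ ?d))"
        using r by (intro ennreal_mult'[symmetric]) auto
      also have "real (2 * ?d) / r ^ (2 * ?d + 1) * (unit_ball_vol ?d * (2 * r) ^ ?d) = (2 ^ (?d + 1) * unit_ball_vol ?d) * (real ?d / r ^ (?d + 1))"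
      proof -
        have "r ^ (2 * ?d + 1) = r ^ ?d * r ^ (?d + 1)" by (simp add: power_add[symmetric] mult_2)
        moreover have "r ^ ?d > 0" "r ^ (?d + 1) > 0" using r by (auto simp del: power_Suc)
        moreover have "real (2 * n) / (a * b) * (w * (c * a)) = (2 * c * w) * (real n / b)" if "a > 0" "b > 0" for a b c w :: real and n
          using that by simp
        ultimately show ?thesis by (simp only: power_mult_distrib) simp
      qed
      also have "ennreal \<dots> = ennreal (2 ^ (?d + 1) * unit_ball_vol ?d) * ennreal (real ?d / r ^ (?d + 1))"
        by (intro ennreal_mult') auto
      finally show ?thesis using True by simp
    qed simp
  qed
  also have "\<dots> = ennreal (2 ^ (?d + 1) * unit_ball_vol ?d) * ennreal (1 / b ^ ?d)"
    by (subst nn_integral_cmult, measurable) (simp only: inverse_power_layer_cake[OF b DIM_positive])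
  also have "\<dots> = ennreal (2 ^ (?d + 1) * unit_ball_vol (real ?d) / b ^ ?d)"
    by (subst ennreal_mult'[symmetric]) auto
  finally show ?thesis .
qed

text \<open>Cancellation in the extended half line needs a finite left-hand side.\<close>

lemma ennreal_absorb_half:
  fixes H B :: ennreal
  assumes "H \<le> ennreal (1 / 2) * H + B" "H < \<infinity>"
  shows "H \<le> 2 * B"
proof (cases B)
  case (real b)
  obtain h where h: "H = ennreal h" "h \<ge> 0" using assms(2) by (cases H) auto
  have "ennreal h \<le> ennreal (1 / 2 * h + b)"
  proof -
    have "ennreal (1 / 2) * ennreal h = ennreal (1 / 2 * h)" by (rule ennreal_mult'[symmetric]) simp
    moreover have "ennreal (1 / 2 * h) + ennreal b = ennreal (1 / 2 * h + b)"
      using h real by (intro ennreal_plus[symmetric]) auto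
    ultimately show ?thesis using assms(1) h(1) real(2) by simp
  qed
  then have "h \<le> 1 / 2 * h + b" using h real by (subst (asm) ennreal_le_iff) auto
  then have "h \<le> 2 * b" by simp
  then have "ennreal h \<le> ennreal (2 * b)" by (rule ennreal_leI)
  then show ?thesis using h real by (simp add: ennreal_mult')
qed simp

text \<open>Average $|\phi(x)|^p \le 2^p(|\phi(y)|^p + |\phi(x)-\phi(y)|^p)$ over $y$ in the strip
$\delta(y) < t\,\delta(x)$, $|x-y| < 2\delta(x)$, of measure at least $ct\,\delta(x)^d$. The second term is the energy, as
$|x-y|^{2d} \le (2\delta(x))^{2d}$. In the first one the order of integration is exchanged: only $x$ with
$\delta(x) > \delta(y)/t$ contribute, which gains $t^d$ against the loss $1/t$.\<close>

lemma fractional_Hardy: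
  fixes \<Omega> :: "'a::euclidean_space set"
  assumes \<Omega>: "bounded_lipschitz_domain \<Omega>" and d: "DIM('a) \<ge> 2" and p: "p > 0"
  obtains C where "C \<ge> 0" "\<And>\<phi>. \<phi> \<in> test_functions \<Omega> \<Longrightarrow>
     (\<integral>\<^sup>+x. ennreal (\<bar>\<phi> x\<bar> powr p / bdist \<Omega> x ^ DIM('a)) * indicator \<Omega> x \<partial>lborel) \<le> ennreal C * energy p \<Omega> \<phi>"
proof -
  let ?d = "DIM('a)" and ?\<delta> = "bdist \<Omega>"
  have op: "open \<Omega>" "bounded \<Omega>" using \<Omega> by (auto simp: bounded_lipschitz_domain_def)
  have [measurable]: "\<Omega> \<in> sets borel" using op by simp
  obtain c where c: "c > 0" and strip: "\<And>x t. x \<in> \<Omega> \<Longrightarrow> 0 < t \<Longrightarrow> t \<le> 1 \<Longrightarrow>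
      emeasure lborel {y \<in> \<Omega>. dist x y < 2 * ?\<delta> x \<and> ?\<delta> y < t * ?\<delta> x} \<ge> ennreal (c * t * ?\<delta> x ^ ?d)"
    using frontier_strip_measure[OF \<Omega>] by blast
  define W where "W = 2 ^ (?d + 1) * unit_ball_vol (real ?d)"
  have W: "W > 0" by (simp add: W_def)
  \<comment> \<open>The factor in front of the Hardy integral will be at most $(2^p/c)\,W\,t^{d-1}$, and $t^{d-1} \le t$ as $d \ge 2$.\<close>
  define t where "t = min 1 (c / (2 * 2 powr p * W))"
  have t: "0 < t" "t \<le> 1" "2 powr p / c * W * t \<le> 1 / 2"
  proof -
    show "0 < t" "t \<le> 1" using c W by (auto simp: t_def)
    have "2 powr p / c * W * t \<le> 2 powr p / c * W * (c / (2 * 2 powr p * W))"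
      using c W by (intro mult_left_mono) (auto simp: t_def)
    also have "\<dots> = 1 / 2" using c W by (simp add: field_simps)
    finally show "2 powr p / c * W * t \<le> 1 / 2" .
  qed
  define q where "q = 2 powr p / (c * t)"
  have q: "q > 0" using c t by (simp add: q_def)
  show ?thesis
  proof (rule that[of "2 * (q * 2 ^ (2 * ?d))"])
    show "0 \<le> 2 * (q * 2 ^ (2 * ?d))" using q by simp
    fix \<phi> assume \<phi>: "\<phi> \<in> test_functions \<Omega>"
    have [measurable]: "\<phi> \<in> borel_measurable borel" by (rule test_function_measurable[OF \<phi>])
    let ?E = "\<lambda>x. {y. y \<in> \<Omega> \<and> dist x y < 2 * ?\<delta> x \<and> ?\<delta> y < t * ?\<delta> x}"
    define H where "H = (\<integral>\<^sup>+x. ennreal (\<bar>\<phi> x\<bar> powr p / ?\<delta> x ^ ?d) * indicator \<Omega> x \<partial>lborel)"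
    define f where "f x y = ennreal (\<bar>\<phi> y\<bar> powr p / ?\<delta> x ^ (2 * ?d)) * indicator (?E x) y * indicator \<Omega> x" for x y
    define g where "g x y = ennreal (\<bar>\<phi> x - \<phi> y\<bar> powr p / norm (x - y) ^ (2 * ?d)) * indicator \<Omega> y * indicator \<Omega> x" for x y
    have [measurable]: "(\<lambda>(x, y). f x y) \<in> borel_measurable (lborel \<Otimes>\<^sub>M lborel)" unfolding f_def by measurable
    have [measurable]: "(\<lambda>(x, y). g x y) \<in> borel_measurable (lborel \<Otimes>\<^sub>M lborel)" unfolding g_def by measurable
    have pt: "ennreal (\<bar>\<phi> x\<bar> powr p / ?\<delta> x ^ ?d) * indicator \<Omega> x
       \<le> (\<integral>\<^sup>+y. ennreal q * (f x y + ennreal (2 ^ (2 * ?d)) * g x y) \<partial>lborel)" for x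
    proof (cases "x \<in> \<Omega>")
      case True
      have \<delta>: "?\<delta> x > 0" by (rule bdist_pos[OF op True])
      have "ennreal (\<bar>\<phi> x\<bar> powr p / ?\<delta> x ^ ?d) = ennreal (\<bar>\<phi> x\<bar> powr p / (c * t * ?\<delta> x ^ (2 * ?d))) * ennreal (c * t * ?\<delta> x ^ ?d)"
        using c t \<delta> by (subst ennreal_mult'[symmetric]) (auto simp: mult_2 power_add)
      also have "\<dots> \<le> ennreal (\<bar>\<phi> x\<bar> powr p / (c * t * ?\<delta> x ^ (2 * ?d))) * emeasure lborel (?E x)"
        using strip[OF True t(1,2)] by (intro mult_left_mono) auto
      also have "\<dots> = (\<integral>\<^sup>+y. ennreal (\<bar>\<phi> x\<bar> powr p / (c * t * ?\<delta> x ^ (2 * ?d))) * indicator (?E x) y \<partial>lborel)"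
        by (rule nn_integral_cmult_indicator[symmetric]) measurable
      also have "\<dots> \<le> (\<integral>\<^sup>+y. ennreal q * (f x y + ennreal (2 ^ (2 * ?d)) * g x y) \<partial>lborel)"
      proof (rule nn_integral_mono)
        fix y
        show "ennreal (\<bar>\<phi> x\<bar> powr p / (c * t * ?\<delta> x ^ (2 * ?d))) * indicator (?E x) y
          \<le> ennreal q * (f x y + ennreal (2 ^ (2 * ?d)) * g x y)"
        proof (cases "y \<in> ?E x")
          case yE: True
          then have y: "y \<in> \<Omega>" "dist x y < 2 * ?\<delta> x" by auto
          define A where "A = \<bar>\<phi> y\<bar> powr p / ?\<delta> x ^ (2 * ?d)"
          define B where "B = \<bar>\<phi> x - \<phi> y\<bar> powr p / norm (x - y) ^ (2 * ?d)"
          have AB: "A \<ge> 0" "B \<ge> 0" using \<delta> by (auto simp: A_def B_def)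
          have "\<bar>\<phi> x\<bar> powr p \<le> (\<bar>\<phi> y\<bar> + \<bar>\<phi> x - \<phi> y\<bar>) powr p" using p by (intro powr_mono2) auto
          also have "\<dots> \<le> 2 powr p * (\<bar>\<phi> y\<bar> powr p + \<bar>\<phi> x - \<phi> y\<bar> powr p)" using p by (intro powr_add_le) auto
          finally have "\<bar>\<phi> x\<bar> powr p / (c * t * ?\<delta> x ^ (2 * ?d)) \<le> 2 powr p * (\<bar>\<phi> y\<bar> powr p + \<bar>\<phi> x - \<phi> y\<bar> powr p) / (c * t * ?\<delta> x ^ (2 * ?d))"
            using c t \<delta> by (intro divide_right_mono) auto
          also have "\<dots> = q * (A + \<bar>\<phi> x - \<phi> y\<bar> powr p / ?\<delta> x ^ (2 * ?d))"
          proof -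
            have "A + \<bar>\<phi> x - \<phi> y\<bar> powr p / ?\<delta> x ^ (2 * ?d) = (\<bar>\<phi> y\<bar> powr p + \<bar>\<phi> x - \<phi> y\<bar> powr p) / ?\<delta> x ^ (2 * ?d)"
              by (simp add: A_def add_divide_distrib)
            then show ?thesis by (simp add: q_def)
          qed
          also have "\<bar>\<phi> x - \<phi> y\<bar> powr p / ?\<delta> x ^ (2 * ?d) \<le> 2 ^ (2 * ?d) * B"
          proof (cases "x = y")
            case False
            have "norm (x - y) ^ (2 * ?d) \<le> (2 * ?\<delta> x) ^ (2 * ?d)"
              using y(2) by (intro power_mono) (auto simp: dist_norm)
            then have "\<bar>\<phi> x - \<phi> y\<bar> powr p / ?\<delta> x ^ (2 * ?d) * norm (x - y) ^ (2 * ?d) \<le> \<bar>\<phi> x - \<phi> y\<bar> powr p / ?\<delta> x ^ (2 * ?d) * (2 * ?\<delta> x) ^ (2 * ?d)"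
              using \<delta> by (intro mult_left_mono) auto
            also have "\<dots> = 2 ^ (2 * ?d) * \<bar>\<phi> x - \<phi> y\<bar> powr p" using \<delta> by (simp add: power_mult_distrib)
            finally show ?thesis unfolding B_def using False by (simp add: pos_le_divide_eq)
          qed (use p AB in simp)
          finally have "\<bar>\<phi> x\<bar> powr p / (c * t * ?\<delta> x ^ (2 * ?d)) \<le> q * (A + 2 ^ (2 * ?d) * B)"
            using q by (simp add: mult_left_mono)
          then have "ennreal (\<bar>\<phi> x\<bar> powr p / (c * t * ?\<delta> x ^ (2 * ?d))) \<le> ennreal (q * (A + 2 ^ (2 * ?d) * B))"
            by (rule ennreal_leI)
          also have "\<dots> = ennreal q * (ennreal A + ennreal (2 ^ (2 * ?d)) * ennreal B)"
            using q AB by (simp add: ennreal_mult')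
          finally show ?thesis using yE True by (simp add: f_def g_def A_def B_def)
        qed simp
      qed
      finally show ?thesis using True by simp
    qed simp
    have "H \<le> (\<integral>\<^sup>+x. (\<integral>\<^sup>+y. ennreal q * (f x y + ennreal (2 ^ (2 * ?d)) * g x y) \<partial>lborel) \<partial>lborel)"
      unfolding H_def by (intro nn_integral_mono pt)
    also have "\<dots> = (\<integral>\<^sup>+x. ennreal q * ((\<integral>\<^sup>+y. f x y \<partial>lborel) + ennreal (2 ^ (2 * ?d)) * (\<integral>\<^sup>+y. g x y \<partial>lborel)) \<partial>lborel)"
      by (intro nn_integral_cong) (simp add: nn_integral_cmult nn_integral_add)
    also have "\<dots> = ennreal q * ((\<integral>\<^sup>+x. \<integral>\<^sup>+y. f x y \<partial>lborel \<partial>lborel) + ennreal (2 ^ (2 * ?d)) * (\<integral>\<^sup>+x. \<integral>\<^sup>+y. g x y \<partial>lborel \<partial>lborel))"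
      by (simp add: nn_integral_cmult nn_integral_add)
    also have "(\<integral>\<^sup>+x. \<integral>\<^sup>+y. g x y \<partial>lborel \<partial>lborel) = energy p \<Omega> \<phi>"
      unfolding g_def energy_def by (intro nn_integral_cong) (simp add: nn_integral_multc)
    also have "(\<integral>\<^sup>+x. \<integral>\<^sup>+y. f x y \<partial>lborel \<partial>lborel) = (\<integral>\<^sup>+y. \<integral>\<^sup>+x. f x y \<partial>lborel \<partial>lborel)"
      by (rule lborel_pair.Fubini') measurable
    also have "\<dots> \<le> (\<integral>\<^sup>+y. ennreal (W * t ^ ?d) * (ennreal (\<bar>\<phi> y\<bar> powr p / ?\<delta> y ^ ?d) * indicator \<Omega> y) \<partial>lborel)"
    proof (rule nn_integral_mono)
      fix y
      show "(\<integral>\<^sup>+x. f x y \<partial>lborel) \<le> ennreal (W * t ^ ?d) * (ennreal (\<bar>\<phi> y\<bar> powr p / ?\<delta> y ^ ?d) * indicator \<Omega> y)"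
      proof (cases "y \<in> \<Omega>")
        case True
        have \<delta>: "?\<delta> y > 0" by (rule bdist_pos[OF op True])
        have "(\<integral>\<^sup>+x. f x y \<partial>lborel) \<le> (\<integral>\<^sup>+x. ennreal (\<bar>\<phi> y\<bar> powr p) * (ennreal (1 / ?\<delta> x ^ (2 * ?d)) * indicator {x. dist x y < 2 * ?\<delta> x \<and> ?\<delta> y / t < ?\<delta> x} x) \<partial>lborel)"
          using t by (intro nn_integral_mono)
            (auto simp: f_def ennreal_mult'[symmetric] pos_divide_less_eq mult.commute split: split_indicator)
        also have "\<dots> = ennreal (\<bar>\<phi> y\<bar> powr p) * (\<integral>\<^sup>+x. ennreal (1 / ?\<delta> x ^ (2 * ?d)) * indicator {x. dist x y < 2 * ?\<delta> x \<and> ?\<delta> y / t < ?\<delta> x} x \<partial>lborel)"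
          by (rule nn_integral_cmult) measurable
        also have "\<dots> \<le> ennreal (\<bar>\<phi> y\<bar> powr p) * ennreal (W / (?\<delta> y / t) ^ ?d)"
          unfolding W_def using \<delta> t by (intro mult_left_mono cone_inverse_power_integral measurable_bdist) auto
        also have "\<dots> = ennreal (W * t ^ ?d) * ennreal (\<bar>\<phi> y\<bar> powr p / ?\<delta> y ^ ?d)"
          using W t by (subst (1 2) ennreal_mult'[symmetric]) (auto simp: power_divide mult_ac)
        finally show ?thesis using True by simp
      next
        case False
        then show ?thesis by (simp add: f_def)
      qed
    qed
    also have "\<dots> = ennreal (W * t ^ ?d) * H"
      unfolding H_def by (rule nn_integral_cmult) measurable
    finally have "H \<le> ennreal q * (ennreal (W * t ^ ?d) * H + ennreal (2 ^ (2 * ?d)) * energy p \<Omega> \<phi>)"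
      by (simp add: mult_left_mono add_right_mono)
    also have "\<dots> = ennreal (q * (W * t ^ ?d)) * H + ennreal (q * 2 ^ (2 * ?d)) * energy p \<Omega> \<phi>"
      using q by (simp add: distrib_left ennreal_mult' mult.assoc)
    also have "\<dots> \<le> ennreal (1 / 2) * H + ennreal (q * 2 ^ (2 * ?d)) * energy p \<Omega> \<phi>"
    proof (intro add_right_mono mult_right_mono ennreal_leI)
      have "t ^ ?d = t ^ (2 + (?d - 2))" by (simp only: le_add_diff_inverse[OF d])
      also have "\<dots> = t * (t * t ^ (?d - 2))" by (simp only: power_add power2_eq_square mult.assoc)
      also have "\<dots> \<le> t * (t * 1)" using t by (intro mult_left_mono power_le_one) auto
      finally have "t ^ ?d \<le> t * t" by simp
      then have "q * (W * t ^ ?d) \<le> q * (W * (t * t))" using q W by (intro mult_left_mono) auto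
      also have "\<dots> = 2 powr p / c * W * t" using t by (simp add: q_def)
      also note t(3)
      finally show "q * (W * t ^ ?d) \<le> 1 / 2" .
    qed auto
    finally have "H \<le> 2 * (ennreal (q * 2 ^ (2 * ?d)) * energy p \<Omega> \<phi>)"
      using test_function_hardy_finite[OF op p \<phi>] unfolding H_def by (rule ennreal_absorb_half)
    then show "(\<integral>\<^sup>+x. ennreal (\<bar>\<phi> x\<bar> powr p / ?\<delta> x ^ ?d) * indicator \<Omega> x \<partial>lborel)
      \<le> ennreal (2 * (q * 2 ^ (2 * ?d))) * energy p \<Omega> \<phi>"
      using q by (simp add: H_def ennreal_mult' mult.assoc)
  qed
qed

section \<open>The logarithmic Hardy inequality on an interval\<close>

text \<open>Convexity with a free weight. The factor in front of the first summand may be taken arbitrarily close to $1$, which the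
recursion over dyadic scales requires.\<close>

lemma powr_add_le_weighted:
  fixes a b \<eta> p :: real
  assumes "p \<ge> 1" "a \<ge> 0" "b \<ge> 0" "\<eta> > 0"
  shows "(a + b) powr p \<le> (1 + \<eta>) powr (p - 1) * a powr p + (1 + 1 / \<eta>) powr (p - 1) * b powr p"
proof -
  have ge1: "1 \<le> (1 + \<eta>) powr (p - 1)" "1 \<le> (1 + 1 / \<eta>) powr (p - 1)"
    using assms by (auto intro!: ge_one_powr_ge_zero)
  consider "a = 0" | "b = 0" | "a > 0" "b > 0" using assms by linarith
  then show ?thesis
  proof cases
    case 1
    then show ?thesis using mult_right_mono[OF ge1(2), of "b powr p"] assms by simp
  next
    case 2
    then show ?thesis using mult_right_mono[OF ge1(1), of "a powr p"] assms by simp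
  next
    case 3
    define t where "t = \<eta> / (1 + \<eta>)"
    have t: "0 \<le> t" "t \<le> 1" "1 - t = 1 / (1 + \<eta>)" "t = 1 / (1 + 1 / \<eta>)" using assms by (auto simp: t_def field_simps)
    have pos: "1 + \<eta> > 0" "1 + 1 / \<eta> > 0" using assms by (auto intro: add_pos_pos)
    have "((1 - t) *\<^sub>R ((1 + \<eta>) * a) + t *\<^sub>R ((1 + 1 / \<eta>) * b)) powr p
       \<le> (1 - t) * ((1 + \<eta>) * a) powr p + t * ((1 + 1 / \<eta>) * b) powr p"
      using 3 pos by (intro convex_onD[OF powr_convex[OF assms(1)]] t(1,2)) auto
    moreover have "(1 - t) *\<^sub>R ((1 + \<eta>) * a) + t *\<^sub>R ((1 + 1 / \<eta>) * b) = a + b"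
    proof -
      have "(1 - t) * (1 + \<eta>) = 1" "t * (1 + 1 / \<eta>) = 1" using pos t(3,4) by simp_all
      then show ?thesis by (simp add: mult.assoc[symmetric])
    qed
    moreover have "(1 - t) * ((1 + \<eta>) * a) powr p = (1 + \<eta>) powr (p - 1) * a powr p"
      unfolding t(3) using pos by (simp add: powr_mult powr_diff)
    moreover have "t * ((1 + 1 / \<eta>) * b) powr p = (1 + 1 / \<eta>) powr (p - 1) * b powr p"
      unfolding t(4) using pos by (simp add: powr_mult powr_diff)
    ultimately show ?thesis by simp
  qed
qed

text \<open>Bernoulli's inequality for exponents $b \le 1$; larger exponents only decrease the left-hand side.\<close>

lemma powr_one_minus_le:
  fixes b z :: real
  assumes "b > 0" "0 \<le> z" "z < 1"
  shows "(1 - z) powr b \<le> 1 - min 1 b * z"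
proof (cases "b \<ge> 1")
  case True
  then have "(1 - z) powr b \<le> (1 - z) powr 1" using assms by (intro powr_mono') auto
  then show ?thesis using assms True by simp
next
  case False
  then have "(1 - z) powr b * 1 powr (1 - b) \<le> b * (1 - z) + (1 - b) * 1"
    using assms by (intro Youngs_inequality_0) auto
  then show ?thesis using False by (simp add: algebra_simps)
qed

text \<open>Choosing the weight $\eta = 1/(2k)$ at step $k$ makes $a_k (k+1)^{1-p}$ almost decreasing: each step gains a
multiple of $a_{k-1}k^{-p}$ and loses a multiple of $g_k$. Summation telescopes.\<close>

lemma critical_discrete_Hardy:
  fixes a g :: "nat \<Rightarrow> real"
  assumes p: "p > 1" and a: "\<And>k. a k \<ge> 0" and g: "\<And>N. (\<Sum>k=1..N. g k) \<le> G"
    and step: "\<And>k \<eta>. k \<ge> 1 \<Longrightarrow> \<eta> > 0 \<Longrightarrow> a k \<le> (1 + \<eta>) powr (p - 1) * a (k - 1) + (1 + 1 / \<eta>) powr (p - 1) * g k"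
    and g0: "\<And>k. g k \<ge> 0"
  shows "(\<Sum>k=1..N. a k / real k powr p) \<le> 2 powr p * 4 / min 1 (p - 1) * (a 0 + 2 powr (p - 1) * G)"
proof -
  define b where "b = p - 1"
  have b: "b > 0" using p by (simp add: b_def)
  define \<mu> where "\<mu> = min 1 b"
  have \<mu>: "\<mu> > 0" using b by (simp add: \<mu>_def)
  define W where "W k = 1 / (real k + 1) powr b" for k
  have W: "W k > 0" for k by (simp add: W_def)
  have one: "\<mu> / 4 * (a (k - 1) / real k powr p) \<le> W (k - 1) * a (k - 1) - W k * a k + 2 powr b * g k" if k: "k \<ge> 1" for k
  proof -
    \<comment> \<open>The growth factor $(1 + 1/(2k))^{p-1}$ consumes only half of the decay of the weights, $(1 + 1/k)^{1-p}$.\<close>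
    define \<eta> where "\<eta> = 1 / (2 * real k)"
    have \<eta>: "\<eta> > 0" using k by (simp add: \<eta>_def)
    have "W k * a k \<le> W k * ((1 + \<eta>) powr b * a (k - 1) + (1 + 1 / \<eta>) powr b * g k)"
      using step[OF k \<eta>] W[of k] unfolding b_def by (intro mult_left_mono) auto
    also have "\<dots> = (W k * (1 + \<eta>) powr b) * a (k - 1) + (W k * (1 + 1 / \<eta>) powr b) * g k"
      by (simp add: algebra_simps)
    also have "\<dots> \<le> (W (k - 1) * (1 - \<mu> / (2 * (real k + 1)))) * a (k - 1) + 2 powr b * g k"
    proof (intro add_mono mult_right_mono a g0)
      have "W k * (1 + \<eta>) powr b = ((1 + \<eta>) / (real k + 1)) powr b"
        using \<eta> by (simp add: W_def powr_divide)
      also have "(1 + \<eta>) / (real k + 1) = (1 / real k) * (1 - 1 / (2 * (real k + 1)))"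
        using k by (simp add: \<eta>_def field_simps)
      also have "\<dots> powr b = W (k - 1) * (1 - 1 / (2 * (real k + 1))) powr b"
        using k by (subst powr_mult) (simp add: W_def powr_divide of_nat_diff)
      also have "\<dots> \<le> W (k - 1) * (1 - \<mu> * (1 / (2 * (real k + 1))))"
        unfolding \<mu>_def using b W[of "k - 1"] by (intro mult_left_mono powr_one_minus_le) (auto simp: field_simps)
      finally show "W k * (1 + \<eta>) powr b \<le> W (k - 1) * (1 - \<mu> / (2 * (real k + 1)))" by simp
      have "W k * (1 + 1 / \<eta>) powr b = ((1 + 2 * real k) / (real k + 1)) powr b"
        using k by (simp add: W_def powr_divide \<eta>_def)
      also have "\<dots> \<le> 2 powr b" using b by (intro powr_mono2) (auto simp: divide_le_eq)
      finally show "W k * (1 + 1 / \<eta>) powr b \<le> 2 powr b" .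
    qed
    finally have 1: "W (k - 1) * a (k - 1) * (\<mu> / (2 * (real k + 1))) \<le> W (k - 1) * a (k - 1) - W k * a k + 2 powr b * g k"
      by (simp add: algebra_simps)
    have "\<mu> / 4 * (a (k - 1) / real k powr p) = W (k - 1) * a (k - 1) * (\<mu> / (4 * real k))"
    proof -
      have "real k powr p = real k powr b * real k" using k by (simp add: b_def powr_diff)
      then show ?thesis using k by (simp add: W_def of_nat_diff mult_ac)
    qed
    also have "\<dots> \<le> W (k - 1) * a (k - 1) * (\<mu> / (2 * (real k + 1)))"
      using k \<mu> a[of "k - 1"] W[of "k - 1"] by (intro mult_left_mono divide_left_mono) auto
    finally show ?thesis using 1 by linarith
  qed
  have G0: "G \<ge> 0" using g[of 0] by simp
  have telescope: "(\<Sum>k=1..N. \<mu> / 4 * (a (k - 1) / real k powr p)) \<le> a 0 + 2 powr b * (\<Sum>k=1..N. g k) - W N * a N" for N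
  proof (induction N)
    case 0
    then show ?case by (simp add: W_def)
  next
    case (Suc N)
    then show ?case using one[of "Suc N"] by (simp add: distrib_left)
  qed
  have "\<mu> / 4 * (\<Sum>k=1..N. a k / real k powr p) \<le> \<mu> / 4 * (2 powr p * (\<Sum>k=1..Suc N. a (k - 1) / real k powr p))"
  proof -
    have "(\<Sum>k=1..N. a k / real k powr p) \<le> (\<Sum>k=1..N. 2 powr p * (a k / real (Suc k) powr p))"
    proof (rule sum_mono)
      fix k assume "k \<in> {1..N}"
      then have k: "k \<ge> 1" by simp
      have "real (Suc k) powr p \<le> (2 * real k) powr p" using k p by (intro powr_mono2) auto
      also have "\<dots> = 2 powr p * real k powr p" by (rule powr_mult)
      finally have "a k * real (Suc k) powr p \<le> a k * (2 powr p * real k powr p)" using a by (intro mult_left_mono)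
      then show "a k / real k powr p \<le> 2 powr p * (a k / real (Suc k) powr p)"
        using k by (simp add: divide_simps mult_ac)
    qed
    also have "\<dots> = 2 powr p * (\<Sum>k=2..Suc N. a (k - 1) / real k powr p)"
      unfolding sum_distrib_left[symmetric]
      by (intro arg_cong[where f="\<lambda>x. 2 powr p * x"] sum.reindex_bij_witness[of _ "\<lambda>k. k - 1" Suc]) auto
    also have "\<dots> \<le> 2 powr p * (\<Sum>k=1..Suc N. a (k - 1) / real k powr p)"
      using a by (intro mult_left_mono sum_mono2) auto
    finally show ?thesis using \<mu> by (intro mult_left_mono) auto
  qed
  also have "\<dots> = 2 powr p * (\<Sum>k=1..Suc N. \<mu> / 4 * (a (k - 1) / real k powr p))"
    by (simp only: sum_distrib_left mult_ac)
  also have "\<dots> \<le> 2 powr p * (a 0 + 2 powr b * G)"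
  proof (intro mult_left_mono)
    have "2 powr b * (\<Sum>k=1..Suc N. g k) \<le> 2 powr b * G" by (intro mult_left_mono g) auto
    moreover have "0 \<le> W (Suc N) * a (Suc N)" using W[of "Suc N"] a[of "Suc N"] by simp
    ultimately show "(\<Sum>k=1..Suc N. \<mu> / 4 * (a (k - 1) / real k powr p)) \<le> a 0 + 2 powr b * G"
      using telescope[of "Suc N"] by linarith
  qed auto
  finally have "(\<Sum>k=1..N. a k / real k powr p) * (\<mu> / 4) \<le> 2 powr p * (a 0 + 2 powr b * G)"
    by (simp only: mult.commute)
  then have "(\<Sum>k=1..N. a k / real k powr p) \<le> 2 powr p * (a 0 + 2 powr b * G) / (\<mu> / 4)"
    using \<mu> by (subst pos_le_divide_eq) auto
  then show ?thesis by (simp add: \<mu>_def b_def mult_ac)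
qed

lemma one_dim_domain_is_ball:
  fixes \<Omega> :: "'a::euclidean_space set"
  assumes d: "DIM('a) = 1" and \<Omega>: "open \<Omega>" "connected \<Omega>" "\<Omega> \<noteq> {}" "bounded \<Omega>"
  obtains c R where "R > 0" "\<Omega> = ball c R"
proof -
  obtain b :: 'a where b: "Basis = {b}" using d by (auto simp: card_1_singleton_iff)
  have bb: "b \<bullet> b = 1" using b by (metis inner_same_Basis insertI1)
  have rep: "x = (x \<bullet> b) *\<^sub>R b" for x
  proof -
    have "(\<Sum>i\<in>{b}. (x \<bullet> i) *\<^sub>R i) = x" unfolding b[symmetric] by (rule euclidean_representation)
    then have "(x \<bullet> b) *\<^sub>R b = x" by simp
    then show ?thesis by (rule sym)
  qed
  have nb: "norm b = 1" using bb by (simp add: norm_eq_1)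
  have nrm: "norm x = \<bar>x \<bullet> b\<bar>" for x
  proof -
    have "norm x = norm ((x \<bullet> b) *\<^sub>R b)" by (rule arg_cong[OF rep])
    then show ?thesis by (simp add: nb)
  qed
  define I where "I = (\<lambda>x. x \<bullet> b) ` \<Omega>"
  have I: "connected I" unfolding I_def using \<Omega>(2) by (intro connected_continuous_image continuous_intros)
  have I_iff: "x \<in> \<Omega> \<longleftrightarrow> x \<bullet> b \<in> I" for x
    unfolding I_def using rep by (metis (no_types, lifting) image_iff)
  have bddI: "bdd_above I" "bdd_below I"
  proof -
    obtain K where K: "\<And>x. x \<in> \<Omega> \<Longrightarrow> norm x \<le> K" using \<Omega>(4) by (auto simp: bounded_iff)
    then have "\<And>t. t \<in> I \<Longrightarrow> \<bar>t\<bar> \<le> K" using nrm by (auto simp: I_def)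
    then show "bdd_above I" "bdd_below I"
      by (auto intro!: bdd_aboveI[of _ K] bdd_belowI[of _ "- K"] simp: abs_le_iff)  (metis abs_le_iff minus_le_iff)
  qed
  have Ine: "I \<noteq> {}" using \<Omega>(3) by (simp add: I_def)
  have ext: "\<exists>e>0. \<forall>s. \<bar>s\<bar> < e \<longrightarrow> t + s \<in> I" if "t \<in> I" for t
  proof -
    have "t *\<^sub>R b \<in> \<Omega>" using that bb by (simp add: I_iff)
    then obtain e where e: "e > 0" "ball (t *\<^sub>R b) e \<subseteq> \<Omega>" using \<Omega>(1) open_contains_ball by blast
    have "t + s \<in> I" if "\<bar>s\<bar> < e" for s
    proof -
      have "(t + s) *\<^sub>R b \<in> ball (t *\<^sub>R b) e" using that by (simp add: dist_norm nrm bb algebra_simps)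
      then have "((t + s) *\<^sub>R b) \<bullet> b \<in> I" using e(2) I_iff by blast
      then show ?thesis by (simp add: bb)
    qed
    then show ?thesis using e(1) by blast
  qed
  have notin: "Inf I \<notin> I" "Sup I \<notin> I"
  proof -
    show "Inf I \<notin> I"
    proof
      assume "Inf I \<in> I"
      then obtain e where e: "e > 0" "\<And>s. \<bar>s\<bar> < e \<Longrightarrow> Inf I + s \<in> I" using ext by blast
      have "Inf I + - (e / 2) \<in> I" by (rule e(2)) (use e in auto)
      then show False using cInf_lower[OF _ bddI(2)] e(1) by force
    qed
    show "Sup I \<notin> I"
    proof
      assume "Sup I \<in> I"
      then obtain e where e: "e > 0" "\<And>s. \<bar>s\<bar> < e \<Longrightarrow> Sup I + s \<in> I" using ext by blast
      have "Sup I + e / 2 \<in> I" by (rule e(2)) (use e in auto)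
      then show False using cSup_upper[OF _ bddI(1)] e(1) by force
    qed
  qed
  have I_eq: "I = {Inf I<..<Sup I}"
  proof safe
    fix t assume "t \<in> I"
    then show "t \<in> {Inf I<..<Sup I}"
      using cInf_lower[OF _ bddI(2)] cSup_upper[OF _ bddI(1)] notin by (metis greaterThanLessThan_iff order_le_imp_less_or_eq)
  next
    fix t assume t: "t \<in> {Inf I<..<Sup I}"
    then obtain u v where "u \<in> I" "u < t" "v \<in> I" "t < v"
      using cInf_less_iff[OF Ine bddI(2), of t] less_cSup_iff[OF Ine bddI(1), of t] by auto
    then show "t \<in> I" using I by (meson connectedD_interval less_imp_le)
  qed
  have lt: "Inf I < Sup I" using I_eq Ine by (metis greaterThanLessThan_empty_iff not_le)
  show ?thesis
  proof (rule that[of "(Sup I - Inf I) / 2" "((Inf I + Sup I) / 2) *\<^sub>R b"])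
    show "(Sup I - Inf I) / 2 > 0" using lt by simp
    show "\<Omega> = ball (((Inf I + Sup I) / 2) *\<^sub>R b) ((Sup I - Inf I) / 2)"
    proof (intro set_eqI)
      fix x
      have "dist (((Inf I + Sup I) / 2) *\<^sub>R b) x = \<bar>(Inf I + Sup I) / 2 - x \<bullet> b\<bar>"
        by (simp add: dist_norm nrm inner_diff_left bb)
      moreover have "x \<in> \<Omega> \<longleftrightarrow> Inf I < x \<bullet> b \<and> x \<bullet> b < Sup I" using I_iff[of x] I_eq by (metis greaterThanLessThan_iff)
      ultimately show "x \<in> \<Omega> \<longleftrightarrow> x \<in> ball (((Inf I + Sup I) / 2) *\<^sub>R b) ((Sup I - Inf I) / 2)"
        by (auto simp: abs_less_iff field_simps)
    qed
  qed
qed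

lemma one_dim_slab_measure:
  fixes \<xi> e :: "'a::euclidean_space"
  assumes d: "DIM('a) = 1" and e: "norm e = 1" and lu: "l \<le> u"
  shows "emeasure lborel {x. l \<le> (\<xi> - x) \<bullet> e \<and> (\<xi> - x) \<bullet> e < u} = ennreal (u - l)"
proof -
  obtain b :: 'a where b: "Basis = {b}" using d by (auto simp: card_1_singleton_iff)
  have bb: "b \<bullet> b = 1" using b by (metis inner_same_Basis insertI1)
  have rep: "x = (x \<bullet> b) *\<^sub>R b" for x
  proof -
    have "(\<Sum>i\<in>{b}. (x \<bullet> i) *\<^sub>R i) = x" unfolding b[symmetric] by (rule euclidean_representation)
    then have "(x \<bullet> b) *\<^sub>R b = x" by simp
    then show ?thesis by (rule sym)
  qed
  have nrm: "norm x = \<bar>x \<bullet> e\<bar>" for x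
  proof -
    have nb: "norm b = 1" using bb by (simp add: norm_eq_1)
    have n: "norm y = \<bar>y \<bullet> b\<bar>" for y
    proof -
      have "norm y = norm ((y \<bullet> b) *\<^sub>R b)" by (rule arg_cong[OF rep])
      then show ?thesis by (simp add: nb)
    qed
    have "x \<bullet> e = ((x \<bullet> b) *\<^sub>R b) \<bullet> e" by (rule arg_cong[OF rep])
    also have "\<dots> = (x \<bullet> b) * (e \<bullet> b)" by (simp add: inner_commute)
    finally show ?thesis using e n[of x] n[of e] by (simp add: abs_mult)
  qed
  have ee: "e \<bullet> e = 1" using e by (simp add: norm_eq_1)
  let ?S = "{x. l \<le> (\<xi> - x) \<bullet> e \<and> (\<xi> - x) \<bullet> e < u}"
  define m where "m = \<xi> - ((l + u) / 2) *\<^sub>R e"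
  have dm: "dist m x = \<bar>(\<xi> - x) \<bullet> e - (l + u) / 2\<bar>" for x
    by (simp add: m_def dist_norm nrm inner_diff_left ee algebra_simps)
  have sub: "ball m ((u - l) / 2) \<subseteq> ?S" "?S \<subseteq> cball m ((u - l) / 2)"
    by (auto simp: dm abs_less_iff abs_le_iff field_simps)
  have [measurable]: "?S \<in> sets borel" by measurable
  have "emeasure lborel (ball m ((u - l) / 2)) = ennreal (u - l)" "emeasure lborel (cball m ((u - l) / 2)) = ennreal (u - l)"
    using lu d by (simp_all add: emeasure_ball emeasure_cball)
  then show ?thesis
    using emeasure_mono[OF sub(1), of lborel] emeasure_mono[OF sub(2), of lborel] by (intro antisym) auto
qed

text \<open>Jensen's inequality, obtained from convexity of the power on the normalized measure.\<close>

lemma mean_deviation_le: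
  fixes \<phi> :: "'a::euclidean_space \<Rightarrow> real"
  assumes \<Omega>: "open \<Omega>" "bounded \<Omega>" and V: "measure lebesgue \<Omega> > 0" and p: "p > 1"
    and \<phi>[measurable]: "\<phi> \<in> borel_measurable borel" and M: "\<And>x. \<bar>\<phi> x\<bar> \<le> M"
  shows "ennreal (\<bar>\<phi> x - average \<Omega> \<phi>\<bar> powr p)
     \<le> ennreal (2 powr p / measure lebesgue \<Omega>) * (\<integral>\<^sup>+y. ennreal (\<bar>\<phi> x - \<phi> y\<bar> powr p) * indicator \<Omega> y \<partial>lborel)"
proof -
  let ?V = "measure lebesgue \<Omega>" and ?L = "lebesgue_on \<Omega>"
  have lm: "\<Omega> \<in> lmeasurable" using \<Omega> by (simp add: lmeasurable_open)
  interpret finite_measure ?L by (rule finite_measure_lebesgue_on[OF lm])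
  have sV: "measure ?L \<Omega> = ?V" using lm by (simp add: measure_restrict_space fmeasurableD)
  have meas: "f \<in> borel_measurable borel \<Longrightarrow> f \<in> borel_measurable ?L" for f :: "'a \<Rightarrow> real"
    by (intro measurable_restrict_space1 measurable_completion) simp
  have M2: "\<bar>\<phi> x - \<phi> y\<bar> \<le> 2 * M" for y using M[of x] M[of y] by linarith
  have int\<phi>: "integrable ?L \<phi>" by (rule integrable_const_bound[where B=M]) (use M in \<open>auto intro!: meas\<close>)
  have int1: "integrable ?L (\<lambda>y. \<bar>\<phi> x - \<phi> y\<bar>)"
    by (rule integrable_const_bound[where B="2 * M"]) (use M2 in \<open>auto intro!: meas\<close>)
  have intp: "integrable ?L (\<lambda>y. \<bar>\<phi> x - \<phi> y\<bar> powr p)"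
    by (rule integrable_const_bound[where B="(2 * M) powr p"]) (use M2 p in \<open>auto intro!: meas powr_mono2\<close>)
  define N where "N = (\<integral>y. \<bar>\<phi> x - \<phi> y\<bar> powr p \<partial>?L) / ?V"
  define g where "g = (\<integral>y. \<bar>\<phi> x - \<phi> y\<bar> \<partial>?L) / ?V"
  have N0: "N \<ge> 0" unfolding N_def using V by (intro divide_nonneg_pos integral_nonneg_AE) auto
  have "\<phi> x - average \<Omega> \<phi> = (\<integral>y. \<phi> x - \<phi> y \<partial>?L) / ?V"
    using int\<phi> V by (simp add: average_def sV field_simps)
  then have "\<bar>\<phi> x - average \<Omega> \<phi>\<bar> \<le> g"
    unfolding g_def using V integral_abs_bound[of ?L "\<lambda>y. \<phi> x - \<phi> y"] by (simp add: divide_right_mono)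
  moreover have glam: "g \<le> q + q powr (1 - p) * N" if q: "q > 0" for q
  proof -
    have pt: "t \<le> q + q powr (1 - p) * t powr p" if "t \<ge> 0" for t
    proof (cases "t \<le> q")
      case False
      then have "t = t powr (1 - p) * t powr p" using q by (simp add: powr_add[symmetric])
      also have "\<dots> \<le> q powr (1 - p) * t powr p"
        using False q p by (intro mult_right_mono powr_mono2') auto
      finally show ?thesis using q by simp
    qed (simp add: add_increasing2)
    have "(\<integral>y. \<bar>\<phi> x - \<phi> y\<bar> \<partial>?L) \<le> (\<integral>y. q + q powr (1 - p) * \<bar>\<phi> x - \<phi> y\<bar> powr p \<partial>?L)"
      using int1 intp by (intro integral_mono pt) auto
    also have "\<dots> = q * ?V + q powr (1 - p) * (N * ?V)"
      using intp V by (simp add: sV N_def)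
    also have "\<dots> = (q + q powr (1 - p) * N) * ?V" by (simp add: algebra_simps)
    finally show ?thesis unfolding g_def using V by (simp add: pos_divide_le_eq)
  qed
  have "g powr p \<le> 2 powr p * N"
  proof (cases "N = 0")
    case True
    have "g \<le> 0"
    proof (rule field_le_epsilon)
      fix q :: real assume "q > 0"
      from glam[OF this] show "g \<le> 0 + q" using True by simp
    qed
    moreover have "g \<ge> 0" unfolding g_def using V by (intro divide_nonneg_pos integral_nonneg_AE) auto
    ultimately show ?thesis using p True by simp
  next
    case False
    then have N: "N > 0" using N0 by simp
    have "(N powr (1 / p)) powr (1 - p) * N = N powr ((1 - p) / p + 1)"
      using N by (simp add: powr_powr powr_add)
    also have "(1 - p) / p + 1 = 1 / p" using p by (simp add: field_simps)
    finally have "g \<le> 2 * N powr (1 / p)" using glam[of "N powr (1 / p)"] N by simp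
    moreover have "g \<ge> 0" unfolding g_def using V by (intro divide_nonneg_pos integral_nonneg_AE) auto
    ultimately have "g powr p \<le> (2 * N powr (1 / p)) powr p" using p by (intro powr_mono2) auto
    also have "\<dots> = 2 powr p * N" using N p by (simp add: powr_mult powr_powr)
    finally show ?thesis .
  qed
  ultimately have "\<bar>\<phi> x - average \<Omega> \<phi>\<bar> powr p \<le> 2 powr p * N"
    using p by (meson abs_ge_zero order_trans powr_mono2 less_imp_le zero_less_one less_trans)
  also have "2 powr p * N = 2 powr p / ?V * (\<integral>y. \<bar>\<phi> x - \<phi> y\<bar> powr p \<partial>?L)" by (simp add: N_def)
  finally have "ennreal (\<bar>\<phi> x - average \<Omega> \<phi>\<bar> powr p) \<le> ennreal (2 powr p / ?V) * ennreal (\<integral>y. \<bar>\<phi> x - \<phi> y\<bar> powr p \<partial>?L)"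
    using V by (subst ennreal_mult'[symmetric]) (auto intro!: ennreal_leI)
  also have "ennreal (\<integral>y. \<bar>\<phi> x - \<phi> y\<bar> powr p \<partial>?L) = (\<integral>\<^sup>+y. ennreal (\<bar>\<phi> x - \<phi> y\<bar> powr p) \<partial>?L)"
    by (rule nn_integral_eq_integral[symmetric]) (use intp in auto)
  also have "\<dots> = (\<integral>\<^sup>+y. ennreal (\<bar>\<phi> x - \<phi> y\<bar> powr p) * indicator \<Omega> y \<partial>lborel)"
    using lm by (intro nn_integral_lebesgue_on) (simp add: fmeasurableD)
  finally show ?thesis .
qed

text \<open>$I_k$ is the part of the interval at distance between $R2^{-k}$ and $2R2^{-k}$ from the endpoint $\xi$. Comparing
means over neighbouring pieces costs the energy between them, since there $|x-y|$ is at most comparable to their length;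
the products of neighbouring pieces are disjoint, so these energies sum up to at most the total one.\<close>

lemma dyadic_log_Hardy:
  fixes \<phi> :: "'a::euclidean_space \<Rightarrow> real" and \<xi> e :: 'a
  assumes d: "DIM('a) = 1" and e: "norm e = 1" and R: "R > 0" and p: "p > 1"
    and \<phi>[measurable]: "\<phi> \<in> borel_measurable borel" and M: "\<And>x. \<bar>\<phi> x - A\<bar> \<le> M"
    and J: "J = {x. 0 < (\<xi> - x) \<bullet> e \<and> (\<xi> - x) \<bullet> e < 2 * R}"
    and E: "energy p J \<phi> \<le> ennreal E" "E \<ge> 0"
    and E0: "(\<integral>\<^sup>+x. ennreal (\<bar>\<phi> x - A\<bar> powr p) * indicator J x \<partial>lborel) \<le> ennreal (R * E0)" "E0 \<ge> 0"
    and W: "\<And>x k. k \<ge> 1 \<Longrightarrow> R / 2 ^ k \<le> (\<xi> - x) \<bullet> e \<Longrightarrow> (\<xi> - x) \<bullet> e < 2 * R / 2 ^ k \<Longrightarrow> W x \<le> 2 ^ k / (R * (real k * ln 2) powr p)"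
  shows "(\<integral>\<^sup>+x. ennreal (\<bar>\<phi> x - A\<bar> powr p * W x) * indicator {x. 0 < (\<xi> - x) \<bullet> e \<and> (\<xi> - x) \<bullet> e < R} x \<partial>lborel)
     \<le> ennreal (1 / ln 2 powr p * (2 powr p * 4 / min 1 (p - 1) * (E0 + 2 powr (p - 1) * (8 * E))))"
proof -
  define t where "t x = (\<xi> - x) \<bullet> e" for x
  have [measurable]: "t \<in> borel_measurable borel" unfolding t_def by measurable
  define I where "I k = {x. R / 2 ^ k \<le> t x \<and> t x < 2 * R / 2 ^ k}" for k :: nat
  have [measurable]: "I k \<in> sets borel" for k unfolding I_def by measurable
  have I_meas: "emeasure lborel (I k) = ennreal (R / 2 ^ k)" for k
    using one_dim_slab_measure[OF d e, of "R / 2 ^ k" "2 * R / 2 ^ k" \<xi>] R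
    by (simp add: I_def t_def diff_divide_distrib[symmetric] divide_right_mono)
  have I_sub: "I k \<subseteq> J" for k
  proof
    fix x assume x: "x \<in> I k"
    have "0 < R / 2 ^ k" using R by simp
    moreover have "2 * R / 2 ^ k \<le> 2 * R / 1" using R by (intro divide_left_mono) auto
    ultimately show "x \<in> J" using x unfolding I_def J t_def[symmetric] by auto
  qed
  have I_inj: "k = k'" if "x \<in> I k" "x \<in> I k'" for x k k'
  proof -
    have False if "k < k'" "x \<in> I k" "x \<in> I k'" for k k'
    proof -
      have "(2::real) ^ (Suc k) \<le> 2 ^ k'" using that by (intro power_increasing) auto
      then have "2 * R / 2 ^ k' \<le> 2 * R / 2 ^ Suc k" using R by (intro divide_left_mono) auto
      then show False using that(2,3) by (simp add: I_def)
    qed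
    then show ?thesis using that by (metis nat_neq_iff)
  qed
  have J_meas[measurable]: "J \<in> sets borel" unfolding J by measurable
  have ee: "e \<bullet> e = 1" using e by (simp add: norm_eq_1)
  have nrm: "norm (x - y) = \<bar>t x - t y\<bar>" for x y
  proof -
    obtain b :: 'a where b: "Basis = {b}" using d by (auto simp: card_1_singleton_iff)
    have rep: "z = (z \<bullet> b) *\<^sub>R b" for z
    proof -
      have "(\<Sum>i\<in>{b}. (z \<bullet> i) *\<^sub>R i) = z" unfolding b[symmetric] by (rule euclidean_representation)
      then have "(z \<bullet> b) *\<^sub>R b = z" by simp
      then show ?thesis by (rule sym)
    qed
    have nb: "norm b = 1" using b by (metis norm_Basis insertI1)
    have n: "norm z = \<bar>z \<bullet> b\<bar>" for z
    proof -
      have "norm z = norm ((z \<bullet> b) *\<^sub>R b)" by (rule arg_cong[OF rep])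
      then show ?thesis by (simp add: nb)
    qed
    have "(x - y) \<bullet> e = (((x - y) \<bullet> b) *\<^sub>R b) \<bullet> e" by (rule arg_cong[OF rep])
    also have "\<dots> = ((x - y) \<bullet> b) * (e \<bullet> b)" by (simp add: inner_commute)
    finally have "\<bar>(x - y) \<bullet> e\<bar> = norm (x - y)" using e n[of "x - y"] n[of e] by (simp add: abs_mult)
    then show ?thesis by (simp add: t_def inner_diff_left abs_minus_commute)
  qed
  define f where "f x = ennreal (\<bar>\<phi> x - A\<bar> powr p)" for x
  have [measurable]: "f \<in> borel_measurable borel" unfolding f_def by measurable
  define F where "F k = (\<integral>\<^sup>+x. f x * indicator (I k) x \<partial>lborel)" for k
  define K where "K x y = ennreal (\<bar>\<phi> x - \<phi> y\<bar> powr p / norm (x - y) ^ (2 * DIM('a)))" for x y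
  have [measurable]: "(\<lambda>(x, y). K x y) \<in> borel_measurable (lborel \<Otimes>\<^sub>M lborel)" unfolding K_def by measurable
  define G where "G k = (\<integral>\<^sup>+x. (\<integral>\<^sup>+y. K x y * indicator (I (k - 1)) y * indicator (I k) x \<partial>lborel) \<partial>lborel)" for k
  have F_le: "F k \<le> ennreal (R * E0)" for k
  proof -
    have "F k \<le> (\<integral>\<^sup>+x. f x * indicator J x \<partial>lborel)"
      unfolding F_def using I_sub[of k] by (intro nn_integral_mono) (auto split: split_indicator)
    then show ?thesis using E0(1) by (simp add: f_def)
  qed
  have G_sum: "(\<Sum>k=1..N. G k) \<le> ennreal E" for N
  proof -
    have "(\<Sum>k=1..N. G k) = (\<integral>\<^sup>+x. (\<integral>\<^sup>+y. (\<Sum>k=1..N. K x y * indicator (I (k - 1)) y * indicator (I k) x) \<partial>lborel) \<partial>lborel)"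
    proof -
      have "(\<Sum>k=1..N. G k) = (\<integral>\<^sup>+x. (\<Sum>k=1..N. \<integral>\<^sup>+y. K x y * indicator (I (k - 1)) y * indicator (I k) x \<partial>lborel) \<partial>lborel)"
        unfolding G_def by (rule nn_integral_sum[symmetric]) measurable
      also have "\<dots> = (\<integral>\<^sup>+x. (\<integral>\<^sup>+y. (\<Sum>k=1..N. K x y * indicator (I (k - 1)) y * indicator (I k) x) \<partial>lborel) \<partial>lborel)"
        by (intro nn_integral_cong nn_integral_sum[symmetric]) measurable
      finally show ?thesis .
    qed
    also have "\<dots> \<le> (\<integral>\<^sup>+x. (\<integral>\<^sup>+y. K x y * indicator J y * indicator J x \<partial>lborel) \<partial>lborel)"
    proof (intro nn_integral_mono)
      fix x y
      have "(\<Sum>k=1..N. K x y * indicator (I (k - 1)) y * indicator (I k) x) \<le> (\<Sum>k=1..N. K x y * indicator J y * indicator (I k) x)"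
        using I_sub by (intro sum_mono mult_right_mono mult_left_mono) (auto split: split_indicator)
      also have "\<dots> = K x y * indicator J y * (\<Sum>k=1..N. indicator (I k) x)" by (simp add: sum_distrib_left)
      also have "(\<Sum>k=1..N. indicator (I k) x :: ennreal) = indicator (\<Union>k\<in>{1..N}. I k) x"
        by (rule indicator_UN_disjoint[symmetric]) (use I_inj in \<open>auto simp: disjoint_family_on_def\<close>)
      also have "\<dots> \<le> indicator J x" using I_sub by (auto split: split_indicator)
      finally show "(\<Sum>k=1..N. K x y * indicator (I (k - 1)) y * indicator (I k) x) \<le> K x y * indicator J y * indicator J x"
        by (simp add: mult_left_mono)
    qed
    also have "\<dots> = energy p J \<phi>"
      unfolding energy_def K_def by (intro nn_integral_cong) (simp add: nn_integral_multc)
    finally show ?thesis using E(1) by simp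
  qed
  have G_le: "G k \<le> ennreal E" if "k \<ge> 1" for k
  proof -
    have "G k \<le> (\<Sum>k=1..k. G k)" using that by (intro member_le_sum) auto
    then show ?thesis using G_sum[of k] by simp
  qed
  define F' where "F' k = enn2real (F k)" for k
  define G' where "G' k = (if k = 0 then 0 else enn2real (G k))" for k
  have F': "F k = ennreal (F' k)" "F' k \<ge> 0" for k
    using F_le[of k] by (auto simp: F'_def ennreal_enn2real_if top_unique)
  have G': "k \<ge> 1 \<Longrightarrow> G k = ennreal (G' k)" "G' k \<ge> 0" for k
    using G_le[of k] by (auto simp: G'_def ennreal_enn2real_if top_unique)
  define a where "a k = F' k * 2 ^ k / R" for k
  have a0: "a k \<ge> 0" for k using F'(2)[of k] R by (simp add: a_def)
  have step: "a k \<le> (1 + \<eta>) powr (p - 1) * a (k - 1) + (1 + 1 / \<eta>) powr (p - 1) * (8 * G' k)"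
    if k: "k \<ge> 1" and \<eta>: "\<eta> > 0" for k \<eta>
  proof -
    define c1 where "c1 = (1 + \<eta>) powr (p - 1)"
    define c2 where "c2 = (1 + 1 / \<eta>) powr (p - 1)"
    define len where "len = 4 * R / 2 ^ k"
    have len: "len > 0" using R by (simp add: len_def)
    have k2: "(2::real) ^ k = 2 * 2 ^ (k - 1)" using k by (cases k) auto
    have c: "c1 \<ge> 0" "c2 \<ge> 0" by (auto simp: c1_def c2_def)
    have pt: "f x * indicator (I (k - 1)) y * indicator (I k) x
       \<le> ennreal c1 * (f y * indicator (I (k - 1)) y * indicator (I k) x) + ennreal (c2 * len^2) * (K x y * indicator (I (k - 1)) y * indicator (I k) x)" for x y
    proof (cases "x \<in> I k \<and> y \<in> I (k - 1)")
      case True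
      have "\<bar>\<phi> x - A\<bar> powr p \<le> (\<bar>\<phi> y - A\<bar> + \<bar>\<phi> x - \<phi> y\<bar>) powr p" using p by (intro powr_mono2) auto
      also have "\<dots> \<le> c1 * \<bar>\<phi> y - A\<bar> powr p + c2 * \<bar>\<phi> x - \<phi> y\<bar> powr p"
        unfolding c1_def c2_def using p \<eta> by (intro powr_add_le_weighted) auto
      also have "\<bar>\<phi> x - \<phi> y\<bar> powr p \<le> len^2 * (\<bar>\<phi> x - \<phi> y\<bar> powr p / norm (x - y) ^ (2 * DIM('a)))"
      proof (cases "x = y")
        case False
        have "2 * R / 2 ^ (k - 1) = len" unfolding len_def k2 by simp
        moreover have "2 * R / 2 ^ k \<le> len" using R unfolding len_def by (intro divide_right_mono) auto
        moreover have "0 < R / 2 ^ k" "0 < R / 2 ^ (k - 1)" using R by auto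
        ultimately have "norm (x - y) \<le> len" using True unfolding nrm I_def by auto
        then have "norm (x - y) ^ 2 \<le> len ^ 2" by (intro power_mono) auto
        then have "\<bar>\<phi> x - \<phi> y\<bar> powr p * norm (x - y) ^ 2 \<le> \<bar>\<phi> x - \<phi> y\<bar> powr p * len ^ 2" by (intro mult_left_mono) auto
        moreover have np: "0 < norm (x - y) ^ 2" using False by simp
        ultimately show ?thesis unfolding d times_divide_eq_right mult_1_right pos_le_divide_eq[OF np] by (simp only: mult.commute)
      qed (use p in simp)
      finally have "\<bar>\<phi> x - A\<bar> powr p \<le> c1 * \<bar>\<phi> y - A\<bar> powr p + c2 * len^2 * (\<bar>\<phi> x - \<phi> y\<bar> powr p / norm (x - y) ^ (2 * DIM('a)))"
        using c by (simp add: mult_left_mono mult.assoc)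
      then have "ennreal (\<bar>\<phi> x - A\<bar> powr p) \<le> ennreal (c1 * \<bar>\<phi> y - A\<bar> powr p + c2 * len^2 * (\<bar>\<phi> x - \<phi> y\<bar> powr p / norm (x - y) ^ (2 * DIM('a))))"
        by (rule ennreal_leI)
      also have "\<dots> = ennreal c1 * f y + ennreal (c2 * len^2) * K x y"
      proof -
        let ?P = "\<bar>\<phi> y - A\<bar> powr p" and ?Q = "\<bar>\<phi> x - \<phi> y\<bar> powr p / norm (x - y) ^ (2 * DIM('a))"
        have "ennreal (c1 * ?P + c2 * len^2 * ?Q) = ennreal (c1 * ?P) + ennreal (c2 * len^2 * ?Q)"
          using c by (intro ennreal_plus mult_nonneg_nonneg) auto
        also have "ennreal (c1 * ?P) = ennreal c1 * ennreal ?P" using c by (intro ennreal_mult') auto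
        also have "ennreal (c2 * len^2 * ?Q) = ennreal (c2 * len^2) * ennreal ?Q"
          using c by (intro ennreal_mult') auto
        finally show ?thesis unfolding f_def K_def .
      qed
      finally show ?thesis using True by (simp add: f_def)
    qed auto
    have "F k * emeasure lborel (I (k - 1)) = (\<integral>\<^sup>+x. (\<integral>\<^sup>+y. f x * indicator (I (k - 1)) y * indicator (I k) x \<partial>lborel) \<partial>lborel)"
    proof -
      have "(\<integral>\<^sup>+y. f x * indicator (I (k - 1)) y * indicator (I k) x \<partial>lborel) = f x * indicator (I k) x * emeasure lborel (I (k - 1))" for x
      proof -
        have "(\<integral>\<^sup>+y. f x * indicator (I (k - 1)) y * indicator (I k) x \<partial>lborel) = (\<integral>\<^sup>+y. f x * indicator (I k) x * indicator (I (k - 1)) y \<partial>lborel)"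
          by (simp only: mult_ac)
        also have "\<dots> = f x * indicator (I k) x * emeasure lborel (I (k - 1))"
          by (rule nn_integral_cmult_indicator) measurable
        finally show ?thesis .
      qed
      then show ?thesis by (simp add: F_def nn_integral_multc)
    qed
    also have "\<dots> \<le> (\<integral>\<^sup>+x. (\<integral>\<^sup>+y. ennreal c1 * (f y * indicator (I (k - 1)) y * indicator (I k) x) + ennreal (c2 * len^2) * (K x y * indicator (I (k - 1)) y * indicator (I k) x) \<partial>lborel) \<partial>lborel)"
      by (intro nn_integral_mono pt)
    also have "\<dots> = ennreal c1 * (\<integral>\<^sup>+x. (\<integral>\<^sup>+y. f y * indicator (I (k - 1)) y * indicator (I k) x \<partial>lborel) \<partial>lborel) + ennreal (c2 * len^2) * G k"
      unfolding G_def by (simp add: nn_integral_add nn_integral_cmult)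
    also have "(\<integral>\<^sup>+x. (\<integral>\<^sup>+y. f y * indicator (I (k - 1)) y * indicator (I k) x \<partial>lborel) \<partial>lborel) = F (k - 1) * emeasure lborel (I k)"
    proof -
      have "(\<integral>\<^sup>+y. f y * indicator (I (k - 1)) y * indicator (I k) x \<partial>lborel) = F (k - 1) * indicator (I k) x" for x
        unfolding F_def by (rule nn_integral_multc) measurable
      then show ?thesis by (simp add: nn_integral_cmult_indicator)
    qed
    finally have "ennreal (F' k) * ennreal (R / 2 ^ (k - 1)) \<le> ennreal c1 * (ennreal (F' (k - 1)) * ennreal (R / 2 ^ k)) + ennreal (c2 * len^2) * ennreal (G' k)"
      unfolding I_meas F'(1) G'(1)[OF k] .
    then have "ennreal (F' k * (R / 2 ^ (k - 1))) \<le> ennreal (c1 * (F' (k - 1) * (R / 2 ^ k)) + c2 * len^2 * G' k)"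
    proof -
      have "ennreal (F' k * (R / 2 ^ (k - 1))) = ennreal (F' k) * ennreal (R / 2 ^ (k - 1))"
        using F'(2) by (intro ennreal_mult') auto
      moreover have "ennreal (c1 * (F' (k - 1) * (R / 2 ^ k)) + c2 * len^2 * G' k)
          = ennreal (c1 * (F' (k - 1) * (R / 2 ^ k))) + ennreal (c2 * len^2 * G' k)"
        using c F'(2) G'(2) R by (intro ennreal_plus mult_nonneg_nonneg) auto
      moreover have "ennreal (c1 * (F' (k - 1) * (R / 2 ^ k))) = ennreal c1 * ennreal (F' (k - 1) * (R / 2 ^ k))"
        using c by (intro ennreal_mult') auto
      moreover have "ennreal (F' (k - 1) * (R / 2 ^ k)) = ennreal (F' (k - 1)) * ennreal (R / 2 ^ k)"
        using F'(2) by (intro ennreal_mult') auto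
      moreover have "ennreal (c2 * len^2 * G' k) = ennreal (c2 * len^2) * ennreal (G' k)"
        using c by (intro ennreal_mult') auto
      ultimately show "ennreal (F' k) * ennreal (R / 2 ^ (k - 1)) \<le> ennreal c1 * (ennreal (F' (k - 1)) * ennreal (R / 2 ^ k)) + ennreal (c2 * len^2) * ennreal (G' k)
          \<Longrightarrow> ennreal (F' k * (R / 2 ^ (k - 1))) \<le> ennreal (c1 * (F' (k - 1) * (R / 2 ^ k)) + c2 * len^2 * G' k)"
        by (simp only:)
    qed
    then have "F' k * (R / 2 ^ (k - 1)) \<le> c1 * (F' (k - 1) * (R / 2 ^ k)) + c2 * len^2 * G' k"
      using c F'(2) G'(2) R by (subst (asm) ennreal_le_iff) (auto intro!: add_nonneg_nonneg mult_nonneg_nonneg)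
    then have "(F' k * (R / 2 ^ (k - 1))) * (2 ^ k * 2 ^ (k - 1) / R^2) \<le> (c1 * (F' (k - 1) * (R / 2 ^ k)) + c2 * len^2 * G' k) * (2 ^ k * 2 ^ (k - 1) / R^2)"
      by (rule mult_right_mono) simp
    also have "(F' k * (R / 2 ^ (k - 1))) * (2 ^ k * 2 ^ (k - 1) / R^2) = a k"
      using R by (simp add: a_def power2_eq_square)
    also have "(c1 * (F' (k - 1) * (R / 2 ^ k)) + c2 * len^2 * G' k) * (2 ^ k * 2 ^ (k - 1) / R^2) = c1 * a (k - 1) + c2 * (8 * G' k)"
      using R unfolding len_def k2 by (simp add: a_def power2_eq_square field_simps)
    finally show ?thesis by (simp add: c1_def c2_def)
  qed
  have sumG: "(\<Sum>k=1..N. 8 * G' k) \<le> 8 * E" for N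
  proof -
    have "ennreal (\<Sum>k=1..N. G' k) = (\<Sum>k=1..N. G k)"
      using G' by (subst sum_ennreal[symmetric]) (auto intro!: sum.cong)
    also have "\<dots> \<le> ennreal E" by (rule G_sum)
    finally have "(\<Sum>k=1..N. G' k) \<le> E" using E(2) by (subst (asm) ennreal_le_iff) auto
    then show ?thesis by (simp add: sum_distrib_left[symmetric])
  qed
  define Z where "Z = 2 powr p * 4 / min 1 (p - 1) * (E0 + 2 powr (p - 1) * (8 * E))"
  have main: "(\<Sum>k=1..N. a k / real k powr p) \<le> Z" for N
  proof -
    have "(\<Sum>k=1..N. a k / real k powr p) \<le> 2 powr p * 4 / min 1 (p - 1) * (a 0 + 2 powr (p - 1) * (8 * E))"
      by (rule critical_discrete_Hardy[OF p a0 sumG step]) (use G' in auto)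
    also have "\<dots> \<le> Z" unfolding Z_def
    proof (intro mult_left_mono add_right_mono)
      have "ennreal (F' 0) \<le> ennreal (R * E0)" using F_le[of 0] F'(1) by simp
      then have "F' 0 \<le> R * E0" using R E0(2) by (subst (asm) ennreal_le_iff) auto
      then show "a 0 \<le> E0" using R by (simp add: a_def pos_divide_le_eq mult.commute)
      show "0 \<le> 2 powr p * 4 / min 1 (p - 1)" using p by simp
    qed
    finally show ?thesis .
  qed
  have "(\<integral>\<^sup>+x. ennreal (\<bar>\<phi> x - A\<bar> powr p * W x) * indicator {x. 0 < (\<xi> - x) \<bullet> e \<and> (\<xi> - x) \<bullet> e < R} x \<partial>lborel)
     \<le> (\<integral>\<^sup>+x. (\<Sum>k. ennreal (2 ^ (k + 1) / (R * (real (k + 1) * ln 2) powr p)) * (f x * indicator (I (k + 1)) x)) \<partial>lborel)"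
  proof (rule nn_integral_mono)
    fix x
    show "ennreal (\<bar>\<phi> x - A\<bar> powr p * W x) * indicator {x. 0 < (\<xi> - x) \<bullet> e \<and> (\<xi> - x) \<bullet> e < R} x
      \<le> (\<Sum>k. ennreal (2 ^ (k + 1) / (R * (real (k + 1) * ln 2) powr p)) * (f x * indicator (I (k + 1)) x))"
    proof (cases "0 < t x \<and> t x < R")
      case True
      have "\<exists>n. R / 2 ^ n \<le> t x"
      proof -
        obtain n where "R / t x < 2 ^ n" using real_arch_pow[of 2 "R / t x"] by auto
        then have "R / 2 ^ n \<le> t x" using True by (simp add: divide_simps mult.commute)
        then show ?thesis by blast
      qed
      define n where "n = (LEAST n. R / 2 ^ n \<le> t x)"
      have n: "R / 2 ^ n \<le> t x" unfolding n_def using \<open>\<exists>n. R / 2 ^ n \<le> t x\<close> by (rule LeastI_ex)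
      have "n \<noteq> 0" using n True by (cases n) auto
      then obtain k where k: "n = k + 1" by (metis add.commute plus_1_eq_Suc not0_implies_Suc)
      have "\<not> R / 2 ^ k \<le> t x" using not_less_Least[of k "\<lambda>n. R / 2 ^ n \<le> t x"] k n_def by simp
      then have xI: "x \<in> I (k + 1)" using n k by (simp add: I_def)
      then have "W x \<le> 2 ^ (k + 1) / (R * (real (k + 1) * ln 2) powr p)"
        by (intro W) (auto simp: I_def t_def)
      then have "\<bar>\<phi> x - A\<bar> powr p * W x \<le> 2 ^ (k + 1) / (R * (real (k + 1) * ln 2) powr p) * \<bar>\<phi> x - A\<bar> powr p"
        unfolding mult.commute[of "_ / _" "\<bar>\<phi> x - A\<bar> powr p"] by (rule mult_left_mono) simp
      then have "ennreal (\<bar>\<phi> x - A\<bar> powr p * W x) \<le> ennreal (2 ^ (k + 1) / (R * (real (k + 1) * ln 2) powr p)) * (f x * indicator (I (k + 1)) x)"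
        using xI R by (simp add: f_def ennreal_mult'[symmetric] ennreal_leI)
      also have "\<dots> = (\<Sum>j\<in>{k}. ennreal (2 ^ (j + 1) / (R * (real (j + 1) * ln 2) powr p)) * (f x * indicator (I (j + 1)) x))" by simp
      also have "\<dots> \<le> (\<Sum>k. ennreal (2 ^ (k + 1) / (R * (real (k + 1) * ln 2) powr p)) * (f x * indicator (I (k + 1)) x))"
        by (rule sum_le_suminf) auto
      finally show ?thesis using True by (simp add: t_def)
    qed (auto simp: t_def)
  qed
  also have "\<dots> = (\<Sum>k. ennreal (2 ^ (k + 1) / (R * (real (k + 1) * ln 2) powr p)) * F (k + 1))"
    unfolding F_def by (subst nn_integral_suminf) (auto simp: nn_integral_cmult)
  also have "\<dots> = (\<Sum>k. ennreal (1 / ln 2 powr p * (a (k + 1) / real (k + 1) powr p)))"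
  proof (rule suminf_cong)
    fix k
    have "2 ^ (k + 1) / (R * (real (k + 1) * ln 2) powr p) * F' (k + 1) = 1 / ln 2 powr p * (a (k + 1) / real (k + 1) powr p)"
      by (simp add: a_def powr_mult mult_ac)
    then show "ennreal (2 ^ (k + 1) / (R * (real (k + 1) * ln 2) powr p)) * F (k + 1) = ennreal (1 / ln 2 powr p * (a (k + 1) / real (k + 1) powr p))"
      unfolding F'(1) using R by (subst ennreal_mult'[symmetric]) auto
  qed
  also have "\<dots> \<le> ennreal (1 / ln 2 powr p * Z)"
    unfolding suminf_eq_SUP
  proof (rule SUP_least)
    fix N
    have "(\<Sum>k<N. ennreal (1 / ln 2 powr p * (a (k + 1) / real (k + 1) powr p))) = ennreal (\<Sum>k<N. 1 / ln 2 powr p * (a (k + 1) / real (k + 1) powr p))"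
      using a0 by (intro sum_ennreal) auto
    also have "(\<Sum>k<N. 1 / ln 2 powr p * (a (k + 1) / real (k + 1) powr p)) = 1 / ln 2 powr p * (\<Sum>k=1..N. a k / real k powr p)"
      unfolding sum_distrib_left[symmetric]
      by (intro arg_cong[where f="\<lambda>x. 1 / ln 2 powr p * x"] sum.reindex_bij_witness[of _ "\<lambda>k. k - 1" Suc]) auto
    also have "ennreal \<dots> \<le> ennreal (1 / ln 2 powr p * Z)" by (intro ennreal_leI mult_left_mono main) auto
    finally show "(\<Sum>k<N. ennreal (1 / ln 2 powr p * (a (k + 1) / real (k + 1) powr p))) \<le> ennreal (1 / ln 2 powr p * Z)" .
  qed
  finally show ?thesis by (simp add: Z_def)
qed

text \<open>The interval is the union of its two halves, up to its midpoint, and each is treated from its own endpoint. On $I_k$ the weight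
$\ln(2R/\delta)$ is at least $k \ln 2$. The starting value is controlled because $A$ is the mean.\<close>

lemma log_Hardy_one_dim:
  fixes \<Omega> :: "'a::euclidean_space set"
  assumes d: "DIM('a) = 1" and \<Omega>: "open \<Omega>" "connected \<Omega>" "\<Omega> \<noteq> {}" "bounded \<Omega>" and p: "p > 1"
  obtains C where "C \<ge> 0" "\<And>\<phi>. \<phi> \<in> test_functions \<Omega> \<Longrightarrow>
     (\<integral>\<^sup>+x. ennreal (\<bar>\<phi> x - average \<Omega> \<phi>\<bar> powr p / (bdist \<Omega> x ^ DIM('a) * ln (2 * inradius \<Omega> / bdist \<Omega> x) powr p)) * indicator \<Omega> x \<partial>lborel)
       \<le> ennreal C * energy p \<Omega> \<phi>"
proof -
  obtain c R where R: "R > 0" and ball: "\<Omega> = ball c R" by (rule one_dim_domain_is_ball[OF d \<Omega>])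
  obtain b :: 'a where B: "Basis = {b}" using d by (auto simp: card_1_singleton_iff)
  then have b: "b \<in> Basis" by (metis insertI1)
  have nb: "norm b = 1" using b by simp
  have V: "measure lebesgue \<Omega> = 2 * R" using R d by (simp add: ball content_ball)
  have fr: "frontier \<Omega> = sphere c R" using R by (simp add: ball)
  have \<delta>_ge: "R - dist c x \<le> bdist \<Omega> x" for x
  proof -
    have "sphere c R \<noteq> {}" using R by simp
    then obtain y where y: "y \<in> sphere c R" "bdist \<Omega> x = dist x y"
      using infdist_attains_inf[of "sphere c R" x] unfolding bdist_def fr by auto
    have "R \<le> dist c x + dist x y" using y(1) dist_triangle[of c y x] by simp
    then show ?thesis using y(2) by simp
  qed
  have inr: "R \<le> inradius \<Omega>"
    using \<delta>_ge[of c] bdist_le_inradius[OF \<Omega>(4), of c] R by (simp add: ball)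
  define Z where "Z = 1 / ln 2 powr p * (2 powr p * 4 / min 1 (p - 1) * (2 powr p * 2 + 2 powr (p - 1) * 8))"
  have Z: "Z > 0" unfolding Z_def using p by (intro mult_pos_pos divide_pos_pos add_pos_pos) auto
  show ?thesis
  proof (rule that[of "2 * Z"])
    show "0 \<le> 2 * Z" using Z by simp
    fix \<phi> assume \<phi>: "\<phi> \<in> test_functions \<Omega>"
    have [measurable]: "\<phi> \<in> borel_measurable borel" by (rule test_function_measurable[OF \<phi>])
    have [measurable]: "\<Omega> \<in> sets borel" using \<Omega> by simp
    obtain M where M: "M \<ge> 0" "\<And>x. \<bar>\<phi> x\<bar> \<le> M" using test_function_bounded[OF \<phi>] by blast
    let ?A = "average \<Omega> \<phi>"
    let ?W = "\<lambda>x. 1 / (bdist \<Omega> x ^ DIM('a) * ln (2 * inradius \<Omega> / bdist \<Omega> x) powr p)"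
    show "(\<integral>\<^sup>+x. ennreal (\<bar>\<phi> x - average \<Omega> \<phi>\<bar> powr p / (bdist \<Omega> x ^ DIM('a) * ln (2 * inradius \<Omega> / bdist \<Omega> x) powr p)) * indicator \<Omega> x \<partial>lborel)
       \<le> ennreal (2 * Z) * energy p \<Omega> \<phi>"
    proof (cases "energy p \<Omega> \<phi>")
      case top
      then show ?thesis using Z by (simp add: ennreal_mult_top)
    next
      case (real E)
      have mean: "(\<integral>\<^sup>+x. ennreal (\<bar>\<phi> x - ?A\<bar> powr p) * indicator \<Omega> x \<partial>lborel) \<le> ennreal (R * (2 powr p * 2 * E))"
      proof -
        have "(\<integral>\<^sup>+x. ennreal (\<bar>\<phi> x - ?A\<bar> powr p) * indicator \<Omega> x \<partial>lborel)
          \<le> (\<integral>\<^sup>+x. ennreal (2 powr p * (2 * R)) * ((\<integral>\<^sup>+y. ennreal (\<bar>\<phi> x - \<phi> y\<bar> powr p / norm (x - y) ^ (2 * DIM('a))) * indicator \<Omega> y \<partial>lborel) * indicator \<Omega> x) \<partial>lborel)"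
        proof (rule nn_integral_mono)
          fix x
          show "ennreal (\<bar>\<phi> x - ?A\<bar> powr p) * indicator \<Omega> x
            \<le> ennreal (2 powr p * (2 * R)) * ((\<integral>\<^sup>+y. ennreal (\<bar>\<phi> x - \<phi> y\<bar> powr p / norm (x - y) ^ (2 * DIM('a))) * indicator \<Omega> y \<partial>lborel) * indicator \<Omega> x)"
          proof (cases "x \<in> \<Omega>")
            case True
            have "ennreal (\<bar>\<phi> x - ?A\<bar> powr p) \<le> ennreal (2 powr p / (2 * R)) * (\<integral>\<^sup>+y. ennreal (\<bar>\<phi> x - \<phi> y\<bar> powr p) * indicator \<Omega> y \<partial>lborel)"
              using mean_deviation_le[OF \<Omega>(1,4) _ p, of \<phi> M x] M R by (simp add: V)
            also have "(\<integral>\<^sup>+y. ennreal (\<bar>\<phi> x - \<phi> y\<bar> powr p) * indicator \<Omega> y \<partial>lborel)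
              \<le> (\<integral>\<^sup>+y. ennreal ((2 * R)^2) * (ennreal (\<bar>\<phi> x - \<phi> y\<bar> powr p / norm (x - y) ^ (2 * DIM('a))) * indicator \<Omega> y) \<partial>lborel)"
            proof (rule nn_integral_mono)
              fix y
              show "ennreal (\<bar>\<phi> x - \<phi> y\<bar> powr p) * indicator \<Omega> y \<le> ennreal ((2 * R)^2) * (ennreal (\<bar>\<phi> x - \<phi> y\<bar> powr p / norm (x - y) ^ (2 * DIM('a))) * indicator \<Omega> y)"
              proof (cases "y \<in> \<Omega> \<and> x \<noteq> y")
                case y: True
                have "norm (x - y) \<le> 2 * R" using y True dist_triangle[of x y c] by (simp add: ball dist_norm norm_minus_commute)
                then have "norm (x - y) ^ 2 \<le> (2 * R)^2" by (intro power_mono) auto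
                then have le: "\<bar>\<phi> x - \<phi> y\<bar> powr p * norm (x - y) ^ 2 \<le> \<bar>\<phi> x - \<phi> y\<bar> powr p * (2 * R)^2" by (intro mult_left_mono) auto
                have np: "0 < norm (x - y) ^ 2" using y by simp
                have "\<bar>\<phi> x - \<phi> y\<bar> powr p \<le> (2 * R)^2 * (\<bar>\<phi> x - \<phi> y\<bar> powr p / norm (x - y) ^ (2 * DIM('a)))"
                  unfolding d times_divide_eq_right mult_1_right pos_le_divide_eq[OF np] using le by (simp only: mult.commute)
                then show ?thesis using y by (simp add: ennreal_mult''[symmetric] ennreal_leI)
              qed (use p in auto)
            qed
            also have "\<dots> = ennreal ((2 * R)^2) * (\<integral>\<^sup>+y. ennreal (\<bar>\<phi> x - \<phi> y\<bar> powr p / norm (x - y) ^ (2 * DIM('a))) * indicator \<Omega> y \<partial>lborel)"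
              by (rule nn_integral_cmult) measurable
            finally have "ennreal (\<bar>\<phi> x - ?A\<bar> powr p) \<le> ennreal (2 powr p / (2 * R)) * (ennreal ((2 * R)^2) * (\<integral>\<^sup>+y. ennreal (\<bar>\<phi> x - \<phi> y\<bar> powr p / norm (x - y) ^ (2 * DIM('a))) * indicator \<Omega> y \<partial>lborel))"
              by (simp add: mult_left_mono)
            moreover have "ennreal (2 powr p / (2 * R)) * ennreal ((2 * R)^2) = ennreal (2 powr p * (2 * R))"
              using R by (subst ennreal_mult'[symmetric]) (auto simp: power2_eq_square)
            ultimately show ?thesis using True by (simp add: mult.assoc[symmetric])
          qed simp
        qed
        also have "\<dots> = ennreal (2 powr p * (2 * R)) * energy p \<Omega> \<phi>"
          unfolding energy_def by (rule nn_integral_cmult) measurable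
        also have "\<dots> = ennreal (R * (2 powr p * 2 * E))"
          using real R by (simp add: ennreal_mult'[symmetric] mult_ac)
        finally show ?thesis .
      qed
      have side: "(\<integral>\<^sup>+x. ennreal (\<bar>\<phi> x - ?A\<bar> powr p * ?W x) * indicator {x. 0 < (c + R *\<^sub>R e - x) \<bullet> e \<and> (c + R *\<^sub>R e - x) \<bullet> e < R} x \<partial>lborel)
         \<le> ennreal (Z * E)" if e: "norm e = 1" "\<And>x. norm x = \<bar>x \<bullet> e\<bar>" for e
      proof -
        have ee: "e \<bullet> e = 1" using e by (simp add: norm_eq_1)
        let ?\<xi> = "c + R *\<^sub>R e"
        have tx: "(?\<xi> - x) \<bullet> e = R - (x - c) \<bullet> e" for x by (simp add: inner_diff_left inner_add_left ee)
        have J: "\<Omega> = {x. 0 < (?\<xi> - x) \<bullet> e \<and> (?\<xi> - x) \<bullet> e < 2 * R}"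
        proof -
          have "dist c x = \<bar>(x - c) \<bullet> e\<bar>" for x using e(2)[of "x - c"] by (simp add: dist_norm norm_minus_commute)
          then show ?thesis unfolding ball tx by (auto simp: abs_less_iff)
        qed
        have bound: "?W x \<le> 2 ^ k / (R * (real k * ln 2) powr p)"
          if k: "k \<ge> 1" "R / 2 ^ k \<le> (?\<xi> - x) \<bullet> e" "(?\<xi> - x) \<bullet> e < 2 * R / 2 ^ k" for x k
        proof -
          have k2: "(2::real) \<le> 2 ^ k" using k(1) power_increasing[of 1 k "2::real"] by simp
          have "2 * R / 2 ^ k \<le> 2 * R / 2" using R k2 by (intro divide_left_mono) auto
          then have "(x - c) \<bullet> e > 0" using k(3) unfolding tx by simp
          then have "dist c x = (x - c) \<bullet> e" using e(2)[of "x - c"] by (simp add: dist_norm norm_minus_commute)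
          then have lo: "R / 2 ^ k \<le> bdist \<Omega> x" using \<delta>_ge[of x] k(2) unfolding tx by simp
          have "?\<xi> \<in> frontier \<Omega>" using R e(1) by (simp add: fr dist_norm)
          then have "bdist \<Omega> x \<le> dist x ?\<xi>" unfolding bdist_def by (rule infdist_le)
          also have "\<dots> = \<bar>(?\<xi> - x) \<bullet> e\<bar>" using e(2)[of "?\<xi> - x"] by (simp only: dist_norm norm_minus_commute[of x])
          also have "\<dots> < 2 * R / 2 ^ k"
          proof -
            have "0 < R / 2 ^ k" using R by simp
            then show ?thesis using k(2,3) by simp
          qed
          finally have hi: "bdist \<Omega> x < 2 * R / 2 ^ k" .
          have pos: "bdist \<Omega> x > 0" "R / 2 ^ k > 0" using lo R by (auto intro: less_le_trans[of 0 "R / 2 ^ k"])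
          have "2 ^ k \<le> 2 * R / bdist \<Omega> x" using hi pos by (simp add: pos_le_divide_eq pos_less_divide_eq mult.commute)
          also have "\<dots> \<le> 2 * inradius \<Omega> / bdist \<Omega> x" using inr pos by (intro divide_right_mono) auto
          finally have "ln (2 ^ k) \<le> ln (2 * inradius \<Omega> / bdist \<Omega> x)" by (intro ln_mono) auto
          then have L: "real k * ln 2 \<le> ln (2 * inradius \<Omega> / bdist \<Omega> x)" by (simp add: ln_realpow)
          have kl: "real k * ln 2 > 0" using k(1) by simp
          have kp: "(real k * ln 2) powr p > 0" unfolding powr_gt_zero using kl by linarith
          have Lp: "(real k * ln 2) powr p \<le> ln (2 * inradius \<Omega> / bdist \<Omega> x) powr p"
            by (rule powr_mono2) (use p kl L in \<open>linarith, linarith, linarith\<close>)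
          have "?W x \<le> 1 / (R / 2 ^ k * (real k * ln 2) powr p)"
            unfolding d power_one_right
          proof (rule divide_left_mono)
            show le: "R / 2 ^ k * (real k * ln 2) powr p \<le> bdist \<Omega> x * ln (2 * inradius \<Omega> / bdist \<Omega> x) powr p"
              using lo Lp pos kp by (intro mult_mono) linarith+
            have pp: "0 < R / 2 ^ k * (real k * ln 2) powr p" by (rule mult_pos_pos[OF pos(2) kp])
            show "0 < bdist \<Omega> x * ln (2 * inradius \<Omega> / bdist \<Omega> x) powr p * (R / 2 ^ k * (real k * ln 2) powr p)"
              by (rule mult_pos_pos[OF less_le_trans[OF pp le] pp])
          qed simp
          then show ?thesis by simp
        qed
        have "(\<integral>\<^sup>+x. ennreal (\<bar>\<phi> x - ?A\<bar> powr p * ?W x) * indicator {x. 0 < (?\<xi> - x) \<bullet> e \<and> (?\<xi> - x) \<bullet> e < R} x \<partial>lborel)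
           \<le> ennreal (1 / ln 2 powr p * (2 powr p * 4 / min 1 (p - 1) * (2 powr p * 2 * E + 2 powr (p - 1) * (8 * E))))"
        proof (rule dyadic_log_Hardy[OF d e(1) R p _ _ J _ _ mean _ bound])
          show "\<bar>\<phi> x - ?A\<bar> \<le> M + \<bar>?A\<bar>" for x using M(2)[of x] by linarith
        qed (use real R in auto)
        also have "1 / ln 2 powr p * (2 powr p * 4 / min 1 (p - 1) * (2 powr p * 2 * E + 2 powr (p - 1) * (8 * E))) = Z * E"
          by (simp add: Z_def algebra_simps)
        finally show ?thesis .
      qed
      have nb2: "norm x = \<bar>x \<bullet> b\<bar>" for x
      proof -
        have "(\<Sum>i\<in>{b}. (x \<bullet> i) *\<^sub>R i) = x" unfolding B[symmetric] by (rule euclidean_representation)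
        then have "x = (x \<bullet> b) *\<^sub>R b" by simp
        then have "norm x = norm ((x \<bullet> b) *\<^sub>R b)" by (rule arg_cong)
        then show ?thesis by (simp add: nb)
      qed
      have s1: "(\<integral>\<^sup>+x. ennreal (\<bar>\<phi> x - ?A\<bar> powr p * ?W x) * indicator {x. 0 < (c + R *\<^sub>R b - x) \<bullet> b \<and> (c + R *\<^sub>R b - x) \<bullet> b < R} x \<partial>lborel) \<le> ennreal (Z * E)"
        by (rule side[OF nb nb2])
      have s2: "(\<integral>\<^sup>+x. ennreal (\<bar>\<phi> x - ?A\<bar> powr p * ?W x) * indicator {x. 0 < (c + R *\<^sub>R (- b) - x) \<bullet> (- b) \<and> (c + R *\<^sub>R (- b) - x) \<bullet> (- b) < R} x \<partial>lborel) \<le> ennreal (Z * E)"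
        by (rule side) (use nb nb2 in auto)
      have "(\<integral>\<^sup>+x. ennreal (\<bar>\<phi> x - ?A\<bar> powr p / (bdist \<Omega> x ^ DIM('a) * ln (2 * inradius \<Omega> / bdist \<Omega> x) powr p)) * indicator \<Omega> x \<partial>lborel)
        \<le> (\<integral>\<^sup>+x. ennreal (\<bar>\<phi> x - ?A\<bar> powr p * ?W x) * indicator {x. 0 < (c + R *\<^sub>R b - x) \<bullet> b \<and> (c + R *\<^sub>R b - x) \<bullet> b < R} x
          + ennreal (\<bar>\<phi> x - ?A\<bar> powr p * ?W x) * indicator {x. 0 < (c + R *\<^sub>R (- b) - x) \<bullet> (- b) \<and> (c + R *\<^sub>R (- b) - x) \<bullet> (- b) < R} x \<partial>lborel)"
      proof (rule nn_integral_mono_AE)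
        show "AE x in lborel. ennreal (\<bar>\<phi> x - ?A\<bar> powr p / (bdist \<Omega> x ^ DIM('a) * ln (2 * inradius \<Omega> / bdist \<Omega> x) powr p)) * indicator \<Omega> x
          \<le> ennreal (\<bar>\<phi> x - ?A\<bar> powr p * ?W x) * indicator {x. 0 < (c + R *\<^sub>R b - x) \<bullet> b \<and> (c + R *\<^sub>R b - x) \<bullet> b < R} x
          + ennreal (\<bar>\<phi> x - ?A\<bar> powr p * ?W x) * indicator {x. 0 < (c + R *\<^sub>R (- b) - x) \<bullet> (- b) \<and> (c + R *\<^sub>R (- b) - x) \<bullet> (- b) < R} x"
        proof (rule eventually_mono[OF AE_lborel_singleton[of c]])
          fix x assume xc: "x \<noteq> c"
          have bb: "b \<bullet> b = 1" using b by simp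
          have t1: "(c + R *\<^sub>R b - x) \<bullet> b = R - (x - c) \<bullet> b" by (simp add: inner_diff_left inner_add_left bb)
          have t2: "(c + R *\<^sub>R (- b) - x) \<bullet> (- b) = R + (x - c) \<bullet> b" by (simp add: inner_diff_left inner_add_left bb)
          show "ennreal (\<bar>\<phi> x - ?A\<bar> powr p / (bdist \<Omega> x ^ DIM('a) * ln (2 * inradius \<Omega> / bdist \<Omega> x) powr p)) * indicator \<Omega> x
          \<le> ennreal (\<bar>\<phi> x - ?A\<bar> powr p * ?W x) * indicator {x. 0 < (c + R *\<^sub>R b - x) \<bullet> b \<and> (c + R *\<^sub>R b - x) \<bullet> b < R} x
          + ennreal (\<bar>\<phi> x - ?A\<bar> powr p * ?W x) * indicator {x. 0 < (c + R *\<^sub>R (- b) - x) \<bullet> (- b) \<and> (c + R *\<^sub>R (- b) - x) \<bullet> (- b) < R} x"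
          proof (cases "x \<in> \<Omega>")
            case True
            have "\<bar>(x - c) \<bullet> b\<bar> < R" "(x - c) \<bullet> b \<noteq> 0"
              using True xc nb2[of "x - c"] by (auto simp: ball dist_norm norm_minus_commute)
            then have "0 < (x - c) \<bullet> b \<and> (x - c) \<bullet> b < R \<or> (x - c) \<bullet> b < 0 \<and> - R < (x - c) \<bullet> b" by linarith
            then show ?thesis unfolding indicator_def mem_Collect_eq t1 t2 using True by auto
          qed simp
        qed
      qed
      also have "\<dots> = (\<integral>\<^sup>+x. ennreal (\<bar>\<phi> x - ?A\<bar> powr p * ?W x) * indicator {x. 0 < (c + R *\<^sub>R b - x) \<bullet> b \<and> (c + R *\<^sub>R b - x) \<bullet> b < R} x \<partial>lborel)
          + (\<integral>\<^sup>+x. ennreal (\<bar>\<phi> x - ?A\<bar> powr p * ?W x) * indicator {x. 0 < (c + R *\<^sub>R (- b) - x) \<bullet> (- b) \<and> (c + R *\<^sub>R (- b) - x) \<bullet> (- b) < R} x \<partial>lborel)"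
        by (rule nn_integral_add) measurable
      also have "\<dots> \<le> ennreal (Z * E) + ennreal (Z * E)" by (intro add_mono s1 s2)
      also have "\<dots> = ennreal (2 * Z) * energy p \<Omega> \<phi>"
        using Z real by (simp add: ennreal_mult'[symmetric] ennreal_plus[symmetric] del: ennreal_plus)
      finally show ?thesis .
    qed
  qed
qed

section \<open>Exponential bounds from sums along a chain\<close>

text \<open>The weighted sum $T$ gives $m_j \le (2/3)^j T$, so the roots decay geometrically and the sum is at most
$C\,T^{1/p}$. For the logarithmic bound, split at $J \approx \ln T / \ln(3/2)$: beyond $J$ the geometric tail is
bounded, and before $J$ a Hoelder-type estimate with the bound on $\sum m_j$ gives $J^{1-1/p}$.\<close>

lemma chain_sum_bounds:
  fixes p B :: real
  assumes p: "p > 1" and B: "B \<ge> 0"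
  obtains K where "K > 0"
    "\<And>m T n. (\<And>j. 0 \<le> m j) \<Longrightarrow> (\<And>n. (\<Sum>j<n. m j) \<le> B) \<Longrightarrow> (\<And>n. (\<Sum>j<n. (3/2) ^ j * m j) \<le> T) \<Longrightarrow>
       (\<Sum>j<n::nat. m j powr (1 / p)) \<le> K * T powr (1 / p) \<and>
       (\<Sum>j<n. m j powr (1 / p)) \<le> K * (1 + ln (1 + T)) powr (1 - 1 / p)"
proof -
  define q where "q = (2 / 3 :: real) powr (1 / p)"
  have q: "0 < q" "q < 1" using p powr_less_mono2[of "1 / p" "2 / 3" 1] by (auto simp: q_def)
  define l where "l = ln (3 / 2 :: real)"
  have l: "l > 0" by (simp add: l_def)
  define K where "K = (1 + 1 / l) * (B + 1) + 1 / (1 - q)"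
  have geo: "(\<Sum>j\<in>A. q ^ j) \<le> 1 / (1 - q)" if "finite A" for A
  proof -
    have "(\<Sum>j\<in>A. q ^ j) \<le> (\<Sum>j. q ^ j)" using q that by (intro sum_le_suminf) auto
    then show ?thesis using q by (simp add: suminf_geometric)
  qed
  have K: "K > 0" "1 / (1 - q) \<le> K" using l q B by (auto simp: K_def add_pos_pos add_nonneg_pos)
  show ?thesis
  proof (rule that[OF K(1)])
    fix m :: "nat \<Rightarrow> real" and T :: real and n :: nat
    assume m: "\<And>j. 0 \<le> m j" and sB: "\<And>n. (\<Sum>j<n. m j) \<le> B" and sT: "\<And>n. (\<Sum>j<n. (3/2) ^ j * m j) \<le> T"
    have T: "T \<ge> 0" using sT[of 0] by simp
    have mj: "m j powr (1 / p) \<le> T powr (1 / p) * q ^ j" for j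
    proof -
      have "(3/2) ^ j * m j \<le> (\<Sum>i<Suc j. (3/2) ^ i * m i)" using m by (simp add: sum_nonneg)
      then have "(3/2) ^ j * m j \<le> T" using sT[of "Suc j"] by linarith
      then have "(2/3) ^ j * ((3/2) ^ j * m j) \<le> (2/3) ^ j * T" by (intro mult_left_mono) auto
      moreover have "(2/3) ^ j * ((3/2) ^ j * m j) = m j"
        by (simp add: mult.assoc[symmetric] power_mult_distrib[symmetric])
      ultimately have "m j \<le> (2/3) ^ j * T" by simp
      then have "m j powr (1 / p) \<le> ((2/3) ^ j * T) powr (1 / p)"
        using m p by (intro powr_mono2) auto
      also have "\<dots> = T powr (1 / p) * q ^ j"
        using T by (simp add: powr_mult q_def powr_power powr_realpow[symmetric] powr_powr mult.commute)
      finally show ?thesis .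
    qed
    have "(\<Sum>j<n. m j powr (1 / p)) \<le> (\<Sum>j<n. T powr (1 / p) * q ^ j)"
      by (intro sum_mono mj)
    also have "\<dots> = T powr (1 / p) * (\<Sum>j<n. q ^ j)" by (simp add: sum_distrib_left)
    also have "\<dots> \<le> T powr (1 / p) * (1 / (1 - q))" by (intro mult_left_mono geo) auto
    also have "\<dots> \<le> T powr (1 / p) * K" using K by (intro mult_left_mono) auto
    finally have 1: "(\<Sum>j<n. m j powr (1 / p)) \<le> K * T powr (1 / p)" by (simp add: mult.commute)
    \<comment> \<open>From index $J$ on, $(2/3)^j T \le (2/3)^{j-J}$.\<close>
    define J where "J = nat \<lceil>ln (1 + T) / l\<rceil>"
    have J: "ln (1 + T) / l \<le> real J" "real J \<le> ln (1 + T) / l + 1"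
      using T l by (auto simp: J_def)
    have "ln (1 + T) \<le> real J * l" using J l by (simp add: pos_divide_le_eq)
    also have "\<dots> = ln ((3/2) ^ J)" by (simp add: ln_realpow l_def)
    finally have "1 + T \<le> (3/2) ^ J" using T by simp
    then have "(2/3) ^ J * T \<le> (2/3) ^ J * (3/2) ^ J" by (intro mult_left_mono) auto
    then have "(2/3) ^ J * T \<le> 1" by (simp add: power_mult_distrib[symmetric])
    then have "((2/3) ^ J * T) powr (1 / p) \<le> 1" using T p by (intro powr_le1) auto
    then have qT: "T powr (1 / p) * q ^ J \<le> 1"
      using T by (simp add: powr_mult q_def powr_power powr_realpow[symmetric] powr_powr mult.commute)
    have head: "(\<Sum>j<J. m j powr (1 / p)) \<le> (B + 1) * real J powr (1 - 1 / p)"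
    proof (cases "J = 0")
      case False
      have pw: "a powr (1 / p) \<le> a + 1" if "a \<ge> 0" for a
      proof (cases "a \<le> 1")
        case True
        then have "a powr (1 / p) \<le> 1" using that p by (intro powr_le1) auto
        then show ?thesis using that by simp
      next
        case False
        then have "a powr (1 / p) \<le> a powr 1" using p by (intro powr_mono) auto
        then show ?thesis using False by simp
      qed
      have "(\<Sum>j<J. m j powr (1 / p)) * real J powr (1 / p) = (\<Sum>j<J. (m j * real J) powr (1 / p))"
        using m by (simp add: sum_distrib_right powr_mult)
      also have "\<dots> \<le> (\<Sum>j<J. m j * real J + 1)" using m by (intro sum_mono pw) auto
      also have "\<dots> = (\<Sum>j<J. m j) * real J + real J" by (simp add: sum.distrib sum_distrib_right)
      also have "\<dots> \<le> B * real J + real J" using sB[of J] by (intro add_mono mult_right_mono) auto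
      also have "\<dots> = (B + 1) * (real J powr (1 - 1 / p) * real J powr (1 / p))"
        using False by (simp add: powr_add[symmetric] algebra_simps)
      finally have "(\<Sum>j<J. m j powr (1 / p)) * real J powr (1 / p) \<le> ((B + 1) * real J powr (1 - 1 / p)) * real J powr (1 / p)"
        by (simp add: mult.assoc)
      then show ?thesis using False by (simp add: mult_le_cancel_right)
    qed simp
    have tail: "(\<Sum>j\<in>{J..<n}. m j powr (1 / p)) \<le> 1 / (1 - q)"
    proof -
      have "(\<Sum>j\<in>{J..<n}. m j powr (1 / p)) \<le> (\<Sum>j\<in>{J..<n}. q ^ (j - J))"
      proof (rule sum_mono)
        fix j assume "j \<in> {J..<n}"
        then have "q ^ j = q ^ J * q ^ (j - J)" by (simp add: power_add[symmetric])
        then have "T powr (1 / p) * q ^ j = (T powr (1 / p) * q ^ J) * q ^ (j - J)" by simp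
        also have "\<dots> \<le> 1 * q ^ (j - J)" using qT q by (intro mult_right_mono) auto
        finally show "m j powr (1 / p) \<le> q ^ (j - J)" using mj[of j] by simp
      qed
      also have "\<dots> = (\<Sum>j<n - J. q ^ j)"
        by (rule sum.reindex_bij_witness[of _ "\<lambda>j. j + J" "\<lambda>j. j - J"]) auto
      also have "\<dots> \<le> 1 / (1 - q)" by (rule geo) simp
      finally show ?thesis .
    qed
    have lT: "1 + ln (1 + T) \<ge> 1" using T by simp
    have "(\<Sum>j<n. m j powr (1 / p)) \<le> (\<Sum>j\<in>{..<J} \<union> {J..<n}. m j powr (1 / p))"
      by (intro sum_mono2) auto
    also have "\<dots> = (\<Sum>j<J. m j powr (1 / p)) + (\<Sum>j\<in>{J..<n}. m j powr (1 / p))"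
      by (rule sum.union_disjoint) auto
    also have "\<dots> \<le> (B + 1) * real J powr (1 - 1 / p) + 1 / (1 - q)" by (intro add_mono head tail)
    also have "\<dots> \<le> (B + 1) * ((1 + 1 / l) * (1 + ln (1 + T)) powr (1 - 1 / p)) + 1 / (1 - q) * (1 + ln (1 + T)) powr (1 - 1 / p)"
    proof (intro add_mono mult_left_mono)
      have "real J \<le> (1 + 1 / l) * (1 + ln (1 + T))"
      proof -
        have "(1 + 1 / l) * (1 + ln (1 + T)) = (ln (1 + T) / l + 1) + (1 / l + ln (1 + T))"
          using l by (simp add: field_simps)
        moreover have "0 \<le> 1 / l + ln (1 + T)" using l T by simp
        ultimately show ?thesis using J(2) by linarith
      qed
      then have "real J powr (1 - 1 / p) \<le> ((1 + 1 / l) * (1 + ln (1 + T))) powr (1 - 1 / p)"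
        using p by (intro powr_mono2) auto
      also have "\<dots> = (1 + 1 / l) powr (1 - 1 / p) * (1 + ln (1 + T)) powr (1 - 1 / p)"
        by (rule powr_mult)
      also have "\<dots> \<le> (1 + 1 / l) powr 1 * (1 + ln (1 + T)) powr (1 - 1 / p)"
        using l p by (intro mult_right_mono powr_mono) auto
      finally show "real J powr (1 - 1 / p) \<le> (1 + 1 / l) * (1 + ln (1 + T)) powr (1 - 1 / p)" using l by simp
      have "1 \<le> (1 + ln (1 + T)) powr (1 - 1 / p)" using lT p by (intro ge_one_powr_ge_zero) auto
      then show "1 / (1 - q) \<le> 1 / (1 - q) * (1 + ln (1 + T)) powr (1 - 1 / p)"
        using q by (simp add: divide_right_mono)
    qed (use B in auto)
    also have "\<dots> = K * (1 + ln (1 + T)) powr (1 - 1 / p)"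
      by (simp add: K_def algebra_simps)
    finally show "(\<Sum>j<n. m j powr (1 / p)) \<le> K * T powr (1 / p) \<and>
       (\<Sum>j<n. m j powr (1 / p)) \<le> K * (1 + ln (1 + T)) powr (1 - 1 / p)" using 1 by blast
  qed
qed

text \<open>If $T < 1$, the first bound on $X$ and the vanishing of order $n_0$ give $T^{n_0/(p-1)} \le T$, which
is where $n_0 \ge p - 1$ enters. If $T \ge 1$, the second bound makes the exponent at most $1 + \ln(1+T)$.\<close>

lemma Phi_chain_bound:
  fixes p K :: real
  assumes p: "p > 1" "real n0 \<ge> p - 1" and K: "K > 0"
    and \<alpha>: "0 \<le> \<alpha>" "\<alpha> \<le> (1 / K) powr (p / (p - 1))"
    and X: "X \<ge> 0" "X \<le> K * T powr (1 / p)" "X \<le> K * (1 + ln (1 + T)) powr (1 - 1 / p)" and T: "T \<ge> 0"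
  shows "Phi n0 (\<alpha> * X powr (p / (p - 1))) \<le> 2 * (exp 1)^2 * T"
proof -
  let ?p' = "p / (p - 1)"
  have p': "?p' > 0" "1 / p * ?p' = 1 / (p - 1)" "(1 - 1 / p) * ?p' = 1" using p by (auto simp: field_simps)
  have key: "\<alpha> * X powr ?p' \<le> Y powr (e * ?p')" if "X \<le> K * Y powr e" "Y \<ge> 0" for Y e
  proof -
    have "\<alpha> * X powr ?p' \<le> (1 / K) powr ?p' * (K * Y powr e) powr ?p'"
      using that X(1) \<alpha> p' by (intro mult_mono powr_mono2) auto
    also have "\<dots> = ((1 / K) * (K * Y powr e)) powr ?p'"
      by (rule powr_mult[symmetric])
    also have "\<dots> = Y powr (e * ?p')" using K by (simp add: powr_powr)
    finally show ?thesis .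
  qed
  have a0: "0 \<le> \<alpha> * X powr ?p'" using \<alpha> by simp
  have a1: "\<alpha> * X powr ?p' \<le> 1 + ln (1 + T)"
    using key[OF X(3)] T unfolding p'(3) by simp
  have a2: "\<alpha> * X powr ?p' \<le> T powr (1 / (p - 1))"
    using key[OF X(2) T] unfolding p'(2) .
  show ?thesis
  proof (cases "T \<ge> 1")
    case True
    have "Phi n0 (\<alpha> * X powr ?p') \<le> exp (\<alpha> * X powr ?p')" by (rule Phi_le_exp[OF a0])
    also have "\<dots> \<le> exp (1 + ln (1 + T))" using a1 by simp
    also have "\<dots> = exp 1 * (1 + T)" using T by (simp add: exp_add)
    also have "\<dots> \<le> (exp 1)^2 * (2 * T)"
    proof (intro mult_mono)
      show "exp 1 \<le> (exp 1 :: real)^2" by (simp add: power2_eq_square)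
    qed (use True in auto)
    finally show ?thesis by simp
  next
    case False
    have "\<alpha> * X powr ?p' \<le> 1 * 1" using a2 False T p powr_le1[of "1 / (p - 1)" T] by simp
    then have e: "exp (\<alpha> * X powr ?p') \<le> (exp 1)^2" by (simp add: power2_eq_square exp_add[symmetric])
    have n0: "n0 > 0" using p by (cases n0) auto
    have "(\<alpha> * X powr ?p') ^ n0 \<le> (T powr (1 / (p - 1))) ^ n0" using a0 a2 by (intro power_mono) auto
    also have "\<dots> = T powr (real n0 / (p - 1))"
      using n0 by (cases "T = 0") (simp_all add: powr_realpow[symmetric] powr_powr)
    also have "\<dots> \<le> T powr 1" using False T p by (intro powr_mono') auto
    also have "\<dots> = T" using T by simp
    finally have "(\<alpha> * X powr ?p') ^ n0 * exp (\<alpha> * X powr ?p') \<le> T * (exp 1)^2"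
      using a0 T e by (intro mult_mono) auto
    moreover have "T * (exp 1)^2 \<le> 2 * (exp 1)^2 * T" using T by simp
    ultimately show ?thesis using Phi_le_power_exp[OF a0, of n0] by linarith
  qed
qed

section \<open>Chains through dyadic annuli\<close>

text \<open>By Markov's inequality each function exceeds three times its average on at most a third of the set.\<close>

lemma exists_below_averages:
  fixes f g :: "'a::euclidean_space \<Rightarrow> ennreal"
  assumes S: "S \<in> sets borel" "emeasure lborel S = ennreal v" "v > 0"
    and [measurable]: "f \<in> borel_measurable borel" "g \<in> borel_measurable borel"
    and f: "(\<integral>\<^sup>+y. f y * indicator S y \<partial>lborel) \<le> ennreal a" "a > 0"
    and g: "(\<integral>\<^sup>+y. g y * indicator S y \<partial>lborel) \<le> ennreal b" "b > 0"
  shows "\<exists>y\<in>S. f y \<le> ennreal (3 * a / v) \<and> g y \<le> ennreal (3 * b / v)"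
proof (rule ccontr)
  assume neg: "\<not> ?thesis"
  have [measurable]: "S \<in> sets borel" by fact
  have one: "1 \<le> F * ennreal (v / (3 * c))" if "ennreal (3 * c / v) < F" "c > 0" for F c
  proof -
    have "1 = ennreal (3 * c / v) * ennreal (v / (3 * c))"
      using that S(3) by (subst ennreal_mult'[symmetric]) auto
    also have "\<dots> \<le> F * ennreal (v / (3 * c))" using that by (intro mult_right_mono) auto
    finally show ?thesis .
  qed
  have pt: "indicator S y \<le> ennreal (v / (3 * a)) * (f y * indicator S y) + ennreal (v / (3 * b)) * (g y * indicator S y)" for y
  proof (cases "y \<in> S")
    case True
    then consider "ennreal (3 * a / v) < f y" | "ennreal (3 * b / v) < g y" using neg by fastforce
    then show ?thesis
    proof cases
      case 1
      then show ?thesis using one[OF 1 f(2)] True by (simp add: mult.commute add_increasing2)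
    next
      case 2
      then show ?thesis using one[OF 2 g(2)] True by (simp add: mult.commute add_increasing)
    qed
  qed simp
  have "ennreal v = (\<integral>\<^sup>+y. indicator S y \<partial>lborel)" using S by simp
  also have "\<dots> \<le> (\<integral>\<^sup>+y. ennreal (v / (3 * a)) * (f y * indicator S y) + ennreal (v / (3 * b)) * (g y * indicator S y) \<partial>lborel)"
    by (rule nn_integral_mono) (rule pt)
  also have "\<dots> = ennreal (v / (3 * a)) * (\<integral>\<^sup>+y. f y * indicator S y \<partial>lborel) + ennreal (v / (3 * b)) * (\<integral>\<^sup>+y. g y * indicator S y \<partial>lborel)"
    by (simp add: nn_integral_add nn_integral_cmult)
  also have "\<dots> \<le> ennreal (v / (3 * a)) * ennreal a + ennreal (v / (3 * b)) * ennreal b"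
    by (intro add_mono mult_left_mono f g) auto
  also have "\<dots> = ennreal (2 / 3 * v)"
    using f(2) g(2) S(3) by (simp add: ennreal_mult'[symmetric] ennreal_plus[symmetric] del: ennreal_plus)
  finally show False using S(3) by simp
qed

definition annulus :: "'a::euclidean_space \<Rightarrow> real \<Rightarrow> nat \<Rightarrow> 'a set" where
  "annulus x r j = {z. r / 2 ^ (j + 1) \<le> dist z x \<and> dist z x < r / 2 ^ j}"

lemma annulus_measurable [measurable]: "annulus x r j \<in> sets borel"
  unfolding annulus_def by measurable

text \<open>A fixed proportion of the volume of the outer ball, in every dimension.\<close>

lemma annulus_volume:
  fixes x :: "'a::euclidean_space"
  assumes "r > 0"
  obtains v where "emeasure lborel (annulus x r j) = ennreal v" "v > 0"
    "v \<ge> unit_ball_vol (real DIM('a)) / 2 * (r / 2 ^ j) ^ DIM('a)"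
proof -
  let ?w = "unit_ball_vol (real DIM('a))"
  define q where "q = r / 2 ^ j"
  define v where "v = ?w * q ^ DIM('a) - ?w * (q / 2) ^ DIM('a)"
  have q: "q > 0" using assms by (simp add: q_def)
  have eq: "annulus x r j = ball x q - ball x (q / 2)"
    by (auto simp: annulus_def q_def dist_commute mult.commute)
  have "emeasure lborel (annulus x r j) = emeasure lborel (ball x q) - emeasure lborel (ball x (q / 2))"
    unfolding eq using q by (intro emeasure_Diff) (auto simp: emeasure_ball intro!: subset_ball)
  also have "\<dots> = ennreal v"
    using q unfolding v_def by (simp add: emeasure_ball ennreal_minus)
  finally have 1: "emeasure lborel (annulus x r j) = ennreal v" .
  have half: "q / 2 = 1 / 2 * q" by simp
  have "(1 / 2 :: real) ^ DIM('a) \<le> (1 / 2) ^ 1" by (rule power_decreasing) auto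
  then have "(1 / 2 * q) ^ DIM('a) \<le> 1 / 2 * q ^ DIM('a)"
    unfolding power_mult_distrib using q by (intro mult_right_mono) auto
  then have "?w * (q / 2) ^ DIM('a) \<le> ?w * (1 / 2 * q ^ DIM('a))"
    unfolding half by (intro mult_left_mono) auto
  moreover have "?w * (1 / 2 * q ^ DIM('a)) = ?w / 2 * q ^ DIM('a)" "?w * q ^ DIM('a) = 2 * (?w / 2 * q ^ DIM('a))"
    by simp_all
  ultimately have 2: "v \<ge> ?w / 2 * q ^ DIM('a)" unfolding v_def by linarith
  moreover have "?w / 2 * q ^ DIM('a) > 0" using q by (intro mult_pos_pos zero_less_power) auto
  ultimately show ?thesis using 1 that unfolding q_def by (meson less_le_trans)
qed

lemma le_powr_inverse:
  fixes a K p :: real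
  assumes "p > 0" "a \<ge> 0" "a powr p \<le> K"
  shows "a \<le> K powr (1 / p)"
proof -
  have "a = (a powr p) powr (1 / p)" using assms by (simp add: powr_powr)
  also have "\<dots> \<le> K powr (1 / p)" using assms by (intro powr_mono2) auto
  finally show ?thesis .
qed

text \<open>Given $z_j$ with $H(z_j)$ at most three times the average $m_j / |A_j|$ over the annulus $A_j$, the inner energy
integral at $z_j$ is at most $H(z_j)$ as well. So there is $z_{j+1}$ in the next annulus where both $H$ and
$|\phi(z_j) - \phi|^p$ are at most three times their averages, and the powers of the radius cancel in the second
bound because the kernel has order exactly $2d$. The points converge to $x$, and $\phi$ is continuous.\<close>

lemma annular_chain:
  fixes \<phi> :: "'a::euclidean_space \<Rightarrow> real"
  assumes p: "p > 0" and r: "r > 0" "ball x r \<subseteq> \<Omega>" and \<phi>: "continuous_on UNIV \<phi>"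
    and \<Omega>[measurable]: "\<Omega> \<in> sets borel" and H[measurable]: "H \<in> borel_measurable borel"
    and HU: "\<And>z. (\<integral>\<^sup>+y. ennreal (\<bar>\<phi> z - \<phi> y\<bar> powr p / norm (z - y) ^ (2 * DIM('a))) * indicator \<Omega> y \<partial>lborel) \<le> H z"
    and m: "\<And>j. m j > 0" "\<And>j. (\<integral>\<^sup>+z. H z * indicator (annulus x r j) z \<partial>lborel) \<le> ennreal (m j)"
  obtains z0 where "z0 \<in> ball x r"
    "H z0 \<le> ennreal (6 * m 0 / (unit_ball_vol (real DIM('a)) * r ^ DIM('a)))"
    "\<And>\<epsilon>. \<epsilon> > 0 \<Longrightarrow> \<forall>\<^sub>F n in sequentially.
        \<bar>\<phi> x - \<phi> z0\<bar> \<le> \<epsilon> + (\<Sum>j<n. (36 * 2 ^ (3 * DIM('a)) / unit_ball_vol (real DIM('a)) ^ 2 * m j) powr (1 / p))"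
proof -
  let ?d = "DIM('a)" and ?w = "unit_ball_vol (real DIM('a))"
  let ?C = "36 * 2 ^ (3 * ?d) / ?w ^ 2"
  have [measurable]: "\<phi> \<in> borel_measurable borel" by (rule borel_measurable_continuous_onI[OF \<phi>])
  define \<rho> where "\<rho> j = r / 2 ^ j" for j
  have \<rho>: "\<rho> j > 0" for j using r by (simp add: \<rho>_def)
  define v where "v j = (SOME v. emeasure lborel (annulus x r j) = ennreal v \<and> v > 0 \<and> v \<ge> ?w / 2 * \<rho> j ^ ?d)" for j
  have v: "emeasure lborel (annulus x r j) = ennreal (v j)" "v j > 0" "v j \<ge> ?w / 2 * \<rho> j ^ ?d" for j
  proof -
    have "\<exists>v. emeasure lborel (annulus x r j) = ennreal v \<and> v > 0 \<and> v \<ge> ?w / 2 * \<rho> j ^ ?d"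
      using annulus_volume[OF r(1), of x j] unfolding \<rho>_def by blast
    from someI_ex[OF this] show "emeasure lborel (annulus x r j) = ennreal (v j)" "v j > 0" "v j \<ge> ?w / 2 * \<rho> j ^ ?d"
      unfolding v_def by auto
  qed
  define P where "P j z \<longleftrightarrow> z \<in> annulus x r j \<and> H z \<le> ennreal (3 * m j / v j)" for j z
  define Q where "Q j z z' \<longleftrightarrow> \<bar>\<phi> z - \<phi> z'\<bar> \<le> (?C * m j) powr (1 / p)" for j z z'
  have ann: "dist z x < \<rho> j" if "z \<in> annulus x r j" for z j using that by (simp add: annulus_def \<rho>_def)
  have \<rho>_anti: "\<rho> j \<le> r" for j using r by (simp add: \<rho>_def divide_le_eq)
  have "\<exists>f. \<forall>n. P n (f n) \<and> Q n (f n) (f (Suc n))"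
  proof (rule dependent_nat_choice)
    have "\<exists>y\<in>annulus x r 0. H y \<le> ennreal (3 * m 0 / v 0) \<and> (0::ennreal) \<le> ennreal (3 * 1 / v 0)"
      by (rule exists_below_averages) (use v m in auto)
    then show "\<exists>z. P 0 z" by (auto simp: P_def)
  next
    fix z j assume "P j z"
    then have z: "z \<in> annulus x r j" "H z \<le> ennreal (3 * m j / v j)" by (auto simp: P_def)
    let ?g = "\<lambda>y. ennreal (\<bar>\<phi> z - \<phi> y\<bar> powr p)"
    \<comment> \<open>Bounds $|z - y|$ for $z$ and $y$ in consecutive annuli.\<close>
    define len where "len = 2 * \<rho> j"
    have len: "len > 0" using \<rho> by (simp add: len_def)
    define b where "b = len ^ (2 * ?d) * (3 * m j / v j)"
    have b: "b > 0" using len m v by (simp add: b_def)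
    have "(\<integral>\<^sup>+y. ?g y * indicator (annulus x r (Suc j)) y \<partial>lborel)
       \<le> (\<integral>\<^sup>+y. ennreal (len ^ (2 * ?d)) * (ennreal (\<bar>\<phi> z - \<phi> y\<bar> powr p / norm (z - y) ^ (2 * ?d)) * indicator \<Omega> y) \<partial>lborel)"
    proof (rule nn_integral_mono)
      fix y
      show "?g y * indicator (annulus x r (Suc j)) y
        \<le> ennreal (len ^ (2 * ?d)) * (ennreal (\<bar>\<phi> z - \<phi> y\<bar> powr p / norm (z - y) ^ (2 * ?d)) * indicator \<Omega> y)"
      proof (cases "y \<in> annulus x r (Suc j) \<and> y \<noteq> z")
        case True
        then have dy: "dist y x < \<rho> (Suc j)" using ann by blast
        have "\<rho> (Suc j) \<le> \<rho> j" unfolding \<rho>_def using r by (intro divide_left_mono) auto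
        then have "norm (z - y) \<le> len"
          using dy ann[OF z(1)] dist_triangle[of z y x] by (simp add: dist_norm norm_minus_commute len_def)
        then have "norm (z - y) ^ (2 * ?d) \<le> len ^ (2 * ?d)" by (intro power_mono) auto
        then have "\<bar>\<phi> z - \<phi> y\<bar> powr p * norm (z - y) ^ (2 * ?d) \<le> \<bar>\<phi> z - \<phi> y\<bar> powr p * len ^ (2 * ?d)"
          by (intro mult_left_mono) auto
        then have "\<bar>\<phi> z - \<phi> y\<bar> powr p \<le> len ^ (2 * ?d) * (\<bar>\<phi> z - \<phi> y\<bar> powr p / norm (z - y) ^ (2 * ?d))"
        proof -
          have np: "norm (z - y) ^ (2 * ?d) > 0" using True by (intro zero_less_power) auto
          show ?thesis unfolding times_divide_eq_right pos_le_divide_eq[OF np]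
            using \<open>\<bar>\<phi> z - \<phi> y\<bar> powr p * norm (z - y) ^ (2 * ?d) \<le> \<bar>\<phi> z - \<phi> y\<bar> powr p * len ^ (2 * ?d)\<close>
            by (simp only: mult.commute)
        qed
        then have "?g y \<le> ennreal (len ^ (2 * ?d)) * ennreal (\<bar>\<phi> z - \<phi> y\<bar> powr p / norm (z - y) ^ (2 * ?d))"
          using len by (subst ennreal_mult'[symmetric]) (auto intro: ennreal_leI)
        moreover have "y \<in> \<Omega>"
        proof -
          have "y \<in> ball x r" using dy \<rho>_anti[of "Suc j"] by (simp add: dist_commute)
          then show ?thesis using r(2) by blast
        qed
        ultimately show ?thesis using True by simp
      qed (use p in auto)
    qed
    also have "\<dots> = ennreal (len ^ (2 * ?d)) * (\<integral>\<^sup>+y. ennreal (\<bar>\<phi> z - \<phi> y\<bar> powr p / norm (z - y) ^ (2 * ?d)) * indicator \<Omega> y \<partial>lborel)"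
      by (rule nn_integral_cmult) measurable
    also have "\<dots> \<le> ennreal (len ^ (2 * ?d)) * ennreal (3 * m j / v j)"
      using HU[of z] z(2) by (intro mult_left_mono) auto
    also have "\<dots> = ennreal b" unfolding b_def using len by (intro ennreal_mult'[symmetric]) auto
    finally have g_le: "(\<integral>\<^sup>+y. ?g y * indicator (annulus x r (Suc j)) y \<partial>lborel) \<le> ennreal b" .
    have "\<exists>y\<in>annulus x r (Suc j). H y \<le> ennreal (3 * m (Suc j) / v (Suc j)) \<and> ?g y \<le> ennreal (3 * b / v (Suc j))"
      by (rule exists_below_averages[OF _ v(1,2) _ _ m(2,1) g_le b]) auto
    then obtain y where y: "y \<in> annulus x r (Suc j)" "H y \<le> ennreal (3 * m (Suc j) / v (Suc j))" "?g y \<le> ennreal (3 * b / v (Suc j))"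
      by blast
    have "\<bar>\<phi> z - \<phi> y\<bar> powr p \<le> 3 * b / v (Suc j)"
      using y(3) b v[of "Suc j"] by (subst (asm) ennreal_le_iff) auto
    also have "3 * b / v (Suc j) = 9 * len ^ (2 * ?d) * m j / (v j * v (Suc j))" by (simp add: b_def)
    also have "\<dots> \<le> 9 * len ^ (2 * ?d) * m j / ((?w / 2 * \<rho> j ^ ?d) * (?w / 2 * \<rho> (Suc j) ^ ?d))"
      using v m len \<rho> by (intro divide_left_mono mult_mono mult_pos_pos mult_nonneg_nonneg) (auto intro!: less_imp_le[of 0])
    also have "\<dots> = ?C * m j"
    proof -
      have "\<rho> (Suc j) = \<rho> j / 2" by (simp add: \<rho>_def mult.commute)
      then have "\<rho> (Suc j) ^ ?d = \<rho> j ^ ?d / 2 ^ ?d" by (simp only: power_divide)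
      moreover have "len ^ (2 * ?d) = 2 ^ (2 * ?d) * (\<rho> j ^ ?d * \<rho> j ^ ?d)"
      proof -
        have "\<rho> j ^ (2 * ?d) = \<rho> j ^ ?d * \<rho> j ^ ?d" by (simp only: mult_2 power_add)
        then show ?thesis by (simp only: len_def power_mult_distrib)
      qed
      moreover have "(2::real) ^ (3 * ?d) = 2 ^ (2 * ?d) * 2 ^ ?d"
      proof -
        have "3 * ?d = 2 * ?d + ?d" by simp
        then show ?thesis by (simp only: power_add)
      qed
      moreover have "9 * (c2 * (a * a)) * q / ((w / 2 * a) * (w / 2 * (a / c1))) = 36 * (c2 * c1) / w ^ 2 * q"
        if "a > 0" "w > 0" "c1 > 0" for a w c1 c2 q :: real
      proof -
        have "w / 2 * a * (w / 2 * (a / c1)) = (w ^ 2 * (a * a)) / (4 * c1)" by (simp add: power2_eq_square)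
        then show ?thesis using that by simp
      qed
      moreover have "\<rho> j ^ ?d > 0" "?w > 0" "(2::real) ^ ?d > 0" using \<rho>[of j] by auto
      ultimately show ?thesis by (simp only:)
    qed
    finally have "Q j z y" unfolding Q_def using p by (intro le_powr_inverse) auto
    then show "\<exists>y. P (Suc j) y \<and> Q j z y" using y by (auto simp: P_def)
  qed
  then obtain f where f: "\<And>n. P n (f n)" "\<And>n. Q n (f n) (f (Suc n))" by blast
  show ?thesis
  proof (rule that[of "f 0"])
    show "f 0 \<in> ball x r" using f(1)[of 0] ann[of "f 0" 0] by (simp add: P_def \<rho>_def dist_commute)
    have "3 * m 0 / v 0 \<le> 3 * m 0 / (?w / 2 * \<rho> 0 ^ ?d)"
      using v[of 0] m(1)[of 0] \<rho>[of 0] by (intro divide_left_mono mult_pos_pos) auto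
    also have "\<dots> = 6 * m 0 / (?w * r ^ ?d)" by (simp add: \<rho>_def)
    finally show "H (f 0) \<le> ennreal (6 * m 0 / (?w * r ^ ?d))"
      using f(1)[of 0] unfolding P_def by (meson ennreal_leI order_trans)
    fix \<epsilon> :: real assume \<epsilon>: "\<epsilon> > 0"
    have lim: "(\<lambda>n. r / 2 ^ n) \<longlonglongrightarrow> 0"
      using tendsto_mult[OF tendsto_const[of r] LIMSEQ_inverse_realpow_zero[of 2]] by (simp add: divide_inverse)
    have le: "norm (dist (f n) x) \<le> r / 2 ^ n" for n
      using f(1)[of n] ann[of "f n" n] by (simp add: P_def \<rho>_def)
    have ev: "\<forall>\<^sub>F n in sequentially. norm (dist (f n) x) \<le> r / 2 ^ n"
      by (intro always_eventually allI le)
    have "(\<lambda>n. dist (f n) x) \<longlonglongrightarrow> 0" by (rule Lim_null_comparison[OF ev lim])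
    then have "f \<longlonglongrightarrow> x" by (rule tendsto_dist_iff[THEN iffD2])
    then have "(\<lambda>n. \<phi> (f n)) \<longlonglongrightarrow> \<phi> x"
    proof (rule isCont_tendsto_compose[rotated])
      show "isCont \<phi> x" using \<phi> by (simp add: continuous_on_eq_continuous_at)
    qed
    then have "\<forall>\<^sub>F n in sequentially. dist (\<phi> (f n)) (\<phi> x) < \<epsilon>" using \<epsilon> by (rule tendstoD)
    moreover have "\<bar>\<phi> (f n) - \<phi> (f 0)\<bar> \<le> (\<Sum>j<n. (?C * m j) powr (1 / p))" for n
    proof (induction n)
      case (Suc n)
      have "\<bar>\<phi> (f n) - \<phi> (f (Suc n))\<bar> \<le> (?C * m n) powr (1 / p)" using f(2)[of n] by (simp add: Q_def)
      then show ?case using Suc unfolding sum.lessThan_Suc by linarith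
    qed simp
    ultimately show "\<forall>\<^sub>F n in sequentially. \<bar>\<phi> x - \<phi> (f 0)\<bar> \<le> \<epsilon> + (\<Sum>j<n. (?C * m j) powr (1 / p))"
    proof -
      assume a1: "\<forall>\<^sub>F n in sequentially. dist (\<phi> (f n)) (\<phi> x) < \<epsilon>"
        and a2: "\<And>n. \<bar>\<phi> (f n) - \<phi> (f 0)\<bar> \<le> (\<Sum>j<n. (?C * m j) powr (1 / p))"
      show "\<forall>\<^sub>F n in sequentially. \<bar>\<phi> x - \<phi> (f 0)\<bar> \<le> \<epsilon> + (\<Sum>j<n. (?C * m j) powr (1 / p))"
      using a1 proof (rule eventually_mono)
      fix n assume a: "dist (\<phi> (f n)) (\<phi> x) < \<epsilon>"
      show "\<bar>\<phi> x - \<phi> (f 0)\<bar> \<le> \<epsilon> + (\<Sum>j<n. (?C * m j) powr (1 / p))"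
        using a2[of n] a unfolding dist_real_def by linarith
    qed
    qed
  qed
qed

section \<open>From a Hardy inequality to exponential integrability\<close>

lemma ball_bdist_subset:
  fixes \<Omega> :: "'a::euclidean_space set"
  assumes "x \<in> \<Omega>"
  shows "ball x (bdist \<Omega> x) \<subseteq> \<Omega>"
proof
  fix y assume y: "y \<in> ball x (bdist \<Omega> x)"
  show "y \<in> \<Omega>"
  proof (rule ccontr)
    assume "y \<notin> \<Omega>"
    then obtain z where z: "z \<in> closed_segment x y" "z \<in> frontier \<Omega>"
      using connected_Int_frontier[of "closed_segment x y" \<Omega>] assms by (auto simp: disjoint_iff)
    then have "bdist \<Omega> x \<le> dist x z" unfolding bdist_def by (intro infdist_le)
    also have "\<dots> \<le> dist x y"
      using segment_bound(1)[OF z(1)] by (simp add: dist_norm norm_minus_commute)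
    finally show False using y by simp
  qed
qed

text \<open>If $z$ lies in the $j$-th annulus of $x$, then $\delta(x)$ and $\delta(z)$ are comparable and $x$ lies in a ball around $z$ of
radius $2^{-j}\delta(z)$. Exchanging the integrals, the volume of that ball divided by $\delta(x)^d$ is of order
$2^{-jd} \le 2^{-j}$.\<close>

lemma annular_mass_integral:
  fixes \<Omega> :: "'a::euclidean_space set"
  assumes \<Omega>: "open \<Omega>" "bounded \<Omega>" and H[measurable]: "H \<in> borel_measurable borel"
  shows "(\<integral>\<^sup>+x. (\<integral>\<^sup>+z. H z * indicator (annulus x (bdist \<Omega> x / 2) j) z \<partial>lborel) * ennreal (1 / bdist \<Omega> x ^ DIM('a)) * indicator \<Omega> x \<partial>lborel)
    \<le> ennreal (unit_ball_vol (real DIM('a)) * (3 / 2) ^ DIM('a) * (1 / 2) ^ j) * (\<integral>\<^sup>+z. H z * indicator \<Omega> z \<partial>lborel)"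
proof -
  let ?d = "DIM('a)" and ?w = "unit_ball_vol (real DIM('a))" and ?\<delta> = "bdist \<Omega>"
  have [measurable]: "\<Omega> \<in> sets borel" using \<Omega> by simp
  define A where "A x z \<longleftrightarrow> ?\<delta> x / 2 / 2 ^ (j + 1) \<le> dist z x \<and> dist z x < ?\<delta> x / 2 / 2 ^ j" for x z
  have Am[measurable]: "Measurable.pred (borel \<Otimes>\<^sub>M borel) (\<lambda>(x, z). A x z)" unfolding A_def by measurable
  have ind: "indicator (annulus x (?\<delta> x / 2) j) z = (indicator {(x, z). A x z} (x, z) :: ennreal)" for x z
    by (simp add: annulus_def A_def indicator_def)
  have [measurable]: "{(x, z). A x z} \<in> sets (borel \<Otimes>\<^sub>M borel)"
    using Am by (simp add: pred_def space_pair_measure)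
  define k where "k x z = H z * indicator {(x, z). A x z} (x, z) * ennreal (1 / ?\<delta> x ^ ?d) * indicator \<Omega> x" for x z
  have k_meas: "(\<lambda>(x, z). k x z) \<in> borel_measurable (lborel \<Otimes>\<^sub>M lborel)"
  proof -
    have "(\<lambda>(x, z). k x z) \<in> borel_measurable (borel \<Otimes>\<^sub>M borel)"
      unfolding k_def split_beta' by measurable
    then show ?thesis by (simp add: measurable_cong_sets[OF sets_pair_measure_cong[OF sets_lborel sets_lborel] refl])
  qed
  have "(\<integral>\<^sup>+x. (\<integral>\<^sup>+z. H z * indicator (annulus x (?\<delta> x / 2) j) z \<partial>lborel) * ennreal (1 / ?\<delta> x ^ ?d) * indicator \<Omega> x \<partial>lborel)
      = (\<integral>\<^sup>+x. (\<integral>\<^sup>+z. k x z \<partial>lborel) \<partial>lborel)"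
  proof (rule nn_integral_cong)
    fix x
    have "(\<lambda>z. H z * indicator (annulus x (?\<delta> x / 2) j) z) \<in> borel_measurable lborel" by measurable
    then show "(\<integral>\<^sup>+z. H z * indicator (annulus x (?\<delta> x / 2) j) z \<partial>lborel) * ennreal (1 / ?\<delta> x ^ ?d) * indicator \<Omega> x
      = (\<integral>\<^sup>+z. k x z \<partial>lborel)"
      unfolding k_def ind[symmetric] mult.assoc[of _ "ennreal _"]
      by (subst nn_integral_multc) auto
  qed
  also have "\<dots> = (\<integral>\<^sup>+z. (\<integral>\<^sup>+x. k x z \<partial>lborel) \<partial>lborel)"
  proof -
    have k_meas': "case_prod (\<lambda>z x. k x z) \<in> borel_measurable (lborel \<Otimes>\<^sub>M lborel)"
      using measurable_compose[OF measurable_pair_swap' k_meas] by (simp add: split_beta')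
    show ?thesis by (rule lborel_pair.Fubini'[OF k_meas'])
  qed
  also have "\<dots> \<le> (\<integral>\<^sup>+z. ennreal (?w * (3 / 2) ^ ?d * (1 / 2) ^ j) * (H z * indicator \<Omega> z) \<partial>lborel)"
  proof (rule nn_integral_mono)
    fix z
    show "(\<integral>\<^sup>+x. k x z \<partial>lborel) \<le> ennreal (?w * (3 / 2) ^ ?d * (1 / 2) ^ j) * (H z * indicator \<Omega> z)"
    proof -
      have near: "z \<in> \<Omega> \<and> dist z x < ?\<delta> z / 2 ^ j \<and> 1 / ?\<delta> x ^ ?d \<le> (3 / 2) ^ ?d / ?\<delta> z ^ ?d"
        if x: "x \<in> \<Omega>" "A x z" for x
      proof -
        have \<delta>x: "?\<delta> x > 0" by (rule bdist_pos[OF \<Omega> x(1)])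
        have "?\<delta> x / 2 / 2 ^ j \<le> ?\<delta> x / 2 / 1" using \<delta>x by (intro divide_left_mono) auto
        then have dzx: "dist z x < ?\<delta> x / 2" using x(2) by (simp add: A_def)
        then have "z \<in> ball x (?\<delta> x)" using \<delta>x by (simp add: dist_commute)
        then have z: "z \<in> \<Omega>" using ball_bdist_subset[OF x(1)] by blast
        have "?\<delta> x \<le> ?\<delta> z + dist x z" "?\<delta> z \<le> ?\<delta> x + dist z x" by (rule bdist_lipschitz)+
        then have cmp: "?\<delta> x / 2 \<le> ?\<delta> z" "2 / 3 * ?\<delta> z \<le> ?\<delta> x" using dzx by (simp_all add: dist_commute)
        have "dist z x < ?\<delta> x / 2 / 2 ^ j" using x(2) by (simp add: A_def)
        also have "\<dots> \<le> ?\<delta> z / 2 ^ j" using cmp(1) by (intro divide_right_mono) auto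
        finally have 1: "dist z x < ?\<delta> z / 2 ^ j" .
        have \<delta>z: "?\<delta> z > 0" by (rule bdist_pos[OF \<Omega> z])
        have "1 / ?\<delta> x ^ ?d \<le> 1 / (2 / 3 * ?\<delta> z) ^ ?d"
          using cmp(2) \<delta>z \<delta>x by (intro divide_left_mono power_mono mult_pos_pos zero_less_power) auto
        also have "\<dots> = (3 / 2) ^ ?d / ?\<delta> z ^ ?d" by (simp add: power_mult_distrib power_divide)
        finally show ?thesis using z 1 by blast
      qed
      show ?thesis
      proof (cases "z \<in> \<Omega>")
        case True
        have \<delta>z: "?\<delta> z > 0" by (rule bdist_pos[OF \<Omega> True])
        have "(\<integral>\<^sup>+x. k x z \<partial>lborel) \<le> (\<integral>\<^sup>+x. (H z * ennreal ((3 / 2) ^ ?d / ?\<delta> z ^ ?d)) * indicator (ball z (?\<delta> z / 2 ^ j)) x \<partial>lborel)"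
        proof (rule nn_integral_mono)
          fix x
          show "k x z \<le> (H z * ennreal ((3 / 2) ^ ?d / ?\<delta> z ^ ?d)) * indicator (ball z (?\<delta> z / 2 ^ j)) x"
          proof (cases "x \<in> \<Omega> \<and> A x z")
            case True
            have "ennreal (1 / ?\<delta> x ^ ?d) \<le> ennreal ((3 / 2) ^ ?d / ?\<delta> z ^ ?d)" using near[of x] True by (intro ennreal_leI) auto
            then show ?thesis using near[of x] True by (auto simp: k_def intro!: mult_left_mono)
          qed (auto simp: k_def)
        qed
        also have "\<dots> = H z * ennreal ((3 / 2) ^ ?d / ?\<delta> z ^ ?d) * ennreal (?w * (?\<delta> z / 2 ^ j) ^ ?d)"
          using \<delta>z by (simp add: nn_integral_cmult_indicator emeasure_ball)
        also have "\<dots> = H z * ennreal ((3 / 2) ^ ?d / ?\<delta> z ^ ?d * (?w * (?\<delta> z / 2 ^ j) ^ ?d))"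
          using \<delta>z by (subst ennreal_mult'[of "(3 / 2) ^ ?d / ?\<delta> z ^ ?d"]) (auto simp: mult.assoc)
        also have "(3 / 2) ^ ?d / ?\<delta> z ^ ?d * (?w * (?\<delta> z / 2 ^ j) ^ ?d) = ?w * (3 / 2) ^ ?d * ((1 / 2) ^ j) ^ ?d"
          using \<delta>z by (simp add: power_divide)
        also have "H z * ennreal (?w * (3 / 2) ^ ?d * ((1 / 2) ^ j) ^ ?d) \<le> H z * ennreal (?w * (3 / 2) ^ ?d * (1 / 2) ^ j)"
        proof (intro ennreal_leI mult_left_mono)
          have "((1 / 2 :: real) ^ j) ^ ?d \<le> ((1 / 2) ^ j) ^ 1"
            by (rule power_decreasing) (auto intro: power_le_one)
          then show "((1 / 2 :: real) ^ j) ^ ?d \<le> (1 / 2) ^ j" by simp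
        qed auto
        finally show ?thesis using True by (simp add: mult.commute)
      next
        case False
        have kz: "k x z = 0" for x
        proof (cases "x \<in> \<Omega> \<and> A x z")
          case True
          then show ?thesis using near[of x] False by blast
        qed (auto simp: k_def)
        show ?thesis unfolding kz by simp
      qed
    qed
  qed
  also have "\<dots> = ennreal (?w * (3 / 2) ^ ?d * (1 / 2) ^ j) * (\<integral>\<^sup>+z. H z * indicator \<Omega> z \<partial>lborel)"
    by (rule nn_integral_cmult) measurable
  finally show ?thesis .
qed

text \<open>The constants depend on $\phi$ only through $B$, and on the centre $A$ and weight $w$ only through $w_0$. This uniformity allows $A$ to
be the mean of $\phi$. The doubling condition replaces $w(z_0)$ at the start of the chain by $w(x)$.\<close>

lemma Hardy_imp_exponential:
  fixes \<Omega> :: "'a::euclidean_space set" and p w0 B :: real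
  assumes \<Omega>: "open \<Omega>" "bounded \<Omega>" and p: "p > 1" "real n0 \<ge> p - 1" and w0: "w0 > 0" and B: "B \<ge> 0"
  obtains \<alpha>0 C where "\<alpha>0 > 0" "C \<ge> 0"
    "\<And>\<phi> A w \<alpha>. continuous_on UNIV \<phi> \<Longrightarrow> w \<in> borel_measurable borel \<Longrightarrow>
       (\<And>x. x \<in> \<Omega> \<Longrightarrow> w0 \<le> w x) \<Longrightarrow>
       (\<And>x y. x \<in> \<Omega> \<Longrightarrow> y \<in> \<Omega> \<Longrightarrow> dist y x < bdist \<Omega> x / 2 \<Longrightarrow> w y \<le> 2 * w x) \<Longrightarrow>
       energy p \<Omega> \<phi> \<le> ennreal B \<Longrightarrow>
       (\<integral>\<^sup>+x. ennreal (\<bar>\<phi> x - A\<bar> powr p / (bdist \<Omega> x ^ DIM('a) * w x powr p)) * indicator \<Omega> x \<partial>lborel) \<le> ennreal B \<Longrightarrow>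
       0 \<le> \<alpha> \<Longrightarrow> \<alpha> \<le> \<alpha>0 \<Longrightarrow>
       (\<integral>\<^sup>+x. ennreal (Phi n0 (\<alpha> * (\<bar>\<phi> x - A\<bar> / w x) powr (p / (p - 1))) / bdist \<Omega> x ^ DIM('a)) * indicator \<Omega> x \<partial>lborel) \<le> ennreal C"
proof -
  let ?d = "DIM('a)" and ?w = "unit_ball_vol (real DIM('a))" and ?\<delta> = "bdist \<Omega>"
  have [measurable]: "\<Omega> \<in> sets borel" using \<Omega> by simp
  define V where "V = measure lborel \<Omega>"
  have V: "emeasure lborel \<Omega> = ennreal V"
    unfolding V_def using emeasure_bounded_finite[OF \<Omega>(2)] by (intro emeasure_eq_ennreal_measure) auto
  have V0: "V \<ge> 0" by (simp add: V_def)
  define B' where "B' = 2 * B + V"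
  have B': "B' \<ge> 0" using B V0 by (simp add: B'_def)
  obtain K where K: "K > 0"
    "\<And>m T n. (\<And>j. 0 \<le> m j) \<Longrightarrow> (\<And>n. (\<Sum>j<n. m j) \<le> B') \<Longrightarrow> (\<And>n. (\<Sum>j<n. (3/2) ^ j * m j) \<le> T) \<Longrightarrow>
       (\<Sum>j<n::nat. m j powr (1 / p)) \<le> K * T powr (1 / p) \<and>
       (\<Sum>j<n. m j powr (1 / p)) \<le> K * (1 + ln (1 + T)) powr (1 - 1 / p)"
    using chain_sum_bounds[OF p(1) B'] by blast
  define C0 where "C0 = 36 * 2 ^ (3 * ?d) / ?w ^ 2"
  define C1 where "C1 = 6 * 3 ^ ?d / ?w"
  have C01: "C0 > 0" "C1 > 0"
  proof -
    have w: "?w > 0" by (rule unit_ball_vol_pos) simp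
    show "C0 > 0" unfolding C0_def by (rule divide_pos_pos) (simp_all only: zero_less_power[OF w] mult_pos_pos zero_less_power zero_less_numeral)
    show "C1 > 0" unfolding C1_def by (rule divide_pos_pos) (simp_all only: w mult_pos_pos zero_less_power zero_less_numeral)
  qed
  define C2 where "C2 = 2 * C1 powr (1 / p) + C0 powr (1 / p) / w0"
  have C2: "C2 > 0" unfolding C2_def using C01 w0 by (intro add_pos_pos) auto
  define K' where "K' = C2 * K"
  have K': "K' > 0" using C2 K by (simp add: K'_def)
  define \<alpha>0 where "\<alpha>0 = (1 / K') powr (p / (p - 1))"
  define Ce where "Ce = 2 * (exp 1)^2 * (?w * (3 / 2) ^ ?d * 4 * B')"
  show ?thesis
  proof (rule that[of \<alpha>0 Ce])
    show "\<alpha>0 > 0" using K' by (simp add: \<alpha>0_def)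
    show "Ce \<ge> 0" unfolding Ce_def using B' by (intro mult_nonneg_nonneg) auto
    fix \<phi> A w \<alpha>
    assume \<phi>: "continuous_on UNIV \<phi>" and [measurable]: "w \<in> borel_measurable borel"
      and w_low: "\<And>x. x \<in> \<Omega> \<Longrightarrow> w0 \<le> w x"
      and w_dbl: "\<And>x y. x \<in> \<Omega> \<Longrightarrow> y \<in> \<Omega> \<Longrightarrow> dist y x < ?\<delta> x / 2 \<Longrightarrow> w y \<le> 2 * w x"
      and en: "energy p \<Omega> \<phi> \<le> ennreal B"
      and hardy: "(\<integral>\<^sup>+x. ennreal (\<bar>\<phi> x - A\<bar> powr p / (?\<delta> x ^ ?d * w x powr p)) * indicator \<Omega> x \<partial>lborel) \<le> ennreal B"
      and \<alpha>: "0 \<le> \<alpha>" "\<alpha> \<le> \<alpha>0"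
    have [measurable]: "\<phi> \<in> borel_measurable borel" by (rule borel_measurable_continuous_onI[OF \<phi>])
    define U where "U z = (\<integral>\<^sup>+y. ennreal (\<bar>\<phi> z - \<phi> y\<bar> powr p / norm (z - y) ^ (2 * ?d)) * indicator \<Omega> y \<partial>lborel)" for z
    have [measurable]: "U \<in> borel_measurable borel" unfolding U_def by measurable
    \<comment> \<open>The summand $1$ keeps all $m_j$ positive, as the chain requires.\<close>
    define H where "H z = U z + ennreal (\<bar>\<phi> z - A\<bar> powr p / (?\<delta> z ^ ?d * w z powr p)) + 1" for z
    have H[measurable]: "H \<in> borel_measurable borel" unfolding H_def by measurable
    have HU: "U z \<le> H z" for z unfolding H_def by (simp add: add.assoc)
    have HA: "ennreal (\<bar>\<phi> z - A\<bar> powr p / (?\<delta> z ^ ?d * w z powr p)) \<le> H z" for z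
      unfolding H_def by (metis add.commute add_increasing2 le_iff_add zero_le order_refl add.assoc)
    have H1: "1 \<le> H z" for z unfolding H_def by simp
    have H_int: "(\<integral>\<^sup>+z. H z * indicator \<Omega> z \<partial>lborel) \<le> ennreal B'"
    proof -
      have "(\<integral>\<^sup>+z. H z * indicator \<Omega> z \<partial>lborel) = (\<integral>\<^sup>+z. U z * indicator \<Omega> z + ennreal (\<bar>\<phi> z - A\<bar> powr p / (?\<delta> z ^ ?d * w z powr p)) * indicator \<Omega> z + indicator \<Omega> z \<partial>lborel)"
        unfolding H_def by (simp add: distrib_right)
      also have "\<dots> = energy p \<Omega> \<phi> + (\<integral>\<^sup>+x. ennreal (\<bar>\<phi> x - A\<bar> powr p / (?\<delta> x ^ ?d * w x powr p)) * indicator \<Omega> x \<partial>lborel) + emeasure lborel \<Omega>"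
        by (simp add: nn_integral_add energy_def U_def)
      also have "\<dots> \<le> ennreal B + ennreal B + ennreal V" unfolding V by (intro add_mono en hardy order_refl)
      also have "\<dots> = ennreal B'" using B V0 by (simp add: B'_def ennreal_plus[symmetric] del: ennreal_plus)
      finally show ?thesis .
    qed
    define T where "T x = (\<Sum>j. ennreal ((3/2) ^ j) * (\<integral>\<^sup>+z. H z * indicator (annulus x (?\<delta> x / 2) j) z \<partial>lborel))" for x
    have key: "ennreal (Phi n0 (\<alpha> * (\<bar>\<phi> x - A\<bar> / w x) powr (p / (p - 1)))) \<le> ennreal (2 * (exp 1)^2) * T x"
      if x: "x \<in> \<Omega>" for x
    proof (cases "T x")
      case top
      then show ?thesis by (simp add: ennreal_mult_top)
    next
      case (real t)
      have \<delta>x: "?\<delta> x > 0" by (rule bdist_pos[OF \<Omega> x])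
      define r where "r = ?\<delta> x / 2"
      have r: "r > 0" "ball x r \<subseteq> \<Omega>"
        using \<delta>x ball_bdist_subset[OF x] by (auto simp: r_def)
      have ann_sub: "annulus x r j \<subseteq> \<Omega>" for j
      proof
        fix z assume z: "z \<in> annulus x r j"
        have "r / 2 ^ j \<le> r / 1" using r by (intro divide_left_mono) auto
        then have "z \<in> ball x r" using z by (simp add: annulus_def dist_commute)
        then show "z \<in> \<Omega>" using r by blast
      qed
      define Mj where "Mj j = (\<integral>\<^sup>+z. H z * indicator (annulus x r j) z \<partial>lborel)" for j
      have ann_disj: "disjoint_family (annulus x r)"
      proof -
        have "annulus x r i \<inter> annulus x r j = {}" if "i < j" for i j
        proof -
          have "(2::real) ^ (i + 1) \<le> 2 ^ j" using that by (intro power_increasing) auto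
          then have "r / 2 ^ j \<le> r / 2 ^ (i + 1)" using r by (intro divide_left_mono) auto
          then show ?thesis by (auto simp: annulus_def)
        qed
        then show ?thesis unfolding disjoint_family_on_def by (metis Int_commute nat_neq_iff)
      qed
      have M_sum: "(\<Sum>j<n. Mj j) \<le> ennreal B'" for n
      proof -
        have "(\<Sum>j<n. Mj j) = (\<integral>\<^sup>+z. (\<Sum>j<n. H z * indicator (annulus x r j) z) \<partial>lborel)"
          unfolding Mj_def by (rule nn_integral_sum[symmetric]) measurable
        also have "\<dots> \<le> (\<integral>\<^sup>+z. H z * indicator \<Omega> z \<partial>lborel)"
        proof (rule nn_integral_mono)
          fix z
          have "(\<Sum>j<n. H z * indicator (annulus x r j) z) = H z * indicator (\<Union>j<n. annulus x r j) z"
            unfolding sum_distrib_left[symmetric]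
            by (subst indicator_UN_disjoint) (auto intro: disjoint_family_on_mono[OF _ ann_disj])
          also have "\<dots> \<le> H z * indicator \<Omega> z"
            using ann_sub by (intro mult_left_mono) (auto split: split_indicator)
          finally show "(\<Sum>j<n. H z * indicator (annulus x r j) z) \<le> H z * indicator \<Omega> z" .
        qed
        also note H_int
        finally show ?thesis .
      qed
      have M_le: "Mj j \<le> ennreal B'" for j
      proof -
        have "Mj j \<le> (\<Sum>i<Suc j. Mj i)" by (rule member_le_sum) auto
        then show ?thesis using M_sum[of "Suc j"] by (rule order_trans)
      qed
      define m where "m j = enn2real (Mj j)" for j
      have m: "Mj j = ennreal (m j)" "m j > 0" for j
      proof -
        have fin: "Mj j \<noteq> \<infinity>" using M_le[of j] by (auto simp: top_unique)
        then show eq: "Mj j = ennreal (m j)" by (simp add: m_def ennreal_enn2real_if)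
        obtain v where v: "emeasure lborel (annulus x r j) = ennreal v" "v > 0"
          using annulus_volume[OF r(1), of x j] by blast
        have "ennreal v = (\<integral>\<^sup>+z. 1 * indicator (annulus x r j) z \<partial>lborel)" using v by simp
        also have "\<dots> \<le> Mj j" unfolding Mj_def by (intro nn_integral_mono mult_right_mono H1) auto
        finally have "ennreal v \<le> ennreal (m j)" using eq by simp
        moreover have "m j \<ge> 0" by (simp add: m_def)
        ultimately have "v \<le> m j" by (subst (asm) ennreal_le_iff) auto
        then show "m j > 0" using v(2) by linarith
      qed
      have m_sum: "(\<Sum>j<n. m j) \<le> B'" for n
      proof -
        have "ennreal (\<Sum>j<n. m j) = (\<Sum>j<n. Mj j)" using m by (subst sum_ennreal[symmetric]) (auto intro: less_imp_le)
        then have "ennreal (\<Sum>j<n. m j) \<le> ennreal B'" using M_sum[of n] by (rule ord_eq_le_trans)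
        then show ?thesis using B' by (simp only: ennreal_le_iff)
      qed
      have m_wsum: "(\<Sum>j<n. (3/2) ^ j * m j) \<le> t" for n
      proof -
        have "ennreal (\<Sum>j<n. (3/2) ^ j * m j) = (\<Sum>j<n. ennreal ((3/2) ^ j) * Mj j)"
          using m by (subst sum_ennreal[symmetric]) (auto simp: ennreal_mult' intro!: less_imp_le)
        also have "\<dots> \<le> T x" unfolding T_def Mj_def r_def by (rule sum_le_suminf) auto
        finally show ?thesis using real by (simp add: ennreal_le_iff)
      qed
      have wx: "w x > 0" using w_low[OF x] w0 by linarith
      obtain z0 where z0: "z0 \<in> ball x r" "H z0 \<le> ennreal (6 * m 0 / (?w * r ^ ?d))"
        "\<And>\<epsilon>. \<epsilon> > 0 \<Longrightarrow> \<forall>\<^sub>F n in sequentially. \<bar>\<phi> x - \<phi> z0\<bar> \<le> \<epsilon> + (\<Sum>j<n. (C0 * m j) powr (1 / p))"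
      proof (rule annular_chain[of p r x \<Omega> \<phi> H m])
        show "p > 0" using p by simp
        show "(\<integral>\<^sup>+z. H z * indicator (annulus x r j) z \<partial>lborel) \<le> ennreal (m j)" for j
          using m(1)[of j] by (simp add: Mj_def)
        show "(\<integral>\<^sup>+y. ennreal (\<bar>\<phi> z - \<phi> y\<bar> powr p / norm (z - y) ^ (2 * ?d)) * indicator \<Omega> y \<partial>lborel) \<le> H z" for z
          using HU[of z] by (simp add: U_def)
      qed (use r \<phi> m in \<open>auto simp: C0_def\<close>)
      have z0\<Omega>: "z0 \<in> \<Omega>" using z0(1) r(2) by blast
      have \<delta>z: "?\<delta> z0 > 0" by (rule bdist_pos[OF \<Omega> z0\<Omega>])
      have wz: "0 < w z0" "w z0 \<le> 2 * w x"
        using w_low[OF z0\<Omega>] w0 w_dbl[OF x z0\<Omega>] z0(1) by (auto simp: r_def dist_commute)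
      have "?\<delta> z0 \<le> ?\<delta> x + dist z0 x" by (rule bdist_lipschitz)
      then have \<delta>z3: "?\<delta> z0 \<le> 3 * r" using z0(1) by (simp add: r_def dist_commute)
      have "ennreal (\<bar>\<phi> z0 - A\<bar> powr p / (?\<delta> z0 ^ ?d * w z0 powr p)) \<le> ennreal (6 * m 0 / (?w * r ^ ?d))"
        using HA[of z0] z0(2) by (rule order_trans)
      moreover have "0 \<le> 6 * m 0 / (?w * r ^ ?d)" using m(2)[of 0] r by (intro divide_nonneg_nonneg) auto
      ultimately have le0: "\<bar>\<phi> z0 - A\<bar> powr p / (?\<delta> z0 ^ ?d * w z0 powr p) \<le> 6 * m 0 / (?w * r ^ ?d)"
        by (simp add: ennreal_le_iff)
      have "0 < ?\<delta> z0 ^ ?d * w z0 powr p" using \<delta>z wz by simp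
      then have "\<bar>\<phi> z0 - A\<bar> powr p \<le> 6 * m 0 / (?w * r ^ ?d) * (?\<delta> z0 ^ ?d * w z0 powr p)"
        using le0 by (simp only: pos_divide_le_eq)
      also have "\<dots> \<le> 6 * m 0 / (?w * r ^ ?d) * ((3 * r) ^ ?d * (2 * w x) powr p)"
        using \<delta>z \<delta>z3 wz p m(2)[of 0] r
        by (intro mult_left_mono mult_mono power_mono powr_mono2 divide_nonneg_nonneg) auto
      also have "\<dots> = C1 * m 0 * (2 * w x) powr p"
        using r by (simp add: C1_def power_mult_distrib)
      finally have "\<bar>\<phi> z0 - A\<bar> \<le> (C1 * m 0 * (2 * w x) powr p) powr (1 / p)"
        using p by (intro le_powr_inverse) auto
      also have "\<dots> = 2 * w x * (C1 powr (1 / p) * m 0 powr (1 / p))"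
        using p wx by (simp add: powr_mult powr_powr)
      finally have first: "\<bar>\<phi> z0 - A\<bar> / w x \<le> 2 * C1 powr (1 / p) * m 0 powr (1 / p)"
        using wx by (simp add: pos_divide_le_eq mult_ac)
      define X where "X = \<bar>\<phi> x - A\<bar> / w x"
      have X0: "X \<ge> 0" using wx by (simp add: X_def)
      have bound: "X \<le> C2 * b" if b: "\<And>n. (\<Sum>j<n. m j powr (1 / p)) \<le> b" for b
      proof (rule field_le_epsilon)
        fix \<epsilon> :: real assume \<epsilon>: "\<epsilon> > 0"
        have "\<forall>\<^sub>F n in sequentially. \<bar>\<phi> x - \<phi> z0\<bar> \<le> \<epsilon> * w0 + (\<Sum>j<n. (C0 * m j) powr (1 / p))"
          using \<epsilon> w0 by (intro z0(3)) simp
        moreover have "\<forall>\<^sub>F n::nat in sequentially. n \<ge> 1" by (rule eventually_ge_at_top)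
        ultimately have "\<forall>\<^sub>F n in sequentially. \<bar>\<phi> x - \<phi> z0\<bar> \<le> \<epsilon> * w0 + (\<Sum>j<n. (C0 * m j) powr (1 / p)) \<and> n \<ge> 1"
          by (rule eventually_conj)
        then obtain n where n: "\<bar>\<phi> x - \<phi> z0\<bar> \<le> \<epsilon> * w0 + (\<Sum>j<n. (C0 * m j) powr (1 / p))" "n \<ge> 1"
          using eventually_happens[of _ "sequentially"] by auto
        define S where "S = (\<Sum>j<n. m j powr (1 / p))"
        have S0: "S \<ge> 0" unfolding S_def by (intro sum_nonneg) auto
        have S: "(\<Sum>j<n. (C0 * m j) powr (1 / p)) = C0 powr (1 / p) * S"
          unfolding S_def by (simp add: powr_mult sum_distrib_left)
        have "m 0 powr (1 / p) \<le> S" unfolding S_def using n(2) by (intro member_le_sum) auto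
        then have a1: "2 * C1 powr (1 / p) * m 0 powr (1 / p) \<le> 2 * C1 powr (1 / p) * S"
          by (intro mult_left_mono) auto
        have "\<bar>\<phi> x - \<phi> z0\<bar> / w x \<le> \<bar>\<phi> x - \<phi> z0\<bar> / w0"
          using w_low[OF x] w0 wx by (intro divide_left_mono) auto
        also have "\<dots> \<le> (\<epsilon> * w0 + C0 powr (1 / p) * S) / w0"
          using n(1) w0 unfolding S by (intro divide_right_mono) auto
        also have "\<dots> = \<epsilon> + C0 powr (1 / p) / w0 * S" using w0 by (simp add: add_divide_distrib)
        finally have a2: "\<bar>\<phi> x - \<phi> z0\<bar> / w x \<le> \<epsilon> + C0 powr (1 / p) / w0 * S" .
        have "X \<le> \<bar>\<phi> x - \<phi> z0\<bar> / w x + \<bar>\<phi> z0 - A\<bar> / w x"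
          unfolding X_def add_divide_distrib[symmetric] using wx by (intro divide_right_mono) auto
        also have "\<dots> \<le> \<epsilon> + C2 * S" using a1 a2 first unfolding C2_def distrib_right by linarith
        also have "\<dots> \<le> \<epsilon> + C2 * b" using b[of n] C2 unfolding S_def by (intro add_left_mono mult_left_mono) auto
        finally show "X \<le> C2 * b + \<epsilon>" by simp
      qed
      have t0: "t \<ge> 0" using real by simp
      have KK: "(\<Sum>j<n. m j powr (1 / p)) \<le> K * t powr (1 / p)"
        "(\<Sum>j<n. m j powr (1 / p)) \<le> K * (1 + ln (1 + t)) powr (1 - 1 / p)" for n
        using K(2)[of m t n] m(2) m_sum m_wsum by (auto intro: less_imp_le)
      have "Phi n0 (\<alpha> * X powr (p / (p - 1))) \<le> 2 * (exp 1)^2 * t"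
      proof (rule Phi_chain_bound[OF p K' \<alpha>(1) _ X0 _ _ t0])
        show "\<alpha> \<le> (1 / K') powr (p / (p - 1))" using \<alpha>(2) by (simp add: \<alpha>0_def)
        show "X \<le> K' * t powr (1 / p)" unfolding K'_def mult.assoc by (rule bound) (rule KK)
        show "X \<le> K' * (1 + ln (1 + t)) powr (1 - 1 / p)" unfolding K'_def mult.assoc by (rule bound) (rule KK)
      qed
      then have "ennreal (Phi n0 (\<alpha> * X powr (p / (p - 1)))) \<le> ennreal (2 * (exp 1)^2 * t)" by (rule ennreal_leI)
      also have "\<dots> = ennreal (2 * (exp 1)^2) * T x" unfolding real(2) by (intro ennreal_mult') auto
      finally show ?thesis by (simp add: X_def)
    qed
    have T_meas: "(\<lambda>x. \<integral>\<^sup>+z. H z * indicator (annulus x (?\<delta> x / 2) j) z \<partial>lborel) \<in> borel_measurable borel" for j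
      unfolding annulus_def indicator_def mem_Collect_eq by measurable
    have "(\<integral>\<^sup>+x. ennreal (Phi n0 (\<alpha> * (\<bar>\<phi> x - A\<bar> / w x) powr (p / (p - 1))) / ?\<delta> x ^ ?d) * indicator \<Omega> x \<partial>lborel)
      \<le> (\<integral>\<^sup>+x. ennreal (2 * (exp 1)^2) * (\<Sum>j. ennreal ((3/2) ^ j) * ((\<integral>\<^sup>+z. H z * indicator (annulus x (?\<delta> x / 2) j) z \<partial>lborel) * ennreal (1 / ?\<delta> x ^ ?d) * indicator \<Omega> x)) \<partial>lborel)"
    proof (rule nn_integral_mono)
      fix x
      show "ennreal (Phi n0 (\<alpha> * (\<bar>\<phi> x - A\<bar> / w x) powr (p / (p - 1))) / ?\<delta> x ^ ?d) * indicator \<Omega> x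
        \<le> ennreal (2 * (exp 1)^2) * (\<Sum>j. ennreal ((3/2) ^ j) * ((\<integral>\<^sup>+z. H z * indicator (annulus x (?\<delta> x / 2) j) z \<partial>lborel) * ennreal (1 / ?\<delta> x ^ ?d) * indicator \<Omega> x))"
      proof (cases "x \<in> \<Omega>")
        case True
        have \<delta>x: "?\<delta> x > 0" by (rule bdist_pos[OF \<Omega> True])
        let ?P = "Phi n0 (\<alpha> * (\<bar>\<phi> x - A\<bar> / w x) powr (p / (p - 1)))"
        have "ennreal (?P / ?\<delta> x ^ ?d) = ennreal ?P * ennreal (1 / ?\<delta> x ^ ?d)"
          using \<delta>x by (subst ennreal_mult''[symmetric]) auto
        also have "\<dots> \<le> ennreal (2 * (exp 1)^2) * T x * ennreal (1 / ?\<delta> x ^ ?d)"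
          by (intro mult_right_mono key True) auto
        also have "\<dots> = ennreal (2 * (exp 1)^2) * (T x * ennreal (1 / ?\<delta> x ^ ?d))" by (simp only: mult.assoc)
        also have "T x * ennreal (1 / ?\<delta> x ^ ?d) = (\<Sum>j. ennreal ((3/2) ^ j) * (\<integral>\<^sup>+z. H z * indicator (annulus x (?\<delta> x / 2) j) z \<partial>lborel) * ennreal (1 / ?\<delta> x ^ ?d))"
          unfolding T_def by (rule ennreal_suminf_multc[symmetric])
        finally show ?thesis using True by (simp add: mult.assoc)
      qed simp
    qed
    also have "\<dots> = ennreal (2 * (exp 1)^2) * (\<Sum>j. ennreal ((3/2) ^ j) * (\<integral>\<^sup>+x. (\<integral>\<^sup>+z. H z * indicator (annulus x (?\<delta> x / 2) j) z \<partial>lborel) * ennreal (1 / ?\<delta> x ^ ?d) * indicator \<Omega> x \<partial>lborel))"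
    proof -
      have mm: "(\<lambda>x. (\<integral>\<^sup>+z. H z * indicator (annulus x (?\<delta> x / 2) j) z \<partial>lborel) * ennreal (1 / ?\<delta> x ^ ?d) * indicator \<Omega> x) \<in> borel_measurable lborel" for j
        using T_meas[of j] by measurable
      show ?thesis
        using mm by (simp add: nn_integral_cmult nn_integral_suminf)
    qed
    also have "\<dots> \<le> ennreal (2 * (exp 1)^2) * (\<Sum>j. ennreal ((3/2) ^ j) * (ennreal (?w * (3 / 2) ^ ?d * (1 / 2) ^ j) * ennreal B'))"
    proof (intro mult_left_mono suminf_le)
      fix j
      have "(\<integral>\<^sup>+x. (\<integral>\<^sup>+z. H z * indicator (annulus x (?\<delta> x / 2) j) z \<partial>lborel) * ennreal (1 / ?\<delta> x ^ ?d) * indicator \<Omega> x \<partial>lborel)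
        \<le> ennreal (?w * (3 / 2) ^ ?d * (1 / 2) ^ j) * (\<integral>\<^sup>+z. H z * indicator \<Omega> z \<partial>lborel)"
        by (rule annular_mass_integral[OF \<Omega> H])
      also have "\<dots> \<le> ennreal (?w * (3 / 2) ^ ?d * (1 / 2) ^ j) * ennreal B'" by (intro mult_left_mono H_int) auto
      finally show "(\<integral>\<^sup>+x. (\<integral>\<^sup>+z. H z * indicator (annulus x (?\<delta> x / 2) j) z \<partial>lborel) * ennreal (1 / ?\<delta> x ^ ?d) * indicator \<Omega> x \<partial>lborel)
        \<le> ennreal (?w * (3 / 2) ^ ?d * (1 / 2) ^ j) * ennreal B'" .
    qed auto
    also have "(\<Sum>j. ennreal ((3/2) ^ j) * (ennreal (?w * (3 / 2) ^ ?d * (1 / 2) ^ j) * ennreal B')) = (\<Sum>j. ennreal (?w * (3 / 2) ^ ?d * B' * (3 / 4) ^ j))"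
    proof (rule suminf_cong)
      fix j
      have "(3/2) ^ j * (?w * (3 / 2) ^ ?d * (1 / 2) ^ j * B') = ?w * (3 / 2) ^ ?d * B' * ((3/2) ^ j * (1/2) ^ j)" by (simp only: mult_ac)
      also have "(3/2 :: real) ^ j * (1/2) ^ j = (3/4) ^ j" unfolding power_mult_distrib[symmetric] by simp
      finally show "ennreal ((3/2) ^ j) * (ennreal (?w * (3 / 2) ^ ?d * (1 / 2) ^ j) * ennreal B') = ennreal (?w * (3 / 2) ^ ?d * B' * (3 / 4) ^ j)"
        using B' by (subst ennreal_mult''[symmetric], simp, subst ennreal_mult'[symmetric]) auto
    qed
    also have "\<dots> = ennreal (\<Sum>j. ?w * (3 / 2) ^ ?d * B' * (3 / 4) ^ j)"
      using B' by (intro suminf_ennreal2 summable_mult summable_geometric) auto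
    also have "(\<Sum>j. ?w * (3 / 2) ^ ?d * B' * (3 / 4) ^ j) = ?w * (3 / 2) ^ ?d * 4 * B'"
      by (subst suminf_mult) (auto simp: suminf_geometric)
    also have "ennreal (2 * (exp 1)^2) * ennreal (?w * (3 / 2) ^ ?d * 4 * B') = ennreal Ce"
      unfolding Ce_def by (rule ennreal_mult'[symmetric]) auto
    finally show "(\<integral>\<^sup>+x. ennreal (Phi n0 (\<alpha> * (\<bar>\<phi> x - A\<bar> / w x) powr (p / (p - 1))) / ?\<delta> x ^ ?d) * indicator \<Omega> x \<partial>lborel) \<le> ennreal Ce" .
  qed
qed

section \<open>Passage from test functions to the closure\<close>

lemma nn_integral_lborel_cong_lebesgue_AE:
  assumes "AE x in lebesgue. f x = g x"
  shows "(\<integral>\<^sup>+x. f x \<partial>lborel) = (\<integral>\<^sup>+x. g x \<partial>lborel)"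
proof -
  have "(\<integral>\<^sup>+x. f x \<partial>lebesgue) = (\<integral>\<^sup>+x. g x \<partial>lebesgue)" by (rule nn_integral_cong_AE[OF assms])
  then show ?thesis by (simp add: nn_integral_completion)
qed

text \<open>Membership in the Sobolev space only gives Lebesgue measurability; this permits replacing a function by a Borel
representative.\<close>

lemma energy_cong_AE:
  assumes "AE x in lebesgue. x \<in> \<Omega> \<longrightarrow> u x = v x"
  shows "energy p \<Omega> u = energy p \<Omega> v"
  unfolding energy_def
proof (rule nn_integral_lborel_cong_lebesgue_AE, rule eventually_mono[OF assms])
  fix x assume x: "x \<in> \<Omega> \<longrightarrow> u x = v x"
  have "(\<integral>\<^sup>+y. ennreal (\<bar>u x - u y\<bar> powr p / norm (x - y) ^ (2 * DIM('a))) * indicator \<Omega> y \<partial>lborel)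
     = (\<integral>\<^sup>+y. ennreal (\<bar>v x - v y\<bar> powr p / norm (x - y) ^ (2 * DIM('a))) * indicator \<Omega> y \<partial>lborel)" if "x \<in> \<Omega>"
    by (rule nn_integral_lborel_cong_lebesgue_AE, rule eventually_mono[OF assms])
      (use x that in \<open>auto split: split_indicator\<close>)
  then show "(\<integral>\<^sup>+y. ennreal (\<bar>u x - u y\<bar> powr p / norm (x - y) ^ (2 * DIM('a))) * indicator \<Omega> y \<partial>lborel) * indicator \<Omega> x
     = (\<integral>\<^sup>+y. ennreal (\<bar>v x - v y\<bar> powr p / norm (x - y) ^ (2 * DIM('a))) * indicator \<Omega> y \<partial>lborel) * indicator \<Omega> x"
    by (cases "x \<in> \<Omega>") auto
qed

lemma energy_add_le:
  fixes u v :: "'a::euclidean_space \<Rightarrow> real"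
  assumes p: "p > 0" and [measurable]: "u \<in> borel_measurable borel" "v \<in> borel_measurable borel" "\<Omega> \<in> sets borel"
  shows "energy p \<Omega> (\<lambda>x. u x + v x) \<le> ennreal (2 powr p) * (energy p \<Omega> u + energy p \<Omega> v)"
proof -
  let ?k = "\<lambda>w x y. ennreal (\<bar>w x - w y\<bar> powr p / norm (x - y) ^ (2 * DIM('a)))"
  have pt: "?k (\<lambda>x. u x + v x) x y \<le> ennreal (2 powr p) * (?k u x y + ?k v x y)" for x y :: 'a
  proof -
    have "\<bar>(u x + v x) - (u y + v y)\<bar> powr p \<le> (\<bar>u x - u y\<bar> + \<bar>v x - v y\<bar>) powr p"
      using p by (intro powr_mono2) auto
    also have "\<dots> \<le> 2 powr p * (\<bar>u x - u y\<bar> powr p + \<bar>v x - v y\<bar> powr p)"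
      using p by (intro powr_add_le) auto
    finally have "\<bar>(u x + v x) - (u y + v y)\<bar> powr p / norm (x - y) ^ (2 * DIM('a))
       \<le> 2 powr p * (\<bar>u x - u y\<bar> powr p / norm (x - y) ^ (2 * DIM('a)) + \<bar>v x - v y\<bar> powr p / norm (x - y) ^ (2 * DIM('a)))"
      unfolding add_divide_distrib[symmetric] times_divide_eq_right by (intro divide_right_mono) auto
    then have "?k (\<lambda>x. u x + v x) x y \<le> ennreal (2 powr p * (\<bar>u x - u y\<bar> powr p / norm (x - y) ^ (2 * DIM('a)) + \<bar>v x - v y\<bar> powr p / norm (x - y) ^ (2 * DIM('a))))"
      by (rule ennreal_leI)
    also have "\<dots> = ennreal (2 powr p) * (?k u x y + ?k v x y)"
      by (simp add: ennreal_mult' ennreal_plus)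
    finally show ?thesis .
  qed
  have "energy p \<Omega> (\<lambda>x. u x + v x) \<le> (\<integral>\<^sup>+x. (\<integral>\<^sup>+y. ennreal (2 powr p) * (?k u x y * indicator \<Omega> y + ?k v x y * indicator \<Omega> y) \<partial>lborel) * indicator \<Omega> x \<partial>lborel)"
    unfolding energy_def
  proof (intro nn_integral_mono mult_right_mono)
    fix x y :: 'a
    show "?k (\<lambda>x. u x + v x) x y * indicator \<Omega> y \<le> ennreal (2 powr p) * (?k u x y * indicator \<Omega> y + ?k v x y * indicator \<Omega> y)"
      using pt[of x y] by (cases "y \<in> \<Omega>") auto
  qed auto
  also have "\<dots> = (\<integral>\<^sup>+x. ennreal (2 powr p) * ((\<integral>\<^sup>+y. ?k u x y * indicator \<Omega> y \<partial>lborel) * indicator \<Omega> x + (\<integral>\<^sup>+y. ?k v x y * indicator \<Omega> y \<partial>lborel) * indicator \<Omega> x) \<partial>lborel)"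
    by (intro nn_integral_cong) (simp add: nn_integral_cmult nn_integral_add distrib_right mult.assoc)
  also have "\<dots> = ennreal (2 powr p) * (energy p \<Omega> u + energy p \<Omega> v)"
    unfolding energy_def by (simp add: nn_integral_cmult nn_integral_add)
  finally show ?thesis .
qed

text \<open>A Borel representative, with approximation so fast that it converges almost everywhere without passing to a further
subsequence.\<close>

lemma W0_space_approx:
  fixes \<Omega> :: "'a::euclidean_space set"
  assumes \<Omega>: "open \<Omega>" and p: "p > 1" "s * p = real DIM('a)" and u: "u \<in> W0_space s p \<Omega>"
  obtains v \<psi> where "v \<in> borel_measurable borel" "AE x in lebesgue. x \<in> \<Omega> \<longrightarrow> u x = v x"
    "\<And>n. \<psi> n \<in> test_functions \<Omega>"
    "\<And>n. energy p \<Omega> (\<lambda>x. v x - \<psi> n x) \<le> ennreal ((1 / 2) ^ n)"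
    "\<And>n. (\<integral>\<^sup>+x. ennreal (\<bar>v x - \<psi> n x\<bar> powr p) * indicator \<Omega> x \<partial>lborel) \<le> ennreal ((1 / 2) ^ n)"
proof -
  have [simp]: "\<Omega> \<in> sets lebesgue" using \<Omega> by auto
  obtain \<phi> where \<phi>: "\<And>k. \<phi> k \<in> test_functions \<Omega>" "(\<lambda>k. W_norm s p \<Omega> (\<lambda>x. u x - \<phi> k x)) \<longlonglongrightarrow> 0"
    using u by (auto simp: W0_space_def)
  have "u \<in> borel_measurable (lebesgue_on \<Omega>)" using u by (auto simp: W0_space_def W_space_def)
  then have "(\<lambda>x. indicat_real \<Omega> x *\<^sub>R u x) \<in> borel_measurable lebesgue"
    by (subst (asm) borel_measurable_restrict_space_iff) auto
  then obtain v where v: "v \<in> borel_measurable lborel" "AE x in lborel. indicat_real \<Omega> x *\<^sub>R u x = v x"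
    using completion_ex_borel_measurable_real by blast
  have vm: "v \<in> borel_measurable borel" using v(1) by simp
  have "AE x in lebesgue. indicat_real \<Omega> x *\<^sub>R u x = v x" using v(2) by (rule AE_completion)
  then have uv: "AE x in lebesgue. x \<in> \<Omega> \<longrightarrow> u x = v x"
    by (rule eventually_mono) auto
  have eW: "W_norm s p \<Omega> w = epowr (energy p \<Omega> w + (\<integral>\<^sup>+x. ennreal (\<bar>w x\<bar> powr p) * indicator \<Omega> x \<partial>lborel)) (1 / p)" for w
    using p by (simp add: W_norm_def gagliardo_seminorm_energy Lp_norm_def epowr_epowr_inverse nn_integral_lebesgue_on)
  have "\<exists>k. energy p \<Omega> (\<lambda>x. v x - \<phi> k x) \<le> ennreal ((1 / 2) ^ n) \<and>
      (\<integral>\<^sup>+x. ennreal (\<bar>v x - \<phi> k x\<bar> powr p) * indicator \<Omega> x \<partial>lborel) \<le> ennreal ((1 / 2) ^ n)" for n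
  proof -
    have "0 < ennreal (((1 / 2) ^ n) powr (1 / p))" by simp
    then have "\<forall>\<^sub>F k in sequentially. W_norm s p \<Omega> (\<lambda>x. u x - \<phi> k x) < ennreal (((1 / 2) ^ n) powr (1 / p))"
      by (rule order_tendstoD(2)[OF \<phi>(2)])
    then obtain k where "W_norm s p \<Omega> (\<lambda>x. u x - \<phi> k x) \<le> ennreal (((1 / 2) ^ n) powr (1 / p))"
      using eventually_happens[of _ "sequentially"] by (auto intro: less_imp_le)
    then have "energy p \<Omega> (\<lambda>x. u x - \<phi> k x) + (\<integral>\<^sup>+x. ennreal (\<bar>u x - \<phi> k x\<bar> powr p) * indicator \<Omega> x \<partial>lborel) \<le> ennreal ((1 / 2) ^ n)"
      unfolding eW using p by (subst (asm) epowr_le_iff) auto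
    moreover have "energy p \<Omega> (\<lambda>x. u x - \<phi> k x) = energy p \<Omega> (\<lambda>x. v x - \<phi> k x)"
      by (rule energy_cong_AE, rule eventually_mono[OF uv]) auto
    moreover have "(\<integral>\<^sup>+x. ennreal (\<bar>u x - \<phi> k x\<bar> powr p) * indicator \<Omega> x \<partial>lborel) = (\<integral>\<^sup>+x. ennreal (\<bar>v x - \<phi> k x\<bar> powr p) * indicator \<Omega> x \<partial>lborel)"
      by (rule nn_integral_lborel_cong_lebesgue_AE, rule eventually_mono[OF uv]) (auto split: split_indicator)
    ultimately have "energy p \<Omega> (\<lambda>x. v x - \<phi> k x) + (\<integral>\<^sup>+x. ennreal (\<bar>v x - \<phi> k x\<bar> powr p) * indicator \<Omega> x \<partial>lborel) \<le> ennreal ((1 / 2) ^ n)"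
      by simp
    note sum_le = this
    show ?thesis
      by (rule exI[of _ k], rule conjI; rule order_trans[OF _ sum_le]) (simp_all add: add_increasing add_increasing2)
  qed
  then obtain K where "\<And>n. energy p \<Omega> (\<lambda>x. v x - \<phi> (K n) x) \<le> ennreal ((1 / 2) ^ n) \<and>
      (\<integral>\<^sup>+x. ennreal (\<bar>v x - \<phi> (K n) x\<bar> powr p) * indicator \<Omega> x \<partial>lborel) \<le> ennreal ((1 / 2) ^ n)"
    by metis
  then show ?thesis using that[of v "\<lambda>n. \<phi> (K n)"] vm uv \<phi>(1) by blast
qed

lemma AE_tendsto_of_summable_Lp:
  fixes v :: "'a::euclidean_space \<Rightarrow> real"
  assumes [measurable]: "v \<in> borel_measurable borel" "\<And>n. \<psi> n \<in> borel_measurable borel" "\<Omega> \<in> sets borel"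
    and p: "p > 0" and le: "\<And>n. (\<integral>\<^sup>+x. ennreal (\<bar>v x - \<psi> n x\<bar> powr p) * indicator \<Omega> x \<partial>lborel) \<le> ennreal ((1 / 2) ^ n)"
  shows "AE x in lborel. x \<in> \<Omega> \<longrightarrow> (\<lambda>n. \<psi> n x) \<longlonglongrightarrow> v x"
proof -
  have "(\<integral>\<^sup>+x. (\<Sum>n. ennreal (\<bar>v x - \<psi> n x\<bar> powr p) * indicator \<Omega> x) \<partial>lborel)
     = (\<Sum>n. \<integral>\<^sup>+x. ennreal (\<bar>v x - \<psi> n x\<bar> powr p) * indicator \<Omega> x \<partial>lborel)"
    by (rule nn_integral_suminf) measurable
  also have "\<dots> \<le> (\<Sum>n. ennreal ((1 / 2) ^ n))" by (intro suminf_le le) auto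
  also have "\<dots> = ennreal (\<Sum>n. (1 / 2) ^ n)" by (intro suminf_ennreal2 summable_geometric) auto
  also have "\<dots> < \<infinity>" by simp
  finally have "AE x in lborel. (\<Sum>n. ennreal (\<bar>v x - \<psi> n x\<bar> powr p) * indicator \<Omega> x) \<noteq> \<infinity>"
    by (intro nn_integral_PInf_AE) auto
  then show ?thesis
  proof (rule eventually_mono, intro impI)
    fix x assume fin: "(\<Sum>n. ennreal (\<bar>v x - \<psi> n x\<bar> powr p) * indicator \<Omega> x) \<noteq> \<infinity>" and x: "x \<in> \<Omega>"
    have "summable (\<lambda>n. \<bar>v x - \<psi> n x\<bar> powr p)"
      using fin x by (intro summable_suminf_not_top) auto
    then have "(\<lambda>n. \<bar>v x - \<psi> n x\<bar> powr p) \<longlonglongrightarrow> 0" by (rule summable_LIMSEQ_zero)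
    then have "(\<lambda>n. (\<bar>v x - \<psi> n x\<bar> powr p) powr (1 / p)) \<longlonglongrightarrow> 0"
      by (rule tendsto_zero_powrI[OF _ tendsto_const]) (use p in auto)
    then have "(\<lambda>n. \<bar>v x - \<psi> n x\<bar>) \<longlonglongrightarrow> 0" using p by (simp add: powr_powr)
    then have "(\<lambda>n. v x - \<psi> n x) \<longlonglongrightarrow> 0" by (simp add: tendsto_rabs_zero_iff)
    from tendsto_diff[OF tendsto_const[of "v x"] this] show "(\<lambda>n. \<psi> n x) \<longlonglongrightarrow> v x" by simp
  qed
qed

lemma average_cong_AE:
  assumes \<Omega>: "\<Omega> \<in> sets lebesgue" and "AE x in lebesgue. x \<in> \<Omega> \<longrightarrow> u x = v x"
    and "u \<in> borel_measurable (lebesgue_on \<Omega>)" "v \<in> borel_measurable (lebesgue_on \<Omega>)"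
  shows "average \<Omega> u = average \<Omega> v"
proof -
  have "AE x in lebesgue_on \<Omega>. u x = v x"
    using assms(1,2) by (subst AE_restrict_space_iff) auto
  then have "(\<integral>x. u x \<partial>lebesgue_on \<Omega>) = (\<integral>x. v x \<partial>lebesgue_on \<Omega>)"
    by (intro integral_cong_AE assms)
  then show ?thesis by (simp add: average_def)
qed

text \<open>From $|t| \le \varepsilon + \varepsilon^{1-p}|t|^p$, convergence in $L^p$ on a set of finite measure implies
convergence in $L^1$.\<close>

lemma average_tendsto:
  fixes v :: "'a::euclidean_space \<Rightarrow> real"
  assumes \<Omega>: "open \<Omega>" "bounded \<Omega>" and p: "p > 1"
    and [measurable]: "v \<in> borel_measurable borel" and \<psi>: "\<And>n. \<psi> n \<in> test_functions \<Omega>"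
    and le: "\<And>n. (\<integral>\<^sup>+x. ennreal (\<bar>v x - \<psi> n x\<bar> powr p) * indicator \<Omega> x \<partial>lborel) \<le> ennreal ((1 / 2) ^ n)"
  shows "(\<lambda>n. average \<Omega> (\<psi> n)) \<longlonglongrightarrow> average \<Omega> v"
proof -
  have lm: "\<Omega> \<in> lmeasurable" using \<Omega> by (simp add: lmeasurable_open)
  have ms: "\<Omega> \<in> sets lebesgue" using \<Omega> by auto
  have [measurable]: "\<Omega> \<in> sets borel" using \<Omega> by simp
  interpret finite_measure "lebesgue_on \<Omega>" by (rule finite_measure_lebesgue_on[OF lm])
  have meas: "f \<in> borel_measurable borel \<Longrightarrow> f \<in> borel_measurable (lebesgue_on \<Omega>)" for f :: "'a \<Rightarrow> real"
    by (intro measurable_restrict_space1 measurable_completion) simp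
  have [measurable]: "\<psi> n \<in> borel_measurable borel" for n by (rule test_function_measurable[OF \<psi>])
  have int\<psi>: "integrable (lebesgue_on \<Omega>) (\<psi> n)" for n
  proof -
    obtain M where "\<And>x. \<bar>\<psi> n x\<bar> \<le> M" using test_function_bounded[OF \<psi>] by blast
    then show ?thesis by (intro integrable_const_bound[where B=M]) (auto intro!: meas)
  qed
  define V where "V = measure lborel \<Omega>"
  have V: "emeasure lborel \<Omega> = ennreal V" "V \<ge> 0"
    unfolding V_def using emeasure_bounded_finite[OF \<Omega>(2)] by (auto intro!: emeasure_eq_ennreal_measure)
  have L1: "(\<integral>\<^sup>+x. ennreal (norm (\<psi> n x - v x)) \<partial>lebesgue_on \<Omega>) \<le> ennreal (\<epsilon> * V + \<epsilon> powr (1 - p) * (1 / 2) ^ n)" if \<epsilon>: "\<epsilon> > 0" for n \<epsilon>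
  proof -
    have pt: "\<bar>t\<bar> \<le> \<epsilon> + \<epsilon> powr (1 - p) * \<bar>t\<bar> powr p" for t :: real
    proof (cases "\<bar>t\<bar> \<le> \<epsilon>")
      case False
      then have "\<bar>t\<bar> = \<bar>t\<bar> powr (1 - p) * \<bar>t\<bar> powr p" using \<epsilon> by (simp add: powr_add[symmetric])
      also have "\<dots> \<le> \<epsilon> powr (1 - p) * \<bar>t\<bar> powr p"
        using False \<epsilon> p by (intro mult_right_mono powr_mono2') auto
      finally show ?thesis using \<epsilon> by simp
    qed (simp add: add_increasing2)
    have "(\<integral>\<^sup>+x. ennreal (norm (\<psi> n x - v x)) \<partial>lebesgue_on \<Omega>) = (\<integral>\<^sup>+x. ennreal (\<bar>\<psi> n x - v x\<bar>) * indicator \<Omega> x \<partial>lborel)"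
      by (simp add: nn_integral_lebesgue_on[OF ms])
    also have "\<dots> \<le> (\<integral>\<^sup>+x. ennreal \<epsilon> * indicator \<Omega> x + ennreal (\<epsilon> powr (1 - p)) * (ennreal (\<bar>v x - \<psi> n x\<bar> powr p) * indicator \<Omega> x) \<partial>lborel)"
    proof (rule nn_integral_mono)
      fix x
      have "ennreal \<bar>\<psi> n x - v x\<bar> \<le> ennreal (\<epsilon> + \<epsilon> powr (1 - p) * \<bar>v x - \<psi> n x\<bar> powr p)"
        using pt[of "\<psi> n x - v x"] by (intro ennreal_leI) (simp add: abs_minus_commute)
      also have "\<dots> = ennreal \<epsilon> + ennreal (\<epsilon> powr (1 - p)) * ennreal (\<bar>v x - \<psi> n x\<bar> powr p)"
        using \<epsilon> by (simp add: ennreal_plus ennreal_mult')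
      finally show "ennreal \<bar>\<psi> n x - v x\<bar> * indicator \<Omega> x \<le> ennreal \<epsilon> * indicator \<Omega> x + ennreal (\<epsilon> powr (1 - p)) * (ennreal (\<bar>v x - \<psi> n x\<bar> powr p) * indicator \<Omega> x)"
        by (cases "x \<in> \<Omega>") auto
    qed
    also have "\<dots> = ennreal \<epsilon> * ennreal V + ennreal (\<epsilon> powr (1 - p)) * (\<integral>\<^sup>+x. ennreal (\<bar>v x - \<psi> n x\<bar> powr p) * indicator \<Omega> x \<partial>lborel)"
      by (simp add: nn_integral_add nn_integral_cmult nn_integral_cmult_indicator V)
    also have "\<dots> \<le> ennreal \<epsilon> * ennreal V + ennreal (\<epsilon> powr (1 - p)) * ennreal ((1 / 2) ^ n)"
      by (intro add_left_mono mult_left_mono le) auto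
    also have "\<dots> = ennreal (\<epsilon> * V + \<epsilon> powr (1 - p) * (1 / 2) ^ n)"
    proof -
      have "ennreal (\<epsilon> * V + \<epsilon> powr (1 - p) * (1 / 2) ^ n) = ennreal (\<epsilon> * V) + ennreal (\<epsilon> powr (1 - p) * (1 / 2) ^ n)"
        using \<epsilon> V by (intro ennreal_plus) auto
      then show ?thesis using \<epsilon> by (simp add: ennreal_mult')
    qed
    finally show ?thesis .
  qed
  have "(\<integral>\<^sup>+x. ennreal (norm (\<psi> 0 x - v x)) \<partial>lebesgue_on \<Omega>) < \<infinity>"
    using L1[of 1 0] by (auto simp: le_less_trans)
  then have "integrable (lebesgue_on \<Omega>) (\<lambda>x. \<psi> 0 x - v x)"
    by (intro integrableI_bounded meas) auto
  from Bochner_Integration.integrable_diff[OF int\<psi>[of 0] this] have intv: "integrable (lebesgue_on \<Omega>) v" by simp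
  have "(\<lambda>n. \<integral>\<^sup>+x. ennreal (norm (\<psi> n x - v x)) \<partial>lebesgue_on \<Omega>) \<longlonglongrightarrow> 0"
  proof (rule order_tendstoI)
    fix a :: ennreal assume a: "0 < a"
    obtain e where e: "0 < e" "e < a" using dense[OF a] by blast
    then obtain b where b: "0 < b" "ennreal b < a"
      by (cases e) auto
    define \<epsilon> where "\<epsilon> = b / (2 * (V + 1))"
    have \<epsilon>: "\<epsilon> > 0" using b V by (simp add: \<epsilon>_def)
    have "\<epsilon> * V \<le> b / 2"
    proof -
      have "\<epsilon> * V \<le> \<epsilon> * (V + 1)" using \<epsilon> by simp
      also have "\<dots> = b / 2"
      proof -
        have "V + 1 \<noteq> 0" using V by simp
        then show ?thesis unfolding \<epsilon>_def by (simp add: divide_simps)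
      qed
      finally show ?thesis .
    qed
    moreover have "(\<lambda>n. \<epsilon> powr (1 - p) * (1 / 2) ^ n) \<longlonglongrightarrow> \<epsilon> powr (1 - p) * 0"
      by (intro tendsto_mult tendsto_const LIMSEQ_realpow_zero) auto
    then have "\<forall>\<^sub>F n in sequentially. \<epsilon> powr (1 - p) * (1 / 2) ^ n < b / 2"
      using b by (intro order_tendstoD(2)) auto
    then show "\<forall>\<^sub>F n in sequentially. (\<integral>\<^sup>+x. ennreal (norm (\<psi> n x - v x)) \<partial>lebesgue_on \<Omega>) < a"
    proof (rule eventually_mono)
      fix n assume "\<epsilon> powr (1 - p) * (1 / 2) ^ n < b / 2"
      then have "\<epsilon> * V + \<epsilon> powr (1 - p) * (1 / 2) ^ n \<le> b" using \<open>\<epsilon> * V \<le> b / 2\<close> by simp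
      then have "ennreal (\<epsilon> * V + \<epsilon> powr (1 - p) * (1 / 2) ^ n) \<le> ennreal b" by (rule ennreal_leI)
      then show "(\<integral>\<^sup>+x. ennreal (norm (\<psi> n x - v x)) \<partial>lebesgue_on \<Omega>) < a"
        using L1[OF \<epsilon>, of n] b(2) by (meson order_le_less_trans order_trans)
    qed
  qed auto
  then have "(\<lambda>n. \<integral>x. \<psi> n x \<partial>lebesgue_on \<Omega>) \<longlonglongrightarrow> (\<integral>x. v x \<partial>lebesgue_on \<Omega>)"
    by (intro tendsto_L1_int int\<psi> intv) auto
  then show ?thesis unfolding average_def by (intro tendsto_mult tendsto_const)
qed

text \<open>The test functions that approximate $u$ may have energy slightly above $1$, but at most
$2^p(1 + 1)$ by the quasi-triangle inequality; hence the bound on test functions is needed at that level. The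
integrands converge almost everywhere, and Fatou's lemma applies.\<close>

lemma hardy_exp_integral_W0_le:
  fixes \<Omega> :: "'a::euclidean_space set"
  assumes \<Omega>: "open \<Omega>" "bounded \<Omega>" and p: "p > 1" "0 < s" "s * p = real DIM('a)" and \<alpha>: "\<alpha> \<ge> 0"
    and test: "\<And>\<phi>. \<phi> \<in> test_functions \<Omega> \<Longrightarrow> energy p \<Omega> \<phi> \<le> ennreal (2 * 2 powr p) \<Longrightarrow> hardy_exp_integral s n0 \<alpha> \<Omega> \<phi> \<le> ennreal C"
    and u: "u \<in> W0_space s p \<Omega>" "gagliardo_seminorm s p \<Omega> u \<le> 1"
  shows "hardy_exp_integral s n0 \<alpha> \<Omega> u \<le> ennreal C"
proof -
  have ms: "\<Omega> \<in> sets lebesgue" using \<Omega> by auto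
  have [measurable]: "\<Omega> \<in> sets borel" using \<Omega> by simp
  have meas: "f \<in> borel_measurable borel \<Longrightarrow> f \<in> borel_measurable (lebesgue_on \<Omega>)" for f :: "'a \<Rightarrow> real"
    by (intro measurable_restrict_space1 measurable_completion) simp
  obtain v \<psi> where v[measurable]: "v \<in> borel_measurable borel" and uv: "AE x in lebesgue. x \<in> \<Omega> \<longrightarrow> u x = v x"
    and \<psi>: "\<And>n. \<psi> n \<in> test_functions \<Omega>"
    and en: "\<And>n. energy p \<Omega> (\<lambda>x. v x - \<psi> n x) \<le> ennreal ((1 / 2) ^ n)"
    and Lp: "\<And>n. (\<integral>\<^sup>+x. ennreal (\<bar>v x - \<psi> n x\<bar> powr p) * indicator \<Omega> x \<partial>lborel) \<le> ennreal ((1 / 2) ^ n)"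
    using W0_space_approx[OF \<Omega>(1) p(1,3) u(1)] by blast
  have [measurable]: "\<psi> n \<in> borel_measurable borel" for n by (rule test_function_measurable[OF \<psi>])
  have ev: "energy p \<Omega> v \<le> 1"
    using u(2) gagliardo_seminorm_le_1_iff[OF ms p(3), of u] energy_cong_AE[OF uv, of p] p(1) by simp
  have e\<psi>: "energy p \<Omega> (\<psi> n) \<le> ennreal (2 * 2 powr p)" for n
  proof -
    have "energy p \<Omega> (\<psi> n) = energy p \<Omega> (\<lambda>x. v x + (- 1) * (v x - \<psi> n x))" by simp
    also have "\<dots> \<le> ennreal (2 powr p) * (energy p \<Omega> v + energy p \<Omega> (\<lambda>x. (- 1) * (v x - \<psi> n x)))"
      using p(1) by (intro energy_add_le) auto
    also have "energy p \<Omega> (\<lambda>x. (- 1) * (v x - \<psi> n x)) = energy p \<Omega> (\<lambda>x. v x - \<psi> n x)"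
      unfolding energy_def by (simp add: abs_minus_commute algebra_simps)
    also have "ennreal (2 powr p) * (energy p \<Omega> v + energy p \<Omega> (\<lambda>x. v x - \<psi> n x)) \<le> ennreal (2 powr p) * (1 + 1)"
    proof (intro mult_left_mono add_mono ev)
      have "ennreal ((1 / 2) ^ n) \<le> ennreal 1" by (intro ennreal_leI power_le_one) auto
      then show "energy p \<Omega> (\<lambda>x. v x - \<psi> n x) \<le> 1" using en[of n] by (simp add: order_trans)
    qed auto
    also have "\<dots> = ennreal (2 * 2 powr p)" by (simp add: ennreal_mult' mult.commute)
    finally show ?thesis .
  qed
  have Xv: "AE x in lebesgue. x \<in> \<Omega> \<longrightarrow> X_fun \<Omega> u x = X_fun \<Omega> v x"
  proof -
    have "average \<Omega> u = average \<Omega> v"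
    proof -
      have "u \<in> borel_measurable (lebesgue_on \<Omega>)" using u(1) by (auto simp: W0_space_def W_space_def)
      then show ?thesis by (rule average_cong_AE[OF ms uv _ meas[OF v]])
    qed
    then show ?thesis using uv by (auto elim: eventually_mono simp: X_fun_def)
  qed
  let ?f = "\<lambda>w x. ennreal (Phi n0 (\<alpha> * X_fun \<Omega> w x powr (p / (p - 1))) / bdist \<Omega> x ^ DIM('a)) * indicator \<Omega> x"
  have hardy: "hardy_exp_integral s n0 \<alpha> \<Omega> w = (\<integral>\<^sup>+x. ?f w x \<partial>lborel)" for w
    unfolding hardy_exp_integral_def Let_def conjugate_exponent(1)[OF p] by (rule nn_integral_lebesgue_on[OF ms])
  have X_meas: "X_fun \<Omega> w \<in> borel_measurable borel" if [measurable]: "w \<in> borel_measurable borel" for w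
    unfolding X_fun_def[abs_def] by measurable
  have Phi_meas[measurable]: "Phi n0 \<in> borel_measurable borel"
    by (rule borel_measurable_continuous_onI[OF continuous_Phi])
  have f_meas: "?f w \<in> borel_measurable lborel" if "w \<in> borel_measurable borel" for w
    using X_meas[OF that] by measurable
  have p': "p / (p - 1) > 0" using p by simp
  have lim: "AE x in lborel. (\<lambda>n. ?f (\<psi> n) x) \<longlonglongrightarrow> ?f v x"
  proof (rule eventually_mono[OF AE_tendsto_of_summable_Lp[OF v _ _ _ Lp]])
    fix x assume x: "x \<in> \<Omega> \<longrightarrow> (\<lambda>n. \<psi> n x) \<longlonglongrightarrow> v x"
    show "(\<lambda>n. ?f (\<psi> n) x) \<longlonglongrightarrow> ?f v x"
    proof (cases "x \<in> \<Omega>")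
      case True
      have avg: "(\<lambda>n. average \<Omega> (\<psi> n)) \<longlonglongrightarrow> average \<Omega> v" by (rule average_tendsto[OF \<Omega> p(1) v \<psi> Lp])
      have Xlim: "(\<lambda>n. X_fun \<Omega> (\<psi> n) x) \<longlonglongrightarrow> X_fun \<Omega> v x"
      proof (cases "DIM('a) = 1")
        case 1: True
        show ?thesis unfolding X_fun_def if_P[OF 1] divide_inverse
          by (intro tendsto_mult tendsto_const tendsto_rabs tendsto_diff avg) (use x True in simp)
      next
        case False
        show ?thesis unfolding X_fun_def if_not_P[OF False] by (intro tendsto_rabs) (use x True in simp)
      qed
      have X_nonneg: "0 \<le> X_fun \<Omega> w x" for w
      proof -
        have "bdist \<Omega> x > 0" "bdist \<Omega> x \<le> inradius \<Omega>" using bdist_pos[OF \<Omega> True] bdist_le_inradius[OF \<Omega>(2) True] by auto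
        then have "0 \<le> ln (2 * inradius \<Omega> / bdist \<Omega> x)" by (intro ln_ge_zero) (simp add: le_divide_eq)
        then show ?thesis by (simp add: X_fun_def)
      qed
      have "(\<lambda>n. X_fun \<Omega> (\<psi> n) x powr (p / (p - 1))) \<longlonglongrightarrow> X_fun \<Omega> v x powr (p / (p - 1))"
        using p' X_nonneg by (intro tendsto_powr2[OF Xlim tendsto_const]) auto
      then have "(\<lambda>n. \<alpha> * X_fun \<Omega> (\<psi> n) x powr (p / (p - 1))) \<longlonglongrightarrow> \<alpha> * X_fun \<Omega> v x powr (p / (p - 1))"
        by (intro tendsto_mult tendsto_const)
      moreover have "isCont (Phi n0) a" for a
        using continuous_Phi by (simp add: continuous_on_eq_continuous_at)
      ultimately have "(\<lambda>n. Phi n0 (\<alpha> * X_fun \<Omega> (\<psi> n) x powr (p / (p - 1)))) \<longlonglongrightarrow> Phi n0 (\<alpha> * X_fun \<Omega> v x powr (p / (p - 1)))"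
        by (rule isCont_tendsto_compose[rotated])
      then have "(\<lambda>n. Phi n0 (\<alpha> * X_fun \<Omega> (\<psi> n) x powr (p / (p - 1))) / bdist \<Omega> x ^ DIM('a)) \<longlonglongrightarrow> Phi n0 (\<alpha> * X_fun \<Omega> v x powr (p / (p - 1))) / bdist \<Omega> x ^ DIM('a)"
        unfolding divide_inverse by (intro tendsto_mult tendsto_const)
      then show ?thesis using True by (simp add: tendsto_ennrealI)
    qed simp
  qed (use p in auto)
  have "hardy_exp_integral s n0 \<alpha> \<Omega> u = (\<integral>\<^sup>+x. ?f v x \<partial>lborel)"
    unfolding hardy
    by (rule nn_integral_lborel_cong_lebesgue_AE, rule eventually_mono[OF Xv]) (auto split: split_indicator)
  also have "\<dots> = (\<integral>\<^sup>+x. liminf (\<lambda>n. ?f (\<psi> n) x) \<partial>lborel)"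
    by (rule nn_integral_cong_AE, rule eventually_mono[OF lim]) (simp add: lim_imp_Liminf)
  also have "\<dots> \<le> liminf (\<lambda>n. \<integral>\<^sup>+x. ?f (\<psi> n) x \<partial>lborel)"
    by (rule nn_integral_liminf) (rule f_meas, measurable)
  also have "\<dots> \<le> ennreal C"
  proof -
    have "(\<integral>\<^sup>+x. ?f (\<psi> n) x \<partial>lborel) \<le> ennreal C" for n using test[OF \<psi> e\<psi>, of n] by (simp add: hardy)
    then have "limsup (\<lambda>n. \<integral>\<^sup>+x. ?f (\<psi> n) x \<partial>lborel) \<le> ennreal C" by (intro Limsup_bounded always_eventually) auto
    then show ?thesis by (meson Liminf_le_Limsup order_trans sequentially_bot)
  qed
  finally show ?thesis .
qed

text \<open>Each of the terms $t^n/n!$ with $n < n_0$ is at most $1 + t^{n_0} \le 1 + n_0!\,\Phi_{n_0}(t)$, and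
$\delta \le R$.\<close>

lemma full_exp_integral_le:
  fixes \<Omega> :: "'a::euclidean_space set"
  assumes \<Omega>: "open \<Omega>" "bounded \<Omega>" "\<Omega> \<noteq> {}" and p: "p > 1" "0 < s" "s * p = real DIM('a)" and \<alpha>: "\<alpha> \<ge> 0"
    and um: "u \<in> borel_measurable (lebesgue_on \<Omega>)"
  shows "full_exp_integral s n0 \<alpha> \<Omega> u \<le> ennreal (real n0 * measure lborel \<Omega>)
     + ennreal (real n0 * fact n0 * inradius \<Omega> ^ DIM('a) + 1) * hardy_exp_integral s n0 \<alpha> \<Omega> u"
proof -
  have ms: "\<Omega> \<in> sets lebesgue" using \<Omega> by auto
  have [measurable]: "\<Omega> \<in> sets borel" using \<Omega> by simp
  let ?R = "inradius \<Omega>" and ?q = "real n0 * fact n0 * inradius \<Omega> ^ DIM('a) + 1"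
  have R: "?R > 0"
  proof -
    obtain x where "x \<in> \<Omega>" using \<Omega>(3) by blast
    then show ?thesis
      using bdist_pos[OF \<Omega>(1,2)] bdist_le_inradius[OF \<Omega>(2)] less_le_trans by blast
  qed
  have q: "?q \<ge> 0" using R by simp
  let ?a = "\<lambda>x. \<alpha> * X_fun \<Omega> u x powr (p / (p - 1))"
  have bm: "bdist \<Omega> \<in> borel_measurable (lebesgue_on \<Omega>)"
    by (intro measurable_restrict_space1 measurable_completion) simp
  have pt: "(\<Sum>n<n0. \<alpha> ^ n * (X_fun \<Omega> u x powr (p / (p - 1))) ^ n / fact n) + Phi n0 (?a x) / bdist \<Omega> x ^ DIM('a)
     \<le> real n0 + ?q * (Phi n0 (?a x) / bdist \<Omega> x ^ DIM('a))" if x: "x \<in> \<Omega>" for x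
  proof -
    have a0: "?a x \<ge> 0" using \<alpha> by simp
    have \<delta>: "bdist \<Omega> x > 0" "bdist \<Omega> x \<le> ?R" using bdist_pos[OF \<Omega>(1,2) x] bdist_le_inradius[OF \<Omega>(2) x] by auto
    have low: "?a x ^ n0 / fact n0 \<le> Phi n0 (?a x)"
    proof -
      have "(\<Sum>k\<in>{0}. ?a x ^ (k + n0) / fact (k + n0)) \<le> (\<Sum>k. ?a x ^ (k + n0) / fact (k + n0))"
        using Phi_eq_suminf[of "?a x" n0] a0 by (intro sum_le_suminf) (auto simp: sums_iff)
      then show ?thesis using Phi_eq_suminf[of "?a x" n0] by (simp add: sums_iff)
    qed
    have "(\<Sum>n<n0. \<alpha> ^ n * (X_fun \<Omega> u x powr (p / (p - 1))) ^ n / fact n) = (\<Sum>n<n0. ?a x ^ n / fact n)"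
      by (simp add: power_mult_distrib)
    also have "\<dots> \<le> (\<Sum>n<n0. 1 + fact n0 * Phi n0 (?a x))"
    proof (rule sum_mono)
      fix n assume n: "n \<in> {..<n0}"
      have "?a x ^ n / fact n \<le> ?a x ^ n / 1" using a0 by (intro divide_left_mono) auto
      also have "?a x ^ n / 1 \<le> 1 + ?a x ^ n0"
      proof (cases "?a x \<le> 1")
        case True
        then have "?a x ^ n \<le> 1" using a0 by (intro power_le_one) auto
        then show ?thesis using a0 by (simp add: add_increasing2)
      next
        case False
        then have "?a x ^ n \<le> ?a x ^ n0" using n by (intro power_increasing) auto
        then show ?thesis by simp
      qed
      also have "\<dots> \<le> 1 + fact n0 * Phi n0 (?a x)" using low by (simp add: pos_divide_le_eq mult.commute)
      finally show "?a x ^ n / fact n \<le> 1 + fact n0 * Phi n0 (?a x)" .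
    qed
    also have "\<dots> = real n0 + real n0 * fact n0 * Phi n0 (?a x)" by (simp add: algebra_simps)
    also have "\<dots> \<le> real n0 + real n0 * fact n0 * (?R ^ DIM('a) * (Phi n0 (?a x) / bdist \<Omega> x ^ DIM('a)))"
    proof (intro add_left_mono mult_left_mono)
      have "bdist \<Omega> x ^ DIM('a) \<le> ?R ^ DIM('a)" using \<delta> by (intro power_mono) auto
      then have "Phi n0 (?a x) / bdist \<Omega> x ^ DIM('a) * bdist \<Omega> x ^ DIM('a) \<le> Phi n0 (?a x) / bdist \<Omega> x ^ DIM('a) * ?R ^ DIM('a)"
        using \<delta> Phi_nonneg[OF a0, of n0] by (intro mult_left_mono) auto
      then show "Phi n0 (?a x) \<le> ?R ^ DIM('a) * (Phi n0 (?a x) / bdist \<Omega> x ^ DIM('a))" using \<delta> by (simp add: mult.commute)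
    qed auto
    finally have "(\<Sum>n<n0. \<alpha> ^ n * (X_fun \<Omega> u x powr (p / (p - 1))) ^ n / fact n)
        \<le> real n0 + real n0 * fact n0 * (?R ^ DIM('a) * (Phi n0 (?a x) / bdist \<Omega> x ^ DIM('a)))" .
    then have "(\<Sum>n<n0. \<alpha> ^ n * (X_fun \<Omega> u x powr (p / (p - 1))) ^ n / fact n) + Phi n0 (?a x) / bdist \<Omega> x ^ DIM('a)
        \<le> real n0 + real n0 * fact n0 * (?R ^ DIM('a) * (Phi n0 (?a x) / bdist \<Omega> x ^ DIM('a))) + Phi n0 (?a x) / bdist \<Omega> x ^ DIM('a)"
      by (rule add_right_mono)
    also have "\<dots> = real n0 + ?q * (Phi n0 (?a x) / bdist \<Omega> x ^ DIM('a))"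
      by (simp only: distrib_right mult_1_left mult.assoc add.assoc)
    finally show ?thesis .
  qed
  have hn: "0 \<le> Phi n0 (?a x) / bdist \<Omega> x ^ DIM('a)" for x
    using \<alpha> by (intro divide_nonneg_nonneg Phi_nonneg) (auto simp: bdist_def infdist_nonneg)
  have sp: "space (lebesgue_on \<Omega>) = \<Omega>" by simp
  have Xm: "X_fun \<Omega> u \<in> borel_measurable (lebesgue_on \<Omega>)"
    unfolding X_fun_def[abs_def] using um bm by measurable
  have hm: "(\<lambda>x. ennreal (Phi n0 (?a x) / bdist \<Omega> x ^ DIM('a))) \<in> borel_measurable (lebesgue_on \<Omega>)"
    using Xm bm borel_measurable_continuous_onI[OF continuous_Phi] by measurable
  have "full_exp_integral s n0 \<alpha> \<Omega> u \<le> (\<integral>\<^sup>+x. ennreal (real n0) + ennreal ?q * ennreal (Phi n0 (?a x) / bdist \<Omega> x ^ DIM('a)) \<partial>lebesgue_on \<Omega>)"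
    unfolding full_exp_integral_def Let_def conjugate_exponent(1)[OF p]
  proof (rule nn_integral_mono)
    fix x assume "x \<in> space (lebesgue_on \<Omega>)"
    then have x: "x \<in> \<Omega>" by simp
    have "ennreal ((\<Sum>n<n0. \<alpha> ^ n * (X_fun \<Omega> u x powr (p / (p - 1))) ^ n / fact n) + Phi n0 (?a x) / bdist \<Omega> x ^ DIM('a))
      \<le> ennreal (real n0 + ?q * (Phi n0 (?a x) / bdist \<Omega> x ^ DIM('a)))" by (rule ennreal_leI[OF pt[OF x]])
    also have "\<dots> = ennreal (real n0) + ennreal (?q * (Phi n0 (?a x) / bdist \<Omega> x ^ DIM('a)))"
      using q hn[of x] by (intro ennreal_plus mult_nonneg_nonneg) auto
    also have "ennreal (?q * (Phi n0 (?a x) / bdist \<Omega> x ^ DIM('a))) = ennreal ?q * ennreal (Phi n0 (?a x) / bdist \<Omega> x ^ DIM('a))"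
      using q by (rule ennreal_mult')
    finally show "ennreal ((\<Sum>n<n0. \<alpha> ^ n * (X_fun \<Omega> u x powr (p / (p - 1))) ^ n / fact n) + Phi n0 (?a x) / bdist \<Omega> x ^ DIM('a))
      \<le> ennreal (real n0) + ennreal ?q * ennreal (Phi n0 (?a x) / bdist \<Omega> x ^ DIM('a))" .
  qed
  also have "\<dots> = (\<integral>\<^sup>+x. ennreal (real n0) \<partial>lebesgue_on \<Omega>) + ennreal ?q * (\<integral>\<^sup>+x. ennreal (Phi n0 (?a x) / bdist \<Omega> x ^ DIM('a)) \<partial>lebesgue_on \<Omega>)"
    using hm by (simp add: nn_integral_add nn_integral_cmult del: nn_integral_const)
  also have "(\<integral>\<^sup>+x. ennreal (real n0) \<partial>lebesgue_on \<Omega>) = ennreal (real n0 * measure lborel \<Omega>)"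
  proof -
    have "(\<integral>\<^sup>+x. ennreal (real n0) \<partial>lebesgue_on \<Omega>) = (\<integral>\<^sup>+x. ennreal (real n0) * indicator \<Omega> x \<partial>lborel)"
      by (rule nn_integral_lebesgue_on[OF ms])
    also have "\<dots> = ennreal (real n0) * emeasure lborel \<Omega>" by (rule nn_integral_cmult_indicator) simp
    also have "emeasure lborel \<Omega> = ennreal (measure lborel \<Omega>)"
      using emeasure_bounded_finite[OF \<Omega>(2)] by (intro emeasure_eq_ennreal_measure) auto
    finally show ?thesis by (simp add: ennreal_mult')
  qed
  also have "(\<integral>\<^sup>+x. ennreal (Phi n0 (?a x) / bdist \<Omega> x ^ DIM('a)) \<partial>lebesgue_on \<Omega>) = hardy_exp_integral s n0 \<alpha> \<Omega> u"
    unfolding hardy_exp_integral_def Let_def conjugate_exponent(1)[OF p] ..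
  finally show ?thesis .
qed

section \<open>Exponential integrability\<close>

text \<open>The two cases of the definition of $X_d$ are the same statement with different centre and weight. For
$d = 1$ the weight $\ln(2R/\delta)$ is at least $\ln 2$, and halving $\delta$ adds $\ln 2$, so it at most doubles.\<close>

lemma test_function_exp_bound:
  fixes \<Omega> :: "'a::euclidean_space set"
  assumes \<Omega>: "bounded_lipschitz_domain \<Omega>"
    and p: "p > 1" "0 < s" "s * p = real DIM('a)" "real n0 \<ge> p - 1" and Q: "Q \<ge> 0"
  obtains \<alpha>0 C where "\<alpha>0 > 0"
    "\<And>\<phi> \<alpha>. \<phi> \<in> test_functions \<Omega> \<Longrightarrow> energy p \<Omega> \<phi> \<le> ennreal Q \<Longrightarrow> 0 \<le> \<alpha> \<Longrightarrow> \<alpha> \<le> \<alpha>0 \<Longrightarrow>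
       hardy_exp_integral s n0 \<alpha> \<Omega> \<phi> \<le> ennreal C"
proof -
  have dom: "open \<Omega>" "connected \<Omega>" "\<Omega> \<noteq> {}" "bounded \<Omega>"
    using \<Omega> by (auto simp: bounded_lipschitz_domain_def)
  have ms: "\<Omega> \<in> sets lebesgue" using dom by auto
  define P where "P A w w0 CH \<longleftrightarrow> 0 < w0 \<and> 0 \<le> CH \<and> w \<in> borel_measurable borel \<and> (\<forall>x\<in>\<Omega>. w0 \<le> w x) \<and>
      (\<forall>x\<in>\<Omega>. \<forall>y\<in>\<Omega>. dist y x < bdist \<Omega> x / 2 \<longrightarrow> w y \<le> 2 * w x) \<and>
      (\<forall>\<phi>. X_fun \<Omega> \<phi> = (\<lambda>x. \<bar>\<phi> x - A \<phi>\<bar> / w x)) \<and>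
      (\<forall>\<phi>\<in>test_functions \<Omega>. (\<integral>\<^sup>+x. ennreal (\<bar>\<phi> x - A \<phi>\<bar> powr p / (bdist \<Omega> x ^ DIM('a) * w x powr p)) * indicator \<Omega> x \<partial>lborel)
         \<le> ennreal CH * energy p \<Omega> \<phi>)" for A w w0 CH
  have "\<exists>A w w0 CH. P A w w0 CH"
  proof (cases "DIM('a) = 1")
    case True
    obtain CH where CH: "CH \<ge> 0" "\<And>\<phi>. \<phi> \<in> test_functions \<Omega> \<Longrightarrow>
       (\<integral>\<^sup>+x. ennreal (\<bar>\<phi> x - average \<Omega> \<phi>\<bar> powr p / (bdist \<Omega> x ^ DIM('a) * ln (2 * inradius \<Omega> / bdist \<Omega> x) powr p)) * indicator \<Omega> x \<partial>lborel)
         \<le> ennreal CH * energy p \<Omega> \<phi>"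
      by (rule log_Hardy_one_dim[OF True dom p(1)]) blast
    let ?w = "\<lambda>x. ln (2 * inradius \<Omega> / bdist \<Omega> x)"
    have low: "ln 2 \<le> ?w x" and dpos: "0 < bdist \<Omega> x" and dR: "bdist \<Omega> x \<le> inradius \<Omega>" if "x \<in> \<Omega>" for x
    proof -
      show a: "0 < bdist \<Omega> x" by (rule bdist_pos[OF dom(1,4) that])
      show b: "bdist \<Omega> x \<le> inradius \<Omega>" by (rule bdist_le_inradius[OF dom(4) that])
      show "ln 2 \<le> ?w x" using a b by (intro ln_mono) (auto simp: le_divide_eq)
    qed
    have dbl: "?w y \<le> 2 * ?w x" if x: "x \<in> \<Omega>" and y: "y \<in> \<Omega>" and xy: "dist y x < bdist \<Omega> x / 2" for x y
    proof -
      have "bdist \<Omega> x / 2 \<le> bdist \<Omega> y" using bdist_lipschitz[of \<Omega> x y] xy by (simp add: dist_commute)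
      then have "2 * inradius \<Omega> / bdist \<Omega> y \<le> 2 * inradius \<Omega> / (bdist \<Omega> x / 2)"
        using dpos[OF x] dR[OF x] dpos[OF y] by (intro divide_left_mono) auto
      also have "\<dots> = 2 * (2 * inradius \<Omega> / bdist \<Omega> x)" by simp
      finally have "?w y \<le> ln (2 * (2 * inradius \<Omega> / bdist \<Omega> x))"
        using dpos[OF y] dR[OF y] by (intro ln_mono) auto
      also have "\<dots> = ln 2 + ?w x" using dpos[OF x] dR[OF x] by (intro ln_mult_pos) auto
      finally show ?thesis using low[OF x] by simp
    qed
    have "P (average \<Omega>) ?w (ln 2) CH"
      unfolding P_def using CH low dbl True by (auto simp: X_fun_def[abs_def])
    then show ?thesis by blast
  next
    case False
    then have d2: "DIM('a) \<ge> 2" using DIM_positive[where 'a='a] by linarith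
    obtain CH where CH: "CH \<ge> 0" "\<And>\<phi>. \<phi> \<in> test_functions \<Omega> \<Longrightarrow>
       (\<integral>\<^sup>+x. ennreal (\<bar>\<phi> x\<bar> powr p / bdist \<Omega> x ^ DIM('a)) * indicator \<Omega> x \<partial>lborel) \<le> ennreal CH * energy p \<Omega> \<phi>"
      by (rule fractional_Hardy[OF \<Omega> d2 less_trans[OF zero_less_one p(1)]]) blast
    have "P (\<lambda>_. 0) (\<lambda>_. 1) 1 CH" unfolding P_def using CH False by (auto simp: X_fun_def[abs_def])
    then show ?thesis by blast
  qed
  then obtain A w w0 CH where PA: "P A w w0 CH" by blast
  have w: "0 < w0" "0 \<le> CH" "w \<in> borel_measurable borel" "\<And>x. x \<in> \<Omega> \<Longrightarrow> w0 \<le> w x"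
    "\<And>x y. x \<in> \<Omega> \<Longrightarrow> y \<in> \<Omega> \<Longrightarrow> dist y x < bdist \<Omega> x / 2 \<Longrightarrow> w y \<le> 2 * w x"
    using PA unfolding P_def by blast+
  have X: "\<And>\<phi>. X_fun \<Omega> \<phi> = (\<lambda>x. \<bar>\<phi> x - A \<phi>\<bar> / w x)" using PA unfolding P_def by blast
  have H: "\<And>\<phi>. \<phi> \<in> test_functions \<Omega> \<Longrightarrow>
      (\<integral>\<^sup>+x. ennreal (\<bar>\<phi> x - A \<phi>\<bar> powr p / (bdist \<Omega> x ^ DIM('a) * w x powr p)) * indicator \<Omega> x \<partial>lborel) \<le> ennreal CH * energy p \<Omega> \<phi>"
    using PA unfolding P_def by blast
  define B where "B = (1 + CH) * Q"
  have B: "B \<ge> 0" "Q \<le> B" "CH * Q \<le> B" using Q w(2) by (simp_all add: B_def algebra_simps)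
  obtain \<alpha>0 C where \<alpha>0: "\<alpha>0 > 0" and C: "\<And>\<phi> A w \<alpha>. continuous_on UNIV \<phi> \<Longrightarrow> w \<in> borel_measurable borel \<Longrightarrow>
       (\<And>x. x \<in> \<Omega> \<Longrightarrow> w0 \<le> w x) \<Longrightarrow>
       (\<And>x y. x \<in> \<Omega> \<Longrightarrow> y \<in> \<Omega> \<Longrightarrow> dist y x < bdist \<Omega> x / 2 \<Longrightarrow> w y \<le> 2 * w x) \<Longrightarrow>
       energy p \<Omega> \<phi> \<le> ennreal B \<Longrightarrow>
       (\<integral>\<^sup>+x. ennreal (\<bar>\<phi> x - A\<bar> powr p / (bdist \<Omega> x ^ DIM('a) * w x powr p)) * indicator \<Omega> x \<partial>lborel) \<le> ennreal B \<Longrightarrow>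
       0 \<le> \<alpha> \<Longrightarrow> \<alpha> \<le> \<alpha>0 \<Longrightarrow>
       (\<integral>\<^sup>+x. ennreal (Phi n0 (\<alpha> * (\<bar>\<phi> x - A\<bar> / w x) powr (p / (p - 1))) / bdist \<Omega> x ^ DIM('a)) * indicator \<Omega> x \<partial>lborel) \<le> ennreal C"
    by (rule Hardy_imp_exponential[OF dom(1,4) p(1,4) w(1) B(1)]) blast
  show ?thesis
  proof (rule that[OF \<alpha>0])
    fix \<phi> \<alpha> assume \<phi>: "\<phi> \<in> test_functions \<Omega>" and e: "energy p \<Omega> \<phi> \<le> ennreal Q" and \<alpha>: "0 \<le> \<alpha>" "\<alpha> \<le> \<alpha>0"
    have eB: "energy p \<Omega> \<phi> \<le> ennreal B" using e ennreal_leI[OF B(2)] by (rule order_trans)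
    have hB: "(\<integral>\<^sup>+x. ennreal (\<bar>\<phi> x - A \<phi>\<bar> powr p / (bdist \<Omega> x ^ DIM('a) * w x powr p)) * indicator \<Omega> x \<partial>lborel) \<le> ennreal B"
    proof -
      note H[OF \<phi>]
      also have "ennreal CH * energy p \<Omega> \<phi> \<le> ennreal CH * ennreal Q" by (intro mult_left_mono e) simp
      also have "\<dots> = ennreal (CH * Q)" using w(2) by (simp add: ennreal_mult')
      also have "\<dots> \<le> ennreal B" by (rule ennreal_leI[OF B(3)])
      finally show ?thesis .
    qed
    have "hardy_exp_integral s n0 \<alpha> \<Omega> \<phi>
        = (\<integral>\<^sup>+x. ennreal (Phi n0 (\<alpha> * (\<bar>\<phi> x - A \<phi>\<bar> / w x) powr (p / (p - 1))) / bdist \<Omega> x ^ DIM('a)) * indicator \<Omega> x \<partial>lborel)"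
      unfolding hardy_exp_integral_def Let_def conjugate_exponent(1)[OF p(1-3)] X by (rule nn_integral_lebesgue_on[OF ms])
    also have "\<dots> \<le> ennreal C"
      by (rule C[OF test_function_continuous[OF \<phi>] w(3) w(4) w(5) eB hB \<alpha>])
    finally show "hardy_exp_integral s n0 \<alpha> \<Omega> \<phi> \<le> ennreal C" .
  qed
qed

theorem mainTheorem3:
  fixes \<Omega> :: "'a::euclidean_space set" and s p :: real and n0 :: nat
  assumes "bounded_lipschitz_domain \<Omega>"
    and "p > 1" and "0 < s" and "s < 1" and "s * p = real DIM('a)"
    and "real n0 \<ge> p - 1" and "p - 1 > real n0 - 1"
  shows "(\<exists>\<alpha>0>0. \<forall>\<alpha>. 0 \<le> \<alpha> \<and> \<alpha> < \<alpha>0 \<longrightarrow>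
            (SUP u \<in> {u \<in> W0_space s p \<Omega>. gagliardo_seminorm s p \<Omega> u \<le> 1}.
               hardy_exp_integral s n0 \<alpha> \<Omega> u) < \<infinity> \<and>
            (SUP u \<in> {u \<in> W0_space s p \<Omega>. gagliardo_seminorm s p \<Omega> u \<le> 1}.
               full_exp_integral s n0 \<alpha> \<Omega> u) < \<infinity>)
       \<and> (\<forall>\<alpha>. \<alpha> > alpha_star TYPE('a) s p \<longrightarrow>
            (SUP u \<in> {u \<in> W0_space s p \<Omega>. gagliardo_seminorm s p \<Omega> u \<le> 1}.
               full_exp_integral s n0 \<alpha> \<Omega> u) = \<infinity>)"
proof -
  have dom: "open \<Omega>" "\<Omega> \<noteq> {}" "bounded \<Omega>"
    using assms(1) by (auto simp: bounded_lipschitz_domain_def)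
  note p = assms(2,3,5)
  have Q: "0 \<le> 2 * 2 powr p" by simp
  obtain \<alpha>0 C where \<alpha>0: "\<alpha>0 > 0" and
    test: "\<And>\<phi> \<alpha>. \<phi> \<in> test_functions \<Omega> \<Longrightarrow> energy p \<Omega> \<phi> \<le> ennreal (2 * 2 powr p) \<Longrightarrow> 0 \<le> \<alpha> \<Longrightarrow> \<alpha> \<le> \<alpha>0 \<Longrightarrow>
       hardy_exp_integral s n0 \<alpha> \<Omega> \<phi> \<le> ennreal C"
    by (rule test_function_exp_bound[OF assms(1) p assms(6) Q]) blast
  define q where "q = real n0 * fact n0 * inradius \<Omega> ^ DIM('a) + 1"
  have bounded: "(SUP u \<in> {u \<in> W0_space s p \<Omega>. gagliardo_seminorm s p \<Omega> u \<le> 1}. hardy_exp_integral s n0 \<alpha> \<Omega> u) < \<infinity> \<and>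
      (SUP u \<in> {u \<in> W0_space s p \<Omega>. gagliardo_seminorm s p \<Omega> u \<le> 1}. full_exp_integral s n0 \<alpha> \<Omega> u) < \<infinity>"
    if \<alpha>: "0 \<le> \<alpha> \<and> \<alpha> < \<alpha>0" for \<alpha>
  proof -
    have hardy: "hardy_exp_integral s n0 \<alpha> \<Omega> u \<le> ennreal C"
      if "u \<in> {u \<in> W0_space s p \<Omega>. gagliardo_seminorm s p \<Omega> u \<le> 1}" for u
    proof (rule hardy_exp_integral_W0_le[OF dom(1,3) p])
      show "0 \<le> \<alpha>" using \<alpha> by (rule conjunct1)
      show "hardy_exp_integral s n0 \<alpha> \<Omega> \<phi> \<le> ennreal C"
        if "\<phi> \<in> test_functions \<Omega>" "energy p \<Omega> \<phi> \<le> ennreal (2 * 2 powr p)" for \<phi>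
        using \<alpha> by (intro test[OF that]) linarith+
      show "u \<in> W0_space s p \<Omega>" "gagliardo_seminorm s p \<Omega> u \<le> 1" using that by simp_all
    qed
    have full: "full_exp_integral s n0 \<alpha> \<Omega> u \<le> ennreal (real n0 * measure lborel \<Omega>) + ennreal q * ennreal C"
      if u: "u \<in> {u \<in> W0_space s p \<Omega>. gagliardo_seminorm s p \<Omega> u \<le> 1}" for u
    proof -
      have "u \<in> borel_measurable (lebesgue_on \<Omega>)" using u by (simp add: W0_space_def W_space_def)
      then have "full_exp_integral s n0 \<alpha> \<Omega> u \<le> ennreal (real n0 * measure lborel \<Omega>) + ennreal q * hardy_exp_integral s n0 \<alpha> \<Omega> u"
        unfolding q_def using conjunct1[OF \<alpha>] by (intro full_exp_integral_le[OF dom(1,3,2) p])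
      also have "\<dots> \<le> ennreal (real n0 * measure lborel \<Omega>) + ennreal q * ennreal C"
        by (intro add_left_mono mult_left_mono hardy[OF u]) simp
      finally show ?thesis .
    qed
    have "(SUP u \<in> {u \<in> W0_space s p \<Omega>. gagliardo_seminorm s p \<Omega> u \<le> 1}. hardy_exp_integral s n0 \<alpha> \<Omega> u) \<le> ennreal C"
      by (rule SUP_least) (rule hardy)
    moreover have "(SUP u \<in> {u \<in> W0_space s p \<Omega>. gagliardo_seminorm s p \<Omega> u \<le> 1}. full_exp_integral s n0 \<alpha> \<Omega> u)
        \<le> ennreal (real n0 * measure lborel \<Omega>) + ennreal q * ennreal C"
      by (rule SUP_least) (rule full)
    moreover have "ennreal (real n0 * measure lborel \<Omega>) + ennreal q * ennreal C < \<infinity>"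
      by (simp add: ennreal_mult_less_top)
    ultimately show ?thesis by (auto intro: le_less_trans)
  qed
  have unbounded: "(SUP u \<in> {u \<in> W0_space s p \<Omega>. gagliardo_seminorm s p \<Omega> u \<le> 1}. full_exp_integral s n0 \<alpha> \<Omega> u) = \<infinity>"
    if "\<alpha> > alpha_star TYPE('a) s p" for \<alpha>
    by (rule full_exp_integral_unbounded[OF dom(1,3,2) assms(2,3,4,5) that])
  show ?thesis using \<alpha>0 bounded unbounded by blast
qed

end
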